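(* Let $W$ be a Coxeter group, $\Bbbk$ a commutative unital ring, and $\mathbf{q}=(q_i)\in\Bbbk^I$ such that $q_i=q_j$ whenever $m_{ij}$ is odd. The assignments $T_i\mapsto s_i+(1-q_i)D_i$, $i\in I$, define an injective homomorphism of algebras $\varphi_W:H_{\mathbf{q}}(W)\hookrightarrow\mathbf{H}(W)\otimes_{\mathbb{Z}}\Bbbk$. Moreover, $\underline{\varphi}_W=(\pi_W\otimes 1)\circ\varphi_W$, where $\underline{\varphi}_W:H_{\mathbf{q}}(W)\to\underline{\mathbf{H}}(W)\otimes_{\mathbb{Z}}\Bbbk$ is the algebra homomorphism given by $T_i\mapsto s_i+(1-q_i)D_i$, $i\in I$, and $\pi_W:\mathbf{H}(W)\twoheadrightarrow\underline{\mathbf{H}}(W)$ is the canonical surjective homomorphism of Hopf algebras (which is the identity on $\mathbb{Z}W$ and satisfies $\pi_W(\mathbf{D}(W))=\underline{\mathbf{D}}(W)$).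
   Context: A Coxeter group $W$ is generated by $s_i$, $i\in I$, subject to relations $(s_is_j)^{m_{ij}}=1$, where $m_{ij}=m_{ji}\in\mathbb{Z}_{\ge 0}$ are such that $m_{ij}=1$ iff $i=j$ ($m_{ij}=0$ imposes no relation). The (generalized) Hecke algebra $H_{\mathbf{q}}(W)$ is the $\Bbbk$-algebra generated by $T_i$, $i\in I$, subject to $T_i^2=(1-q_i)T_i+q_i$ for $i\in I$ and the braid relations $\underbrace{T_iT_j\cdots}_{m_{ij}}=\underbrace{T_jT_i\cdots}_{m_{ij}}$ for all distinct $i,j\in I$. $\hat{\mathbf{H}}(W)$ is the (unital associative) $\mathbb{Z}$-algebra generated by $s_i,D_i$, $i\in I$, subject to relations: (i) $s_i^2=1$, $D_i^2=D_i$, $s_iD_i+D_is_i=s_i-1$ for $i\in I$; (ii) $(s_is_j)^{m_{ij}}=1$; (iii) $\underbrace{D_is_js_i\cdots s_{j'}}_{m_{ij}}=\underbrace{s_j\cdots s_{i'}s_{j'}D_{i'}}_{m_{ij}}$ for all distinct $i,j\in I$ with $m_{ij}\ne 0$, where $i'=i$ if $m_{ij}$ is even, $i'=j$ if $m_{ij}$ is odd, and $\{i',j'\}=\{i,j\}$ (each side has $m_{ij}$ factors with indices alternating between $i$ and $j$). It is a Hopf algebra over $\mathbb{Z}$ with $\Delta(s_i)=s_i\otimes s_i$, $\Delta(D_i)=D_i\otimes 1+s_i\otimes D_i$, $\varepsilon(s_i)=1$, $\varepsilon(D_i)=0$, $S(s_i)=s_i$, $S(D_i)=-s_iD_i$.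 $\mathcal{S}:=\{ws_iw^{-1}\mid w\in W,i\in I\}$. For each $s\in\mathcal{S}$ there is a unique $D_s\in\hat{\mathbf{H}}(W)$ such that $D_{s_i}=D_i$ for $i\in I$ and $D_{s_iss_i}=s_iD_ss_i$ for any $i\in I$, $s\in\mathcal{S}\setminus\{s_i\}$. $\hat{\mathbf{D}}(W)$ is the subalgebra of $\hat{\mathbf{H}}(W)$ generated by all $D_s$, $s\in\mathcal{S}$, and $\mathbf{K}(W):=\bigcap_{w\in W}w\hat{\mathbf{D}}(W)w^{-1}$. $\underline{\mathbf{H}}(W)=\hat{\mathbf{H}}(W)/\mathbf{J}(W)$, where $\mathbf{J}(W)$ is the (Hopf) ideal generated by $\mathbf{K}(W)\cap\operatorname{Ker}\varepsilon$. For $J\subset I$, $W_J$ is the (Coxeter) subgroup generated by $s_j$, $j\in J$; $\hat{\mathbf{D}}(W_J)$ is identified with the subalgebra of $\hat{\mathbf{D}}(W)$ generated by all $D_s$ with $s\in\mathcal{S}\cap W_J$. $\hat{\mathbf{D}}(W)$ is filtered by $\deg D_s=1$ (degree at most $r$ means: lies in the $\mathbb{Z}$-span of products of at most $r$ of the $D_s$). For distinct $i,j\in I$, $\mathbf{K}_{ij}(W)$ is the set of all elements of $\mathbf{K}(W_{\{i,j\}})\cap\operatorname{Ker}\varepsilon$ having degree at most $m_{ij}$. $\mathbf{H}(W)=\hat{\mathbf{H}}(W)/\underline{\mathbf{J}}(W)$, where $\underline{\mathbf{J}}(W)$ is the (Hopf) ideal generated by all $\mathbf{K}_{ij}(W)$,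 $i\ne j$. $\underline{\mathbf{D}}(W)$ and $\mathbf{D}(W)$ are the images of $\hat{\mathbf{D}}(W)$ in $\underline{\mathbf{H}}(W)$ and $\mathbf{H}(W)$. Images of $s_i,D_i$ in quotients are denoted by the same symbols; the canonical homomorphism $\pi_W$ is the one induced by the identity of $\hat{\mathbf{H}}(W)$, i.e., $s_i\mapsto s_i$, $D_i\mapsto D_i$. *)

theory Defs
  imports "HOL-Algebra.QuotRing" "HOL-Algebra.IntRing" "HOL-Algebra.Generated_Rings"
begin

definition msupp :: "('r, 'b) ring_scheme \<Rightarrow> ('x \<Rightarrow> 'r) \<Rightarrow> 'x set" where
  "msupp R f = {x. f x \<noteq> \<zero>\<^bsub>R\<^esub>}"

definition mterm :: "('r, 'b) ring_scheme \<Rightarrow> 'r \<Rightarrow> 'x \<Rightarrow> 'x \<Rightarrow> 'r" where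
  "mterm R c x = (\<lambda>y. if y = x then c else \<zero>\<^bsub>R\<^esub>)"

definition monoid_ring :: "('r, 'b) ring_scheme \<Rightarrow> ('x, 'c) monoid_scheme \<Rightarrow> ('x \<Rightarrow> 'r) ring" where
  "monoid_ring R M =
     \<lparr>carrier = {f. (\<forall>x. f x \<in> carrier R) \<and> finite (msupp R f) \<and> msupp R f \<subseteq> carrier M},
      mult = (\<lambda>f g z. \<Oplus>\<^bsub>R\<^esub>p \<in> {p \<in> msupp R f \<times> msupp R g. fst p \<otimes>\<^bsub>M\<^esub> snd p = z}.
                f (fst p) \<otimes>\<^bsub>R\<^esub> g (snd p)),
      one = mterm R \<one>\<^bsub>R\<^esub> \<one>\<^bsub>M\<^esub>,
      zero = (\<lambda>x. \<zero>\<^bsub>R\<^esub>),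
      add = (\<lambda>f g x. f x \<oplus>\<^bsub>R\<^esub> g x)\<rparr>"

definition free_monoid :: "'g set \<Rightarrow> 'g list monoid" where
  "free_monoid X = \<lparr>carrier = lists X, mult = (@), one = []\<rparr>"

abbreviation free_algebra :: "('r, 'b) ring_scheme \<Rightarrow> 'g set \<Rightarrow> ('g list \<Rightarrow> 'r) ring" where
  "free_algebra R X \<equiv> monoid_ring R (free_monoid X)"

definition presented_algebra ::
    "('r, 'b) ring_scheme \<Rightarrow> 'g set \<Rightarrow> ('g list \<Rightarrow> 'r) set \<Rightarrow> ('g list \<Rightarrow> 'r) set ring" where
  "presented_algebra R X E = free_algebra R X Quot (Idl\<^bsub>free_algebra R X\<^esub> E)"

definition presented_class ::
    "('r, 'b) ring_scheme \<Rightarrow> 'g set \<Rightarrow> ('g list \<Rightarrow> 'r) set \<Rightarrow> ('g list \<Rightarrow> 'r) \<Rightarrow> ('g list \<Rightarrow> 'r) set" where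
  "presented_class R X E x = (Idl\<^bsub>free_algebra R X\<^esub> E) +>\<^bsub>free_algebra R X\<^esub> x"

text \<open>The tensor product over \<open>\<int>\<close>: the free abelian group on \<open>A \<times> B\<close> modulo the subgroup generated
  by the bilinearity relators. The product \<open>(a \<otimes> b)(a' \<otimes> b') = aa' \<otimes> bb'\<close> is the one of the monoid
  ring of the multiplicative monoid \<open>A \<times> B\<close>, in which that subgroup is a two-sided ideal.\<close>

abbreviation tensor_free ::
    "('a, 'm) ring_scheme \<Rightarrow> ('b, 'n) ring_scheme \<Rightarrow> ('a \<times> 'b \<Rightarrow> int) ring" where
  "tensor_free A B \<equiv> monoid_ring \<Z> (A \<times>\<times> B)"

definition tensor_relators ::
    "('a, 'm) ring_scheme \<Rightarrow> ('b, 'n) ring_scheme \<Rightarrow> ('a \<times> 'b \<Rightarrow> int) set" where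
  "tensor_relators A B =
     {mterm \<Z> 1 (a \<oplus>\<^bsub>A\<^esub> a', b) \<ominus>\<^bsub>tensor_free A B\<^esub> (mterm \<Z> 1 (a, b) \<oplus>\<^bsub>tensor_free A B\<^esub> mterm \<Z> 1 (a', b))
       | a a' b. a \<in> carrier A \<and> a' \<in> carrier A \<and> b \<in> carrier B} \<union>
     {mterm \<Z> 1 (a, b \<oplus>\<^bsub>B\<^esub> b') \<ominus>\<^bsub>tensor_free A B\<^esub> (mterm \<Z> 1 (a, b) \<oplus>\<^bsub>tensor_free A B\<^esub> mterm \<Z> 1 (a, b'))
       | a b b'. a \<in> carrier A \<and> b \<in> carrier B \<and> b' \<in> carrier B}"

definition tensor_null ::
    "('a, 'm) ring_scheme \<Rightarrow> ('b, 'n) ring_scheme \<Rightarrow> ('a \<times> 'b \<Rightarrow> int) set" where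
  "tensor_null A B = generate (add_monoid (tensor_free A B)) (tensor_relators A B)"

definition tensor ::
    "('a, 'm) ring_scheme \<Rightarrow> ('b, 'n) ring_scheme \<Rightarrow> ('a \<times> 'b \<Rightarrow> int) set ring" where
  "tensor A B = tensor_free A B Quot tensor_null A B"

definition pure ::
    "('a, 'm) ring_scheme \<Rightarrow> ('b, 'n) ring_scheme \<Rightarrow> 'a \<Rightarrow> 'b \<Rightarrow> ('a \<times> 'b \<Rightarrow> int) set" where
  "pure A B a b = tensor_null A B +>\<^bsub>tensor_free A B\<^esub> mterm \<Z> 1 (a, b)"

definition tensor_map ::
    "('a, 'm) ring_scheme \<Rightarrow> ('b, 'n) ring_scheme \<Rightarrow> ('c, 'p) ring_scheme \<Rightarrow> ('d, 'q) ring_scheme \<Rightarrow>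
     ('a \<Rightarrow> 'c) \<Rightarrow> ('b \<Rightarrow> 'd) \<Rightarrow> ('a \<times> 'b \<Rightarrow> int) set \<Rightarrow> ('c \<times> 'd \<Rightarrow> int) set" where
  "tensor_map A B A' B' f g =
     (THE h. h \<in> extensional (carrier (tensor A B))
           \<and> h \<in> hom (add_monoid (tensor A B)) (add_monoid (tensor A' B'))
           \<and> (\<forall>a\<in>carrier A. \<forall>b\<in>carrier B. h (pure A B a b) = pure A' B' (f a) (g b)))"

definition coxeter_matrix :: "'i set \<Rightarrow> ('i \<Rightarrow> 'i \<Rightarrow> nat) \<Rightarrow> bool" where
  "coxeter_matrix I m \<longleftrightarrow> (\<forall>i\<in>I. \<forall>j\<in>I. m i j = m j i \<and> (m i j = 1 \<longleftrightarrow> i = j))"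

fun alt :: "'i \<Rightarrow> 'i \<Rightarrow> nat \<Rightarrow> 'i list" where
  "alt i j 0 = []"
| "alt i j (Suc n) = i # alt j i n"

text \<open>Since the relations include \<open>s\<^sub>i\<^sup>2 = 1\<close> (the case \<open>i = j\<close>), the monoid presented by them is
  the group presented by them, and words in the \<open>s\<^sub>i\<close> without inverses suffice.\<close>

inductive_set coxeter_cong :: "'i set \<Rightarrow> ('i \<Rightarrow> 'i \<Rightarrow> nat) \<Rightarrow> ('i list \<times> 'i list) set"
  for I m where
  relation: "\<lbrakk>i \<in> I; j \<in> I\<rbrakk> \<Longrightarrow> (concat (replicate (m i j) [i, j]), []) \<in> coxeter_cong I m"
| refl: "u \<in> lists I \<Longrightarrow> (u, u) \<in> coxeter_cong I m"
| sym: "(u, v) \<in> coxeter_cong I m \<Longrightarrow> (v, u) \<in> coxeter_cong I m"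
| trans: "\<lbrakk>(u, v) \<in> coxeter_cong I m; (v, w) \<in> coxeter_cong I m\<rbrakk> \<Longrightarrow> (u, w) \<in> coxeter_cong I m"
| append: "\<lbrakk>(u, v) \<in> coxeter_cong I m; (u', v') \<in> coxeter_cong I m\<rbrakk>
          \<Longrightarrow> (u @ u', v @ v') \<in> coxeter_cong I m"

definition coxeter_group :: "'i set \<Rightarrow> ('i \<Rightarrow> 'i \<Rightarrow> nat) \<Rightarrow> 'i list set monoid" where
  "coxeter_group I m =
     \<lparr>carrier = lists I // coxeter_cong I m,
      mult = (\<lambda>A B. coxeter_cong I m `` {u @ v | u v. u \<in> A \<and> v \<in> B}),
      one = coxeter_cong I m `` {[]}\<rparr>"

definition simple_refl :: "'i set \<Rightarrow> ('i \<Rightarrow> 'i \<Rightarrow> nat) \<Rightarrow> 'i \<Rightarrow> 'i list set" where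
  "simple_refl I m i = coxeter_cong I m `` {[i]}"

definition reflections :: "'i set \<Rightarrow> ('i \<Rightarrow> 'i \<Rightarrow> nat) \<Rightarrow> 'i list set set" where
  "reflections I m =
     {w \<otimes>\<^bsub>coxeter_group I m\<^esub> simple_refl I m i \<otimes>\<^bsub>coxeter_group I m\<^esub> inv\<^bsub>coxeter_group I m\<^esub> w
       | w i. w \<in> carrier (coxeter_group I m) \<and> i \<in> I}"

definition parabolic :: "'i set \<Rightarrow> ('i \<Rightarrow> 'i \<Rightarrow> nat) \<Rightarrow> 'i set \<Rightarrow> 'i list set set" where
  "parabolic I m J = generate (coxeter_group I m) (simple_refl I m ` J)"

definition Hecke_relators ::
    "('k, 'b) ring_scheme \<Rightarrow> 'i set \<Rightarrow> ('i \<Rightarrow> 'i \<Rightarrow> nat) \<Rightarrow> ('i \<Rightarrow> 'k) \<Rightarrow> ('i list \<Rightarrow> 'k) set" where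
  "Hecke_relators K I m q =
     {mterm K \<one>\<^bsub>K\<^esub> [i, i] \<ominus>\<^bsub>free_algebra K I\<^esub>
        (mterm K (\<one>\<^bsub>K\<^esub> \<ominus>\<^bsub>K\<^esub> q i) [i] \<oplus>\<^bsub>free_algebra K I\<^esub> mterm K (q i) []) | i. i \<in> I} \<union>
     {mterm K \<one>\<^bsub>K\<^esub> (alt i j (m i j)) \<ominus>\<^bsub>free_algebra K I\<^esub> mterm K \<one>\<^bsub>K\<^esub> (alt j i (m i j))
       | i j. i \<in> I \<and> j \<in> I \<and> i \<noteq> j}"

definition Hecke_algebra ::
    "('k, 'b) ring_scheme \<Rightarrow> 'i set \<Rightarrow> ('i \<Rightarrow> 'i \<Rightarrow> nat) \<Rightarrow> ('i \<Rightarrow> 'k) \<Rightarrow> ('i list \<Rightarrow> 'k) set ring" where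
  "Hecke_algebra K I m q = presented_algebra K I (Hecke_relators K I m q)"

definition Hecke_scalar ::
    "('k, 'b) ring_scheme \<Rightarrow> 'i set \<Rightarrow> ('i \<Rightarrow> 'i \<Rightarrow> nat) \<Rightarrow> ('i \<Rightarrow> 'k) \<Rightarrow> 'k \<Rightarrow> ('i list \<Rightarrow> 'k) set" where
  "Hecke_scalar K I m q c = presented_class K I (Hecke_relators K I m q) (mterm K c [])"

definition Hecke_T ::
    "('k, 'b) ring_scheme \<Rightarrow> 'i set \<Rightarrow> ('i \<Rightarrow> 'i \<Rightarrow> nat) \<Rightarrow> ('i \<Rightarrow> 'k) \<Rightarrow> 'i \<Rightarrow> ('i list \<Rightarrow> 'k) set" where
  "Hecke_T K I m q i = presented_class K I (Hecke_relators K I m q) (mterm K \<one>\<^bsub>K\<^esub> [i])"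

datatype 'i hgen = gen_s 'i | gen_D 'i

type_synonym 'i hhat = "('i hgen list \<Rightarrow> int) set"

abbreviation hgens :: "'i set \<Rightarrow> 'i hgen set" where
  "hgens I \<equiv> gen_s ` I \<union> gen_D ` I"

abbreviation hword :: "'i hgen list \<Rightarrow> ('i hgen list \<Rightarrow> int)" where
  "hword u \<equiv> mterm \<Z> 1 u"

definition Hhat_relators :: "'i set \<Rightarrow> ('i \<Rightarrow> 'i \<Rightarrow> nat) \<Rightarrow> ('i hgen list \<Rightarrow> int) set" where
  "Hhat_relators I m =
     {hword [gen_s i, gen_s i] \<ominus>\<^bsub>free_algebra \<Z> (hgens I)\<^esub> hword [] | i. i \<in> I} \<union>
     {hword [gen_D i, gen_D i] \<ominus>\<^bsub>free_algebra \<Z> (hgens I)\<^esub> hword [gen_D i] | i. i \<in> I} \<union>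
     {(hword [gen_s i, gen_D i] \<oplus>\<^bsub>free_algebra \<Z> (hgens I)\<^esub> hword [gen_D i, gen_s i])
        \<ominus>\<^bsub>free_algebra \<Z> (hgens I)\<^esub> (hword [gen_s i] \<ominus>\<^bsub>free_algebra \<Z> (hgens I)\<^esub> hword []) | i. i \<in> I} \<union>
     {hword (concat (replicate (m i j) [gen_s i, gen_s j])) \<ominus>\<^bsub>free_algebra \<Z> (hgens I)\<^esub> hword []
        | i j. i \<in> I \<and> j \<in> I} \<union>
     {hword (gen_D i # map gen_s (alt j i (m i j - 1))) \<ominus>\<^bsub>free_algebra \<Z> (hgens I)\<^esub>
        hword (map gen_s (alt j i (m i j - 1)) @ [gen_D (if even (m i j) then i else j)])
        | i j. i \<in> I \<and> j \<in> I \<and> i \<noteq> j \<and> m i j \<noteq> 0}"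

definition Hhat :: "'i set \<Rightarrow> ('i \<Rightarrow> 'i \<Rightarrow> nat) \<Rightarrow> 'i hhat ring" where
  "Hhat I m = presented_algebra \<Z> (hgens I) (Hhat_relators I m)"

definition Hhat_word :: "'i set \<Rightarrow> ('i \<Rightarrow> 'i \<Rightarrow> nat) \<Rightarrow> 'i hgen list \<Rightarrow> 'i hhat" where
  "Hhat_word I m u = presented_class \<Z> (hgens I) (Hhat_relators I m) (hword u)"

abbreviation Hhat_s :: "'i set \<Rightarrow> ('i \<Rightarrow> 'i \<Rightarrow> nat) \<Rightarrow> 'i \<Rightarrow> 'i hhat" where
  "Hhat_s I m i \<equiv> Hhat_word I m [gen_s i]"

abbreviation Hhat_D :: "'i set \<Rightarrow> ('i \<Rightarrow> 'i \<Rightarrow> nat) \<Rightarrow> 'i \<Rightarrow> 'i hhat" where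
  "Hhat_D I m i \<equiv> Hhat_word I m [gen_D i]"

text \<open>The image of \<open>w \<in> W\<close> does not depend on the word representing \<open>w\<close>.\<close>

definition Hhat_of_W :: "'i set \<Rightarrow> ('i \<Rightarrow> 'i \<Rightarrow> nat) \<Rightarrow> 'i list set \<Rightarrow> 'i hhat" where
  "Hhat_of_W I m w = the_elem ((\<lambda>u. Hhat_word I m (map gen_s u)) ` w)"

definition Hhat_counit :: "'i set \<Rightarrow> ('i \<Rightarrow> 'i \<Rightarrow> nat) \<Rightarrow> 'i hhat \<Rightarrow> int" where
  "Hhat_counit I m =
     (THE e. e \<in> extensional (carrier (Hhat I m)) \<and> e \<in> ring_hom (Hhat I m) \<Z>
           \<and> (\<forall>i\<in>I. e (Hhat_s I m i) = 1 \<and> e (Hhat_D I m i) = 0))"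

text \<open>That there is exactly one family \<open>(D\<^sub>s)\<close> as described is a theorem about Coxeter groups.\<close>

definition D_refl :: "'i set \<Rightarrow> ('i \<Rightarrow> 'i \<Rightarrow> nat) \<Rightarrow> 'i list set \<Rightarrow> 'i hhat" where
  "D_refl I m =
     (THE d. d \<in> reflections I m \<rightarrow>\<^sub>E carrier (Hhat I m)
           \<and> (\<forall>i\<in>I. d (simple_refl I m i) = Hhat_D I m i)
           \<and> (\<forall>i\<in>I. \<forall>t\<in>reflections I m - {simple_refl I m i}.
                d (simple_refl I m i \<otimes>\<^bsub>coxeter_group I m\<^esub> t \<otimes>\<^bsub>coxeter_group I m\<^esub> simple_refl I m i)
                  = Hhat_s I m i \<otimes>\<^bsub>Hhat I m\<^esub> d t \<otimes>\<^bsub>Hhat I m\<^esub> Hhat_s I m i))"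

text \<open>For \<open>J \<subseteq> I\<close> the algebras of \<open>W\<^sub>J\<close> are taken inside the one \<open>Hhat\<close> of \<open>W\<close>; \<open>J = I\<close> gives
  those of \<open>W\<close> itself.\<close>

definition Dhat :: "'i set \<Rightarrow> ('i \<Rightarrow> 'i \<Rightarrow> nat) \<Rightarrow> 'i set \<Rightarrow> 'i hhat set" where
  "Dhat I m J = generate_ring (Hhat I m) (D_refl I m ` (reflections I m \<inter> parabolic I m J))"

definition Kalg :: "'i set \<Rightarrow> ('i \<Rightarrow> 'i \<Rightarrow> nat) \<Rightarrow> 'i set \<Rightarrow> 'i hhat set" where
  "Kalg I m J =
     (\<Inter>w\<in>parabolic I m J.
        (\<lambda>x. Hhat_of_W I m w \<otimes>\<^bsub>Hhat I m\<^esub> x \<otimes>\<^bsub>Hhat I m\<^esub> Hhat_of_W I m (inv\<^bsub>coxeter_group I m\<^esub> w)) ` Dhat I m J)"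

definition Ker_counit :: "'i set \<Rightarrow> ('i \<Rightarrow> 'i \<Rightarrow> nat) \<Rightarrow> 'i hhat set" where
  "Ker_counit I m = {x \<in> carrier (Hhat I m). Hhat_counit I m x = 0}"

text \<open>The filtration of \<open>Dhat I m I\<close> by the number of factors \<open>D\<^sub>s\<close>, with \<open>s\<close> ranging over all reflections.\<close>

definition Dhat_deg_le :: "'i set \<Rightarrow> ('i \<Rightarrow> 'i \<Rightarrow> nat) \<Rightarrow> nat \<Rightarrow> 'i hhat set" where
  "Dhat_deg_le I m r =
     generate (add_monoid (Hhat I m))
       {foldr (\<otimes>\<^bsub>Hhat I m\<^esub>) (map (D_refl I m) ts) \<one>\<^bsub>Hhat I m\<^esub>
         | ts. ts \<in> lists (reflections I m) \<and> length ts \<le> r}"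

definition K_pair :: "'i set \<Rightarrow> ('i \<Rightarrow> 'i \<Rightarrow> nat) \<Rightarrow> 'i \<Rightarrow> 'i \<Rightarrow> 'i hhat set" where
  "K_pair I m i j = Kalg I m {i, j} \<inter> Ker_counit I m \<inter> Dhat_deg_le I m (m i j)"

text \<open>In the usual notation \<open>H_alg\<close> is \<open>H(W)\<close>, the quotient by the underlined ideal \<open>J\<close> generated by the
  \<open>K\<^sub>i\<^sub>j\<close>, and \<open>H_lower\<close> is the underlined \<open>H(W)\<close>, the quotient by the ideal \<open>J(W)\<close> generated by
  the augmentation part of \<open>K(W)\<close>.\<close>

definition J_full :: "'i set \<Rightarrow> ('i \<Rightarrow> 'i \<Rightarrow> nat) \<Rightarrow> 'i hhat set" where
  "J_full I m = Idl\<^bsub>Hhat I m\<^esub> (Kalg I m I \<inter> Ker_counit I m)"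

definition J_pairs :: "'i set \<Rightarrow> ('i \<Rightarrow> 'i \<Rightarrow> nat) \<Rightarrow> 'i hhat set" where
  "J_pairs I m = Idl\<^bsub>Hhat I m\<^esub> (\<Union>(i, j)\<in>{(i, j). i \<in> I \<and> j \<in> I \<and> i \<noteq> j}. K_pair I m i j)"

definition H_alg :: "'i set \<Rightarrow> ('i \<Rightarrow> 'i \<Rightarrow> nat) \<Rightarrow> 'i hhat set ring" where
  "H_alg I m = Hhat I m Quot J_pairs I m"

definition H_lower :: "'i set \<Rightarrow> ('i \<Rightarrow> 'i \<Rightarrow> nat) \<Rightarrow> 'i hhat set ring" where
  "H_lower I m = Hhat I m Quot J_full I m"

definition to_H :: "'i set \<Rightarrow> ('i \<Rightarrow> 'i \<Rightarrow> nat) \<Rightarrow> 'i hhat \<Rightarrow> 'i hhat set" where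
  "to_H I m x = J_pairs I m +>\<^bsub>Hhat I m\<^esub> x"

definition to_H_lower :: "'i set \<Rightarrow> ('i \<Rightarrow> 'i \<Rightarrow> nat) \<Rightarrow> 'i hhat \<Rightarrow> 'i hhat set" where
  "to_H_lower I m x = J_full I m +>\<^bsub>Hhat I m\<^esub> x"

definition is_pi :: "'i set \<Rightarrow> ('i \<Rightarrow> 'i \<Rightarrow> nat) \<Rightarrow> ('i hhat set \<Rightarrow> 'i hhat set) \<Rightarrow> bool" where
  "is_pi I m p \<longleftrightarrow>
     p \<in> extensional (carrier (H_alg I m)) \<and> p \<in> ring_hom (H_alg I m) (H_lower I m)
     \<and> (\<forall>x\<in>carrier (Hhat I m). p (to_H I m x) = to_H_lower I m x)"

text \<open>\<open>f\<close> is required to be \<open>K\<close>-linear by compatibility with the structure maps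
  \<open>c \<mapsto> c\<cdot>1\<close> and \<open>c \<mapsto> 1 \<otimes> c\<close>; the image of \<open>T\<^sub>i\<close> is \<open>s\<^sub>i \<otimes> 1 + D\<^sub>i \<otimes> (1 - q\<^sub>i)\<close>.\<close>

definition is_Hecke_hom ::
    "('k, 'b) ring_scheme \<Rightarrow> 'i set \<Rightarrow> ('i \<Rightarrow> 'i \<Rightarrow> nat) \<Rightarrow> ('i \<Rightarrow> 'k) \<Rightarrow> ('a, 'n) ring_scheme \<Rightarrow>
     ('i \<Rightarrow> 'a) \<Rightarrow> ('i \<Rightarrow> 'a) \<Rightarrow> (('i list \<Rightarrow> 'k) set \<Rightarrow> ('a \<times> 'k \<Rightarrow> int) set) \<Rightarrow> bool" where
  "is_Hecke_hom K I m q A s d f \<longleftrightarrow>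
     f \<in> extensional (carrier (Hecke_algebra K I m q))
     \<and> f \<in> ring_hom (Hecke_algebra K I m q) (tensor A K)
     \<and> (\<forall>c\<in>carrier K. f (Hecke_scalar K I m q c) = pure A K \<one>\<^bsub>A\<^esub> c)
     \<and> (\<forall>i\<in>I. f (Hecke_T K I m q i) =
          pure A K (s i) \<one>\<^bsub>K\<^esub> \<oplus>\<^bsub>tensor A K\<^esub> pure A K (d i) (\<one>\<^bsub>K\<^esub> \<ominus>\<^bsub>K\<^esub> q i))"

text \<open>The Hopf structure inherited by a quotient \<open>A\<close> of \<open>Hhat\<close>: \<open>\<Delta>\<close>, \<open>\<epsilon>\<close> multiplicative and \<open>S\<close>
  antimultiplicative with the prescribed values on generators. As the \<open>s\<^sub>i\<close>, \<open>D\<^sub>i\<close> generate \<open>A\<close>, at most one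
  such triple exists, and it satisfies the Hopf algebra axioms since these hold on generators.\<close>

definition Hopf_maps ::
    "'i set \<Rightarrow> ('a, 'n) ring_scheme \<Rightarrow> ('i \<Rightarrow> 'a) \<Rightarrow> ('i \<Rightarrow> 'a) \<Rightarrow>
     ('a \<Rightarrow> ('a \<times> 'a \<Rightarrow> int) set) \<Rightarrow> ('a \<Rightarrow> int) \<Rightarrow> ('a \<Rightarrow> 'a) \<Rightarrow> bool" where
  "Hopf_maps I A s d \<Delta> \<epsilon> S \<longleftrightarrow>
     \<Delta> \<in> ring_hom A (tensor A A)
     \<and> (\<forall>i\<in>I. \<Delta> (s i) = pure A A (s i) (s i)
            \<and> \<Delta> (d i) = pure A A (d i) \<one>\<^bsub>A\<^esub> \<oplus>\<^bsub>tensor A A\<^esub> pure A A (s i) (d i))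
     \<and> \<epsilon> \<in> ring_hom A \<Z>
     \<and> (\<forall>i\<in>I. \<epsilon> (s i) = 1 \<and> \<epsilon> (d i) = 0)
     \<and> S \<in> ring_hom A (A\<lparr>mult := \<lambda>x y. y \<otimes>\<^bsub>A\<^esub> x\<rparr>)
     \<and> (\<forall>i\<in>I. S (s i) = s i \<and> S (d i) = \<ominus>\<^bsub>A\<^esub> (s i \<otimes>\<^bsub>A\<^esub> d i))"

definition Hopf_map_compatible ::
    "('a, 'n) ring_scheme \<Rightarrow> ('c, 'p) ring_scheme \<Rightarrow>
     ('a \<Rightarrow> ('a \<times> 'a \<Rightarrow> int) set) \<Rightarrow> ('a \<Rightarrow> int) \<Rightarrow> ('a \<Rightarrow> 'a) \<Rightarrow>
     ('c \<Rightarrow> ('c \<times> 'c \<Rightarrow> int) set) \<Rightarrow> ('c \<Rightarrow> int) \<Rightarrow> ('c \<Rightarrow> 'c) \<Rightarrow> ('a \<Rightarrow> 'c) \<Rightarrow> bool" where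
  "Hopf_map_compatible A B \<Delta> \<epsilon> S \<Delta>' \<epsilon>' S' f \<longleftrightarrow>
     (\<forall>x\<in>carrier A. \<Delta>' (f x) = tensor_map A A B B f f (\<Delta> x) \<and> \<epsilon>' (f x) = \<epsilon> x \<and> S' (f x) = f (S x))"

definition is_ZW_embedding ::
    "'i set \<Rightarrow> ('i \<Rightarrow> 'i \<Rightarrow> nat) \<Rightarrow> ('a, 'n) ring_scheme \<Rightarrow> ('i \<Rightarrow> 'a) \<Rightarrow> (('i list set \<Rightarrow> int) \<Rightarrow> 'a) \<Rightarrow> bool" where
  "is_ZW_embedding I m A s g \<longleftrightarrow>
     g \<in> ring_hom (monoid_ring \<Z> (coxeter_group I m)) A
     \<and> inj_on g (carrier (monoid_ring \<Z> (coxeter_group I m)))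
     \<and> (\<forall>i\<in>I. g (mterm \<Z> 1 (simple_refl I m i)) = s i)"

end

theory Submission
  imports Defs "HOL.Transcendental"
begin

text \<open>
  \<open>Hhat\<close> acts from the right on \<open>Hhat \<otimes> \<int>W\<close> through the coproduct, where \<open>s\<^sub>i\<close> acts on \<open>\<int>W\<close> by right
  multiplication and \<open>D\<^sub>i\<close> by \<open>a \<mapsto> a - a s\<^sub>i\<close> if \<open>a s\<^sub>i\<close> is shorter than \<open>a\<close> and by \<open>a \<mapsto> 0\<close> otherwise.
  An element \<open>x\<close> is the sum of the coefficients of \<open>(1 \<otimes> 1) x\<close>, and their counits \<open>ef x\<close> vanish on both
  ideals. Hence \<open>x \<otimes> c \<mapsto> \<Sum>\<^sub>w c \<sqdot> ef x w \<sqdot> T\<^sub>w\<close> is a left inverse of the homomorphism of the theorem.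

  For the braid relation replace \<open>1 - q\<^sub>i\<close> by a power of a formal parameter \<open>X\<close>. The two alternating products
  of the \<open>s\<^sub>i + X\<^sup>a D\<^sub>i\<close> act on \<open>\<int>W[[X]]\<close> by right Hecke operators, which commute with the left ones; so their
  action on \<open>w\<close> is determined by their action on \<open>1\<close>. It follows that the lowest coefficient of their difference is
  \<open>\<Sum>\<^sub>w k\<^sub>w w\<close> with \<open>k\<^sub>w \<in> K\<^sub>i\<^sub>j\<close>. Subtracting the product of the \<open>s\<^sub>i + X\<^sup>a D\<^sub>i\<close> over a reduced word of \<open>w\<close>,
  multiplied by \<open>k\<^sub>w\<close>, for all \<open>w\<close>, raises the order and keeps all properties used; so every coefficient lies in
  the ideal generated by \<open>K\<^sub>i\<^sub>j\<close>.
\<close>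

section \<open>Quotients by additive subgroups and ideals\<close>

text \<open>K(W) and the K_ij are intersections of conjugates of a subalgebra, and no generators of
  them are at hand, so membership has to be recognised rather than computed. The coproduct action
  does this: an element of the algebra generated by the D_s acts at 1 by right multiplication of the
  coefficient alone, and an element of K(W) acts in this way at every group element, since
  conjugation moves each of them to 1. For the converse, conjugates are controlled by comparing the
  coefficients of the action at different elements of the dihedral group. This is the task of the
  formal parameter: the left Hecke operators are left translations modulo higher powers of X, so the
  coefficients are comparable in the lowest degree, and the reduction has to go degree by degree. If
  m_ij is odd, the two generators are conjugate and the left and right operators interact at
  elements with s_k w = w s_i; their commutation there rests on equal weights, whence q_i = q_j. If
  m_ij is even, the two parameters become powers of one, with exponents that can be separated
  again.\<close>

definition qlift :: "('a, 'm) ring_scheme \<Rightarrow> 'a set \<Rightarrow> ('a \<Rightarrow> 'b) \<Rightarrow> 'a set \<Rightarrow> 'b" where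
  "qlift S J f = restrict (\<lambda>X. f (SOME x. x \<in> X)) (carrier (S Quot J))"

lemma carrier_Quot: "carrier (S Quot J) = (\<lambda>x. J +>\<^bsub>S\<^esub> x) ` carrier S"
  by (auto simp: FactRing_def A_RCOSETS_def' )

text \<open>Several maps of the proof are only additive: the extensions of bilinear maps to tensor
  products, the maps sending \<open>x\<close> to \<open>ef x w\<close>, the left inverse of the
  Hecke homomorphism. Lifting to quotients and extension from terms are therefore set up for
  additive maps, and ring homomorphisms inherit them.\<close>

locale abgroup_hom = S: abelian_group S + A: abelian_group A
  for S (structure) and A (structure) +
  fixes f
  assumes closed [simp, intro]: "x \<in> carrier S \<Longrightarrow> f x \<in> carrier A"
    and add [simp]: "\<lbrakk>x \<in> carrier S; y \<in> carrier S\<rbrakk> \<Longrightarrow> f (x \<oplus>\<^bsub>S\<^esub> y) = f x \<oplus>\<^bsub>A\<^esub> f y"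
begin

lemma zero [simp]: "f \<zero>\<^bsub>S\<^esub> = \<zero>\<^bsub>A\<^esub>"
  using add[of "\<zero>\<^bsub>S\<^esub>" "\<zero>\<^bsub>S\<^esub>"] by (metis A.add.l_cancel_one' S.add.l_one S.zero_closed closed)

lemma a_inv [simp]: "x \<in> carrier S \<Longrightarrow> f (\<ominus>\<^bsub>S\<^esub> x) = \<ominus>\<^bsub>A\<^esub> f x"
  by (metis A.minus_equality S.add.inv_closed S.l_neg add closed zero)

lemma a_minus [simp]: "\<lbrakk>x \<in> carrier S; y \<in> carrier S\<rbrakk> \<Longrightarrow> f (x \<ominus>\<^bsub>S\<^esub> y) = f x \<ominus>\<^bsub>A\<^esub> f y"
  by (simp add: a_minus_def)

end

lemma abgroup_homI:
  assumes "abelian_group S" "abelian_group A"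
    and "\<And>x. x \<in> carrier S \<Longrightarrow> f x \<in> carrier A"
    and "\<And>x y. \<lbrakk>x \<in> carrier S; y \<in> carrier S\<rbrakk> \<Longrightarrow> f (x \<oplus>\<^bsub>S\<^esub> y) = f x \<oplus>\<^bsub>A\<^esub> f y"
  shows "abgroup_hom S A f"
  using assms by (simp add: abgroup_hom_def abgroup_hom_axioms_def)

locale ring_homo = S: ring S + A: ring A for S (structure) and A (structure) +
  fixes f assumes ring_hom: "f \<in> ring_hom S A"

sublocale ring_homo \<subseteq> abgroup_hom S A f
  using ring_hom by unfold_locales (auto simp: ring_hom_closed ring_hom_add)

lemma (in ring_homo) mult [simp]: "\<lbrakk>x \<in> carrier S; y \<in> carrier S\<rbrakk> \<Longrightarrow> f (x \<otimes>\<^bsub>S\<^esub> y) = f x \<otimes>\<^bsub>A\<^esub> f y"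
  using ring_hom by (rule ring_hom_mult)

lemma (in ring_homo) one [simp]: "f \<one>\<^bsub>S\<^esub> = \<one>\<^bsub>A\<^esub>"
  using ring_hom by (rule ring_hom_one)

lemma ring_homoI: "\<lbrakk>ring S; ring A; f \<in> ring_hom S A\<rbrakk> \<Longrightarrow> ring_homo S A f"
  by (simp add: ring_homo_def ring_homo_axioms_def)

lemma (in additive_subgroup) rep_coset:
  assumes "abelian_group G" "x \<in> carrier G"
  shows "\<exists>j\<in>H. (SOME y. y \<in> H +>\<^bsub>G\<^esub> x) = j \<oplus>\<^bsub>G\<^esub> x"
proof -
  interpret A: abelian_group G by fact
  have "\<zero> \<in> H" by (rule zero_closed)
  then have "H +> x \<noteq> {}" by (auto simp: a_r_coset_def' simp del: zero_closed)
  then have "(SOME y. y \<in> H +>\<^bsub>G\<^esub> x) \<in> H +> x" by (simp add: some_in_eq)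
  then show ?thesis unfolding a_r_coset_def' by blast
qed

text \<open>The representative picked by \<open>SOME\<close> inside \<open>qlift\<close> differs
  from \<open>x\<close> by an element of \<open>J\<close>, on which \<open>f\<close>
  vanishes.\<close>

lemma (in abgroup_hom) qlift_coset:
  assumes "additive_subgroup J S" "\<And>j. j \<in> J \<Longrightarrow> f j = \<zero>\<^bsub>A\<^esub>" "x \<in> carrier S"
  shows "qlift S J f (J +>\<^bsub>S\<^esub> x) = f x"
proof -
  interpret J: additive_subgroup J S by fact
  obtain j where j: "j \<in> J" "(SOME y. y \<in> J +>\<^bsub>S\<^esub> x) = j \<oplus>\<^bsub>S\<^esub> x"
    using J.rep_coset S.abelian_group_axioms assms(3) by blast
  have "j \<in> carrier S" using j(1) by (rule J.a_Hcarr)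
  then have "f (j \<oplus>\<^bsub>S\<^esub> x) = f x" using assms j by simp
  then show ?thesis using assms(3) j(2) by (auto simp: qlift_def carrier_Quot)
qed

lemma Quot_add:
  assumes "abelian_group S" "additive_subgroup J S" "x \<in> carrier S" "y \<in> carrier S"
  shows "(J +>\<^bsub>S\<^esub> x) \<oplus>\<^bsub>S Quot J\<^esub> (J +>\<^bsub>S\<^esub> y) = J +>\<^bsub>S\<^esub> (x \<oplus>\<^bsub>S\<^esub> y)"
proof -
  interpret S: abelian_group S by fact
  have "abelian_subgroup J S"
    using assms by (simp add: abelian_subgroupI3)
  then show ?thesis
    using assms by (simp add: FactRing_def abelian_subgroup.a_rcos_sum)
qed

lemma (in abgroup_hom) qlift_hom:
  assumes J: "additive_subgroup J S" "\<And>j. j \<in> J \<Longrightarrow> f j = \<zero>\<^bsub>A\<^esub>" and "abelian_group (S Quot J)"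
  shows "abgroup_hom (S Quot J) A (qlift S J f)"
proof (rule abgroup_homI)
  fix X Y assume "X \<in> carrier (S Quot J)" "Y \<in> carrier (S Quot J)"
  then obtain x y where "x \<in> carrier S" "X = J +>\<^bsub>S\<^esub> x" "y \<in> carrier S" "Y = J +>\<^bsub>S\<^esub> y"
    by (auto simp: carrier_Quot)
  then show "qlift S J f (X \<oplus>\<^bsub>S Quot J\<^esub> Y) = qlift S J f X \<oplus>\<^bsub>A\<^esub> qlift S J f Y"
    using J by (simp add: Quot_add S.abelian_group_axioms qlift_coset)
next
  fix X assume "X \<in> carrier (S Quot J)"
  then obtain x where "x \<in> carrier S" "X = J +>\<^bsub>S\<^esub> x" by (auto simp: carrier_Quot)
  then show "qlift S J f X \<in> carrier A" using J by (simp add: qlift_coset)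
qed (use assms A.abelian_group_axioms in auto)

lemma (in ideal) Quot_mult:
  "\<lbrakk>x \<in> carrier R; y \<in> carrier R\<rbrakk> \<Longrightarrow> (I +> x) \<otimes>\<^bsub>R Quot I\<^esub> (I +> y) = I +> (x \<otimes> y)"
  by (simp add: FactRing_def rcoset_mult_add)

lemma (in ideal) Quot_add:
  "\<lbrakk>x \<in> carrier R; y \<in> carrier R\<rbrakk> \<Longrightarrow> (I +> x) \<oplus>\<^bsub>R Quot I\<^esub> (I +> y) = I +> (x \<oplus> y)"
  by (simp add: FactRing_def a_rcos_sum)

lemma (in ideal) Quot_one: "\<one>\<^bsub>R Quot I\<^esub> = I +> \<one>"
  by (simp add: FactRing_def)

lemma (in ring_homo) qlift_ring_hom:
  assumes "ideal J S" and z: "\<And>j. j \<in> J \<Longrightarrow> f j = \<zero>\<^bsub>A\<^esub>"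
  shows "qlift S J f \<in> ring_hom (S Quot J) A"
proof -
  interpret J: ideal J S by fact
  note q = qlift_coset[OF J.additive_subgroup_axioms z]
  show ?thesis
  proof (rule ring_hom_memI)
    fix X Y assume "X \<in> carrier (S Quot J)" "Y \<in> carrier (S Quot J)"
    then obtain x y where "x \<in> carrier S" "X = J +>\<^bsub>S\<^esub> x" "y \<in> carrier S" "Y = J +>\<^bsub>S\<^esub> y"
      by (auto simp: carrier_Quot)
    then show "qlift S J f (X \<otimes>\<^bsub>S Quot J\<^esub> Y) = qlift S J f X \<otimes>\<^bsub>A\<^esub> qlift S J f Y"
      "qlift S J f (X \<oplus>\<^bsub>S Quot J\<^esub> Y) = qlift S J f X \<oplus>\<^bsub>A\<^esub> qlift S J f Y"
      by (simp_all add: J.Quot_mult J.Quot_add q)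
  next
    fix X assume "X \<in> carrier (S Quot J)"
    then obtain x where "x \<in> carrier S" "X = J +>\<^bsub>S\<^esub> x" by (auto simp: carrier_Quot)
    then show "qlift S J f X \<in> carrier A" by (simp add: q)
  qed (simp add: J.Quot_one q)
qed

lemma qlift_extensional: "qlift S J f \<in> extensional (carrier (S Quot J))"
  by (simp add: qlift_def)

text \<open>The kernel is a two-sided ideal, and \<open>Idl\<close> is the smallest one containing
  \<open>E\<close>.\<close>

lemma (in ring_homo) zero_on_Idl:
  assumes "E \<subseteq> carrier S" "\<And>x. x \<in> E \<Longrightarrow> f x = \<zero>\<^bsub>A\<^esub>" "x \<in> Idl\<^bsub>S\<^esub> E"
  shows "f x = \<zero>\<^bsub>A\<^esub>"
proof -
  have "ideal (a_kernel S A f) S"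
    by (simp add: A.ring_axioms S.ring_axioms ring_hom ring_hom_ring.kernel_is_ideal ring_hom_ringI2)
  moreover have "E \<subseteq> a_kernel S A f" using assms by (auto simp: a_kernel_def')
  ultimately have "x \<in> a_kernel S A f" using assms(3) S.genideal_minimal by blast
  then show ?thesis by (simp add: a_kernel_def')
qed

section \<open>Monoid rings\<close>

lemma mterm_eq [simp]: "mterm R c x x = c"
  by (simp add: mterm_def)

lemma mterm_neq [simp]: "y \<noteq> x \<Longrightarrow> mterm R c x y = \<zero>\<^bsub>R\<^esub>"
  by (simp add: mterm_def)

lemma msupp_mterm: "msupp R (mterm R c x) \<subseteq> {x}"
  by (auto simp: msupp_def mterm_def)

text \<open>Additive extension of a map prescribed on single terms. The coefficient is an argument
  of \<open>\<tau>\<close> because \<open>A\<close> may be a mere abelian group without scalars from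
  \<open>R\<close>; the same definition then serves ring homomorphisms, bilinear maps and integral
  combinations of the \<open>Tw w\<close>.\<close>

definition mr_ext :: "('r, 'b) ring_scheme \<Rightarrow> ('a, 'c) ring_scheme \<Rightarrow> ('x \<Rightarrow> 'r \<Rightarrow> 'a) \<Rightarrow> ('x \<Rightarrow> 'r) \<Rightarrow> 'a" where
  "mr_ext R A \<tau> f = finsum A (\<lambda>x. \<tau> x (f x)) (msupp R f)"

locale mring = R: ring R + M: monoid M for R (structure) and M (structure)
begin

abbreviation RM where "RM \<equiv> monoid_ring R M"

lemma mem_iff: "f \<in> carrier RM \<longleftrightarrow> (\<forall>x. f x \<in> carrier R) \<and> finite (msupp R f) \<and> msupp R f \<subseteq> carrier M"
  by (simp add: monoid_ring_def)

lemma coeff: "f \<in> carrier RM \<Longrightarrow> f x \<in> carrier R" by (simp add: mem_iff)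
lemma fin [intro]: "f \<in> carrier RM \<Longrightarrow> finite (msupp R f)" using mem_iff by blast
lemma supp: "f \<in> carrier RM \<Longrightarrow> msupp R f \<subseteq> carrier M" using mem_iff by blast
lemma outside: "f \<in> carrier RM \<Longrightarrow> x \<notin> carrier M \<Longrightarrow> f x = \<zero>\<^bsub>R\<^esub>"
  using supp[of f] unfolding msupp_def by blast

lemma add_eq [simp]: "f \<oplus>\<^bsub>RM\<^esub> g = (\<lambda>x. f x \<oplus>\<^bsub>R\<^esub> g x)" by (simp add: monoid_ring_def)
lemma zero_eq [simp]: "\<zero>\<^bsub>RM\<^esub> = (\<lambda>x. \<zero>\<^bsub>R\<^esub>)" by (simp add: monoid_ring_def)
lemma one_eq: "\<one>\<^bsub>RM\<^esub> = mterm R \<one>\<^bsub>R\<^esub> \<one>\<^bsub>M\<^esub>" by (simp add: monoid_ring_def)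

lemma mterm_closed [simp, intro]: "c \<in> carrier R \<Longrightarrow> x \<in> carrier M \<Longrightarrow> mterm R c x \<in> carrier RM"
  using msupp_mterm[of R c x] unfolding mem_iff by (auto simp: mterm_def intro: finite_subset)

lemma memI:
  assumes "\<And>x. f x \<in> carrier R" "finite A" "A \<subseteq> carrier M" "\<And>x. x \<notin> A \<Longrightarrow> f x = \<zero>\<^bsub>R\<^esub>"
  shows "f \<in> carrier RM"
proof -
  have "msupp R f \<subseteq> A" using assms(4) by (auto simp: msupp_def)
  then show ?thesis using assms unfolding mem_iff by (auto intro: finite_subset)
qed

lemma add_closed: "\<lbrakk>f \<in> carrier RM; g \<in> carrier RM\<rbrakk> \<Longrightarrow> (\<lambda>x. f x \<oplus>\<^bsub>R\<^esub> g x) \<in> carrier RM"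
  using coeff[of f] coeff[of g] supp[of f] supp[of g] fin[of f] fin[of g]
  by (intro memI[of _ "msupp R f \<union> msupp R g"]) (auto simp: msupp_def)

lemma uminus_closed: "f \<in> carrier RM \<Longrightarrow> (\<lambda>x. \<ominus>\<^bsub>R\<^esub> f x) \<in> carrier RM"
  using coeff[of f] supp[of f] fin[of f] by (intro memI[of _ "msupp R f"]) (auto simp: msupp_def)

lemma abelian_group_RM: "abelian_group RM"
proof (rule abelian_groupI)
  fix f assume "f \<in> carrier RM"
  then show "\<exists>g\<in>carrier RM. g \<oplus>\<^bsub>RM\<^esub> f = \<zero>\<^bsub>RM\<^esub>"
    using coeff[of f] by (intro bexI[of _ "\<lambda>x. \<ominus>\<^bsub>R\<^esub> f x"]) (auto simp: R.l_neg uminus_closed)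
  show "\<zero>\<^bsub>RM\<^esub> \<oplus>\<^bsub>RM\<^esub> f = f" using \<open>f \<in> carrier RM\<close> coeff[of f] by auto
next
  fix f g h assume "f \<in> carrier RM" "g \<in> carrier RM" "h \<in> carrier RM"
  then show "f \<oplus>\<^bsub>RM\<^esub> g \<oplus>\<^bsub>RM\<^esub> h = f \<oplus>\<^bsub>RM\<^esub> (g \<oplus>\<^bsub>RM\<^esub> h)"
    using coeff[of f] coeff[of g] coeff[of h] by (auto simp: R.a_assoc)
next
  fix f g assume "f \<in> carrier RM" "g \<in> carrier RM"
  then show "f \<oplus>\<^bsub>RM\<^esub> g = g \<oplus>\<^bsub>RM\<^esub> f"
    using coeff[of f] coeff[of g] by (auto simp: R.a_comm)
qed (auto simp: add_closed intro: memI[of _ "{}"])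

sublocale RMg: abelian_group RM by (rule abelian_group_RM)

lemma uminus_eq: "f \<in> carrier RM \<Longrightarrow> \<ominus>\<^bsub>RM\<^esub> f = (\<lambda>x. \<ominus>\<^bsub>R\<^esub> f x)"
  using coeff[of f] by (intro RMg.minus_equality) (auto simp: R.l_neg uminus_closed)

lemma mterm_add: "\<lbrakk>c \<in> carrier R; d \<in> carrier R\<rbrakk> \<Longrightarrow> mterm R c x \<oplus>\<^bsub>RM\<^esub> mterm R d x = mterm R (c \<oplus>\<^bsub>R\<^esub> d) x"
  by (auto simp: mterm_def)

lemma mterm_zero: "mterm R \<zero>\<^bsub>R\<^esub> x = \<zero>\<^bsub>RM\<^esub>"
  by (auto simp: mterm_def)

text \<open>Induction on the support: setting one coefficient to zero splits off a single
  term.\<close>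

lemma RM_induct [consumes 1, case_names zero mterm add]:
  assumes "f \<in> carrier RM" and "P \<zero>\<^bsub>RM\<^esub>"
    and t: "\<And>c x. \<lbrakk>c \<in> carrier R; x \<in> carrier M\<rbrakk> \<Longrightarrow> P (mterm R c x)"
    and a: "\<And>f g. \<lbrakk>f \<in> carrier RM; g \<in> carrier RM; P f; P g\<rbrakk> \<Longrightarrow> P (f \<oplus>\<^bsub>RM\<^esub> g)"
  shows "P f"
proof -
  have "finite A \<Longrightarrow> \<forall>f\<in>carrier RM. msupp R f = A \<longrightarrow> P f" for A
  proof (induction A rule: finite_induct)
    case empty
    then show ?case using assms(2) by (auto simp: msupp_def)
  next
    case (insert y A)
    show ?case
    proof (intro ballI impI)
      fix f assume f: "f \<in> carrier RM" "msupp R f = insert y A"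
      let ?g = "f(y := \<zero>\<^bsub>R\<^esub>)"
      have "y \<in> carrier M" using f supp by blast
      have sg: "msupp R ?g = A" using f(2) insert.hyps by (auto simp: msupp_def fun_eq_iff)
      then have g: "?g \<in> carrier RM" using f insert.hyps supp[OF f(1)] coeff[OF f(1)]
        by (intro memI[of _ A]) (auto simp: msupp_def)
      have "f = mterm R (f y) y \<oplus>\<^bsub>RM\<^esub> ?g"
        using coeff[OF f(1)] by (auto simp: mterm_def fun_eq_iff)
      moreover have "P (mterm R (f y) y \<oplus>\<^bsub>RM\<^esub> ?g)"
        using insert.IH g sg \<open>y \<in> carrier M\<close> f coeff[OF f(1)] by (intro a t) auto
      ultimately show "P f" by simp
    qed
  qed
  then show ?thesis using assms(1) by auto
qed

end

locale mring_ext = mring R M + A: abelian_group A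
  for R (structure) and M (structure) and A (structure) +
  fixes \<tau>
  assumes tau_closed [simp, intro]: "\<And>x c. \<lbrakk>x \<in> carrier M; c \<in> carrier R\<rbrakk> \<Longrightarrow> \<tau> x c \<in> carrier A"
    and tau_add: "\<And>x c d. \<lbrakk>x \<in> carrier M; c \<in> carrier R; d \<in> carrier R\<rbrakk> \<Longrightarrow> \<tau> x (c \<oplus>\<^bsub>R\<^esub> d) = \<tau> x c \<oplus>\<^bsub>A\<^esub> \<tau> x d"
begin

lemma tau_zero: "x \<in> carrier M \<Longrightarrow> \<tau> x \<zero>\<^bsub>R\<^esub> = \<zero>\<^bsub>A\<^esub>"
  using tau_add[of x "\<zero>\<^bsub>R\<^esub>" "\<zero>\<^bsub>R\<^esub>"]
  by (metis A.add.l_cancel_one' R.add.one_closed R.add.r_one tau_closed)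

text \<open>Additivity forces \<open>\<tau> x\<close> to vanish at zero, so points outside the
  support may be included. Two functions thereby get a common index set.\<close>

lemma ext_eq:
  assumes "f \<in> carrier RM" "finite B" "msupp R f \<subseteq> B" "B \<subseteq> carrier M"
  shows "mr_ext R A \<tau> f = finsum A (\<lambda>x. \<tau> x (f x)) B"
  unfolding mr_ext_def using assms coeff[OF assms(1)]
  by (intro A.add.finprod_mono_neutral_cong_left) (auto simp: msupp_def tau_zero subset_iff)

lemma ext_hom: "abgroup_hom RM A (mr_ext R A \<tau>)"
proof (rule abgroup_homI)
  fix f g assume fg: "f \<in> carrier RM" "g \<in> carrier RM"
  let ?B = "msupp R f \<union> msupp R g"
  note cf = coeff[OF fg(1)] coeff[OF fg(2)]
  have B: "finite ?B" "?B \<subseteq> carrier M" using fg supp by auto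
  have 1: "msupp R (\<lambda>x. f x \<oplus>\<^bsub>R\<^esub> g x) \<subseteq> ?B" using fg by (auto simp: msupp_def)
  have "mr_ext R A \<tau> (\<lambda>x. f x \<oplus>\<^bsub>R\<^esub> g x) = finsum A (\<lambda>x. \<tau> x (f x \<oplus>\<^bsub>R\<^esub> g x)) ?B"
    using fg B 1 add_closed by (intro ext_eq) auto
  also have "\<dots> = finsum A (\<lambda>x. \<tau> x (f x) \<oplus>\<^bsub>A\<^esub> \<tau> x (g x)) ?B"
    using B fg cf by (intro A.finsum_cong') (auto simp: tau_add subset_iff)
  also have "\<dots> = mr_ext R A \<tau> f \<oplus>\<^bsub>A\<^esub> mr_ext R A \<tau> g"
    using B fg cf by (subst A.finsum_addf) (auto simp: subset_iff ext_eq[OF _ B(1) _ B(2)])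
  finally show "mr_ext R A \<tau> (f \<oplus>\<^bsub>RM\<^esub> g) = mr_ext R A \<tau> f \<oplus>\<^bsub>A\<^esub> mr_ext R A \<tau> g" by simp
next
  fix f assume "f \<in> carrier RM"
  then show "mr_ext R A \<tau> f \<in> carrier A"
    unfolding mr_ext_def using supp[of f] coeff[of f] by (intro A.finsum_closed) (auto simp: subset_iff)
qed (simp_all add: A.abelian_group_axioms abelian_group_RM)

lemma ext_mterm: "\<lbrakk>c \<in> carrier R; x \<in> carrier M\<rbrakk> \<Longrightarrow> mr_ext R A \<tau> (mterm R c x) = \<tau> x c"
  using ext_eq[of "mterm R c x" "{x}"] msupp_mterm[of R c x] by auto

end

section \<open>Multiplication in monoid rings\<close>

context mring begin

text \<open>The rectangle replaces the set of pairs lying over \<open>z\<close>, which depends on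
  the exact supports of both factors. Distributivity needs one index set for two functions and their
  sum.\<close>

lemma mult_eq:
  assumes "f \<in> carrier RM" "g \<in> carrier RM" "finite A" "finite B" "msupp R f \<subseteq> A" "msupp R g \<subseteq> B"
  shows "(f \<otimes>\<^bsub>RM\<^esub> g) z = (\<Oplus>\<^bsub>R\<^esub>p\<in>A \<times> B. if fst p \<otimes>\<^bsub>M\<^esub> snd p = z then f (fst p) \<otimes>\<^bsub>R\<^esub> g (snd p) else \<zero>\<^bsub>R\<^esub>)"
proof -
  have "(f \<otimes>\<^bsub>RM\<^esub> g) z = (\<Oplus>\<^bsub>R\<^esub>p \<in> {p \<in> msupp R f \<times> msupp R g. fst p \<otimes>\<^bsub>M\<^esub> snd p = z}.
                f (fst p) \<otimes>\<^bsub>R\<^esub> g (snd p))" by (simp add: monoid_ring_def)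
  also have "\<dots> = (\<Oplus>\<^bsub>R\<^esub>p\<in>A \<times> B. if fst p \<otimes>\<^bsub>M\<^esub> snd p = z then f (fst p) \<otimes>\<^bsub>R\<^esub> g (snd p) else \<zero>\<^bsub>R\<^esub>)"
    using assms coeff[OF assms(1)] coeff[OF assms(2)] fin[OF assms(1)] fin[OF assms(2)]
    by (intro R.add.finprod_mono_neutral_cong_left) (auto simp: msupp_def)
  finally show ?thesis .
qed

lemma mult_closed:
  assumes "f \<in> carrier RM" "g \<in> carrier RM"
  shows "f \<otimes>\<^bsub>RM\<^esub> g \<in> carrier RM"
proof (rule memI)
  let ?S = "msupp R f \<times> msupp R g"
  show "finite ((\<lambda>p. fst p \<otimes>\<^bsub>M\<^esub> snd p) ` ?S)" using assms by auto
  show "(\<lambda>p. fst p \<otimes>\<^bsub>M\<^esub> snd p) ` ?S \<subseteq> carrier M" using assms supp by fastforce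
  fix z
  show "(f \<otimes>\<^bsub>RM\<^esub> g) z \<in> carrier R"
    using assms coeff[OF assms(1)] coeff[OF assms(2)] fin[OF assms(1)] fin[OF assms(2)]
    by (subst mult_eq[OF assms, of "msupp R f" "msupp R g"]) (auto intro!: R.finsum_closed)
  assume "z \<notin> (\<lambda>p. fst p \<otimes>\<^bsub>M\<^esub> snd p) ` ?S"
  then have "fst p \<otimes>\<^bsub>M\<^esub> snd p \<noteq> z" if "p \<in> ?S" for p using that by blast
  then have "(\<Oplus>\<^bsub>R\<^esub>p\<in>?S. if fst p \<otimes>\<^bsub>M\<^esub> snd p = z then f (fst p) \<otimes>\<^bsub>R\<^esub> g (snd p) else \<zero>\<^bsub>R\<^esub>)
     = (\<Oplus>\<^bsub>R\<^esub>p\<in>?S. \<zero>\<^bsub>R\<^esub>)"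
    by (intro R.finsum_cong') auto
  then show "(f \<otimes>\<^bsub>RM\<^esub> g) z = \<zero>\<^bsub>R\<^esub>"
    using assms fin[OF assms(1)] fin[OF assms(2)]
    by (subst mult_eq[OF assms, of "msupp R f" "msupp R g"]) simp_all
qed

lemma mult_mterm:
  assumes "c \<in> carrier R" "d \<in> carrier R" "x \<in> carrier M" "y \<in> carrier M"
  shows "mterm R c x \<otimes>\<^bsub>RM\<^esub> mterm R d y = mterm R (c \<otimes>\<^bsub>R\<^esub> d) (x \<otimes>\<^bsub>M\<^esub> y)"
proof
  fix z
  show "(mterm R c x \<otimes>\<^bsub>RM\<^esub> mterm R d y) z = mterm R (c \<otimes>\<^bsub>R\<^esub> d) (x \<otimes>\<^bsub>M\<^esub> y) z"
    using assms mult_eq[of "mterm R c x" "mterm R d y" "{x}" "{y}" z]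
    by (cases "z = x \<otimes>\<^bsub>M\<^esub> y") (simp_all add: msupp_mterm)
qed

lemma mult_distr:
  assumes "f \<in> carrier RM" "g \<in> carrier RM" "h \<in> carrier RM"
  shows "(f \<oplus>\<^bsub>RM\<^esub> g) \<otimes>\<^bsub>RM\<^esub> h = f \<otimes>\<^bsub>RM\<^esub> h \<oplus>\<^bsub>RM\<^esub> g \<otimes>\<^bsub>RM\<^esub> h"
    and "h \<otimes>\<^bsub>RM\<^esub> (f \<oplus>\<^bsub>RM\<^esub> g) = h \<otimes>\<^bsub>RM\<^esub> f \<oplus>\<^bsub>RM\<^esub> h \<otimes>\<^bsub>RM\<^esub> g"
proof -
  let ?A = "msupp R f \<union> msupp R g" and ?B = "msupp R h"
  have fin: "finite ?A" "finite ?B" using assms by auto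
  note cf = coeff[OF assms(1)] coeff[OF assms(2)] coeff[OF assms(3)]
  have s: "msupp R (\<lambda>x. f x \<oplus>\<^bsub>R\<^esub> g x) \<subseteq> ?A" using assms by (auto simp: msupp_def)
  show "(f \<oplus>\<^bsub>RM\<^esub> g) \<otimes>\<^bsub>RM\<^esub> h = f \<otimes>\<^bsub>RM\<^esub> h \<oplus>\<^bsub>RM\<^esub> g \<otimes>\<^bsub>RM\<^esub> h"
  proof
    fix z
    let ?t = "\<lambda>f p. if fst p \<otimes>\<^bsub>M\<^esub> snd p = z then f (fst p) \<otimes>\<^bsub>R\<^esub> h (snd p) else \<zero>\<^bsub>R\<^esub>"
    have "((\<lambda>x. f x \<oplus>\<^bsub>R\<^esub> g x) \<otimes>\<^bsub>RM\<^esub> h) z = finsum R (?t (\<lambda>x. f x \<oplus>\<^bsub>R\<^esub> g x)) (?A \<times> ?B)"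
      using assms s fin by (intro mult_eq add_closed) auto
    also have "\<dots> = finsum R (\<lambda>p. ?t f p \<oplus>\<^bsub>R\<^esub> ?t g p) (?A \<times> ?B)"
      using cf by (intro R.finsum_cong') (auto simp: R.l_distr)
    also have "\<dots> = finsum R (?t f) (?A \<times> ?B) \<oplus>\<^bsub>R\<^esub> finsum R (?t g) (?A \<times> ?B)"
      using cf by (intro R.finsum_addf) auto
    also have "\<dots> = (f \<otimes>\<^bsub>RM\<^esub> h) z \<oplus>\<^bsub>R\<^esub> (g \<otimes>\<^bsub>RM\<^esub> h) z"
      using assms fin by (simp add: mult_eq[where A = ?A and B = ?B])
    finally show "((f \<oplus>\<^bsub>RM\<^esub> g) \<otimes>\<^bsub>RM\<^esub> h) z = (f \<otimes>\<^bsub>RM\<^esub> h \<oplus>\<^bsub>RM\<^esub> g \<otimes>\<^bsub>RM\<^esub> h) z"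
      by simp
  qed
  show "h \<otimes>\<^bsub>RM\<^esub> (f \<oplus>\<^bsub>RM\<^esub> g) = h \<otimes>\<^bsub>RM\<^esub> f \<oplus>\<^bsub>RM\<^esub> h \<otimes>\<^bsub>RM\<^esub> g"
  proof
    fix z
    let ?t = "\<lambda>f p. if fst p \<otimes>\<^bsub>M\<^esub> snd p = z then h (fst p) \<otimes>\<^bsub>R\<^esub> f (snd p) else \<zero>\<^bsub>R\<^esub>"
    have "(h \<otimes>\<^bsub>RM\<^esub> (\<lambda>x. f x \<oplus>\<^bsub>R\<^esub> g x)) z = finsum R (?t (\<lambda>x. f x \<oplus>\<^bsub>R\<^esub> g x)) (?B \<times> ?A)"
      using assms s fin by (intro mult_eq add_closed) auto
    also have "\<dots> = finsum R (\<lambda>p. ?t f p \<oplus>\<^bsub>R\<^esub> ?t g p) (?B \<times> ?A)"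
      using cf by (intro R.finsum_cong') (auto simp: R.r_distr)
    also have "\<dots> = finsum R (?t f) (?B \<times> ?A) \<oplus>\<^bsub>R\<^esub> finsum R (?t g) (?B \<times> ?A)"
      using cf by (intro R.finsum_addf) auto
    also have "\<dots> = (h \<otimes>\<^bsub>RM\<^esub> f) z \<oplus>\<^bsub>R\<^esub> (h \<otimes>\<^bsub>RM\<^esub> g) z"
      using assms fin by (simp add: mult_eq[where A = ?B and B = ?A])
    finally show "(h \<otimes>\<^bsub>RM\<^esub> (f \<oplus>\<^bsub>RM\<^esub> g)) z = (h \<otimes>\<^bsub>RM\<^esub> f \<oplus>\<^bsub>RM\<^esub> h \<otimes>\<^bsub>RM\<^esub> g) z"
      by simp
  qed
qed

lemma RM_zero_mult: "f \<in> carrier RM \<Longrightarrow> \<zero>\<^bsub>RM\<^esub> \<otimes>\<^bsub>RM\<^esub> f = \<zero>\<^bsub>RM\<^esub>"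
  "f \<in> carrier RM \<Longrightarrow> f \<otimes>\<^bsub>RM\<^esub> \<zero>\<^bsub>RM\<^esub> = \<zero>\<^bsub>RM\<^esub>"
  by (auto simp: monoid_ring_def msupp_def)

lemma add_closed': "\<lbrakk>f \<in> carrier RM; g \<in> carrier RM\<rbrakk> \<Longrightarrow> f \<oplus>\<^bsub>RM\<^esub> g \<in> carrier RM"
  by (rule RMg.a_closed)

lemma zero_closed': "\<zero>\<^bsub>RM\<^esub> \<in> carrier RM"
  by (rule RMg.zero_closed)

lemmas RM_rules = mult_distr mult_closed RM_zero_mult add_closed' zero_closed'

text \<open>Both sides of associativity are additive in each factor. Inductions over
  \<open>h\<close>, \<open>g\<close> and \<open>f\<close> bring it down to terms, where it is
  associativity in \<open>R\<close> and in \<open>M\<close>.\<close>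

lemma ring_RM: "ring RM"
proof (rule ringI)
  note add_eq [simp del] zero_eq [simp del]
  show "abelian_group RM" by (rule abelian_group_RM)
  show "monoid RM"
  proof (rule monoidI)
    fix f g h assume f: "f \<in> carrier RM" and g: "g \<in> carrier RM" and h: "h \<in> carrier RM"
    have 1: "mterm R c x \<otimes>\<^bsub>RM\<^esub> mterm R d y \<otimes>\<^bsub>RM\<^esub> h = mterm R c x \<otimes>\<^bsub>RM\<^esub> (mterm R d y \<otimes>\<^bsub>RM\<^esub> h)"
      if "c \<in> carrier R" "x \<in> carrier M" "d \<in> carrier R" "y \<in> carrier M" for c x d y
      using h that by (induction rule: RM_induct)
        (simp_all add: RM_rules mult_mterm R.m_assoc M.m_assoc)
    have 2: "mterm R c x \<otimes>\<^bsub>RM\<^esub> g \<otimes>\<^bsub>RM\<^esub> h = mterm R c x \<otimes>\<^bsub>RM\<^esub> (g \<otimes>\<^bsub>RM\<^esub> h)"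
      if "c \<in> carrier R" "x \<in> carrier M" for c x
      using g h that by (induction rule: RM_induct) (simp_all add: RM_rules 1)
    show "f \<otimes>\<^bsub>RM\<^esub> g \<otimes>\<^bsub>RM\<^esub> h = f \<otimes>\<^bsub>RM\<^esub> (g \<otimes>\<^bsub>RM\<^esub> h)"
      using f g h by (induction rule: RM_induct) (simp_all add: RM_rules 2)
  next
    fix f assume f: "f \<in> carrier RM"
    then show "\<one>\<^bsub>RM\<^esub> \<otimes>\<^bsub>RM\<^esub> f = f"
      by (induction rule: RM_induct) (simp_all add: RM_rules one_eq mult_mterm)
    show "f \<otimes>\<^bsub>RM\<^esub> \<one>\<^bsub>RM\<^esub> = f"
      using f by (induction rule: RM_induct) (simp_all add: RM_rules one_eq mult_mterm)
  qed (simp_all add: mult_closed one_eq)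
qed (simp_all only: mult_distr)

declare add_eq [simp del] zero_eq [simp del]

end

section \<open>The universal property of monoid rings\<close>

locale mring_lift = mring R M + A: ring A
  for R (structure) and M (structure) and A (structure) +
  fixes \<alpha> \<mu>
  assumes alpha: "\<alpha> \<in> ring_hom R A" and mu: "\<mu> \<in> hom M A" and mu_one: "\<mu> \<one>\<^bsub>M\<^esub> = \<one>\<^bsub>A\<^esub>"
    and comm: "\<And>c x. \<lbrakk>c \<in> carrier R; x \<in> carrier M\<rbrakk> \<Longrightarrow> \<alpha> c \<otimes>\<^bsub>A\<^esub> \<mu> x = \<mu> x \<otimes>\<^bsub>A\<^esub> \<alpha> c"
begin

lemma mu_closed [simp]: "x \<in> carrier M \<Longrightarrow> \<mu> x \<in> carrier A"
  using mu by (auto simp: hom_def)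

lemma mu_mult: "\<lbrakk>x \<in> carrier M; y \<in> carrier M\<rbrakk> \<Longrightarrow> \<mu> (x \<otimes>\<^bsub>M\<^esub> y) = \<mu> x \<otimes>\<^bsub>A\<^esub> \<mu> y"
  using mu by (auto simp: hom_def)

sublocale al: ring_homo R A \<alpha>
  using alpha by unfold_locales

sublocale mring_ext R M A "\<lambda>x c. \<alpha> c \<otimes>\<^bsub>A\<^esub> \<mu> x"
  by unfold_locales (auto simp: A.l_distr)

definition lift where "lift = mr_ext R A (\<lambda>x c. \<alpha> c \<otimes>\<^bsub>A\<^esub> \<mu> x)"

sublocale li: abgroup_hom RM A lift
  unfolding lift_def by (rule ext_hom)

lemma lift_mterm: "\<lbrakk>c \<in> carrier R; x \<in> carrier M\<rbrakk> \<Longrightarrow> lift (mterm R c x) = \<alpha> c \<otimes>\<^bsub>A\<^esub> \<mu> x"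
  by (simp add: lift_def ext_mterm)

text \<open>When two terms are multiplied, the factor \<open>\<mu> x\<close> of the first has to
  pass the coefficient \<open>\<alpha> d\<close> of the second; this is the purpose of
  \<open>comm\<close>. The rest is additivity in both factors.\<close>

lemma lift_ring_hom: "lift \<in> ring_hom RM A"
proof (rule ring_hom_memI)
  fix f g assume f: "f \<in> carrier RM" and g: "g \<in> carrier RM"
  have 1: "lift (mterm R c x \<otimes>\<^bsub>RM\<^esub> g) = lift (mterm R c x) \<otimes>\<^bsub>A\<^esub> lift g"
    if "c \<in> carrier R" "x \<in> carrier M" for c x
    using g that
  proof (induction rule: RM_induct)
    case (mterm d y)
    have "\<mu> x \<otimes>\<^bsub>A\<^esub> (\<alpha> d \<otimes>\<^bsub>A\<^esub> \<mu> y) = \<alpha> d \<otimes>\<^bsub>A\<^esub> (\<mu> x \<otimes>\<^bsub>A\<^esub> \<mu> y)"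
      using mterm comm[of d x] by (metis A.m_assoc al.closed mu_closed)
    then show ?case using mterm by (simp add: mult_mterm lift_mterm mu_mult A.m_assoc)
  qed (simp_all add: RM_rules lift_mterm A.r_distr)
  show "lift (f \<otimes>\<^bsub>RM\<^esub> g) = lift f \<otimes>\<^bsub>A\<^esub> lift g"
    using f g by (induction rule: RM_induct) (simp_all add: RM_rules 1 A.l_distr)
qed (simp_all add: one_eq lift_mterm mu_one)

end


section \<open>Presented algebras\<close>

definition wprod :: "('a, 'm) monoid_scheme \<Rightarrow> ('x \<Rightarrow> 'a) \<Rightarrow> 'x list \<Rightarrow> 'a" where
  "wprod A g u = foldr (\<lambda>x y. g x \<otimes>\<^bsub>A\<^esub> y) u \<one>\<^bsub>A\<^esub>"

lemma wprod_Nil [simp]: "wprod A g [] = \<one>\<^bsub>A\<^esub>" by (simp add: wprod_def)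
lemma wprod_Cons [simp]: "wprod A g (x # u) = g x \<otimes>\<^bsub>A\<^esub> wprod A g u" by (simp add: wprod_def)

lemma (in monoid) wprod_closed [simp]: "(\<And>x. x \<in> set u \<Longrightarrow> g x \<in> carrier G) \<Longrightarrow> wprod G g u \<in> carrier G"
  by (induction u) auto

lemma (in monoid) wprod_append:
  "\<lbrakk>\<And>x. x \<in> set u \<Longrightarrow> g x \<in> carrier G; \<And>x. x \<in> set v \<Longrightarrow> g x \<in> carrier G\<rbrakk> \<Longrightarrow>
   wprod G g (u @ v) = wprod G g u \<otimes> wprod G g v"
  by (induction u) (auto simp: m_assoc)

lemma monoid_free_monoid: "monoid (free_monoid X)"
  by (rule monoidI) (auto simp: free_monoid_def)

lemma free_monoid_simps [simp]:
  "carrier (free_monoid X) = lists X" "mult (free_monoid X) = (@)" "one (free_monoid X) = []"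
  by (simp_all add: free_monoid_def)

locale presentation = R: ring R for R (structure) +
  fixes X and E
  assumes relators: "E \<subseteq> carrier (free_algebra R X)"
begin

sublocale mring R "free_monoid X"
  by (intro mring.intro R.ring_axioms monoid_free_monoid)

abbreviation FA where "FA \<equiv> free_algebra R X"
abbreviation PA where "PA \<equiv> presented_algebra R X E"
abbreviation pc where "pc \<equiv> presented_class R X E"

sublocale FA: ring FA by (rule ring_RM)

lemma ideal_Idl: "ideal (Idl\<^bsub>FA\<^esub> E) FA"
  by (rule FA.genideal_ideal[OF relators])

sublocale PA: ring PA
  unfolding presented_algebra_def by (rule ideal.quotient_is_ring[OF ideal_Idl])

sublocale pc: ring_homo FA PA pc
proof (rule ring_homoI)
  show "pc \<in> ring_hom FA PA"
    unfolding presented_algebra_def using ideal.rcos_ring_hom[OF ideal_Idl]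
    by (simp add: presented_class_def[abs_def])
qed (rule FA.ring_axioms, rule PA.ring_axioms)

lemma carrier_PA: "carrier PA = pc ` carrier FA"
  by (simp add: presented_algebra_def carrier_Quot presented_class_def)

lemma pc_relator: "e \<in> E \<Longrightarrow> pc e = \<zero>\<^bsub>PA\<^esub>"
proof -
  assume e: "e \<in> E"
  then have "e \<in> Idl\<^bsub>FA\<^esub> E" using FA.genideal_self[OF relators] by blast
  then show ?thesis
    unfolding presented_class_def presented_algebra_def
    by (simp add: FactRing_def additive_subgroup.a_Hcarr
        abelian_subgroup.a_rcos_const abelian_subgroupI3 ideal.axioms(1)[OF ideal_Idl] abelian_group_RM)
qed

lemma relation: "\<lbrakk>x \<ominus>\<^bsub>FA\<^esub> y \<in> E; x \<in> carrier FA; y \<in> carrier FA\<rbrakk> \<Longrightarrow> pc x = pc y"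
  using pc_relator[of "x \<ominus>\<^bsub>FA\<^esub> y"] by simp

lemma mterm_append: "\<lbrakk>c \<in> carrier R; d \<in> carrier R; u \<in> lists X; v \<in> lists X\<rbrakk> \<Longrightarrow>
    pc (mterm R (c \<otimes>\<^bsub>R\<^esub> d) (u @ v)) = pc (mterm R c u) \<otimes>\<^bsub>PA\<^esub> pc (mterm R d v)"
  using mult_mterm[of c d u v] by (simp flip: pc.mult)

lemma PA_induct [consumes 1, case_names scalar gen add mult]:
  assumes "x \<in> carrier PA"
    and s: "\<And>c. c \<in> carrier R \<Longrightarrow> P (pc (mterm R c []))"
    and g: "\<And>x. x \<in> X \<Longrightarrow> P (pc (mterm R \<one>\<^bsub>R\<^esub> [x]))"
    and a: "\<And>x y. \<lbrakk>x \<in> carrier PA; y \<in> carrier PA; P x; P y\<rbrakk> \<Longrightarrow> P (x \<oplus>\<^bsub>PA\<^esub> y)"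
    and m: "\<And>x y. \<lbrakk>x \<in> carrier PA; y \<in> carrier PA; P x; P y\<rbrakk> \<Longrightarrow> P (x \<otimes>\<^bsub>PA\<^esub> y)"
  shows "P x"
proof -
  have w: "P (pc (mterm R c u))" if "c \<in> carrier R" "u \<in> lists X" for c u
    using that(2,1)
  proof (induction u arbitrary: c rule: lists.induct)
    case (Cons x u)
    have "pc (mterm R c (x # u)) = pc (mterm R \<one>\<^bsub>R\<^esub> [x]) \<otimes>\<^bsub>PA\<^esub> pc (mterm R c u)"
      using mterm_append[of "\<one>\<^bsub>R\<^esub>" c "[x]" u] Cons by simp
    then show ?case using Cons by (auto intro!: m g pc.closed)
  qed (use s in auto)
  have "f \<in> carrier FA \<Longrightarrow> P (pc f)" for f
  proof (induction rule: RM_induct)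
    case zero
    \<comment> \<open>Zero is the class of a scalar term with coefficient zero, so the case
      \<open>scalar\<close> covers it.\<close>
    have "P (pc (mterm R \<zero>\<^bsub>R\<^esub> []))" by (intro w) auto
    then show ?case by (simp only: mterm_zero)
  next
    case (add f g)
    then show ?case by (simp add: a)
  qed (use w in auto)
  then show ?thesis using assms(1) by (auto simp: carrier_PA)
qed

lemma PA_hom_eqI:
  assumes "f \<in> ring_hom PA A" "g \<in> ring_hom PA A"
    and "\<And>c. c \<in> carrier R \<Longrightarrow> f (pc (mterm R c [])) = g (pc (mterm R c []))"
    and "\<And>x. x \<in> X \<Longrightarrow> f (pc (mterm R \<one>\<^bsub>R\<^esub> [x])) = g (pc (mterm R \<one>\<^bsub>R\<^esub> [x]))"
    and "x \<in> carrier PA"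
  shows "f x = g x"
  using assms(5)
proof (induction rule: PA_induct)
  case (add x y)
  then show ?case by (simp add: ring_hom_add[OF assms(1)] ring_hom_add[OF assms(2)])
next
  case (mult x y)
  then show ?case by (simp add: ring_hom_mult[OF assms(1)] ring_hom_mult[OF assms(2)])
qed (use assms in auto)

text \<open>\<open>rel\<close> speaks of an arbitrary homomorphism \<open>H\<close> with the
  expected values on terms. Callers can thus check the relators by the rules for homomorphisms,
  without access to the lift built inside the proof.\<close>

lemma PA_lift:
  assumes "ring A" and al: "\<alpha> \<in> ring_hom R A" and g: "\<And>x. x \<in> X \<Longrightarrow> g x \<in> carrier A"
    and comm: "\<And>c x. \<lbrakk>c \<in> carrier R; x \<in> X\<rbrakk> \<Longrightarrow> \<alpha> c \<otimes>\<^bsub>A\<^esub> g x = g x \<otimes>\<^bsub>A\<^esub> \<alpha> c"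
    and rel: "\<And>H e. \<lbrakk>ring_homo FA A H; \<And>c u. \<lbrakk>c \<in> carrier R; u \<in> lists X\<rbrakk> \<Longrightarrow> H (mterm R c u) = \<alpha> c \<otimes>\<^bsub>A\<^esub> wprod A g u;
           e \<in> E\<rbrakk> \<Longrightarrow> H e = \<zero>\<^bsub>A\<^esub>"
  shows "\<exists>h\<in>ring_hom PA A \<inter> extensional (carrier PA).
     \<forall>c\<in>carrier R. \<forall>u\<in>lists X. h (pc (mterm R c u)) = \<alpha> c \<otimes>\<^bsub>A\<^esub> wprod A g u"
proof -
  interpret A: ring A by fact
  have wc: "wprod A g u \<in> carrier A" if "u \<in> lists X" for u
    using that g by (intro A.wprod_closed) auto
  have ac: "\<alpha> c \<in> carrier A" if "c \<in> carrier R" for c using al that by (rule ring_hom_closed)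
  interpret L: mring_lift R "free_monoid X" A \<alpha> "wprod A g"
  proof unfold_locales
    show "wprod A g \<in> hom (free_monoid X) A"
      using g wc by (auto simp: hom_def intro!: A.wprod_append) 
    fix c x assume "c \<in> carrier R" "x \<in> carrier (free_monoid X)"
    then have "c \<in> carrier R" "x \<in> lists X" by auto
    from this(2) this(1) show "\<alpha> c \<otimes>\<^bsub>A\<^esub> wprod A g x = wprod A g x \<otimes>\<^bsub>A\<^esub> \<alpha> c"
    proof (induction x rule: lists.induct)
      case (Cons x u)
      note cl = ac[OF Cons.prems] g[OF Cons.hyps(1)] wc[OF Cons.hyps(2)]
      have "\<alpha> c \<otimes>\<^bsub>A\<^esub> (g x \<otimes>\<^bsub>A\<^esub> wprod A g u) = g x \<otimes>\<^bsub>A\<^esub> (\<alpha> c \<otimes>\<^bsub>A\<^esub> wprod A g u)"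
        using cl comm[OF Cons.prems Cons.hyps(1)] by (metis A.m_assoc)
      then show ?case using cl Cons by (simp add: A.m_assoc)
    qed (use ac in auto)
  qed (use al in auto)
  interpret H: ring_homo FA A L.lift
    using L.lift_ring_hom FA.ring_axioms A.ring_axioms by (intro ring_homoI)
  have z: "L.lift e = \<zero>\<^bsub>A\<^esub>" if "e \<in> E" for e
    using rel[OF H.ring_homo_axioms _ that] by (simp add: L.lift_mterm)
  have z': "L.lift e = \<zero>\<^bsub>A\<^esub>" if "e \<in> Idl\<^bsub>FA\<^esub> E" for e
    using H.zero_on_Idl[OF relators z that] .
  let ?h = "qlift FA (Idl\<^bsub>FA\<^esub> E) L.lift"
  have "?h (pc x) = L.lift x" if "x \<in> carrier FA" for x
    unfolding presented_class_def using that z'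
    by (intro L.li.qlift_coset ideal.axioms(1)[OF ideal_Idl]) auto
  moreover have "?h \<in> ring_hom PA A"
    unfolding presented_algebra_def using z' by (intro H.qlift_ring_hom ideal_Idl) auto
  moreover have "?h \<in> extensional (carrier PA)"
    unfolding presented_algebra_def by (rule qlift_extensional)
  ultimately show ?thesis by (intro bexI[of _ ?h]) (auto simp: L.lift_mterm)
qed

end

section \<open>Tensor products\<close>

lemma ring_int: "ring \<Z>" using int_is_cring by (rule cring.axioms)

lemma int_a_inv [simp]: "\<ominus>\<^bsub>\<Z>\<^esub> n = - n"
  by (rule abelian_group.minus_equality[OF ring.is_abelian_group[OF ring_int]]) auto

lemma (in abelian_group) int_mult_add: "x \<in> carrier G \<Longrightarrow> [(m + n :: int)] \<cdot> x = [m] \<cdot> x \<oplus> [n] \<cdot> x"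
  by (rule add.int_pow_mult)

lemma (in abelian_group) int_mult_minus: "x \<in> carrier G \<Longrightarrow> [(m - n :: int)] \<cdot> x = [m] \<cdot> x \<ominus> [n] \<cdot> x"
  using add.int_pow_diff[of x m n] by (simp add: a_minus_def)

lemma (in abelian_group) int_mult_distr:
  "\<lbrakk>x \<in> carrier G; y \<in> carrier G\<rbrakk> \<Longrightarrow> [(n :: int)] \<cdot> (x \<oplus> y) = [n] \<cdot> x \<oplus> [n] \<cdot> y"
  by (rule add.int_pow_distrib)

locale tensor_rings = A: ring A + B: ring B for A (structure) and B (structure)
begin

abbreviation AB where "AB \<equiv> A \<times>\<times> B"

lemma monoid_AB: "monoid AB"
  by (intro DirProd_monoid A.monoid_axioms B.monoid_axioms)

sublocale mring \<Z> AB
  by (intro mring.intro ring_int monoid_AB)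

sublocale TF: ring RM by (rule ring_RM)

abbreviation mt :: "'a \<times> 'c \<Rightarrow> 'a \<times> 'c \<Rightarrow> int" where "mt \<equiv> mterm \<Z> 1"

lemma mt_closed [simp, intro]: "\<lbrakk>a \<in> carrier A; b \<in> carrier B\<rbrakk> \<Longrightarrow> mterm \<Z> n (a, b) \<in> carrier RM"
  by auto

lemma mt_mult: "\<lbrakk>a \<in> carrier A; b \<in> carrier B; a' \<in> carrier A; b' \<in> carrier B\<rbrakk> \<Longrightarrow>
   mterm \<Z> n (a, b) \<otimes>\<^bsub>RM\<^esub> mterm \<Z> k (a', b') = mterm \<Z> (n * k) (a \<otimes>\<^bsub>A\<^esub> a', b \<otimes>\<^bsub>B\<^esub> b')"
  using mult_mterm[of n k "(a, b)" "(a', b')"] by simp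

abbreviation rels where "rels \<equiv> tensor_relators A B"
abbreviation N where "N \<equiv> tensor_null A B"

lemma rels_closed: "rels \<subseteq> carrier RM"
  unfolding tensor_relators_def by (auto intro!: RMg.minus_closed RMg.a_closed)

lemma N_subgroup: "additive_subgroup N RM"
  unfolding tensor_null_def
  using RMg.add.generate_is_subgroup[of rels] rels_closed
  by (intro additive_subgroup.intro) simp

lemma rels_in_N: "e \<in> rels \<Longrightarrow> e \<in> N"
  unfolding tensor_null_def by (rule generate.incl)

lemma N_induct [consumes 1, case_names zero rel uminus add]:
  assumes "x \<in> N" "P \<zero>\<^bsub>RM\<^esub>" "\<And>e. e \<in> rels \<Longrightarrow> P e"
    and "\<And>x. \<lbrakk>x \<in> carrier RM; P x\<rbrakk> \<Longrightarrow> P (\<ominus>\<^bsub>RM\<^esub> x)"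
    and "\<And>x y. \<lbrakk>x \<in> carrier RM; y \<in> carrier RM; P x; P y\<rbrakk> \<Longrightarrow> P (x \<oplus>\<^bsub>RM\<^esub> y)"
  shows "P x"
proof -
  have "P x \<and> x \<in> carrier RM" using assms(1) unfolding tensor_null_def
  proof (induction rule: generate.induct)
    case (inv h)
    moreover have "inv\<^bsub>add_monoid RM\<^esub> h = \<ominus>\<^bsub>RM\<^esub> h" by (simp add: a_inv_def)
    ultimately show ?case using assms rels_closed by auto
  qed (use assms rels_closed in auto)
  then show ?thesis ..
qed

text \<open>Terms multiply componentwise, so distributivity turns a bilinearity relator into a
  relator of the same kind. Hence the subgroup they generate is an ideal.\<close>

lemma rels_mult:
  assumes a: "a \<in> carrier A" "b \<in> carrier B" and e: "e \<in> rels"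
  shows "mt (a, b) \<otimes>\<^bsub>RM\<^esub> e \<in> rels" "e \<otimes>\<^bsub>RM\<^esub> mt (a, b) \<in> rels"
proof -
  consider (1) a1 a2 b1 where "a1 \<in> carrier A" "a2 \<in> carrier A" "b1 \<in> carrier B"
      "e = mt (a1 \<oplus>\<^bsub>A\<^esub> a2, b1) \<ominus>\<^bsub>RM\<^esub> (mt (a1, b1) \<oplus>\<^bsub>RM\<^esub> mt (a2, b1))"
    | (2) a1 b1 b2 where "a1 \<in> carrier A" "b1 \<in> carrier B" "b2 \<in> carrier B"
      "e = mt (a1, b1 \<oplus>\<^bsub>B\<^esub> b2) \<ominus>\<^bsub>RM\<^esub> (mt (a1, b1) \<oplus>\<^bsub>RM\<^esub> mt (a1, b2))"
    using e unfolding tensor_relators_def by blast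
  then have "mt (a, b) \<otimes>\<^bsub>RM\<^esub> e \<in> rels \<and> e \<otimes>\<^bsub>RM\<^esub> mt (a, b) \<in> rels"
  proof cases
    case 1
    have "mt (a, b) \<otimes>\<^bsub>RM\<^esub> e = mt (a \<otimes>\<^bsub>A\<^esub> a1 \<oplus>\<^bsub>A\<^esub> a \<otimes>\<^bsub>A\<^esub> a2, b \<otimes>\<^bsub>B\<^esub> b1) \<ominus>\<^bsub>RM\<^esub>
        (mt (a \<otimes>\<^bsub>A\<^esub> a1, b \<otimes>\<^bsub>B\<^esub> b1) \<oplus>\<^bsub>RM\<^esub> mt (a \<otimes>\<^bsub>A\<^esub> a2, b \<otimes>\<^bsub>B\<^esub> b1))"
      using 1 a by (simp add: a_minus_def TF.r_distr TF.r_minus mt_mult A.r_distr)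
    moreover have "e \<otimes>\<^bsub>RM\<^esub> mt (a, b) = mt (a1 \<otimes>\<^bsub>A\<^esub> a \<oplus>\<^bsub>A\<^esub> a2 \<otimes>\<^bsub>A\<^esub> a, b1 \<otimes>\<^bsub>B\<^esub> b) \<ominus>\<^bsub>RM\<^esub>
        (mt (a1 \<otimes>\<^bsub>A\<^esub> a, b1 \<otimes>\<^bsub>B\<^esub> b) \<oplus>\<^bsub>RM\<^esub> mt (a2 \<otimes>\<^bsub>A\<^esub> a, b1 \<otimes>\<^bsub>B\<^esub> b))"
      using 1 a by (simp add: a_minus_def TF.l_distr TF.l_minus mt_mult A.l_distr)
    ultimately show ?thesis using 1 a unfolding tensor_relators_def by blast
  next
    case 2
    have "mt (a, b) \<otimes>\<^bsub>RM\<^esub> e = mt (a \<otimes>\<^bsub>A\<^esub> a1, b \<otimes>\<^bsub>B\<^esub> b1 \<oplus>\<^bsub>B\<^esub> b \<otimes>\<^bsub>B\<^esub> b2) \<ominus>\<^bsub>RM\<^esub>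
        (mt (a \<otimes>\<^bsub>A\<^esub> a1, b \<otimes>\<^bsub>B\<^esub> b1) \<oplus>\<^bsub>RM\<^esub> mt (a \<otimes>\<^bsub>A\<^esub> a1, b \<otimes>\<^bsub>B\<^esub> b2))"
      using 2 a by (simp add: a_minus_def TF.r_distr TF.r_minus mt_mult B.r_distr)
    moreover have "e \<otimes>\<^bsub>RM\<^esub> mt (a, b) = mt (a1 \<otimes>\<^bsub>A\<^esub> a, b1 \<otimes>\<^bsub>B\<^esub> b \<oplus>\<^bsub>B\<^esub> b2 \<otimes>\<^bsub>B\<^esub> b) \<ominus>\<^bsub>RM\<^esub>
        (mt (a1 \<otimes>\<^bsub>A\<^esub> a, b1 \<otimes>\<^bsub>B\<^esub> b) \<oplus>\<^bsub>RM\<^esub> mt (a1 \<otimes>\<^bsub>A\<^esub> a, b2 \<otimes>\<^bsub>B\<^esub> b))"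
      using 2 a by (simp add: a_minus_def TF.l_distr TF.l_minus mt_mult B.l_distr)
    ultimately show ?thesis using 2 a unfolding tensor_relators_def by blast
  qed
  then show "mt (a, b) \<otimes>\<^bsub>RM\<^esub> e \<in> rels" "e \<otimes>\<^bsub>RM\<^esub> mt (a, b) \<in> rels" by auto
qed

text \<open>With integer coefficients every term is reached from zero by adding or subtracting the
  term with coefficient 1.\<close>

lemma TF_induct [consumes 1, case_names zero mt add uminus]:
  assumes "f \<in> carrier RM" and z: "P \<zero>\<^bsub>RM\<^esub>"
    and t: "\<And>a b. \<lbrakk>a \<in> carrier A; b \<in> carrier B\<rbrakk> \<Longrightarrow> P (mt (a, b))"
    and a: "\<And>f g. \<lbrakk>f \<in> carrier RM; g \<in> carrier RM; P f; P g\<rbrakk> \<Longrightarrow> P (f \<oplus>\<^bsub>RM\<^esub> g)"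
    and u: "\<And>f. \<lbrakk>f \<in> carrier RM; P f\<rbrakk> \<Longrightarrow> P (\<ominus>\<^bsub>RM\<^esub> f)"
  shows "P f"
  using assms(1)
proof (induction rule: RM_induct)
  case (mterm n x)
  then obtain p q where x: "x = (p, q)" "p \<in> carrier A" "q \<in> carrier B" by auto
  show ?case
  proof (induction n rule: int_induct[where k = 0])
    case base
    then show ?case using z by (simp add: mterm_zero[simplified])
  next
    case (step1 i)
    have "mterm \<Z> (i + 1) x = mterm \<Z> i x \<oplus>\<^bsub>RM\<^esub> mt x" by (simp add: mterm_add)
    then show ?case using step1 x t by (auto intro!: a)
  next
    case (step2 i)
    have "\<ominus>\<^bsub>RM\<^esub> mt x = mterm \<Z> (- 1) x"
    proof -
      have "mt x \<in> carrier RM" using x by auto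
      then show ?thesis by (simp only: uminus_eq) (simp add: mterm_def fun_eq_iff)
    qed
    then have "mterm \<Z> (i - 1) x = mterm \<Z> i x \<oplus>\<^bsub>RM\<^esub> \<ominus>\<^bsub>RM\<^esub> mt x"
      by (simp add: mterm_add)
    then show ?case using step2 x t by (auto intro!: a u)
  qed
qed (use z a in auto)

lemma N_ideal: "ideal N RM"
proof (rule idealI)
  interpret N: additive_subgroup N RM by (rule N_subgroup)
  have Nc: "x \<in> N \<Longrightarrow> x \<in> carrier RM" for x by (rule N.a_Hcarr)
  have 1: "mt (a, b) \<otimes>\<^bsub>RM\<^esub> x \<in> N \<and> x \<otimes>\<^bsub>RM\<^esub> mt (a, b) \<in> N"
    if "x \<in> N" "a \<in> carrier A" "b \<in> carrier B" for a b x
    using that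
  proof (induction rule: N_induct)
    case zero
    then show ?case using N.zero_closed by simp
  next
    case (rel e)
    then show ?case using rels_mult rels_in_N by blast
  next
    case (uminus x)
    then show ?case by (auto simp: TF.r_minus TF.l_minus N.a_inv_closed)
  next
    case (add x y)
    then show ?case by (auto simp: TF.r_distr TF.l_distr N.a_closed)
  qed
  fix x f assume "x \<in> N" "f \<in> carrier RM"
  from this(2,1) have "f \<otimes>\<^bsub>RM\<^esub> x \<in> N \<and> x \<otimes>\<^bsub>RM\<^esub> f \<in> N"
    by (induction rule: TF_induct)
      (use 1 Nc N.zero_closed in \<open>auto simp: TF.r_minus TF.l_minus TF.r_distr TF.l_distr N.a_inv_closed N.a_closed\<close>)
  then show "f \<otimes>\<^bsub>RM\<^esub> x \<in> N" "x \<otimes>\<^bsub>RM\<^esub> f \<in> N" by auto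
qed (rule TF.ring_axioms, rule additive_subgroup.a_subgroup[OF N_subgroup])

section \<open>The tensor product as a ring\<close>

abbreviation T where "T \<equiv> tensor A B"
abbreviation pu where "pu \<equiv> pure A B"

sublocale T: ring T
  unfolding tensor_def by (rule ideal.quotient_is_ring[OF N_ideal])

lemma pure_closed [simp, intro]: "\<lbrakk>a \<in> carrier A; b \<in> carrier B\<rbrakk> \<Longrightarrow> pu a b \<in> carrier T"
  by (simp add: pure_def tensor_def carrier_Quot)

lemma pure_mult: "\<lbrakk>a \<in> carrier A; b \<in> carrier B; a' \<in> carrier A; b' \<in> carrier B\<rbrakk> \<Longrightarrow>
   pu a b \<otimes>\<^bsub>T\<^esub> pu a' b' = pu (a \<otimes>\<^bsub>A\<^esub> a') (b \<otimes>\<^bsub>B\<^esub> b')"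
  unfolding pure_def tensor_def using ideal.Quot_mult[OF N_ideal, of "mt (a, b)" "mt (a', b')"]
  by (simp add: mt_mult)

lemma pure_one: "\<one>\<^bsub>T\<^esub> = pu \<one>\<^bsub>A\<^esub> \<one>\<^bsub>B\<^esub>"
  unfolding pure_def tensor_def by (simp add: ideal.Quot_one[OF N_ideal] one_eq)

lemma coset_eq:
  assumes "x \<ominus>\<^bsub>RM\<^esub> y \<in> N" "x \<in> carrier RM" "y \<in> carrier RM"
  shows "N +>\<^bsub>RM\<^esub> x = N +>\<^bsub>RM\<^esub> y"
  using abelian_subgroup.a_repr_independence'[of N RM x y]
    abelian_subgroup.a_rcos_module_imp assms
  by (metis (no_types, lifting) N_ideal TF.quotient_eq_iff_same_a_r_cos)

lemma pure_add_left: "\<lbrakk>a \<in> carrier A; a' \<in> carrier A; b \<in> carrier B\<rbrakk> \<Longrightarrow> pu (a \<oplus>\<^bsub>A\<^esub> a') b = pu a b \<oplus>\<^bsub>T\<^esub> pu a' b"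
proof -
  assume a: "a \<in> carrier A" "a' \<in> carrier A" "b \<in> carrier B"
  have "N +>\<^bsub>RM\<^esub> mt (a \<oplus>\<^bsub>A\<^esub> a', b) = N +>\<^bsub>RM\<^esub> (mt (a, b) \<oplus>\<^bsub>RM\<^esub> mt (a', b))"
    using a by (intro coset_eq rels_in_N) (auto simp: tensor_relators_def)
  then show ?thesis
    unfolding pure_def tensor_def using a by (simp add: ideal.Quot_add[OF N_ideal])
qed

lemma pure_add_right: "\<lbrakk>a \<in> carrier A; b \<in> carrier B; b' \<in> carrier B\<rbrakk> \<Longrightarrow> pu a (b \<oplus>\<^bsub>B\<^esub> b') = pu a b \<oplus>\<^bsub>T\<^esub> pu a b'"
proof -
  assume a: "a \<in> carrier A" "b \<in> carrier B" "b' \<in> carrier B"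
  have "N +>\<^bsub>RM\<^esub> mt (a, b \<oplus>\<^bsub>B\<^esub> b') = N +>\<^bsub>RM\<^esub> (mt (a, b) \<oplus>\<^bsub>RM\<^esub> mt (a, b'))"
    using a by (intro coset_eq rels_in_N) (auto simp: tensor_relators_def)
  then show ?thesis
    unfolding pure_def tensor_def using a by (simp add: ideal.Quot_add[OF N_ideal])
qed

lemma pure_left_hom: "b \<in> carrier B \<Longrightarrow> abgroup_hom A T (\<lambda>a. pu a b)"
  by (rule abgroup_homI) (auto simp: pure_add_left A.abelian_group_axioms T.abelian_group_axioms)

lemma pure_right_hom: "a \<in> carrier A \<Longrightarrow> abgroup_hom B T (pu a)"
  by (rule abgroup_homI) (auto simp: pure_add_right B.abelian_group_axioms T.abelian_group_axioms)

text \<open>The sign of a negative pure tensor can be absorbed by the left factor, and zero is pure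
  as well. So sums of pure tensors exhaust \<open>T\<close>, and two cases suffice.\<close>

lemma T_induct [consumes 1, case_names pure add]:
  assumes "x \<in> carrier T" and p: "\<And>a b. \<lbrakk>a \<in> carrier A; b \<in> carrier B\<rbrakk> \<Longrightarrow> P (pu a b)"
    and a: "\<And>x y. \<lbrakk>x \<in> carrier T; y \<in> carrier T; P x; P y\<rbrakk> \<Longrightarrow> P (x \<oplus>\<^bsub>T\<^esub> y)"
  shows "P x"
proof -
  let ?c = "\<lambda>f. N +>\<^bsub>RM\<^esub> f"
  interpret c: ring_homo RM T ?c
    using ideal.rcos_ring_hom[OF N_ideal] TF.ring_axioms T.ring_axioms
    by (intro ring_homoI) (auto simp: tensor_def)
  have p0: "pu \<zero>\<^bsub>A\<^esub> \<zero>\<^bsub>B\<^esub> = \<zero>\<^bsub>T\<^esub>"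
    using abgroup_hom.zero[OF pure_left_hom[of "\<zero>\<^bsub>B\<^esub>"]] by simp
  \<comment> \<open>\<open>P\<close> is not assumed stable under negation, while
    \<open>TF_induct\<close> has a negation step; both signs are therefore carried along.\<close>
  have "f \<in> carrier RM \<Longrightarrow> P (?c f) \<and> P (\<ominus>\<^bsub>T\<^esub> ?c f)" for f
  proof (induction rule: TF_induct)
    case zero
    then show ?case using p[of "\<zero>\<^bsub>A\<^esub>" "\<zero>\<^bsub>B\<^esub>"] p0 by simp
  next
    case (mt x y)
    have "\<ominus>\<^bsub>T\<^esub> ?c (mt (x, y)) = pu (\<ominus>\<^bsub>A\<^esub> x) y"
      using abgroup_hom.a_inv[OF pure_left_hom[of y], of x] mt by (simp add: pure_def)
    then show ?case using mt p[of x y] p[of "\<ominus>\<^bsub>A\<^esub> x" y] by (simp add: pure_def)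
  next
    case (add f g)
    then show ?case by (simp add: a T.minus_add)
  next
    case (uminus f)
    then show ?case by simp
  qed
  then show ?thesis using assms(1) by (auto simp: tensor_def carrier_Quot)
qed

lemma T_lift:
  assumes "abelian_group G" and cl: "\<And>a b. \<lbrakk>a \<in> carrier A; b \<in> carrier B\<rbrakk> \<Longrightarrow> \<beta> a b \<in> carrier G"
    and l: "\<And>a a' b. \<lbrakk>a \<in> carrier A; a' \<in> carrier A; b \<in> carrier B\<rbrakk> \<Longrightarrow> \<beta> (a \<oplus>\<^bsub>A\<^esub> a') b = \<beta> a b \<oplus>\<^bsub>G\<^esub> \<beta> a' b"
    and r: "\<And>a b b'. \<lbrakk>a \<in> carrier A; b \<in> carrier B; b' \<in> carrier B\<rbrakk> \<Longrightarrow> \<beta> a (b \<oplus>\<^bsub>B\<^esub> b') = \<beta> a b \<oplus>\<^bsub>G\<^esub> \<beta> a b'"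
  shows "\<exists>h. h \<in> extensional (carrier T) \<and> abgroup_hom T G h \<and>
     (\<forall>a\<in>carrier A. \<forall>b\<in>carrier B. h (pu a b) = \<beta> a b)"
proof -
  interpret G: abelian_group G by fact
  interpret X: mring_ext \<Z> AB G "\<lambda>x n. [n] \<cdot>\<^bsub>G\<^esub> \<beta> (fst x) (snd x)"
    by unfold_locales (auto simp: cl G.int_mult_add)
  let ?e = "mr_ext \<Z> G (\<lambda>x n. [n] \<cdot>\<^bsub>G\<^esub> \<beta> (fst x) (snd x))"
  interpret e: abgroup_hom RM G ?e by (rule X.ext_hom)
  have em: "?e (mt (a, b)) = \<beta> a b" if "a \<in> carrier A" "b \<in> carrier B" for a b
    using that by (subst X.ext_mterm) (auto simp: cl G.add.int_pow_1)
  have z: "?e x = \<zero>\<^bsub>G\<^esub>" if "x \<in> N" for x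
    using that
  proof (induction rule: N_induct)
    case (rel x)
    then show ?case unfolding tensor_relators_def
      by (auto simp: em l r cl G.r_neg a_minus_def)
  qed auto
  let ?h = "qlift RM N ?e"
  have "?h (pu a b) = \<beta> a b" if "a \<in> carrier A" "b \<in> carrier B" for a b
    unfolding pure_def using that z by (simp add: e.qlift_coset N_subgroup em)
  moreover have "abgroup_hom T G ?h"
    unfolding tensor_def using z T.abelian_group_axioms[unfolded tensor_def]
    by (intro e.qlift_hom N_subgroup) auto
  ultimately show ?thesis
    unfolding tensor_def by (intro exI[of _ ?h]) (auto intro: qlift_extensional)
qed

lemma T_hom_eqI:
  assumes "abgroup_hom T G f" "abgroup_hom T G g"
    and "\<And>a b. \<lbrakk>a \<in> carrier A; b \<in> carrier B\<rbrakk> \<Longrightarrow> f (pu a b) = g (pu a b)" and "x \<in> carrier T"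
  shows "f x = g x"
proof -
  interpret f: abgroup_hom T G f by fact
  interpret g: abgroup_hom T G g by fact
  show ?thesis using assms(4) by (induction rule: T_induct) (simp_all add: assms(3))
qed

end

section \<open>Functoriality of the tensor product\<close>

locale tensor_maps = S: tensor_rings A B + S': tensor_rings A' B'
  for A (structure) and B (structure) and A' (structure) and B' (structure) +
  fixes f g
  assumes f: "f \<in> ring_hom A A'" and g: "g \<in> ring_hom B B'"
begin

sublocale f: ring_homo A A' f by (intro ring_homoI f S.A.ring_axioms S'.A.ring_axioms)
sublocale g: ring_homo B B' g by (intro ring_homoI g S.B.ring_axioms S'.B.ring_axioms)

text \<open>Justifies the definite description in \<open>tensor_map\<close>: existence is the
  universal property, and uniqueness holds because pure tensors generate additively and the map is
  extensional.\<close>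

lemma tensor_map_ex1: "\<exists>!h. h \<in> extensional (carrier S.T) \<and> h \<in> hom (add_monoid S.T) (add_monoid S'.T)
   \<and> (\<forall>a\<in>carrier A. \<forall>b\<in>carrier B. h (S.pu a b) = S'.pu (f a) (g b))"
proof (rule ex_ex1I)
  have *: "h \<in> hom (add_monoid S.T) (add_monoid S'.T) \<longleftrightarrow> abgroup_hom S.T S'.T h" for h
    by (auto simp: hom_def abgroup_hom_def abgroup_hom_axioms_def S.T.abelian_group_axioms S'.T.abelian_group_axioms)
  show "\<exists>h. h \<in> extensional (carrier S.T) \<and> h \<in> hom (add_monoid S.T) (add_monoid S'.T)
   \<and> (\<forall>a\<in>carrier A. \<forall>b\<in>carrier B. h (S.pu a b) = S'.pu (f a) (g b))"
    unfolding * by (rule S.T_lift) (auto simp: S'.pure_add_left S'.pure_add_right S'.T.abelian_group_axioms)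
  fix h k
  assume h: "h \<in> extensional (carrier S.T) \<and> h \<in> hom (add_monoid S.T) (add_monoid S'.T)
   \<and> (\<forall>a\<in>carrier A. \<forall>b\<in>carrier B. h (S.pu a b) = S'.pu (f a) (g b))"
    and k: "k \<in> extensional (carrier S.T) \<and> k \<in> hom (add_monoid S.T) (add_monoid S'.T)
   \<and> (\<forall>a\<in>carrier A. \<forall>b\<in>carrier B. k (S.pu a b) = S'.pu (f a) (g b))"
  show "h = k"
  proof (rule extensionalityI[of _ "carrier S.T"])
    fix x assume x: "x \<in> carrier S.T"
    show "h x = k x"
      by (rule S.T_hom_eqI[OF _ _ _ x, of S'.T]) (use h k in \<open>simp_all only: *\<close>)
  qed (use h k in auto)
qed

abbreviation tm where "tm \<equiv> tensor_map A B A' B' f g"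

lemma tensor_map:
  shows tensor_map_hom: "abgroup_hom S.T S'.T tm"
    and tensor_map_pure: "\<And>a b. \<lbrakk>a \<in> carrier A; b \<in> carrier B\<rbrakk> \<Longrightarrow> tm (S.pu a b) = S'.pu (f a) (g b)"
  using theI'[OF tensor_map_ex1]
  by (auto simp: tensor_map_def hom_def abgroup_hom_def abgroup_hom_axioms_def S.T.abelian_group_axioms S'.T.abelian_group_axioms)

sublocale tm: abgroup_hom S.T S'.T tm by (rule tensor_map_hom)

lemma tensor_map_ring_hom: "tm \<in> ring_hom S.T S'.T"
proof (rule ring_hom_memI)
  fix x y assume x: "x \<in> carrier S.T" and y: "y \<in> carrier S.T"
  have 1: "tm (S.pu a b \<otimes>\<^bsub>S.T\<^esub> y) = tm (S.pu a b) \<otimes>\<^bsub>S'.T\<^esub> tm y" if "a \<in> carrier A" "b \<in> carrier B" for a b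
    using y that
    by (induction rule: S.T_induct)
      (simp_all add: S.pure_mult S'.pure_mult tensor_map_pure S.T.r_distr S'.T.r_distr)
  show "tm (x \<otimes>\<^bsub>S.T\<^esub> y) = tm x \<otimes>\<^bsub>S'.T\<^esub> tm y"
    using x y by (induction rule: S.T_induct) (simp_all add: 1 S.T.l_distr S'.T.l_distr)
qed (simp_all add: S.pure_one S'.pure_one tensor_map_pure)

end

section \<open>Coxeter groups\<close>

declare in_listsD [rule del] in_listsI [rule del]

lemma rev_in_lists [simp]: "rev u \<in> lists A \<longleftrightarrow> u \<in> lists A"
  by (simp add: in_lists_conv_set)

lemma append_group_sum:
  fixes f :: "nat \<Rightarrow> 'a::comm_monoid_add"
  shows "(\<Sum>x<a + b. f x) = (\<Sum>x<a. f x) + (\<Sum>x<b. f (a + x))"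
  by (induction b) (simp_all add: add.assoc)

lemma lists_subset: "u \<in> lists J \<Longrightarrow> J \<subseteq> I \<Longrightarrow> u \<in> lists I"
  using lists_mono by blast

lemma length_alt [simp]: "length (alt i j n) = n"
  by (induction i j n rule: alt.induct) auto

lemma set_alt: "set (alt i j n) \<subseteq> {i, j}"
  by (induction i j n rule: alt.induct) auto

lemma alt_snoc: "alt i j (Suc n) = alt i j n @ [if even n then i else j]"
  by (induction i j n rule: alt.induct) auto

lemma rev_alt: "rev (alt i j n) = (if even n then alt j i n else alt i j n)"
proof (induction n)
  case (Suc n)
  have "rev (alt i j (Suc n)) = (if even n then i else j) # rev (alt i j n)" by (simp only: alt_snoc) simp
  then show ?case using Suc by simp
qed simp

lemma alt_append: "alt i j (k + n) = alt i j k @ (if even k then alt i j n else alt j i n)"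
  by (induction i j k rule: alt.induct) auto

lemma alt_double: "alt i j (2 * n) = concat (replicate n [i, j])"
  by (induction n) auto

lemma alt_in_lists [simp]: "\<lbrakk>i \<in> J; j \<in> J\<rbrakk> \<Longrightarrow> alt i j n \<in> lists J"
  using set_alt[of i j n] by (auto simp: in_lists_conv_set)

lemma map_alt: "map f (alt i j n) = alt (f i) (f j) n"
  by (induction i j n rule: alt.induct) auto

locale coxeter =
  fixes I :: "'i set" and m :: "'i \<Rightarrow> 'i \<Rightarrow> nat"
  assumes coxeter_matrix: "coxeter_matrix I m"
begin

abbreviation W where "W \<equiv> coxeter_group I m"
abbreviation cl where "cl u \<equiv> coxeter_cong I m `` {u}"
abbreviation s where "s \<equiv> simple_refl I m"
abbreviation wmult (infixl "\<bullet>" 70) where "x \<bullet> y \<equiv> x \<otimes>\<^bsub>W\<^esub> y"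
abbreviation iv where "iv x \<equiv> inv\<^bsub>W\<^esub> x"
abbreviation e0 where "e0 \<equiv> \<one>\<^bsub>W\<^esub>"

lemma m_sym: "\<lbrakk>i \<in> I; j \<in> I\<rbrakk> \<Longrightarrow> m i j = m j i"
  and m_one_iff: "\<lbrakk>i \<in> I; j \<in> I\<rbrakk> \<Longrightarrow> m i j = 1 \<longleftrightarrow> i = j"
  using coxeter_matrix unfolding coxeter_matrix_def by auto

lemma m_ge2: "\<lbrakk>i \<in> I; j \<in> I; i \<noteq> j; m i j \<noteq> 0\<rbrakk> \<Longrightarrow> 2 \<le> m i j"
  using m_one_iff[of i j] by linarith

lemma cong_lists: "(u, v) \<in> coxeter_cong I m \<Longrightarrow> u \<in> lists I \<and> v \<in> lists I"
proof (induction rule: coxeter_cong.induct)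
  case (relation i j)
  have "set (concat (replicate (m i j) [i, j])) \<subseteq> I" using relation by auto
  then show ?case by (auto simp: in_lists_conv_set)
qed auto

lemma equiv_cong: "equiv (lists I) (coxeter_cong I m)"
proof (rule equivI)
  show "coxeter_cong I m \<subseteq> lists I \<times> lists I" using cong_lists by auto
  show "refl_on (lists I) (coxeter_cong I m)"
    by (auto simp: refl_on_def intro: coxeter_cong.refl)
  show "sym (coxeter_cong I m)" by (auto simp: sym_def intro: coxeter_cong.sym)
  show "trans (coxeter_cong I m)" by (auto simp: trans_def intro: coxeter_cong.trans)
qed

lemma carrier_W: "carrier W = cl ` lists I"
  by (auto simp: coxeter_group_def quotient_def)

lemma cl_closed [simp]: "u \<in> lists I \<Longrightarrow> cl u \<in> carrier W"
  by (auto simp: carrier_W)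

lemma W_cases: "w \<in> carrier W \<Longrightarrow> \<exists>u\<in>lists I. w = cl u"
  by (auto simp: carrier_W)

lemma cl_eq_iff: "\<lbrakk>u \<in> lists I; v \<in> lists I\<rbrakk> \<Longrightarrow> cl u = cl v \<longleftrightarrow> (u, v) \<in> coxeter_cong I m"
  using eq_equiv_class_iff[OF equiv_cong] by blast

lemma cl_self: "u \<in> lists I \<Longrightarrow> u \<in> cl u"
  by (auto intro: coxeter_cong.refl)

lemma cl_append: "\<lbrakk>u \<in> lists I; v \<in> lists I\<rbrakk> \<Longrightarrow> cl (u @ v) = cl u \<bullet> cl v"
proof -
  assume uv: "u \<in> lists I" "v \<in> lists I"
  have "cl u \<bullet> cl v = coxeter_cong I m `` {x @ y | x y. x \<in> cl u \<and> y \<in> cl v}"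
    by (simp add: coxeter_group_def)
  also have "\<dots> = cl (u @ v)"
  proof (intro Set.equalityI subsetI)
    fix z assume "z \<in> coxeter_cong I m `` {x @ y | x y. x \<in> cl u \<and> y \<in> cl v}"
    then obtain x y where "(u, x) \<in> coxeter_cong I m" "(v, y) \<in> coxeter_cong I m" "(x @ y, z) \<in> coxeter_cong I m"
      by auto
    then show "z \<in> cl (u @ v)" by (auto intro: coxeter_cong.append coxeter_cong.trans)
  next
    fix z assume "z \<in> cl (u @ v)"
    then show "z \<in> coxeter_cong I m `` {x @ y | x y. x \<in> cl u \<and> y \<in> cl v}"
      using cl_self uv by blast
  qed
  finally show ?thesis by simp
qed

lemma one_W: "e0 = cl []" by (simp add: coxeter_group_def)

lemma s_def: "s i = cl [i]" by (simp add: simple_refl_def)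

lemma s_closed [simp]: "i \<in> I \<Longrightarrow> s i \<in> carrier W" by (simp add: s_def)

lemma cl_Cons: "\<lbrakk>i \<in> I; u \<in> lists I\<rbrakk> \<Longrightarrow> cl (i # u) = s i \<bullet> cl u"
  using cl_append[of "[i]" u] by (simp add: s_def)

lemma cl_relation: "\<lbrakk>i \<in> I; j \<in> I\<rbrakk> \<Longrightarrow> cl (concat (replicate (m i j) [i, j])) = e0"
  using coxeter_cong.relation[of i I j m] cong_lists by (auto simp: cl_eq_iff one_W)

lemma s_square: "i \<in> I \<Longrightarrow> s i \<bullet> s i = e0"
  using cl_relation[of i i] m_one_iff[of i i] cl_append[of "[i]" "[i]"] by (simp add: s_def)

lemma rev_inverse: "u \<in> lists I \<Longrightarrow> cl (rev u @ u) = e0"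
proof (induction u)
  case (Cons i u)
  then have i: "i \<in> I" "u \<in> lists I" "rev u \<in> lists I" by auto
  have "cl (rev (i # u) @ i # u) = cl (rev u @ ([i, i] @ u))" by simp
  also have "\<dots> = cl (rev u) \<bullet> cl ([i, i] @ u)" using i by (subst cl_append) auto
  also have "cl ([i, i] @ u) = cl ([] @ u)"
  proof -
    have "([i, i], []) \<in> coxeter_cong I m"
      using coxeter_cong.relation[of i I i m] m_one_iff[of i i] i by simp
    then have "([i, i] @ u, [] @ u) \<in> coxeter_cong I m"
      using i by (intro coxeter_cong.append coxeter_cong.refl)
    then show ?thesis using i by (subst cl_eq_iff) auto
  qed
  also have "cl (rev u) \<bullet> cl ([] @ u) = cl (rev u @ u)" using i by (simp add: cl_append)
  finally show ?case using Cons i by simp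
qed (simp add: one_W)

lemma group_W: "group W"
proof (rule groupI)
  fix x y assume "x \<in> carrier W" "y \<in> carrier W"
  then obtain u v where "u \<in> lists I" "x = cl u" "v \<in> lists I" "y = cl v" using W_cases by metis
  then show "x \<bullet> y \<in> carrier W" by (simp flip: cl_append)
next
  fix x y z assume "x \<in> carrier W" "y \<in> carrier W" "z \<in> carrier W"
  then obtain u v w where "u \<in> lists I" "x = cl u" "v \<in> lists I" "y = cl v" "w \<in> lists I" "z = cl w"
    using W_cases by metis
  then show "x \<bullet> y \<bullet> z = x \<bullet> (y \<bullet> z)" by (simp flip: cl_append)
next
  fix x assume "x \<in> carrier W"
  then obtain u where u: "u \<in> lists I" "x = cl u" using W_cases by metis
  then show "e0 \<bullet> x = x" by (simp add: one_W flip: cl_append)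
  have "cl (rev u) \<bullet> x = e0" using u rev_inverse[of u] cl_append[of "rev u" u] by auto
  then show "\<exists>y\<in>carrier W. y \<bullet> x = e0" using u by (intro bexI[of _ "cl (rev u)"]) auto
qed (simp add: one_W)

sublocale W: group W by (rule group_W)

lemma iv_cl: "u \<in> lists I \<Longrightarrow> iv (cl u) = cl (rev u)"
proof -
  assume u: "u \<in> lists I"
  then have "cl (rev u) \<bullet> cl u = e0" using rev_inverse[of u] cl_append[of "rev u" u] by auto
  then show ?thesis using u by (intro W.inv_equality) auto
qed

lemma iv_s [simp]: "i \<in> I \<Longrightarrow> iv (s i) = s i"
  by (intro W.inv_equality) (auto simp: s_square)

lemma s_s_left [simp]: "\<lbrakk>i \<in> I; x \<in> carrier W\<rbrakk> \<Longrightarrow> s i \<bullet> (s i \<bullet> x) = x"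
  by (simp add: s_square flip: W.m_assoc)

lemma s_s_right [simp]: "\<lbrakk>i \<in> I; x \<in> carrier W\<rbrakk> \<Longrightarrow> x \<bullet> s i \<bullet> s i = x"
  by (simp add: s_square W.m_assoc)

lemma iv_left [simp]: "\<lbrakk>x \<in> carrier W; y \<in> carrier W\<rbrakk> \<Longrightarrow> iv x \<bullet> (x \<bullet> y) = y"
  "\<lbrakk>x \<in> carrier W; y \<in> carrier W\<rbrakk> \<Longrightarrow> x \<bullet> (iv x \<bullet> y) = y"
  by (simp_all flip: W.m_assoc)

lemma conj_eq_iff: "\<lbrakk>x \<in> carrier W; t \<in> carrier W; r \<in> carrier W\<rbrakk> \<Longrightarrow>
    x \<bullet> t \<bullet> iv x = r \<longleftrightarrow> t = iv x \<bullet> r \<bullet> x"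
  by (auto simp: W.m_assoc)

lemma W_s_induct [consumes 1, case_names one step]:
  assumes "w \<in> carrier W" "P e0" "\<And>i w. \<lbrakk>i \<in> I; w \<in> carrier W; P w\<rbrakk> \<Longrightarrow> P (s i \<bullet> w)"
  shows "P w"
proof -
  have "u \<in> lists I \<Longrightarrow> P (cl u)" for u
    by (induction u) (use assms in \<open>auto simp: one_W cl_Cons\<close>)
  then show ?thesis using assms(1) by (auto simp: carrier_W)
qed

subsection \<open>The reflection cocycle\<close>

text \<open>Parity of the number of occurrences of \<open>t\<close> among the reflections v^-1 s_k
  v, one for each letter \<open>k\<close> of the word, with v the suffix behind it. This is the
  classical reflection cocycle. It plays the part of a root system: signs of roots become available
  without any roots.\<close>

primrec par :: "'i list \<Rightarrow> 'i list set \<Rightarrow> bool" where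
  "par [] t = False"
| "par (i # u) t = (par u t \<noteq> (cl u \<bullet> t \<bullet> iv (cl u) = s i))"

lemma par_append: "\<lbrakk>u \<in> lists I; v \<in> lists I; t \<in> carrier W\<rbrakk> \<Longrightarrow>
   par (u @ v) t = (par v t \<noteq> par u (cl v \<bullet> t \<bullet> iv (cl v)))"
proof (induction u)
  case (Cons i u)
  then have "i \<in> I" "u \<in> lists I" by auto
  then show ?case using Cons by (auto simp: cl_append W.inv_mult_group W.m_assoc)
qed auto

text \<open>Conjugation by \<open>s j\<close> inverts the product of the two generators.\<close>

lemma dihedral_pow: "\<lbrakk>i \<in> I; j \<in> I\<rbrakk> \<Longrightarrow> (s i \<bullet> s j) [^]\<^bsub>W\<^esub> (n::nat) \<bullet> s j \<bullet> (s i \<bullet> s j) [^]\<^bsub>W\<^esub> n = s j"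
proof (induction n)
  case (Suc n)
  let ?p = "s i \<bullet> s j"
  have p: "?p \<in> carrier W" using Suc by simp
  have "?p [^]\<^bsub>W\<^esub> Suc n \<bullet> s j \<bullet> ?p [^]\<^bsub>W\<^esub> Suc n = (?p [^]\<^bsub>W\<^esub> n \<bullet> ?p) \<bullet> s j \<bullet> (?p \<bullet> ?p [^]\<^bsub>W\<^esub> n)"
    using W.nat_pow_Suc2[OF p, of n] W.nat_pow_Suc[of ?p n] by metis
  also have "\<dots> = ?p [^]\<^bsub>W\<^esub> n \<bullet> (?p \<bullet> s j \<bullet> ?p) \<bullet> ?p [^]\<^bsub>W\<^esub> n"
    using p Suc.prems by (simp only: W.m_assoc W.m_closed W.nat_pow_closed s_closed)
  also have "?p \<bullet> s j \<bullet> ?p = s j" using Suc by (simp add: W.m_assoc)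
  finally show ?case using Suc by simp
qed simp

lemma cl_replicate: "\<lbrakk>i \<in> I; j \<in> I\<rbrakk> \<Longrightarrow> cl (concat (replicate n [i, j])) = (s i \<bullet> s j) [^]\<^bsub>W\<^esub> n"
  and replicate_lists: "\<lbrakk>i \<in> I; j \<in> I\<rbrakk> \<Longrightarrow> concat (replicate n [i, j]) \<in> lists I"
proof -
  assume ij: "i \<in> I" "j \<in> I"
  then have l: "concat (replicate n [i, j]) \<in> lists I" for n
    using set_alt[of i j "2 * n"] by (auto simp flip: alt_double)
  then show "concat (replicate n [i, j]) \<in> lists I" .
  show "cl (concat (replicate n [i, j])) = (s i \<bullet> s j) [^]\<^bsub>W\<^esub> n"
  proof (induction n)
    case (Suc n)
    then show ?case using ij l[of n] W.nat_pow_Suc2[of "s i \<bullet> s j" n] by (simp add: cl_Cons W.m_assoc)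
  qed (simp add: one_W)
qed

text \<open>With p = s_i s_j, the reflections attached to the letters, read from the right, are s_j
  p^x: the letter \<open>j\<close> of a block gives an even exponent, the letter \<open>i\<close>
  the odd one after it.\<close>

lemma par_replicate:
  assumes ij: "i \<in> I" "j \<in> I" and t: "t \<in> carrier W"
  shows "par (concat (replicate n [i, j])) t =
     odd (\<Sum>x<2 * n. of_bool (t = s j \<bullet> (s i \<bullet> s j) [^]\<^bsub>W\<^esub> x) :: nat)"
proof (induction n)
  case (Suc n)
  let ?p = "s i \<bullet> s j" and ?u = "concat (replicate n [i, j])"
  let ?q = "?p [^]\<^bsub>W\<^esub> n"
  have p: "?p \<in> carrier W" and q: "?q \<in> carrier W" using ij by simp_all
  have u: "cl ?u = ?q" "?u \<in> lists I" using cl_replicate[OF ij] replicate_lists[OF ij] by auto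
  have iq: "iv ?q \<bullet> s j = s j \<bullet> ?q"
  proof -
    have "iv ?q \<bullet> (?q \<bullet> s j \<bullet> ?q) = s j \<bullet> ?q" using q ij by (simp add: W.m_assoc)
    then show ?thesis by (simp only: dihedral_pow[OF ij])
  qed
  have "?q \<bullet> t \<bullet> iv ?q = s j \<longleftrightarrow> t = s j \<bullet> (?q \<bullet> ?q)"
    using conj_eq_iff[OF q t, of "s j"] ij iq q by (simp add: W.m_assoc)
  then have 1: "?q \<bullet> t \<bullet> iv ?q = s j \<longleftrightarrow> t = s j \<bullet> ?p [^]\<^bsub>W\<^esub> (2 * n)"
    using W.nat_pow_mult[OF p, of n n] by (simp add: mult_2)
  have c: "cl (j # ?u) = s j \<bullet> ?q" using u ij by (simp add: cl_Cons)
  have "iv (s j \<bullet> ?q) \<bullet> s i \<bullet> (s j \<bullet> ?q) = iv ?q \<bullet> s j \<bullet> (?p \<bullet> ?q)"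
    using ij q by (simp add: W.inv_mult_group W.m_assoc)
  also have "\<dots> = s j \<bullet> (?q \<bullet> (?p \<bullet> ?q))" using iq q p ij by (simp add: W.m_assoc)
  also have "?q \<bullet> (?p \<bullet> ?q) = ?p [^]\<^bsub>W\<^esub> (2 * n + 1)"
    using W.nat_pow_Suc2[OF p, of n] W.nat_pow_mult[OF p, of n "Suc n"] by (simp add: mult_2)
  finally have 2: "cl (j # ?u) \<bullet> t \<bullet> iv (cl (j # ?u)) = s i \<longleftrightarrow> t = s j \<bullet> ?p [^]\<^bsub>W\<^esub> (2 * n + 1)"
    using conj_eq_iff[of "s j \<bullet> ?q" t "s i"] ij q t c by simp
  have "par (concat (replicate (Suc n) [i, j])) t =
    ((par ?u t \<noteq> (t = s j \<bullet> ?p [^]\<^bsub>W\<^esub> (2 * n))) \<noteq> (t = s j \<bullet> ?p [^]\<^bsub>W\<^esub> (2 * n + 1)))"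
    using 1 2 u by simp
  then show ?case unfolding Suc.IH by (simp add: of_bool_def)
qed simp

text \<open>The relator has 2m letters with reflections s_j p^x for x < 2m. As p^m = 1, the second
  half of the list repeats the first, so every count is even. This makes the parity a function on
  the group.\<close>

lemma par_relation: "\<lbrakk>i \<in> I; j \<in> I; t \<in> carrier W\<rbrakk> \<Longrightarrow> \<not> par (concat (replicate (m i j) [i, j])) t"
proof -
  assume a: "i \<in> I" "j \<in> I" "t \<in> carrier W"
  let ?p = "s i \<bullet> s j"
  have p: "?p \<in> carrier W" "?p [^]\<^bsub>W\<^esub> m i j = e0"
    using a cl_relation[of i j] cl_replicate[of i j "m i j"] by auto
  have "?p [^]\<^bsub>W\<^esub> (m i j + x) = ?p [^]\<^bsub>W\<^esub> x" for x
    using p W.nat_pow_mult[OF p(1), of "m i j" x] by simp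
  then show ?thesis
    unfolding par_replicate[OF a] mult_2 append_group_sum by simp
qed

lemma par_cong: "(u, v) \<in> coxeter_cong I m \<Longrightarrow> \<forall>t\<in>carrier W. par u t = par v t"
proof (induction rule: coxeter_cong.induct)
  case (append u v u' v')
  have l: "u \<in> lists I" "v \<in> lists I" "u' \<in> lists I" "v' \<in> lists I"
    using append.hyps cong_lists by auto
  have "cl u' = cl v'" using append.hyps l by (simp add: cl_eq_iff)
  then show ?case using append l by (auto simp: par_append)
qed (use par_relation in auto)

text \<open>\<open>sg w t\<close> means that \<open>w\<close> makes the positive root of the reflection \<open>t\<close> negative.\<close>

definition sg :: "'i list set \<Rightarrow> 'i list set \<Rightarrow> bool" where
  "sg w t = par (SOME u. u \<in> lists I \<and> cl u = w) t"

lemma sg_cl: "\<lbrakk>u \<in> lists I; t \<in> carrier W\<rbrakk> \<Longrightarrow> sg (cl u) t = par u t"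
proof -
  assume a: "u \<in> lists I" "t \<in> carrier W"
  let ?v = "SOME v. v \<in> lists I \<and> cl v = cl u"
  have "?v \<in> lists I \<and> cl ?v = cl u" by (rule someI[of _ u]) (use a in auto)
  then have "(?v, u) \<in> coxeter_cong I m" using a cl_eq_iff by blast
  then show ?thesis using par_cong a by (simp add: sg_def)
qed

lemma sg_mult: "\<lbrakk>x \<in> carrier W; y \<in> carrier W; t \<in> carrier W\<rbrakk> \<Longrightarrow>
   sg (x \<bullet> y) t = (sg y t \<noteq> sg x (y \<bullet> t \<bullet> iv y))"
proof -
  assume a: "x \<in> carrier W" "y \<in> carrier W" "t \<in> carrier W"
  then obtain u v where "u \<in> lists I" "x = cl u" "v \<in> lists I" "y = cl v" using W_cases by metis
  then show ?thesis using a sg_cl[of "u @ v" t] by (simp add: sg_cl par_append cl_append)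
qed

lemma sg_one [simp]: "t \<in> carrier W \<Longrightarrow> \<not> sg e0 t"
  by (simp add: one_W sg_cl)

lemma sg_s: "\<lbrakk>i \<in> I; t \<in> carrier W\<rbrakk> \<Longrightarrow> sg (s i) t \<longleftrightarrow> t = s i"
  using sg_cl[of "[i]" t] by (simp add: s_def one_W[symmetric])

lemma sg_iv: "\<lbrakk>x \<in> carrier W; t \<in> carrier W\<rbrakk> \<Longrightarrow> sg (iv x) t = sg x (iv x \<bullet> t \<bullet> x)"
  using sg_mult[of x "iv x" t] by simp

abbreviation RF where "RF \<equiv> reflections I m"

lemma reflI: "\<lbrakk>x \<in> carrier W; i \<in> I\<rbrakk> \<Longrightarrow> x \<bullet> s i \<bullet> iv x \<in> RF"
  unfolding reflections_def by blast

lemma reflE: "t \<in> RF \<Longrightarrow> (\<And>x i. \<lbrakk>x \<in> carrier W; i \<in> I; t = x \<bullet> s i \<bullet> iv x\<rbrakk> \<Longrightarrow> P) \<Longrightarrow> P"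
  unfolding reflections_def by blast

lemma refl_closed [simp]: "t \<in> RF \<Longrightarrow> t \<in> carrier W"
  by (elim reflE) auto

lemma s_refl [simp]: "i \<in> I \<Longrightarrow> s i \<in> RF"
  using reflI[of e0 i] by simp

lemma refl_conj: "\<lbrakk>t \<in> RF; y \<in> carrier W\<rbrakk> \<Longrightarrow> y \<bullet> t \<bullet> iv y \<in> RF"
proof (elim reflE)
  fix x i assume a: "y \<in> carrier W" "x \<in> carrier W" "i \<in> I" "t = x \<bullet> s i \<bullet> iv x"
  then have "y \<bullet> t \<bullet> iv y = (y \<bullet> x) \<bullet> s i \<bullet> iv (y \<bullet> x)" by (simp add: W.inv_mult_group W.m_assoc)
  then show ?thesis using a by (simp add: reflI)
qed

lemma refl_square: "t \<in> RF \<Longrightarrow> t \<bullet> t = e0"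
  by (elim reflE) (simp add: W.m_assoc)

lemma iv_refl: "t \<in> RF \<Longrightarrow> iv t = t"
  using refl_square by (intro W.inv_equality) auto

lemma sg_mult_s: "\<lbrakk>x \<in> carrier W; i \<in> I\<rbrakk> \<Longrightarrow> sg (x \<bullet> s i) (s i) = (\<not> sg x (s i))"
  by (simp add: sg_mult sg_s W.m_assoc)

text \<open>For t = x s_i x^-1 the contributions of x and of x^-1 coincide and cancel modulo 2; the
  letter in the middle remains.\<close>

lemma sg_refl_self: "t \<in> RF \<Longrightarrow> sg t t"
proof (elim reflE)
  fix x i assume a: "x \<in> carrier W" "i \<in> I" "t = x \<bullet> s i \<bullet> iv x"
  then have t: "t \<in> carrier W" "iv x \<bullet> t \<bullet> x = s i" by (auto simp: W.m_assoc)
  have "sg (x \<bullet> (s i \<bullet> iv x)) t = (sg (s i \<bullet> iv x) t \<noteq> sg x (s i))"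
    using a t by (subst sg_mult) (auto simp: W.inv_mult_group W.m_assoc)
  also have "sg (s i \<bullet> iv x) t = (sg x (s i) \<noteq> True)"
    using a t by (subst sg_mult) (auto simp: sg_iv sg_s W.m_assoc)
  finally show ?thesis using a by (auto simp: W.m_assoc)
qed

lemma sg_mult_refl: "\<lbrakk>w \<in> carrier W; t \<in> RF\<rbrakk> \<Longrightarrow> sg (w \<bullet> t) t = (\<not> sg w t)"
  by (simp add: sg_mult sg_refl_self W.m_assoc refl_square iv_refl)

subsection \<open>Length\<close>

text \<open>The strong exchange condition. An odd count is not zero, so \<open>t\<close> is the
  reflection attached to some letter, and deleting that letter multiplies the element by
  \<open>t\<close> on the right.\<close>

lemma par_delete: "\<lbrakk>u \<in> lists I; t \<in> carrier W; par u t\<rbrakk> \<Longrightarrow>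
    \<exists>v\<in>lists I. cl v = cl u \<bullet> t \<and> Suc (length v) = length u"
proof (induction u)
  case (Cons i u)
  then have i: "i \<in> I" "u \<in> lists I" by auto
  show ?case
  proof (cases "par u t")
    case True
    then obtain v where "v \<in> lists I" "cl v = cl u \<bullet> t" "Suc (length v) = length u"
      using Cons i by auto
    then show ?thesis using i Cons.prems by (intro bexI[of _ "i # v"]) (auto simp: cl_Cons W.m_assoc)
  next
    case False
    then have "cl u \<bullet> t \<bullet> iv (cl u) = s i" using Cons.prems by auto
    then have "s i \<bullet> cl u = cl u \<bullet> t \<bullet> iv (cl u) \<bullet> cl u" by simp
    also have "\<dots> = cl u \<bullet> t" using Cons.prems i by (simp add: W.m_assoc)
    finally have e: "s i \<bullet> cl u = cl u \<bullet> t" .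
    have "cl (i # u) \<bullet> t = s i \<bullet> (cl u \<bullet> t)" using i Cons.prems by (simp add: cl_Cons W.m_assoc)
    then have "cl u = cl (i # u) \<bullet> t" using i by (simp flip: e)
    then show ?thesis using i by (intro bexI[of _ u]) auto
  qed
qed simp

definition len :: "'i list set \<Rightarrow> nat" where
  "len w = (LEAST n. \<exists>u\<in>lists I. length u = n \<and> cl u = w)"

lemma reduced_word: "w \<in> carrier W \<Longrightarrow> \<exists>u\<in>lists I. length u = len w \<and> cl u = w"
  unfolding len_def by (rule LeastI_ex) (use W_cases in metis)

lemma len_le: "u \<in> lists I \<Longrightarrow> len (cl u) \<le> length u"
  unfolding len_def by (rule Least_le) auto

lemma len_one [simp]: "len e0 = 0"
  using len_le[of "[]"] by (simp add: one_W)

lemma sg_len_less: "\<lbrakk>w \<in> carrier W; t \<in> carrier W; sg w t\<rbrakk> \<Longrightarrow> len (w \<bullet> t) < len w"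
proof -
  assume a: "w \<in> carrier W" "t \<in> carrier W" "sg w t"
  obtain u where u: "u \<in> lists I" "length u = len w" "cl u = w" using reduced_word[OF a(1)] by auto
  have "par u t" using a u sg_cl[of u t] by simp
  then obtain v where "v \<in> lists I" "cl v = w \<bullet> t" "Suc (length v) = length u"
    using a u par_delete[of u t] by metis
  then show ?thesis using len_le[of v] u by simp
qed

text \<open>Strong exchange gives one direction. For the other it is applied to
  \<open>w \<bullet> t\<close>, where the sign at \<open>t\<close> is the opposite one.\<close>

lemma sg_len: "\<lbrakk>w \<in> carrier W; t \<in> RF\<rbrakk> \<Longrightarrow> sg w t \<longleftrightarrow> len (w \<bullet> t) < len w"
  using sg_len_less[of w t] sg_len_less[of "w \<bullet> t" t] sg_mult_refl[of w t]
  by (auto simp: W.m_assoc refl_square)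

lemma len_mult_s_le: "\<lbrakk>w \<in> carrier W; i \<in> I\<rbrakk> \<Longrightarrow> len (w \<bullet> s i) \<le> Suc (len w)"
proof -
  assume a: "w \<in> carrier W" "i \<in> I"
  obtain u where u: "u \<in> lists I" "length u = len w" "cl u = w" using reduced_word[OF a(1)] by auto
  then show ?thesis using a len_le[of "u @ [i]"] by (auto simp: cl_append s_def)
qed

lemma len_up: "\<lbrakk>w \<in> carrier W; i \<in> I; \<not> sg w (s i)\<rbrakk> \<Longrightarrow> len (w \<bullet> s i) = Suc (len w)"
  using sg_len[of "w \<bullet> s i" "s i"] len_mult_s_le[of w i] sg_mult_s[of w i] by auto

subsection \<open>The order of a product of two generators\<close>

text \<open>The dual of the geometric representation: \<open>f\<close> lists the values of a linear
  functional on the simple roots, and \<open>ga i f\<close> is its composite with the reflection in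
  the root of \<open>i\<close>. The numbers 2, -2 and -2 cos(pi/m) are twice the standard bilinear
  form. Working with functionals avoids a space of finite combinations of roots.\<close>

definition ga :: "'i \<Rightarrow> ('i \<Rightarrow> real) \<Rightarrow> 'i \<Rightarrow> real" where
  "ga i f = (\<lambda>k. f k - (if k = i then 2 else if m i k = 0 then - 2 else - 2 * cos (pi / m i k)) * f i)"

lemma ga_self: "ga i f i = - f i" by (simp add: ga_def)

lemma ga_ga [simp]: "ga i (ga i f) = f"
  by (auto simp: ga_def fun_eq_iff)

definition kap :: "'i \<Rightarrow> 'i \<Rightarrow> real" where
  "kap i j = (if m i j = 0 then 2 else 2 * cos (pi / m i j))"

lemma ga_other: "k \<noteq> i \<Longrightarrow> ga i f k = f k + kap i k * f i"
  by (simp add: ga_def kap_def)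

lemma kap_sym: "\<lbrakk>i \<in> I; j \<in> I\<rbrakk> \<Longrightarrow> kap i j = kap j i"
  using m_sym[of i j] by (simp add: kap_def)

text \<open>On the values at \<open>i\<close> and \<open>j\<close> the product of the two
  reflections is a rotation by the angle 2 \<theta> in oblique coordinates. Multiplication by sin
  \<theta> clears the denominator of the closed form.\<close>

lemma ga_pow:
  assumes ij: "i \<in> I" "j \<in> I" "i \<noteq> j" "m i j \<noteq> 0"
  defines "\<theta> \<equiv> pi / m i j"
  shows "sin \<theta> * (((ga i \<circ> ga j) ^^ n) f j) = sin ((2 * n + 1) * \<theta>) * f j + sin (2 * n * \<theta>) * f i"
    and "sin \<theta> * (((ga i \<circ> ga j) ^^ n) f i) = - (sin (2 * n * \<theta>) * f j + sin ((2 * n - 1) * \<theta>) * f i)"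
proof (induction n)
  case (Suc n)
  let ?g = "((ga i \<circ> ga j) ^^ n) f"
  let ?k = "2 * cos \<theta>"
  have k: "kap i j = ?k" "kap j i = ?k" using ij kap_sym[of i j] by (auto simp: kap_def \<theta>_def)
  have gj: "((ga i \<circ> ga j) ^^ Suc n) f j = (?k\<^sup>2 - 1) * ?g j + ?k * ?g i"
    using ij by (simp add: ga_self ga_other k power2_eq_square algebra_simps)
  have gi: "((ga i \<circ> ga j) ^^ Suc n) f i = - (?k * ?g j + ?g i)"
    using ij by (simp add: ga_self ga_other k algebra_simps)
  define a where "a = 2 * real n * \<theta>"
  have A: "(2 * real n + 1) * \<theta> = a + \<theta>" "2 * real n * \<theta> = a" "(2 * real n - 1) * \<theta> = a - \<theta>"
     "(2 * real (Suc n) + 1) * \<theta> = a + (\<theta> + \<theta> + \<theta>)" "2 * real (Suc n) * \<theta> = a + (\<theta> + \<theta>)"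
     "(2 * real (Suc n) - 1) * \<theta> = a + \<theta>"
    by (simp_all add: a_def algebra_simps)
  have sc: "(sin \<theta>)\<^sup>2 = 1 - (cos \<theta>)\<^sup>2" by (simp add: sin_squared_eq)
  have s3: "sin (\<theta> + \<theta> + \<theta>) = (?k\<^sup>2 - 1) * sin \<theta>"
    "cos (\<theta> + \<theta> + \<theta>) = 4 * cos \<theta> ^ 3 - 3 * cos \<theta>"
  proof -
    have 1: "sin \<theta> * (sin \<theta> * x) = x - cos \<theta> * (cos \<theta> * x)" for x
    proof -
      have "sin \<theta> * (sin \<theta> * x) = (sin \<theta>)\<^sup>2 * x" by (simp add: power2_eq_square)
      then show ?thesis unfolding sc by (simp add: power2_eq_square left_diff_distrib)
    qed
    have "sin (\<theta> + \<theta> + \<theta>) = (sin \<theta> * cos \<theta> + cos \<theta> * sin \<theta>) * cos \<theta> + (cos \<theta> * cos \<theta> - sin \<theta> * sin \<theta>) * sin \<theta>"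
      "cos (\<theta> + \<theta> + \<theta>) = (cos \<theta> * cos \<theta> - sin \<theta> * sin \<theta>) * cos \<theta> - (sin \<theta> * cos \<theta> + cos \<theta> * sin \<theta>) * sin \<theta>"
      by (simp_all only: sin_add cos_add)
    then show "sin (\<theta> + \<theta> + \<theta>) = (?k\<^sup>2 - 1) * sin \<theta>"
      "cos (\<theta> + \<theta> + \<theta>) = 4 * cos \<theta> ^ 3 - 3 * cos \<theta>"
      using 1[of "sin \<theta>"] 1[of "cos \<theta>"]
      by (simp_all add: algebra_simps power2_eq_square power3_eq_cube)
  qed
  have s2: "sin (\<theta> + \<theta>) = ?k * sin \<theta>" "cos (\<theta> + \<theta>) = 2 * (cos \<theta>)\<^sup>2 - 1"
    using sc by (simp_all add: sin_double cos_double)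
  note IH = Suc.IH[unfolded A]
  have "sin \<theta> * (((ga i \<circ> ga j) ^^ Suc n) f j) =
      (?k\<^sup>2 - 1) * (sin \<theta> * ?g j) + ?k * (sin \<theta> * ?g i)" unfolding gj by (simp add: algebra_simps)
  also have "\<dots> = ((?k\<^sup>2 - 1) * sin (a + \<theta>) - ?k * sin a) * f j + ((?k\<^sup>2 - 1) * sin a - ?k * sin (a - \<theta>)) * f i"
    unfolding IH by (simp add: algebra_simps)
  also have "(?k\<^sup>2 - 1) * sin (a + \<theta>) - ?k * sin a = sin (a + (\<theta> + \<theta> + \<theta>))"
    unfolding sin_add[of a] s3 by (simp add: algebra_simps power2_eq_square power3_eq_cube)
  also have "(?k\<^sup>2 - 1) * sin a - ?k * sin (a - \<theta>) = sin (a + (\<theta> + \<theta>))"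
    unfolding sin_add[of a] sin_diff s2 by (simp add: algebra_simps power2_eq_square power3_eq_cube)
  finally show "sin \<theta> * (((ga i \<circ> ga j) ^^ Suc n) f j) =
      sin ((2 * real (Suc n) + 1) * \<theta>) * f j + sin (2 * real (Suc n) * \<theta>) * f i"
    by (simp only: A)
  have "sin \<theta> * (((ga i \<circ> ga j) ^^ Suc n) f i) = - (?k * (sin \<theta> * ?g j) + sin \<theta> * ?g i)"
    unfolding gi by (simp add: algebra_simps)
  also have "\<dots> = - ((?k * sin (a + \<theta>) - sin a) * f j + (?k * sin a - sin (a - \<theta>)) * f i)"
    unfolding IH by (simp add: algebra_simps)
  also have "?k * sin (a + \<theta>) - sin a = sin (a + (\<theta> + \<theta>))"
    unfolding sin_add[of a] s2 by (simp add: algebra_simps power2_eq_square power3_eq_cube)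
  also have "?k * sin a - sin (a - \<theta>) = sin (a + \<theta>)"
    unfolding sin_add[of a] sin_diff by (simp add: algebra_simps power2_eq_square power3_eq_cube)
  finally show "sin \<theta> * (((ga i \<circ> ga j) ^^ Suc n) f i) =
      - (sin (2 * real (Suc n) * \<theta>) * f j + sin ((2 * real (Suc n) - 1) * \<theta>) * f i)"
    by (simp only: A)
qed auto

lemma sin_angle: "\<lbrakk>i \<in> I; j \<in> I; i \<noteq> j; m i j \<noteq> 0\<rbrakk> \<Longrightarrow> sin (pi / m i j) > 0"
  using m_ge2[of i j] by (intro sin_gt_zero) (auto simp: field_simps)

lemma solve_symmetric_system:
  fixes c :: real assumes "4 - c\<^sup>2 \<noteq> 0"
  obtains l u where "2 * l - u * c = a" "2 * u - l * c = b"
proof -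
  let ?D = "4 - c\<^sup>2"
  obtain l u where D: "l * ?D = 2 * a + c * b" "u * ?D = 2 * b + c * a"
    using assms by (metis nonzero_eq_divide_eq)
  have "(2 * l - u * c) * ?D = 2 * (l * ?D) - c * (u * ?D)" by (simp add: algebra_simps)
  also have "\<dots> = a * ?D" unfolding D by (simp add: algebra_simps power2_eq_square)
  finally have 1: "2 * l - u * c = a" using assms by simp
  have "(2 * u - l * c) * ?D = 2 * (u * ?D) - c * (l * ?D)" by (simp add: algebra_simps)
  also have "\<dots> = b * ?D" unfolding D by (simp add: algebra_simps power2_eq_square)
  finally have "2 * u - l * c = b" using assms by simp
  then show ?thesis using 1 that by blast
qed

text \<open>In the plane of the two roots the power is a full rotation, and on the orthogonal
  complement both reflections are trivial. The form on the plane has determinant proportional to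
  (sin \<theta>)^2, so every other root can be split into the two parts.\<close>

lemma ga_relation:
  assumes ij: "i \<in> I" "j \<in> I"
  shows "((ga i \<circ> ga j) ^^ m i j) f = f"
proof (cases "i = j \<or> m i j = 0")
  case True
  then show ?thesis using m_one_iff[of i j] ij by auto
next
  case False
  then have ne: "i \<noteq> j" "m i j \<noteq> 0" by auto
  let ?\<theta> = "pi / m i j" and ?G = "ga i \<circ> ga j"
  note sn = sin_angle[OF ij ne]
  have m0: "real (m i j) * ?\<theta> = pi" using ne by simp
  have e: "2 * real (m i j) * ?\<theta> = 2 * pi" "(2 * real (m i j) + 1) * ?\<theta> = 2 * pi + ?\<theta>"
    "(2 * real (m i j) - 1) * ?\<theta> = 2 * pi - ?\<theta>"
    using ne by (simp_all add: field_simps)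
  have "sin (2 * pi + ?\<theta>) = sin ?\<theta>" "sin (2 * pi - ?\<theta>) = - sin ?\<theta>"
    by (simp_all only: sin_add sin_diff, simp_all)
  then have "sin ?\<theta> * ((?G ^^ m i j) f j) = sin ?\<theta> * f j" "sin ?\<theta> * ((?G ^^ m i j) f i) = sin ?\<theta> * f i"
    unfolding ga_pow[OF ij ne] e by simp_all
  then have fj: "(?G ^^ m i j) f j = f j" and fi: "(?G ^^ m i j) f i = f i"
    using sn by simp_all
  show ?thesis
  proof
    fix k
    show "(?G ^^ m i j) f k = f k"
    proof (cases "k = i \<or> k = j")
      case True
      then show ?thesis using fi fj by auto
    next
      case k: False
      let ?c = "2 * cos ?\<theta>"
      have kk: "kap i j = ?c" "kap j i = ?c" using ij ne kap_sym[of i j] by (auto simp: kap_def)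
      have "(sin ?\<theta>)\<^sup>2 > 0" using sn by simp
      moreover have "4 - ?c\<^sup>2 = 4 * (sin ?\<theta>)\<^sup>2" by (simp add: sin_squared_eq power_mult_distrib)
      ultimately have d: "4 - ?c\<^sup>2 \<noteq> 0" by linarith
      then obtain l u where lu: "2 * l - u * ?c = - kap i k" "2 * u - l * ?c = - kap j k"
        by (rule solve_symmetric_system)
      \<comment> \<open>\<open>l\<close> and \<open>u\<close> make the combination of the roots of
        \<open>k\<close>, \<open>i\<close>, \<open>j\<close> orthogonal to the last two. Its value
        is therefore unchanged by both reflections.\<close>
      define nv where "nv g = g k - l * g i - u * g j" for g :: "'i \<Rightarrow> real"
      have "nv (ga i g) = nv g + (kap i k + (2 * l - u * ?c)) * g i" for g
        using k ne by (simp add: nv_def ga_self ga_other kk algebra_simps)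
      moreover have "nv (ga j g) = nv g + (kap j k + (2 * u - l * ?c)) * g j" for g
        using k ne by (simp add: nv_def ga_self ga_other kk algebra_simps)
      ultimately have "nv (?G g) = nv g" for g using lu by simp
      then have "nv ((?G ^^ n) f) = nv f" for n by (induction n) auto
      from this[of "m i j"] show ?thesis using fi fj by (simp add: nv_def)
    qed
  qed
qed

lemma foldr_ga_replicate: "foldr ga (concat (replicate n [i, j])) f = ((ga i \<circ> ga j) ^^ n) f"
  by (induction n) auto

lemma ga_cong: "(u, v) \<in> coxeter_cong I m \<Longrightarrow> \<forall>f. foldr ga u f = foldr ga v f"
  by (induction rule: coxeter_cong.induct) (auto simp: foldr_ga_replicate ga_relation)

text \<open>A trivial power acts trivially on functionals. For m > 0 this makes n times the rotation
  angle 2 pi/m a multiple of 2 pi; for m = 0 divisibility by m means n = 0.\<close>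

lemma s_s_pow_one:
  assumes ij: "i \<in> I" "j \<in> I" "i \<noteq> j" and n: "(s i \<bullet> s j) [^]\<^bsub>W\<^esub> (n::nat) = e0"
  shows "m i j dvd n"
proof -
  have "(concat (replicate n [i, j]), []) \<in> coxeter_cong I m"
    using n cl_replicate[of i j n] replicate_lists[of i j n] ij by (simp add: one_W cl_eq_iff)
  then have g: "((ga i \<circ> ga j) ^^ n) f = f" for f
    using ga_cong by (fastforce simp: foldr_ga_replicate)
  define f where "f = (\<lambda>k. if k = j then 1 else 0 :: real)"
  have f: "f j = 1" "f i = 0" using ij by (auto simp: f_def)
  show ?thesis
  proof (cases "m i j = 0")
    case True
    then have k: "kap i j = 2" "kap j i = 2" using kap_sym[of i j] ij by (auto simp: kap_def)
    \<comment> \<open>Without a relation the product is unipotent but not trivial on the plane, so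
      the values grow linearly.\<close>
    have "((ga i \<circ> ga j) ^^ n) f j = 2 * n + 1 \<and> ((ga i \<circ> ga j) ^^ n) f i = - 2 * n"
      using ij f by (induction n) (auto simp: ga_self ga_other k)
    then show ?thesis using g[of f] f True by auto
  next
    case False
    let ?\<theta> = "pi / m i j"
    note sn = sin_angle[OF ij False]
    have 1: "sin ?\<theta> = sin ((2 * n + 1) * ?\<theta>)" and 2: "sin (2 * n * ?\<theta>) = 0"
      using ga_pow[OF ij False, of n f] f g[of f] by (simp_all add: add.commute)
    have "(2 * n + 1) * ?\<theta> = 2 * n * ?\<theta> + ?\<theta>" by (simp add: algebra_simps)
    then have "sin ?\<theta> = sin (2 * n * ?\<theta> + ?\<theta>)" using 1 by (simp only:)
    then have "sin ?\<theta> = cos (2 * n * ?\<theta>) * sin ?\<theta>" using 2 unfolding sin_add by (simp only: mult_zero_left add_0)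
    then have "cos (2 * n * ?\<theta>) = 1" using sn by simp
    then obtain z :: int where "2 * n * ?\<theta> = z * 2 * pi" using cos_one_2pi_int by auto
    then have "real n = real_of_int z * m i j" using False by (simp add: field_simps)
    then have "int n = z * int (m i j)" by (metis of_int_eq_iff of_int_mult of_int_of_nat_eq)
    then have "int (m i j) dvd int n" by simp
    then show ?thesis by simp
  qed
qed

lemma s_inj: "\<lbrakk>i \<in> I; j \<in> I; s i = s j\<rbrakk> \<Longrightarrow> i = j"
  using s_s_pow_one[of i j 1] m_one_iff[of i j] by (auto simp: s_square)


subsection \<open>Parabolic subgroups\<close>

lemma parabolic_eq:
  assumes J: "J \<subseteq> I"
  shows "parabolic I m J = cl ` lists J"
proof
  have lJ: "u \<in> lists J \<Longrightarrow> u \<in> lists I" for u using J lists_subset by metis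
  show "parabolic I m J \<subseteq> cl ` lists J"
  proof
    fix w assume "w \<in> parabolic I m J"
    then show "w \<in> cl ` lists J"
      unfolding parabolic_def
    proof (induction rule: generate.induct)
      case (eng x y)
      then obtain u v where "u \<in> lists J" "v \<in> lists J" "x = cl u" "y = cl v" by auto
      then show ?case using lJ by (intro image_eqI[of _ _ "u @ v"]) (auto simp: cl_append)
    qed (use J one_W in \<open>auto simp: s_def iv_cl intro!: image_eqI[of _ _ "[x]" for x]\<close>)
  qed
  have "u \<in> lists J \<Longrightarrow> cl u \<in> parabolic I m J" for u
    unfolding parabolic_def
  proof (induction u)
    case (Cons i u)
    then have "cl u \<in> generate W (s ` J)" "s i \<in> generate W (s ` J)" by (auto intro: generate.incl)
    moreover have "i \<in> I" "u \<in> lists I" using Cons.prems J lJ by auto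
    ultimately show ?case by (simp add: cl_Cons generate.eng)
  qed (auto simp flip: one_W intro: generate.one)
  then show "cl ` lists J \<subseteq> parabolic I m J" by auto
qed

lemma parabolic_I: "parabolic I m I = carrier W"
  by (simp add: parabolic_eq carrier_W)

lemma parabolic_subgroup: "J \<subseteq> I \<Longrightarrow> subgroup (parabolic I m J) W"
  unfolding parabolic_def by (intro W.generate_is_subgroup) auto

lemma parabolic_closed: "J \<subseteq> I \<Longrightarrow> w \<in> parabolic I m J \<Longrightarrow> w \<in> carrier W"
  using parabolic_subgroup subgroup.mem_carrier by metis

text \<open>\<open>y\<close> is a shortest element of the coset of \<open>w\<close>. A reflection of
  the parabolic subgroup keeps \<open>y\<close> inside its coset and cannot shorten it, which by
  \<open>sg_len\<close> is the statement about signs.\<close>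

lemma min_coset_rep:
  assumes J: "J \<subseteq> I" and w: "w \<in> carrier W"
  obtains y v where "y \<in> carrier W" "v \<in> parabolic I m J" "w = y \<bullet> v"
    "\<And>x. x \<in> parabolic I m J \<Longrightarrow> len y \<le> len (y \<bullet> x)"
    "\<And>t. t \<in> parabolic I m J \<inter> RF \<Longrightarrow> \<not> sg y t"
proof -
  interpret P: subgroup "parabolic I m J" W by (rule parabolic_subgroup[OF J])
  obtain v0 where v0: "v0 \<in> parabolic I m J"
    and min: "\<And>x. x \<in> parabolic I m J \<Longrightarrow> len (w \<bullet> v0) \<le> len (w \<bullet> x)"
    using ex_has_least_nat[of "\<lambda>x. x \<in> parabolic I m J" e0 "\<lambda>x. len (w \<bullet> x)"] by auto
  have le: "len (w \<bullet> v0) \<le> len (w \<bullet> v0 \<bullet> x)" if "x \<in> parabolic I m J" for x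
    using min[of "v0 \<bullet> x"] that v0 w by (simp add: W.m_assoc)
  show ?thesis
  proof (rule that)
    show "w = w \<bullet> v0 \<bullet> iv v0" using w v0 by (simp add: W.m_assoc)
    show "len (w \<bullet> v0) \<le> len (w \<bullet> v0 \<bullet> x)" if "x \<in> parabolic I m J" for x by (rule le[OF that])
    show "\<not> sg (w \<bullet> v0) t" if "t \<in> parabolic I m J \<inter> RF" for t
      using le[of t] that sg_len[of "w \<bullet> v0" t] w v0 by auto
  qed (use w v0 in auto)
qed

section \<open>Alternating words and dihedral parabolic subgroups\<close>

lemma cl_snoc: "\<lbrakk>u \<in> lists I; i \<in> I\<rbrakk> \<Longrightarrow> cl (u @ [i]) = cl u \<bullet> s i"
  by (simp add: cl_append s_def)

lemma braid_W: "\<lbrakk>i \<in> I; j \<in> I\<rbrakk> \<Longrightarrow> cl (alt i j (m i j)) = cl (alt j i (m i j))"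
proof -
  assume ij: "i \<in> I" "j \<in> I"
  let ?X = "if even (m i j) then alt i j (m i j) else alt j i (m i j)"
  have X: "?X \<in> lists I" "alt i j (m i j) \<in> lists I" using ij by auto
  have "cl (alt i j (m i j)) \<bullet> cl ?X = cl (alt i j (m i j + m i j))"
    using X by (simp add: alt_append flip: cl_append)
  also have "\<dots> = e0" using ij cl_relation by (simp add: alt_double flip: mult_2)
  finally have "cl (alt i j (m i j)) = iv (cl ?X)" using X by (intro W.inv_equality[symmetric]) auto
  also have "\<dots> = cl (rev ?X)" using X(1) by (rule iv_cl)
  also have "rev ?X = alt j i (m i j)" by (simp add: rev_alt)
  finally show ?thesis .
qed

lemma braid_W_rev: "\<lbrakk>i \<in> I; j \<in> I\<rbrakk> \<Longrightarrow> cl (rev (alt i j (m i j))) = cl (rev (alt j i (m i j)))"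
  using braid_W[of i j] by (auto simp: rev_alt)

text \<open>The word ends in \<open>i\<close>. Its last letter contributes s_i; the reflections of
  the rest are conjugated by s_i, which turns powers of s_i s_j into powers of s_j s_i.\<close>

lemma par_rev_alt: "\<lbrakk>i \<in> I; j \<in> I; t \<in> carrier W\<rbrakk> \<Longrightarrow>
   par (rev (alt i j n)) t = odd (\<Sum>x<n. of_bool (t = s i \<bullet> (s j \<bullet> s i) [^]\<^bsub>W\<^esub> x) :: nat)"
proof (induction n arbitrary: i j t)
  case (Suc n)
  let ?p = "s i \<bullet> s j" and ?p' = "s j \<bullet> s i"
  have l: "rev (alt j i n) \<in> lists I" using Suc.prems by simp
  have "par (rev (alt i j (Suc n))) t = ((t = s i) \<noteq> par (rev (alt j i n)) (s i \<bullet> t \<bullet> s i))"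
    using l Suc.prems par_append[of "rev (alt j i n)" "[i]" t] by (simp add: s_def[symmetric] one_W[symmetric])
  also have "par (rev (alt j i n)) (s i \<bullet> t \<bullet> s i) =
      odd (\<Sum>x<n. of_bool (s i \<bullet> t \<bullet> s i = s j \<bullet> ?p [^]\<^bsub>W\<^esub> x) :: nat)"
    using Suc by simp
  also have "(\<lambda>x::nat. s i \<bullet> t \<bullet> s i = s j \<bullet> ?p [^]\<^bsub>W\<^esub> x) = (\<lambda>x. t = s i \<bullet> ?p' [^]\<^bsub>W\<^esub> Suc x)"
  proof
    fix x :: nat
    have c: "s i \<bullet> ?p [^]\<^bsub>W\<^esub> k \<bullet> s i = ?p' [^]\<^bsub>W\<^esub> k" for k :: nat
    proof (induction k)
      case (Suc k)
      have "s i \<bullet> ?p [^]\<^bsub>W\<^esub> Suc k \<bullet> s i = s i \<bullet> ?p [^]\<^bsub>W\<^esub> k \<bullet> s i \<bullet> (s j \<bullet> s i)"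
        using Suc.prems \<open>i \<in> I\<close> \<open>j \<in> I\<close> by (simp add: W.m_assoc)
      then show ?case using Suc by simp
    qed (use Suc.prems in \<open>simp add: s_square\<close>)
    have "s i \<bullet> t \<bullet> s i = s j \<bullet> ?p [^]\<^bsub>W\<^esub> x \<longleftrightarrow> t = s i \<bullet> (s j \<bullet> ?p [^]\<^bsub>W\<^esub> x) \<bullet> s i"
      using conj_eq_iff[of "s i" t "s j \<bullet> ?p [^]\<^bsub>W\<^esub> x"] Suc.prems by simp
    also have "s i \<bullet> (s j \<bullet> ?p [^]\<^bsub>W\<^esub> x) \<bullet> s i = s i \<bullet> (s j \<bullet> (s i \<bullet> (s i \<bullet> ?p [^]\<^bsub>W\<^esub> x \<bullet> s i)))"
      using Suc.prems by (simp add: W.m_assoc)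
    also have "\<dots> = s i \<bullet> ?p' [^]\<^bsub>W\<^esub> Suc x"
      unfolding c using Suc.prems W.nat_pow_Suc2[of ?p' x] by (simp add: W.m_assoc)
    finally show "(s i \<bullet> t \<bullet> s i = s j \<bullet> ?p [^]\<^bsub>W\<^esub> x) = (t = s i \<bullet> ?p' [^]\<^bsub>W\<^esub> Suc x)" .
  qed
  finally show ?case unfolding sum.lessThan_Suc_shift using Suc.prems by simp
qed simp

lemma s_s_pow_iff: "\<lbrakk>i \<in> I; j \<in> I; i \<noteq> j\<rbrakk> \<Longrightarrow> (s i \<bullet> s j) [^]\<^bsub>W\<^esub> (n::nat) = e0 \<longleftrightarrow> m i j dvd n"
proof
  assume ij: "i \<in> I" "j \<in> I" "i \<noteq> j" and "m i j dvd n"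
  then obtain k where "n = m i j * k" by auto
  moreover have "(s i \<bullet> s j) [^]\<^bsub>W\<^esub> m i j = e0" using ij cl_relation[of i j] cl_replicate[of i j "m i j"] by simp
  ultimately show "(s i \<bullet> s j) [^]\<^bsub>W\<^esub> n = e0" using ij W.nat_pow_pow[of "s i \<bullet> s j" "m i j" k] by simp
qed (rule s_s_pow_one)

text \<open>If s_j occurred among the reflections s_i (s_j s_i)^x with x < n, then (s_j s_i)^(x+1)
  would be trivial, although x + 1 is positive and below the order of s_j s_i.\<close>

lemma alt_up:
  assumes ij: "i \<in> I" "j \<in> I" "i \<noteq> j" and n: "m i j \<noteq> 0 \<Longrightarrow> n < m i j"
  shows "\<not> sg (cl (rev (alt i j n))) (s j)"
proof -
  have "\<not> s j = s i \<bullet> (s j \<bullet> s i) [^]\<^bsub>W\<^esub> x" if "x < n" for x :: nat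
  proof
    assume "s j = s i \<bullet> (s j \<bullet> s i) [^]\<^bsub>W\<^esub> x"
    then have "s j \<bullet> s j = s j \<bullet> (s i \<bullet> (s j \<bullet> s i) [^]\<^bsub>W\<^esub> x)" by simp
    then have "(s j \<bullet> s i) [^]\<^bsub>W\<^esub> Suc x = e0"
      using ij W.nat_pow_Suc2[of "s j \<bullet> s i" x] by (simp add: s_square W.m_assoc)
    then have "m j i dvd Suc x" using ij s_s_pow_iff by blast
    then have d: "m i j dvd Suc x" using m_sym ij by simp
    show False
    proof (cases "m i j = 0")
      case False
      then show False using d dvd_imp_le[of "m i j" "Suc x"] n that by simp
    qed (use d in simp)
  qed
  then show ?thesis using ij by (simp add: sg_cl par_rev_alt)
qed

text \<open>Letters are appended one at a time to an alternating word. A repeated letter cancels and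
  a new one extends the word; at length m the braid relation first exchanges the two words, after
  which the letter cancels.\<close>

lemma parabolic_alt:
  assumes ij: "i \<in> I" "j \<in> I" "i \<noteq> j" and w: "w \<in> parabolic I m {i, j}"
  shows "\<exists>a b n. {a, b} = {i, j} \<and> w = cl (rev (alt a b n)) \<and> (m i j \<noteq> 0 \<longrightarrow> n \<le> m i j)"
proof -
  have "u \<in> lists {i, j} \<Longrightarrow> \<exists>a b n. {a, b} = {i, j} \<and> cl u = cl (rev (alt a b n)) \<and> (m i j \<noteq> 0 \<longrightarrow> n \<le> m i j)" for u
  proof (induction u rule: rev_induct)
    case Nil
    then show ?case by (intro exI[of _ i] exI[of _ j] exI[of _ 0]) auto
  next
    case (snoc k u)
    then obtain a b n where IH: "{a, b} = {i, j}" "cl u = cl (rev (alt a b n))" "m i j \<noteq> 0 \<longrightarrow> n \<le> m i j"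
      by auto
    have ab: "a \<in> I" "b \<in> I" "a \<noteq> b" "m a b = m i j" using IH(1) ij m_sym by (auto simp: doubleton_eq_iff)
    have "k \<in> {a, b}" using snoc.prems unfolding IH(1) by simp
    then have k: "k = a \<or> k = b" "k \<in> I" using ab(1,2) by auto
    have u: "u \<in> lists I" using snoc.prems ij by (auto intro: lists_subset[of u "{i, j}"])
    have l: "rev (alt x y n) \<in> lists I" if "x \<in> I" "y \<in> I" for x y n using that by simp
    have c: "cl (u @ [k]) = cl (rev (alt a b n)) \<bullet> s k" using u k IH by (simp add: cl_snoc)
    have red: "cl (rev (alt x y (Suc n))) \<bullet> s x = cl (rev (alt y x n))" if "x \<in> I" "y \<in> I" for x y n
      using that l[of y x n] by (simp add: cl_snoc)
    have ext: "cl (rev (alt x y n)) \<bullet> s y = cl (rev (alt y x (Suc n)))" if "x \<in> I" "y \<in> I" for x y n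
      using that l[of x y n] by (simp add: cl_snoc)
    have ba: "{b, a} = {i, j}" using IH(1) by (simp only: insert_commute)
    have I: ?case if "{x, y} = {i, j}" "cl (u @ [k]) = cl (rev (alt x y n))" "m i j \<noteq> 0 \<Longrightarrow> n \<le> m i j" for x y n
      using that by blast
    \<comment> \<open>\<open>rev (alt a b n)\<close> ends in \<open>a\<close>. So \<open>a\<close>
      cancels unless the word is empty, and \<open>b\<close> extends it unless the length is already
      m.\<close>
    consider (z) "n = 0" | (r) n' where "n = Suc n'" "k = a" | (e) "k = b" "m i j \<noteq> 0 \<longrightarrow> n < m i j"
      | (w) n' where "k = b" "n = m i j" "n = Suc n'"
      using k IH(3) by (cases n) (auto simp: le_less, metis)
    then show ?case
    proof cases
      case z
      obtain k' where k': "{k, k'} = {i, j}" using k(1) IH(1) ba by blast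
      have "cl (u @ [k]) = cl (rev (alt k k' (Suc 0)))" using c z k by (simp add: s_def flip: one_W)
      then show ?thesis using m_ge2[OF ij] by (intro I[OF k', of "Suc 0"]) simp_all
    next
      case r
      then have "cl (u @ [k]) = cl (rev (alt b a n'))" using c red ab by simp
      then show ?thesis using IH(3) r(1) by (intro I[OF ba, of n']) simp_all
    next
      case e
      then have "cl (u @ [k]) = cl (rev (alt b a (Suc n)))" using c ext ab by simp
      then show ?thesis using e(2) by (intro I[OF ba, of "Suc n"]) simp_all
    next
      case w
      have "cl (u @ [k]) = cl (rev (alt b a n)) \<bullet> s b" using c w ab braid_W_rev[of a b] by simp
      also have "\<dots> = cl (rev (alt a b n'))" unfolding w(3) using red ab(1,2) by blast
      finally show ?thesis using IH(3) w(3) by (intro I[OF IH(1), of n']) simp_all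
    qed
  qed
  then show ?thesis using w ij by (auto simp: parabolic_eq)
qed

text \<open>Factor \<open>w\<close> as a shortest coset representative \<open>y\<close> times a
  dihedral element \<open>v\<close>. Since \<open>y\<close> changes no sign of a dihedral
  reflection, both descents belong to \<open>v\<close>, and by \<open>alt_up\<close> an alternating
  word with both descents has length m.\<close>

lemma two_descents:
  assumes w: "w \<in> carrier W" and ij: "i \<in> I" "j \<in> I" "i \<noteq> j" and d: "sg w (s i)" "sg w (s j)"
  obtains y where "y \<in> carrier W" "m i j \<noteq> 0" "w = y \<bullet> cl (rev (alt i j (m i j)))"
    "\<And>x. x \<in> parabolic I m {i, j} \<Longrightarrow> len y \<le> len (y \<bullet> x)"
    "\<And>t. t \<in> parabolic I m {i, j} \<inter> RF \<Longrightarrow> \<not> sg y t"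
proof -
  have J: "{i, j} \<subseteq> I" using ij by simp
  interpret P: subgroup "parabolic I m {i, j}" W by (rule parabolic_subgroup[OF J])
  obtain y v where y: "y \<in> carrier W" and v: "v \<in> parabolic I m {i, j}" and w: "w = y \<bullet> v"
    and min: "\<And>x. x \<in> parabolic I m {i, j} \<Longrightarrow> len y \<le> len (y \<bullet> x)"
      "\<And>t. t \<in> parabolic I m {i, j} \<inter> RF \<Longrightarrow> \<not> sg y t"
    using min_coset_rep[OF J w] by metis
  have vc: "v \<in> carrier W" using v by (rule P.mem_carrier)
  have "s k \<in> parabolic I m {i, j}" if "k \<in> {i, j}" for k
    unfolding parabolic_def using that by (auto intro: generate.incl)
  then have "v \<bullet> s k \<bullet> iv v \<in> parabolic I m {i, j} \<inter> RF" if "k \<in> {i, j}" for k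
    using that v vc J by (auto intro!: reflI)
  note conj = this
  have sv: "sg v (s k)" if "k \<in> {i, j}" for k
  proof -
    have k: "s k \<in> carrier W" using that J by auto
    have "sg (y \<bullet> v) (s k)" using d that w by auto
    moreover have "\<not> sg y (v \<bullet> s k \<bullet> iv v)" using min(2) conj that by blast
    ultimately show ?thesis using sg_mult[OF y vc k] by simp
  qed
  obtain a b n where ab: "{a, b} = {i, j}" "v = cl (rev (alt a b n))" "m i j \<noteq> 0 \<longrightarrow> n \<le> m i j"
    using parabolic_alt[OF ij v] by auto
  have ab': "a \<in> I" "b \<in> I" "a \<noteq> b" "m a b = m i j" using ab(1) ij m_sym by (auto simp: doubleton_eq_iff)
  have "\<not> (m i j \<noteq> 0 \<longrightarrow> n < m i j)"
    using alt_up[OF ab'(1-3), of n] ab'(4) sv[of b] ab by auto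
  then have n: "m i j \<noteq> 0" "n = m i j" using ab(3) by auto
  have "v = cl (rev (alt i j (m i j)))"
    using ab n braid_W_rev[of i j] ij by (auto simp: doubleton_eq_iff)
  then show ?thesis using that y n w min by blast
qed

text \<open>Each appended letter is an ascent for the alternating word by \<open>alt_up\<close>, and
  \<open>y\<close> does not change this sign.\<close>

lemma len_coset:
  assumes y: "y \<in> carrier W" and ij: "i \<in> I" "j \<in> I" "i \<noteq> j"
    and min: "\<And>t. t \<in> parabolic I m {i, j} \<inter> RF \<Longrightarrow> \<not> sg y t"
    and n: "m i j \<noteq> 0 \<Longrightarrow> n \<le> m i j"
  shows "len (y \<bullet> cl (rev (alt i j n))) = len y + n"
  using ij min n
proof (induction n arbitrary: i j)
  case 0
  then show ?case using y by (simp flip: one_W)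
next
  case (Suc n)
  let ?v = "cl (rev (alt j i n))"
  have J: "{i, j} \<subseteq> I" using Suc.prems by simp
  interpret P: subgroup "parabolic I m {i, j}" W by (rule parabolic_subgroup[OF J])
  have v: "?v \<in> parabolic I m {i, j}"
    using J by (simp add: parabolic_eq)
  then have vc: "?v \<in> carrier W" by (rule P.mem_carrier)
  have sp: "s i \<in> parabolic I m {i, j}" unfolding parabolic_def by (auto intro: generate.incl)
  have "m j i \<noteq> 0 \<Longrightarrow> n < m j i" using Suc.prems(1-3,5) m_sym[of i j] by auto
  then have "\<not> sg ?v (s i)" using Suc.prems(1-3) by (intro alt_up) auto
  moreover have "\<not> sg y (?v \<bullet> s i \<bullet> iv ?v)"
    using v vc sp J by (intro Suc.prems(4)) (auto intro: reflI)
  ultimately have "\<not> sg (y \<bullet> ?v) (s i)" using y vc J by (subst sg_mult) auto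
  then have "len (y \<bullet> ?v \<bullet> s i) = Suc (len (y \<bullet> ?v))" using y vc J by (intro len_up) auto
  moreover have "len (y \<bullet> ?v) = len y + n"
    using Suc.prems m_sym[of i j] by (intro Suc.IH) (auto simp: insert_commute)
  moreover have "cl (rev (alt i j (Suc n))) = ?v \<bullet> s i"
    using J by (simp add: cl_snoc)
  ultimately show ?case using y vc J by (simp add: W.m_assoc)
qed

text \<open>Induction on length. Equal last letters are cancelled. If they differ, both are descents
  of the element, which is therefore some \<open>y\<close> times the longest dihedral element; each
  word can then be exchanged for a reduced word of \<open>y\<close> followed by an alternating word,
  and \<open>braid\<close> compares the two results.\<close>

theorem matsumoto:
  assumes A: "monoid A" and g: "\<And>i. i \<in> I \<Longrightarrow> g i \<in> carrier A"
    and braid: "\<And>i j. \<lbrakk>i \<in> I; j \<in> I; i \<noteq> j\<rbrakk> \<Longrightarrow> wprod A g (alt i j (m i j)) = wprod A g (alt j i (m i j))"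
    and u: "u \<in> lists I" "length u = len (cl u)" and v: "v \<in> lists I" "length v = len (cl v)"
    and uv: "cl u = cl v"
  shows "wprod A g u = wprod A g v"
  using u v uv
proof (induction "length u" arbitrary: u v)
  case 0
  then show ?case by simp
next
  case (Suc n)
  interpret A: monoid A by fact
  have wa: "wprod A g (x @ y) = wprod A g x \<otimes>\<^bsub>A\<^esub> wprod A g y" if "x \<in> lists I" "y \<in> lists I" for x y
    using that g by (intro A.wprod_append) (auto simp: in_lists_conv_set)
  have wc: "wprod A g x \<in> carrier A" if "x \<in> lists I" for x
    using that g by (intro A.wprod_closed) (auto simp: in_lists_conv_set)
  have red: "length x = len (cl x)" if "x \<in> lists I" "k \<in> I" "length (x @ [k]) = len (cl (x @ [k]))" for x k
    using that len_le[of x] len_mult_s_le[of "cl x" k] by (simp add: cl_snoc)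
  have sgk: "sg (cl (x @ [k])) (s k)" if "x \<in> lists I" "k \<in> I" "length (x @ [k]) = len (cl (x @ [k]))" for x k
    using that len_le[of x] sg_len[of "cl (x @ [k])" "s k"] by (simp add: cl_snoc)
  obtain u' i where u': "u = u' @ [i]" using Suc.hyps(2) by (cases u rule: rev_cases) auto
  have "length v = Suc n" using Suc by simp
  then obtain v' j where v': "v = v' @ [j]" by (cases v rule: rev_cases) auto
  have l: "u' \<in> lists I" "i \<in> I" "v' \<in> lists I" "j \<in> I" using Suc.prems u' v' by auto
  have ru: "length u' = len (cl u')" and rv: "length v' = len (cl v')"
    using red[of u' i] red[of v' j] Suc.prems u' v' l by auto
  show ?case
  proof (cases "i = j")
    case True
    have "cl u' \<bullet> s i \<bullet> s i = cl v' \<bullet> s i \<bullet> s i"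
      using Suc.prems(5) l True unfolding u' v' by (simp add: cl_snoc)
    then have "cl u' = cl v'" using l by simp
    then have "wprod A g u' = wprod A g v'"
      using Suc.hyps(2) ru rv l u' by (intro Suc.hyps(1)) auto
    then show ?thesis using l u' v' True by (simp add: wa)
  next
    case False
    let ?w = "cl u"
    have w: "?w \<in> carrier W" using Suc.prems by simp
    obtain y where y: "y \<in> carrier W" "m i j \<noteq> 0" "?w = y \<bullet> cl (rev (alt i j (m i j)))"
      and min: "\<And>x. x \<in> parabolic I m {i, j} \<Longrightarrow> len y \<le> len (y \<bullet> x)"
        "\<And>t. t \<in> parabolic I m {i, j} \<inter> RF \<Longrightarrow> \<not> sg y t"
      using two_descents[OF w l(2,4) False] sgk[of u' i] sgk[of v' j] Suc.prems u' v' l by metis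
    obtain r where r: "r \<in> lists I" "length r = len y" "cl r = y" using reduced_word[OF y(1)] by auto
    obtain k where k: "m i j = Suc k" using y(2) by (cases "m i j") auto
    have mij: "m j i = m i j" using m_sym l by simp
    have lw: "len ?w = len y + m i j"
      unfolding y(3) using y l False min by (intro len_coset) auto
    have al: "rev (alt a b n) \<in> lists I" if "a \<in> I" "b \<in> I" for a b n using that by simp
    \<comment> \<open>\<open>x\<close> and the word on the right are reduced words for one and the
      same element of length \<open>n\<close>, the given element with its last letter
      \<open>a\<close> removed. The induction hypothesis identifies their products.\<close>
    have key: "wprod A g x = wprod A g (r @ rev (alt b a k))"
      if x: "x \<in> lists I" "a \<in> I" "b \<in> I" "length x = len (cl x)" "length x = n"
        "cl (x @ [a]) = ?w" "cl (rev (alt a b (m i j))) = cl (rev (alt i j (m i j)))" for x a b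
    proof -
      have "cl (rev (alt a b (m i j))) = cl (rev (alt b a k)) \<bullet> s a"
        using x al[of b a k] by (simp add: k cl_snoc)
      moreover have "cl x \<bullet> s a = ?w" using x by (simp only: cl_snoc)
      ultimately have "cl x \<bullet> s a = y \<bullet> (cl (rev (alt b a k)) \<bullet> s a)" using x(7) y(3) by (simp only:)
      then have "cl x \<bullet> s a = cl (r @ rev (alt b a k)) \<bullet> s a"
        using x r al[of b a k] y(1) by (simp add: cl_append W.m_assoc)
      then have "cl x \<bullet> s a \<bullet> s a = cl (r @ rev (alt b a k)) \<bullet> s a \<bullet> s a" by simp
      then have e: "cl x = cl (r @ rev (alt b a k))" using that r al[of b a k] by simp
      have "length (r @ rev (alt b a k)) = n" using lw r k Suc.hyps(2) Suc.prems(2) by simp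
      then show ?thesis
        using e that r al[of b a k] by (intro Suc.hyps(1)) auto
    qed
    have 1: "wprod A g u' = wprod A g (r @ rev (alt j i k))"
      using l ru Suc.hyps(2) u' by (intro key[of _ i]) auto
    have 2: "wprod A g v' = wprod A g (r @ rev (alt i j k))"
      using l rv Suc.hyps(2) v' \<open>length v = Suc n\<close> Suc.prems(5) braid_W_rev[of i j]
      by (intro key[of _ j]) auto
    have "wprod A g u = wprod A g (r @ rev (alt i j (m i j)))"
      using l r al[of j i k] by (simp add: u' wa wc 1 k A.m_assoc g)
    also have "wprod A g (r @ rev (alt i j (m i j))) = wprod A g (r @ rev (alt j i (m i j)))"
    proof -
      have "wprod A g (rev (alt i j (m i j))) = wprod A g (rev (alt j i (m i j)))"
        using braid[of i j] braid[of j i] l False mij by (auto simp: rev_alt)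
      then show ?thesis using r l al by (simp add: wa)
    qed
    also have "\<dots> = wprod A g v"
      using l r al[of i j k] by (simp add: v' wa wc 2 k A.m_assoc g)
    finally show ?thesis .
  qed
qed

end

section \<open>The algebra generated by $s_i$ and $D_i$\<close>

lemma ring_hom_int_mult:
  assumes "abgroup_hom S A f" "x \<in> carrier S"
  shows "f ([(n::int)] \<cdot>\<^bsub>S\<^esub> x) = [n] \<cdot>\<^bsub>A\<^esub> f x"
proof -
  interpret abgroup_hom S A f by fact
  have nat: "f ([(k::nat)] \<cdot>\<^bsub>S\<^esub> x) = [k] \<cdot>\<^bsub>A\<^esub> f x" for k
    using assms(2) by (induction k) (auto simp: S.add.nat_pow_Suc A.add.nat_pow_Suc)
  show ?thesis
  proof (cases "n \<ge> 0")
    case True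
    then show ?thesis using nat by (simp add: add_pow_int_ge)
  next
    case False
    then show ?thesis using nat assms(2) by (simp add: add_pow_int_lt)
  qed
qed

lemma (in ring) int_embed: "(\<lambda>n::int. [n] \<cdot> \<one>) \<in> ring_hom \<Z> R"
proof (rule ring_hom_memI)
  fix a b :: int
  show "[(a \<otimes>\<^bsub>\<Z>\<^esub> b)] \<cdot> \<one> = ([a] \<cdot> \<one>) \<otimes> ([b] \<cdot> \<one>)"
    using add_pow_ldistr_int[of \<one> "[b] \<cdot> \<one>" a] add.int_pow_pow[of \<one> a b] 
    by (simp add: mult.commute)
  show "[(a \<oplus>\<^bsub>\<Z>\<^esub> b)] \<cdot> \<one> = ([a] \<cdot> \<one>) \<oplus> ([b] \<cdot> \<one>)"
    by (simp add: int_mult_add)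
qed (auto simp: add.int_pow_1)

lemma (in ring) int_mult_comm: "x \<in> carrier R \<Longrightarrow> ([(n::int)] \<cdot> \<one>) \<otimes> x = x \<otimes> ([n] \<cdot> \<one>)"
  by (simp add: add_pow_ldistr_int add_pow_rdistr_int)

context coxeter begin

abbreviation H where "H \<equiv> Hhat I m"
abbreviation HP where "HP \<equiv> free_algebra \<Z> (hgens I)"
abbreviation hs where "hs \<equiv> Hhat_s I m"
abbreviation hD where "hD \<equiv> Hhat_D I m"
abbreviation hmult (infixl "\<star>" 70) where "x \<star> y \<equiv> x \<otimes>\<^bsub>H\<^esub> y"

lemma mring_HP: "mring \<Z> (free_monoid (hgens I))"
  by (intro mring.intro ring_int monoid_free_monoid)

lemma hword_closed: "u \<in> lists (hgens I) \<Longrightarrow> hword u \<in> carrier HP"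
  using mring.mterm_closed[OF mring_HP] by simp

lemma ring_HP: "ring HP" by (rule mring.ring_RM[OF mring_HP])

lemma gen_lists: "map gen_s u \<in> lists (hgens I) \<longleftrightarrow> u \<in> lists I"
  by (induction u) auto

lemma relators_closed: "Hhat_relators I m \<subseteq> carrier HP"
proof -
  interpret F: ring HP by (rule ring_HP)
  have 1: "concat (replicate n [gen_s i, gen_s j]) \<in> lists (hgens I)" if "i \<in> I" "j \<in> I" for i j n
    using gen_lists[of "alt i j (2 * n)"] that by (simp add: map_alt flip: alt_double)
  have 2: "map gen_s (alt j i n) \<in> lists (hgens I)" if "i \<in> I" "j \<in> I" for i j n
    using that by (simp add: gen_lists)
  show ?thesis
    unfolding Hhat_relators_def using 1 2
    by (auto intro!: F.minus_closed F.a_closed hword_closed)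
qed

sublocale HP: presentation \<Z> "hgens I" "Hhat_relators I m"
  by (intro presentation.intro presentation_axioms.intro ring_int relators_closed)

lemma H_eq: "HP.PA = H" by (simp add: Hhat_def)

sublocale H: ring H using HP.PA.ring_axioms by (simp add: H_eq)

lemma word_eq: "Hhat_word I m u = HP.pc (hword u)" by (simp add: Hhat_word_def)

lemma word_append: "\<lbrakk>u \<in> lists (hgens I); v \<in> lists (hgens I)\<rbrakk> \<Longrightarrow>
    Hhat_word I m (u @ v) = Hhat_word I m u \<star> Hhat_word I m v"
  using HP.mterm_append[of 1 1 u v] by (simp add: word_eq H_eq)

lemma word_closed: "u \<in> lists (hgens I) \<Longrightarrow> Hhat_word I m u \<in> carrier H"
  using HP.pc.closed[OF hword_closed] by (simp add: word_eq H_eq)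

lemma hs_closed [simp]: "i \<in> I \<Longrightarrow> hs i \<in> carrier H" by (simp add: word_closed)
lemma hd_closed [simp]: "i \<in> I \<Longrightarrow> hD i \<in> carrier H" by (simp add: word_closed)

lemma word_Nil: "Hhat_word I m [] = \<one>\<^bsub>H\<^esub>"
  using HP.pc.one by (simp add: word_eq HP.one_eq H_eq)

lemma word_wprod: "u \<in> lists I \<Longrightarrow> Hhat_word I m (map gen_s u) = wprod H hs u"
proof (induction u)
  case (Cons i u)
  then show ?case using word_append[of "[gen_s i]" "map gen_s u"] by (simp add: gen_lists)
qed (simp add: word_Nil)

lemma wprod_hs_closed [simp]: "u \<in> lists I \<Longrightarrow> wprod H hs u \<in> carrier H"
  by (intro H.wprod_closed) (auto simp: in_lists_conv_set)

lemma wprod_hs_append: "\<lbrakk>u \<in> lists I; v \<in> lists I\<rbrakk> \<Longrightarrow> wprod H hs (u @ v) = wprod H hs u \<star> wprod H hs v"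
  by (intro H.wprod_append) (auto simp: in_lists_conv_set)

lemma relationI:
  assumes "hword u \<ominus>\<^bsub>HP\<^esub> hword v \<in> Hhat_relators I m" "u \<in> lists (hgens I)" "v \<in> lists (hgens I)"
  shows "Hhat_word I m u = Hhat_word I m v"
  unfolding word_eq using assms by (intro HP.relation hword_closed)

lemma hs_sq: "i \<in> I \<Longrightarrow> hs i \<star> hs i = \<one>\<^bsub>H\<^esub>"
proof -
  assume i: "i \<in> I"
  have "Hhat_word I m [gen_s i, gen_s i] = Hhat_word I m []"
  proof (rule relationI)
    show "hword [gen_s i, gen_s i] \<ominus>\<^bsub>HP\<^esub> hword [] \<in> Hhat_relators I m"
      using i unfolding Hhat_relators_def by blast
  qed (use i in auto)
  then show ?thesis using word_append[of "[gen_s i]" "[gen_s i]"] i by (simp add: word_Nil)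
qed

lemma hd_idem: "i \<in> I \<Longrightarrow> hD i \<star> hD i = hD i"
proof -
  assume i: "i \<in> I"
  have "Hhat_word I m [gen_D i, gen_D i] = Hhat_word I m [gen_D i]"
  proof (rule relationI)
    show "hword [gen_D i, gen_D i] \<ominus>\<^bsub>HP\<^esub> hword [gen_D i] \<in> Hhat_relators I m"
      using i unfolding Hhat_relators_def by blast
  qed (use i in auto)
  then show ?thesis using word_append[of "[gen_D i]" "[gen_D i]"] i by simp
qed

lemma hs_hd: "i \<in> I \<Longrightarrow> hs i \<star> hD i \<oplus>\<^bsub>H\<^esub> hD i \<star> hs i = hs i \<ominus>\<^bsub>H\<^esub> \<one>\<^bsub>H\<^esub>"
proof -
  assume i: "i \<in> I"
  have w: "[gen_s i, gen_D i] \<in> lists (hgens I)" "[gen_D i, gen_s i] \<in> lists (hgens I)"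
    "[gen_s i] \<in> lists (hgens I)" "[] \<in> lists (hgens I)" using i by auto
  have "(hword [gen_s i, gen_D i] \<oplus>\<^bsub>HP\<^esub> hword [gen_D i, gen_s i])
        \<ominus>\<^bsub>HP\<^esub> (hword [gen_s i] \<ominus>\<^bsub>HP\<^esub> hword []) \<in> Hhat_relators I m"
    using i unfolding Hhat_relators_def by blast
  then have "HP.pc (hword [gen_s i, gen_D i] \<oplus>\<^bsub>HP\<^esub> hword [gen_D i, gen_s i]) =
      HP.pc (hword [gen_s i] \<ominus>\<^bsub>HP\<^esub> hword [])"
    using hword_closed[OF w(1)] hword_closed[OF w(2)] hword_closed[OF w(3)] hword_closed[OF w(4)]
    by (intro HP.relation HP.RMg.a_closed HP.RMg.minus_closed)
  then have "Hhat_word I m [gen_s i, gen_D i] \<oplus>\<^bsub>H\<^esub> Hhat_word I m [gen_D i, gen_s i] =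
      hs i \<ominus>\<^bsub>H\<^esub> Hhat_word I m []"
    using hword_closed[OF w(1)] hword_closed[OF w(2)] hword_closed[OF w(3)] hword_closed[OF w(4)]
    by (simp add: word_eq H_eq)
  then show ?thesis
    using i word_append[of "[gen_s i]" "[gen_D i]"] word_append[of "[gen_D i]" "[gen_s i]"] by (simp add: word_Nil)
qed

lemma hs_relation: "\<lbrakk>i \<in> I; j \<in> I\<rbrakk> \<Longrightarrow> wprod H hs (concat (replicate (m i j) [i, j])) = \<one>\<^bsub>H\<^esub>"
proof -
  assume ij: "i \<in> I" "j \<in> I"
  have e: "map gen_s (concat (replicate (m i j) [i, j])) = concat (replicate (m i j) [gen_s i, gen_s j])"
    by (simp add: map_concat)
  have "Hhat_word I m (map gen_s (concat (replicate (m i j) [i, j]))) = Hhat_word I m []"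
  proof (rule relationI)
    show "hword (map gen_s (concat (replicate (m i j) [i, j]))) \<ominus>\<^bsub>HP\<^esub> hword [] \<in> Hhat_relators I m"
      using ij unfolding Hhat_relators_def e by blast
    show "map gen_s (concat (replicate (m i j) [i, j])) \<in> lists (hgens I)"
      using replicate_lists[OF ij] gen_lists by blast
  qed simp
  then show ?thesis using ij replicate_lists[OF ij] by (simp add: word_wprod word_Nil)
qed

lemma hd_braid: "\<lbrakk>i \<in> I; j \<in> I; i \<noteq> j; m i j \<noteq> 0\<rbrakk> \<Longrightarrow>
   hD i \<star> wprod H hs (alt j i (m i j - 1)) = wprod H hs (alt j i (m i j - 1)) \<star> hD (if even (m i j) then i else j)"
proof -
  assume ij: "i \<in> I" "j \<in> I" "i \<noteq> j" "m i j \<noteq> 0"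
  let ?u = "map gen_s (alt j i (m i j - 1))" and ?k = "if even (m i j) then i else j"
  have u: "?u \<in> lists (hgens I)" using ij by (simp add: gen_lists)
  have "Hhat_word I m (gen_D i # ?u) = Hhat_word I m (?u @ [gen_D ?k])"
  proof (rule relationI)
    show "hword (gen_D i # ?u) \<ominus>\<^bsub>HP\<^esub> hword (?u @ [gen_D ?k]) \<in> Hhat_relators I m"
      using ij unfolding Hhat_relators_def by blast
  qed (use u ij in auto)
  then show ?thesis
    using u ij word_append[of "[gen_D i]" ?u] word_append[of ?u "[gen_D ?k]"] by (simp add: word_wprod)
qed

text \<open>The mixed relation between s_i and D_i, read as a rule that moves \<open>hD i\<close> to
  the left of \<open>hs i\<close> behind an arbitrary factor.\<close>

lemma hd_hs_hd: "\<lbrakk>i \<in> I; X \<in> carrier H\<rbrakk> \<Longrightarrow> X \<star> hs i \<star> hD i = X \<star> hs i \<ominus>\<^bsub>H\<^esub> X \<ominus>\<^bsub>H\<^esub> X \<star> hD i \<star> hs i"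
proof -
  assume a: "i \<in> I" "X \<in> carrier H"
  have "X \<star> (hs i \<star> hD i \<oplus>\<^bsub>H\<^esub> hD i \<star> hs i) = X \<star> (hs i \<ominus>\<^bsub>H\<^esub> \<one>\<^bsub>H\<^esub>)" using hs_hd a by simp
  then have "X \<star> hs i \<star> hD i \<oplus>\<^bsub>H\<^esub> X \<star> hD i \<star> hs i = X \<star> hs i \<ominus>\<^bsub>H\<^esub> X"
    using a by (simp add: H.r_distr a_minus_def H.r_minus H.m_assoc)
  then have "X \<star> hs i \<star> hD i \<oplus>\<^bsub>H\<^esub> X \<star> hD i \<star> hs i \<ominus>\<^bsub>H\<^esub> X \<star> hD i \<star> hs i =
     X \<star> hs i \<ominus>\<^bsub>H\<^esub> X \<ominus>\<^bsub>H\<^esub> X \<star> hD i \<star> hs i" by simp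
  then show ?thesis using a by (simp add: a_minus_def H.a_assoc H.r_neg)
qed

lemma hs_sq_right [simp]: "\<lbrakk>i \<in> I; X \<in> carrier H\<rbrakk> \<Longrightarrow> X \<star> hs i \<star> hs i = X"
  by (simp add: H.m_assoc hs_sq)

lemma hd_idem_right [simp]: "\<lbrakk>i \<in> I; X \<in> carrier H\<rbrakk> \<Longrightarrow> X \<star> hD i \<star> hD i = X \<star> hD i"
  by (simp add: H.m_assoc hd_idem)

text \<open>Integer scalars are multiples of 1, so closure under sums and negatives takes care of
  them.\<close>

lemma H_induct [consumes 1, case_names one s D add uminus mult]:
  assumes x: "x \<in> carrier H" and one: "P \<one>\<^bsub>H\<^esub>"
    and s: "\<And>i. i \<in> I \<Longrightarrow> P (hs i)" and D: "\<And>i. i \<in> I \<Longrightarrow> P (hD i)"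
    and a: "\<And>x y. \<lbrakk>x \<in> carrier H; y \<in> carrier H; P x; P y\<rbrakk> \<Longrightarrow> P (x \<oplus>\<^bsub>H\<^esub> y)"
    and u: "\<And>x. \<lbrakk>x \<in> carrier H; P x\<rbrakk> \<Longrightarrow> P (\<ominus>\<^bsub>H\<^esub> x)"
    and mu: "\<And>x y. \<lbrakk>x \<in> carrier H; y \<in> carrier H; P x; P y\<rbrakk> \<Longrightarrow> P (x \<star> y)"
  shows "P x"
  using x[folded H_eq]
proof (induction rule: HP.PA_induct)
  case (scalar c)
  have z: "P \<zero>\<^bsub>H\<^esub>" using a[OF _ _ one u[OF _ one]] by (simp add: H.r_neg)
  have 1: "P ([c] \<cdot>\<^bsub>H\<^esub> \<one>\<^bsub>H\<^esub>)"
  proof (induction c rule: int_induct[where k = 0])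
    case (step1 i)
    then show ?case using one by (auto simp: H.int_mult_add H.add.int_pow_1 intro!: a)
  next
    case (step2 i)
    then show ?case using one by (auto simp: H.int_mult_minus H.add.int_pow_1 a_minus_def intro!: a u)
  qed (use z in \<open>simp add: add_pow_int_ge H.add.nat_pow_0\<close>)
  have "mterm \<Z> c [] = [c] \<cdot>\<^bsub>HP\<^esub> mterm \<Z> 1 []" for c :: int
  proof (induction c rule: int_induct[where k = 0])
    case base
    then show ?case using HP.mterm_zero[of "[]"] by (simp add: add_pow_int_ge HP.RMg.add.nat_pow_0)
  next
    case (step1 i)
    then show ?case using HP.mterm_add[of i 1 "[]"] by (simp add: HP.RMg.int_mult_add HP.RMg.add.int_pow_1)
  next
    case (step2 i)
    have "mterm \<Z> i [] = mterm \<Z> (i - 1) [] \<oplus>\<^bsub>HP\<^esub> mterm \<Z> 1 []" using HP.mterm_add[of "i - 1" 1 "[]"] by simp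
    moreover have "mterm \<Z> k [] \<in> carrier HP" for k :: int by simp
    ultimately show ?case using step2
      by (simp add: HP.RMg.int_mult_minus HP.RMg.add.int_pow_1 a_minus_def HP.RMg.a_assoc HP.RMg.r_neg)
  qed
  from this[of c] have "HP.pc (mterm \<Z> c []) = HP.pc ([c] \<cdot>\<^bsub>HP\<^esub> hword [])" by (simp only:)
  also have "\<dots> = [c] \<cdot>\<^bsub>H\<^esub> HP.pc (hword [])"
    using ring_hom_int_mult[OF HP.pc.abgroup_hom_axioms, of "hword []" c] by (simp add: H_eq)
  finally have "HP.pc (mterm \<Z> c []) = [c] \<cdot>\<^bsub>H\<^esub> \<one>\<^bsub>H\<^esub>"
    using word_Nil by (simp only: word_eq)
  then show ?case using 1 by simp
next
  case (gen g)
  then show ?case using s D by (auto simp: word_eq)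
qed (use a mu in \<open>auto simp: H_eq\<close>)

lemma H_hom_eqI:
  assumes "ring_homo H A f" "ring_homo H A g"
    and "\<And>i. i \<in> I \<Longrightarrow> f (hs i) = g (hs i)" "\<And>i. i \<in> I \<Longrightarrow> f (hD i) = g (hD i)" and "x \<in> carrier H"
  shows "f x = g x"
proof -
  interpret f: ring_homo H A f by fact
  interpret g: ring_homo H A g by fact
  show ?thesis using assms(5) by (induction rule: H_induct) (simp_all add: assms)
qed

lemma H_lift:
  assumes "ring A" and cl: "\<And>i. i \<in> I \<Longrightarrow> \<sigma> i \<in> carrier A" "\<And>i. i \<in> I \<Longrightarrow> \<delta> i \<in> carrier A"
    and r1: "\<And>i. i \<in> I \<Longrightarrow> \<sigma> i \<otimes>\<^bsub>A\<^esub> \<sigma> i = \<one>\<^bsub>A\<^esub>"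
    and r2: "\<And>i. i \<in> I \<Longrightarrow> \<delta> i \<otimes>\<^bsub>A\<^esub> \<delta> i = \<delta> i"
    and r3: "\<And>i. i \<in> I \<Longrightarrow> \<sigma> i \<otimes>\<^bsub>A\<^esub> \<delta> i \<oplus>\<^bsub>A\<^esub> \<delta> i \<otimes>\<^bsub>A\<^esub> \<sigma> i = \<sigma> i \<ominus>\<^bsub>A\<^esub> \<one>\<^bsub>A\<^esub>"
    and r4: "\<And>i j. \<lbrakk>i \<in> I; j \<in> I\<rbrakk> \<Longrightarrow> wprod A \<sigma> (concat (replicate (m i j) [i, j])) = \<one>\<^bsub>A\<^esub>"
    and r5: "\<And>i j. \<lbrakk>i \<in> I; j \<in> I; i \<noteq> j; m i j \<noteq> 0\<rbrakk> \<Longrightarrow>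
       \<delta> i \<otimes>\<^bsub>A\<^esub> wprod A \<sigma> (alt j i (m i j - 1)) = wprod A \<sigma> (alt j i (m i j - 1)) \<otimes>\<^bsub>A\<^esub> \<delta> (if even (m i j) then i else j)"
  shows "\<exists>h. ring_homo H A h \<and> h \<in> extensional (carrier H) \<and> (\<forall>i\<in>I. h (hs i) = \<sigma> i \<and> h (hD i) = \<delta> i)"
proof -
  interpret A: ring A by fact
  define g where "g = (\<lambda>x. case x of gen_s i \<Rightarrow> \<sigma> i | gen_D i \<Rightarrow> \<delta> i)"
  have g [simp]: "g (gen_s i) = \<sigma> i" "g (gen_D i) = \<delta> i" for i by (simp_all add: g_def)
  have gc: "x \<in> hgens I \<Longrightarrow> g x \<in> carrier A" for x using cl by auto
  have wg: "wprod A g (map gen_s u) = wprod A \<sigma> u" for u by (induction u) auto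
  have wga: "wprod A g (u @ v) = wprod A g u \<otimes>\<^bsub>A\<^esub> wprod A g v" if "u \<in> lists (hgens I)" "v \<in> lists (hgens I)" for u v
    using that gc by (intro A.wprod_append) (auto simp: in_lists_conv_set)
  have "\<exists>h\<in>ring_hom HP.PA A \<inter> extensional (carrier HP.PA).
     \<forall>c\<in>UNIV. \<forall>u\<in>lists (hgens I). h (HP.pc (mterm \<Z> c u)) = ([c] \<cdot>\<^bsub>A\<^esub> \<one>\<^bsub>A\<^esub>) \<otimes>\<^bsub>A\<^esub> wprod A g u"
  proof (rule HP.PA_lift[where \<alpha> = "\<lambda>n. [n] \<cdot>\<^bsub>A\<^esub> \<one>\<^bsub>A\<^esub>" and g = g])
    show "ring A" "(\<lambda>n. [(n::int)] \<cdot>\<^bsub>A\<^esub> \<one>\<^bsub>A\<^esub>) \<in> ring_hom \<Z> A" by (rule assms(1), rule A.int_embed)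
    show "x \<in> hgens I \<Longrightarrow> g x \<in> carrier A" for x by (rule gc)
  next
    fix c :: int and x assume "x \<in> hgens I"
    then show "([c] \<cdot>\<^bsub>A\<^esub> \<one>\<^bsub>A\<^esub>) \<otimes>\<^bsub>A\<^esub> g x = g x \<otimes>\<^bsub>A\<^esub> ([c] \<cdot>\<^bsub>A\<^esub> \<one>\<^bsub>A\<^esub>)" using gc by (intro A.int_mult_comm)
  next
    fix h e assume h: "ring_homo HP A h" and e: "e \<in> Hhat_relators I m"
      and hm: "\<And>c u. \<lbrakk>c \<in> UNIV; u \<in> lists (hgens I)\<rbrakk> \<Longrightarrow> h (mterm \<Z> c u) = ([c] \<cdot>\<^bsub>A\<^esub> \<one>\<^bsub>A\<^esub>) \<otimes>\<^bsub>A\<^esub> wprod A g u"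
    interpret h: ring_homo HP A h by fact
    have hw: "h (hword u) = wprod A g u" if "u \<in> lists (hgens I)" for u
    proof -
      have "wprod A g u \<in> carrier A" using that gc by (intro A.wprod_closed) (auto simp: in_lists_conv_set)
      then show ?thesis using hm[of 1 u] that by (simp add: A.add.int_pow_1)
    qed
    have d: "h (hword u \<ominus>\<^bsub>HP\<^esub> hword v) = \<zero>\<^bsub>A\<^esub>"
      if "u \<in> lists (hgens I)" "v \<in> lists (hgens I)" "wprod A g u = wprod A g v" for u v
    proof -
      have "h (hword u \<ominus>\<^bsub>HP\<^esub> hword v) = h (hword u) \<ominus>\<^bsub>A\<^esub> h (hword v)"
        using that hword_closed by (intro h.a_minus)
      also have "\<dots> = \<zero>\<^bsub>A\<^esub>" 
        using that gc by (simp add: hw a_minus_def A.r_neg A.wprod_closed in_lists_conv_set)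
      finally show ?thesis .
    qed
    consider (1) i where "i \<in> I" "e = hword [gen_s i, gen_s i] \<ominus>\<^bsub>HP\<^esub> hword []"
      | (2) i where "i \<in> I" "e = hword [gen_D i, gen_D i] \<ominus>\<^bsub>HP\<^esub> hword [gen_D i]"
      | (3) i where "i \<in> I" "e = (hword [gen_s i, gen_D i] \<oplus>\<^bsub>HP\<^esub> hword [gen_D i, gen_s i])
        \<ominus>\<^bsub>HP\<^esub> (hword [gen_s i] \<ominus>\<^bsub>HP\<^esub> hword [])"
      | (4) i j where "i \<in> I" "j \<in> I" "e = hword (concat (replicate (m i j) [gen_s i, gen_s j])) \<ominus>\<^bsub>HP\<^esub> hword []"
      | (5) i j where "i \<in> I" "j \<in> I" "i \<noteq> j" "m i j \<noteq> 0" "e = hword (gen_D i # map gen_s (alt j i (m i j - 1))) \<ominus>\<^bsub>HP\<^esub>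
        hword (map gen_s (alt j i (m i j - 1)) @ [gen_D (if even (m i j) then i else j)])"
      using e unfolding Hhat_relators_def by blast
    then show "h e = \<zero>\<^bsub>A\<^esub>"
    proof cases
      case 1
      show ?thesis unfolding 1(2) by (rule d) (use 1 cl r1 in auto)
    next
      case 2
      show ?thesis unfolding 2(2) by (rule d) (use 2 cl r2 in auto)
    next
      case 3
      have w: "hword [gen_s i, gen_D i] \<in> carrier HP" "hword [gen_D i, gen_s i] \<in> carrier HP"
        "hword [gen_s i] \<in> carrier HP" "hword [] \<in> carrier HP" using 3 by (auto intro!: hword_closed)
      have "h e = (h (hword [gen_s i, gen_D i]) \<oplus>\<^bsub>A\<^esub> h (hword [gen_D i, gen_s i])) \<ominus>\<^bsub>A\<^esub>
          (h (hword [gen_s i]) \<ominus>\<^bsub>A\<^esub> h (hword []))"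
        unfolding 3 using w by (simp only: h.a_minus h.add HP.RMg.a_closed HP.RMg.minus_closed)
      also have "\<dots> = \<zero>\<^bsub>A\<^esub>" using 3 cl r3[of i] by (simp add: hw)
      finally show ?thesis .
    next
      case 4
      have e: "map gen_s (concat (replicate (m i j) [i, j])) = concat (replicate (m i j) [gen_s i, gen_s j])"
        by (simp add: map_concat)
      have "wprod A g (concat (replicate (m i j) [gen_s i, gen_s j])) = wprod A g []"
        using r4[OF 4(1,2)] wg by (simp flip: e)
      then show ?thesis
        unfolding 4(3) using 4 replicate_lists[OF 4(1,2)] by (intro d) (auto simp: gen_lists simp flip: e)
    next
      case 5
      let ?u = "map gen_s (alt j i (m i j - 1))"
      have u: "?u \<in> lists (hgens I)" using 5 by (simp add: gen_lists)
      show ?thesis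
        unfolding 5(5)
      proof (rule d)
        show "wprod A g (gen_D i # ?u) = wprod A g (?u @ [gen_D (if even (m i j) then i else j)])"
          using r5[OF 5(1-4)] u 5 cl by (subst wga) (auto simp: wg)
      qed (use u 5 in auto)
    qed
  qed
  then obtain h where h: "h \<in> ring_hom H A" "h \<in> extensional (carrier H)"
    and hm: "\<And>u. u \<in> lists (hgens I) \<Longrightarrow> h (Hhat_word I m u) = ([(1::int)] \<cdot>\<^bsub>A\<^esub> \<one>\<^bsub>A\<^esub>) \<otimes>\<^bsub>A\<^esub> wprod A g u"
    by (auto simp: H_eq word_eq)
  have "h (hs i) = \<sigma> i \<and> h (hD i) = \<delta> i" if "i \<in> I" for i
    using hm[of "[gen_s i]"] hm[of "[gen_D i]"] that cl by (auto simp: A.add.int_pow_1)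
  moreover have "ring_homo H A h" using h(1) H.ring_axioms A.ring_axioms by (intro ring_homoI)
  ultimately show ?thesis using h(2) by blast
qed

subsection \<open>The group algebra and the counit\<close>

abbreviation wH where "wH \<equiv> Hhat_of_W I m"

lemma wprod_cong: "(u, v) \<in> coxeter_cong I m \<Longrightarrow> wprod H hs u = wprod H hs v"
proof (induction rule: coxeter_cong.induct)
  case (append u v u' v')
  then show ?case using cong_lists by (metis wprod_hs_append)
qed (auto simp: hs_relation)

lemma wH_cl: "u \<in> lists I \<Longrightarrow> wH (cl u) = wprod H hs u"
proof -
  assume u: "u \<in> lists I"
  have "(\<lambda>v. Hhat_word I m (map gen_s v)) ` cl u = {wprod H hs u}"
  proof (rule Set.equalityI)
    show "(\<lambda>v. Hhat_word I m (map gen_s v)) ` cl u \<subseteq> {wprod H hs u}"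
    proof (rule image_subsetI)
      fix v assume "v \<in> cl u"
      then have "(u, v) \<in> coxeter_cong I m" by simp
      then show "Hhat_word I m (map gen_s v) \<in> {wprod H hs u}"
        using word_wprod[of v] wprod_cong cong_lists by fastforce
    qed
    show "{wprod H hs u} \<subseteq> (\<lambda>v. Hhat_word I m (map gen_s v)) ` cl u"
      using word_wprod[OF u] cl_self[OF u] by (auto simp: image_iff)
  qed
  then show ?thesis by (simp add: Hhat_of_W_def)
qed

lemma wH_closed [simp]: "w \<in> carrier W \<Longrightarrow> wH w \<in> carrier H"
  using W_cases[of w] by (auto simp: wH_cl)

lemma wH_mult: "\<lbrakk>x \<in> carrier W; y \<in> carrier W\<rbrakk> \<Longrightarrow> wH (x \<bullet> y) = wH x \<star> wH y"
proof -
  assume "x \<in> carrier W" "y \<in> carrier W"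
  then obtain u v where "u \<in> lists I" "x = cl u" "v \<in> lists I" "y = cl v" using W_cases by metis
  then show ?thesis using wH_cl[of "u @ v"] by (simp add: wH_cl wprod_hs_append cl_append)
qed

lemma wH_one [simp]: "wH e0 = \<one>\<^bsub>H\<^esub>"
  using wH_cl[of "[]"] by (simp add: one_W)

lemma wH_s: "i \<in> I \<Longrightarrow> wH (s i) = hs i"
  using wH_cl[of "[i]"] by (simp add: s_def)

lemma wH_iv [simp]: "w \<in> carrier W \<Longrightarrow> wH w \<star> wH (iv w) = \<one>\<^bsub>H\<^esub>" "w \<in> carrier W \<Longrightarrow> wH (iv w) \<star> wH w = \<one>\<^bsub>H\<^esub>"
  by (simp_all flip: wH_mult)

lemma wH_iv_left [simp]: "\<lbrakk>w \<in> carrier W; X \<in> carrier H\<rbrakk> \<Longrightarrow> wH w \<star> (wH (iv w) \<star> X) = X"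
  "\<lbrakk>w \<in> carrier W; X \<in> carrier H\<rbrakk> \<Longrightarrow> wH (iv w) \<star> (wH w \<star> X) = X"
  by (simp_all flip: H.m_assoc)

abbreviation eps where "eps \<equiv> Hhat_counit I m"

text \<open>The counit is a definite description. The values 1 and 0 satisfy all relations, which
  gives existence; uniqueness follows from generation by the \<open>hs i\<close> and
  \<open>hD i\<close>.\<close>

lemma counit: "ring_homo H \<Z> eps \<and> (\<forall>i\<in>I. eps (hs i) = 1 \<and> eps (hD i) = 0)"
proof -
  let ?P = "\<lambda>e. e \<in> extensional (carrier H) \<and> e \<in> ring_hom H \<Z> \<and> (\<forall>i\<in>I. e (hs i) = 1 \<and> e (hD i) = 0)"
  have rh: "ring_homo H \<Z> e \<longleftrightarrow> e \<in> ring_hom H \<Z>" for e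
    using H.ring_axioms ring_int by (auto simp: ring_homo_def ring_homo_axioms_def)
  have w1: "wprod \<Z> (\<lambda>_. 1) u = 1" for u :: "'i list" by (induction u) auto
  have "\<exists>h. ring_homo H \<Z> h \<and> h \<in> extensional (carrier H) \<and> (\<forall>i\<in>I. h (hs i) = 1 \<and> h (hD i) = 0)"
    using H_lift[OF ring_int, of "\<lambda>_. 1" "\<lambda>_. 0"] by (simp add: w1 a_minus_def)
  then obtain e where e: "?P e" using rh by blast
  have "f = e" if "?P f" for f
  proof (rule extensionalityI[of _ "carrier H"])
    fix x assume x: "x \<in> carrier H"
    show "f x = e x" by (rule H_hom_eqI[OF _ _ _ _ x, of \<Z>]) (use that e rh in simp_all)
  qed (use that e in auto)
  then have "?P (THE e. ?P e)" using e by (intro theI[of ?P e]) blast+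
  then show ?thesis using rh by (simp add: Hhat_counit_def)
qed

sublocale eps: ring_homo H \<Z> eps using counit by blast

lemma eps_gen [simp]: "i \<in> I \<Longrightarrow> eps (hs i) = 1" "i \<in> I \<Longrightarrow> eps (hD i) = 0"
  using counit by auto

lemma eps_wH [simp]: "w \<in> carrier W \<Longrightarrow> eps (wH w) = 1"
proof (induction rule: W_s_induct)
  case one
  then show ?case using eps.one by simp
next
  case (step i w)
  then show ?case using eps.mult[of "hs i" "wH w"] by (simp add: wH_mult wH_s)
qed

lemma eps_simps [simp]: "x \<in> carrier H \<Longrightarrow> eps (\<ominus>\<^bsub>H\<^esub> x) = - eps x"
  "eps \<zero>\<^bsub>H\<^esub> = 0"
  using eps.a_inv eps.zero by auto

subsection \<open>The elements $D_s$\<close>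

lemma nontrivial_descent:
  assumes "x \<in> carrier W" "x \<noteq> e0"
  obtains k where "k \<in> I" "sg x (s k)"
proof -
  obtain u where u: "u \<in> lists I" "length u = len x" "cl u = x" using reduced_word[OF assms(1)] by auto
  then have "u \<noteq> []" using assms by (auto simp: one_W)
  then obtain v k where v: "u = v @ [k]" by (cases u rule: rev_cases) auto
  then have l: "v \<in> lists I" "k \<in> I" using u by auto
  have "x \<bullet> s k = cl v" using u v l by (auto simp: cl_snoc)
  then have "len (x \<bullet> s k) < len x" using len_le[OF l(1)] u v by simp
  then show ?thesis using that l assms sg_len[of x "s k"] by auto
qed

text \<open>If \<open>x\<close> carries the simple root of \<open>i\<close> to that of \<open>j\<close>, then splitting off the longest element of
  a rank two parabolic subgroup reduces the claim to the defining relation (iii).\<close>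

lemma wH_hd_commute:
  assumes "x \<in> carrier W" "i \<in> I" "j \<in> I" "x \<bullet> s i = s j \<bullet> x" "\<not> sg x (s i)"
  shows "wH x \<star> hD i = hD j \<star> wH x"
  using assms
proof (induction "len x" arbitrary: x i rule: less_induct)
  case less
  note x = less.prems(1) and i = less.prems(2) and j = less.prems(3) and xi = less.prems(4)
  show ?case
  proof (cases "x = e0")
    case True
    then have "i = j" using less.prems by (intro s_inj) auto
    then show ?thesis using True j by simp
  next
    case False
    then obtain k where k: "k \<in> I" "sg x (s k)" using nontrivial_descent[OF x] by metis
    then have ik: "i \<noteq> k" using less.prems by auto
    \<comment> \<open>\<open>x\<close> has the descent \<open>k\<close> but not \<open>i\<close>.
      Its neighbour x s_i has both, because \<open>x\<close> does not carry s_k to s_j by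
      conjugation, so that \<open>two_descents\<close> applies to it.\<close>
    let ?z = "x \<bullet> s i" and ?m = "m i k"
    have z: "?z \<in> carrier W" using x i by simp
    have "sg ?z (s i)" using sg_mult_s[OF x i] less.prems by simp
    moreover have "sg ?z (s k)"
    proof -
      have "x \<bullet> s k \<bullet> iv x \<noteq> s j"
      proof
        assume "x \<bullet> s k \<bullet> iv x = s j"
        then have "s k = iv x \<bullet> s j \<bullet> x" using x k j conj_eq_iff[of x "s k" "s j"] by simp
        then have "s k = iv x \<bullet> (s j \<bullet> x)" using x j by (simp add: W.m_assoc)
        also have "\<dots> = s i" using x i by (simp flip: xi)
        finally show False using s_inj i k ik by blast
      qed
      then show ?thesis unfolding xi using x j k by (simp add: sg_mult sg_s)
    qed
    ultimately obtain y where y: "y \<in> carrier W" "?m \<noteq> 0" "?z = y \<bullet> cl (rev (alt i k ?m))"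
      and min: "\<And>x. x \<in> parabolic I m {i, k} \<Longrightarrow> len y \<le> len (y \<bullet> x)"
        "\<And>t. t \<in> parabolic I m {i, k} \<inter> RF \<Longrightarrow> \<not> sg y t"
      using two_descents[OF z i k(1) ik] by metis
    obtain n where n: "?m = Suc n" using y(2) by (cases ?m) auto
    let ?w = "rev (alt k i n)" and ?j = "if even ?m then i else k"
    let ?u = "cl ?w"
    have w: "?w \<in> lists I" using i k by simp
    then have u: "?u \<in> carrier W" by simp
    have ui: "?u \<bullet> s i = cl (rev (alt i k ?m))" using w i by (simp add: n cl_snoc)
    have jI: "?j \<in> I" using i k by simp
    have rw: "?w = (if even ?m then alt k i n else alt i k n)" by (simp add: rev_alt n)
    have "?u \<bullet> s i = cl (if even ?m then alt k i ?m else alt i k ?m)"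
      unfolding ui by (simp add: rev_alt)
    also have "\<dots> = cl (if even ?m then alt i k ?m else alt k i ?m)"
      using braid_W[OF i k(1)] braid_W[OF k(1) i] m_sym[OF i k(1)] by simp
    also have "\<dots> = s ?j \<bullet> ?u" unfolding rw using i k by (auto simp: n cl_Cons)
    finally have uj: "?u \<bullet> s i = s ?j \<bullet> ?u" .
    have "?z = y \<bullet> (?u \<bullet> s i)" using y ui by simp
    then have "x \<bullet> s i \<bullet> s i = y \<bullet> ?u \<bullet> s i \<bullet> s i" using y(1) u i by (simp add: W.m_assoc)
    then have xyu: "x = y \<bullet> ?u" using x y(1) u i by simp
    have "hD i \<star> wprod H hs (alt k i (?m - 1)) = wprod H hs (alt k i (?m - 1)) \<star> hD ?j"
      "hD k \<star> wprod H hs (alt i k (?m - 1)) = wprod H hs (alt i k (?m - 1)) \<star> hD (if even ?m then k else i)"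
      using hd_braid[OF i k(1) ik] hd_braid[OF k(1) i] ik y(2) m_sym[OF i k(1)] by auto
    then have "wprod H hs ?w \<star> hD i = hD ?j \<star> wprod H hs ?w"
      unfolding rw by (cases "even ?m") (auto simp: n)
    then have hu: "wH ?u \<star> hD i = hD ?j \<star> wH ?u" using w by (simp add: wH_cl)
    have J: "{i, k} \<subseteq> I" using i k by simp
    have yj: "wH y \<star> hD ?j = hD j \<star> wH y"
    proof (rule less.hyps)
      have sp: "cl v \<in> parabolic I m {i, k}" if "v \<in> lists {i, k}" for v using J that by (simp add: parabolic_eq)
      have "?u \<bullet> s k = cl (?w @ [k])" using w k by (simp add: cl_snoc)
      moreover have "?w @ [k] \<in> lists {i, k}" by simp
      \<comment> \<open>\<open>y\<close> is shortest in its coset, and the coset contains x s_k,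
        which is shorter than \<open>x\<close>.\<close>
      ultimately have "len y \<le> len (y \<bullet> (?u \<bullet> s k))" using sp min(1) by metis
      also have "\<dots> = len (x \<bullet> s k)" using xyu y(1) u k by (simp add: W.m_assoc)
      also have "\<dots> < len x" using sg_len_less[OF x _ k(2)] k by simp
      finally show "len y < len x" .
      have "y \<bullet> s ?j \<bullet> ?u = s j \<bullet> y \<bullet> ?u"
        using xi y(1) u i j jI unfolding xyu by (simp add: W.m_assoc uj)
      then show "y \<bullet> s ?j = s j \<bullet> y" using y(1) u j jI by simp
      have "s ?j \<in> parabolic I m {i, k}" using sp[of "[?j]"] by (simp add: s_def)
      then show "\<not> sg y (s ?j)" using jI by (intro min(2)) auto
    qed (use y j jI in auto)
    have "wH x \<star> hD i = wH y \<star> (wH ?u \<star> hD i)" unfolding xyu using y(1) u i by (simp add: wH_mult H.m_assoc)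
    also have "\<dots> = (wH y \<star> hD ?j) \<star> wH ?u" unfolding hu using y(1) u jI by (simp only: H.m_assoc wH_closed hd_closed)
    also have "\<dots> = hD j \<star> wH x" unfolding yj xyu using y(1) u j by (simp add: wH_mult H.m_assoc)
    finally show ?thesis .
  qed
qed

text \<open>Both x and x s_i conjugate s_i to \<open>t\<close>, and exactly one of them leaves the
  root of \<open>i\<close> positive.\<close>

lemma refl_pos:
  assumes "t \<in> RF"
  obtains x i where "x \<in> carrier W" "i \<in> I" "t = x \<bullet> s i \<bullet> iv x" "\<not> sg x (s i)"
proof -
  obtain x i where xi: "x \<in> carrier W" "i \<in> I" "t = x \<bullet> s i \<bullet> iv x" using assms by (rule reflE)
  show ?thesis
  proof (cases "sg x (s i)")
    case True
    show ?thesis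
      by (rule that[of "x \<bullet> s i" i]) (use True xi in \<open>auto simp: sg_mult_s W.inv_mult_group W.m_assoc\<close>)
  qed (use xi that in blast)
qed

definition conjD :: "'i list set \<Rightarrow> 'i \<Rightarrow> 'i hhat" where
  "conjD x i = wH x \<star> hD i \<star> wH (iv x)"

lemma conjD_closed [simp]: "\<lbrakk>x \<in> carrier W; i \<in> I\<rbrakk> \<Longrightarrow> conjD x i \<in> carrier H"
  by (simp add: conjD_def)

lemma conjD_conj: "\<lbrakk>x \<in> carrier W; i \<in> I; y \<in> carrier W\<rbrakk> \<Longrightarrow> wH y \<star> conjD x i \<star> wH (iv y) = conjD (y \<bullet> x) i"
  by (simp add: conjD_def wH_mult W.inv_mult_group H.m_assoc)

text \<open>y^-1 x carries the simple root of \<open>i\<close> to that of \<open>j\<close> without a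
  change of sign, so \<open>wH_hd_commute\<close> moves \<open>hD i\<close> through it.\<close>

lemma conjD_unique:
  assumes x: "x \<in> carrier W" "i \<in> I" "\<not> sg x (s i)" and y: "y \<in> carrier W" "j \<in> I" "\<not> sg y (s j)"
    and e: "x \<bullet> s i \<bullet> iv x = y \<bullet> s j \<bullet> iv y"
  shows "conjD x i = conjD y j"
proof -
  let ?z = "iv y \<bullet> x"
  have z: "?z \<in> carrier W" using x y by simp
  have e': "iv y \<bullet> (x \<bullet> s i \<bullet> iv x) \<bullet> y = s j" using x y unfolding e by (simp add: W.m_assoc)
  have "sg (iv y) (x \<bullet> s i \<bullet> iv x) = sg y (s j)" using x y e' by (subst sg_iv) auto
  then have "\<not> sg ?z (s i)" using x y by (subst sg_mult) auto
  moreover have "?z \<bullet> s i = s j \<bullet> ?z" using x y by (simp add: W.m_assoc flip: e')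
  ultimately have "wH ?z \<star> hD i = hD j \<star> wH ?z" using wH_hd_commute[OF z] x y by blast
  then have "conjD ?z i = conjD e0 j"
    unfolding conjD_def using z y by (simp add: H.m_assoc)
  then have "wH y \<star> conjD ?z i \<star> wH (iv y) = wH y \<star> conjD e0 j \<star> wH (iv y)" by simp
  then show ?thesis using x y z by (simp add: conjD_conj)
qed

abbreviation Dr where "Dr \<equiv> D_refl I m"

text \<open>The elements x D_i x^-1 with x s_i longer than x depend only on the reflection, and this
  family satisfies the defining recursion. Conversely the recursion determines all values by
  induction on the length of \<open>x\<close>, so the definite description denotes this
  family.\<close>

lemma D_refl_eq: "\<lbrakk>x \<in> carrier W; i \<in> I; \<not> sg x (s i)\<rbrakk> \<Longrightarrow> Dr (x \<bullet> s i \<bullet> iv x) = conjD x i"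
proof -
  assume xi: "x \<in> carrier W" "i \<in> I" "\<not> sg x (s i)"
  let ?P = "\<lambda>d. d \<in> RF \<rightarrow>\<^sub>E carrier H
           \<and> (\<forall>i\<in>I. d (s i) = hD i)
           \<and> (\<forall>i\<in>I. \<forall>t\<in>RF - {s i}. d (s i \<bullet> t \<bullet> s i) = hs i \<star> d t \<star> hs i)"
  have "\<forall>t\<in>RF. \<exists>c. \<forall>x i. x \<in> carrier W \<and> i \<in> I \<and> \<not> sg x (s i) \<and> t = x \<bullet> s i \<bullet> iv x \<longrightarrow> conjD x i = c"
    using conjD_unique by metis
  then obtain d0 where d0: "\<And>x i. \<lbrakk>x \<in> carrier W; i \<in> I; \<not> sg x (s i)\<rbrakk> \<Longrightarrow> d0 (x \<bullet> s i \<bullet> iv x) = conjD x i"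
    using reflI by metis
  define d where "d = restrict d0 RF"
  have d: "d (x \<bullet> s i \<bullet> iv x) = conjD x i" if "x \<in> carrier W" "i \<in> I" "\<not> sg x (s i)" for x i
    using d0 that reflI by (simp add: d_def)
  have Pd: "?P d"
  proof (intro conjI ballI)
    show "d \<in> RF \<rightarrow>\<^sub>E carrier H"
    proof (rule PiE_I)
      fix t assume "t \<in> RF"
      then obtain x i where "x \<in> carrier W" "i \<in> I" "t = x \<bullet> s i \<bullet> iv x" "\<not> sg x (s i)" by (rule refl_pos)
      then show "d t \<in> carrier H" using d by simp
    qed (simp add: d_def)
    show "d (s i) = hD i" if "i \<in> I" for i
      using d[of e0 i] that by (simp add: conjD_def)
    fix i t assume i: "i \<in> I" and t: "t \<in> RF - {s i}"
    then obtain x k where x: "x \<in> carrier W" "k \<in> I" "t = x \<bullet> s k \<bullet> iv x" "\<not> sg x (s k)" using refl_pos by blast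
    have "\<not> sg (s i \<bullet> x) (s k)" using x t i by (simp add: sg_mult sg_s)
    then have "d (s i \<bullet> x \<bullet> s k \<bullet> iv (s i \<bullet> x)) = conjD (s i \<bullet> x) k" using x i by (intro d) auto
    then show "d (s i \<bullet> t \<bullet> s i) = hs i \<star> d t \<star> hs i"
      using x i conjD_conj[of x k "s i"] d by (simp add: W.m_assoc W.inv_mult_group wH_s)
  qed
  have uniq: "f (x \<bullet> s i \<bullet> iv x) = conjD x i"
    if P: "?P f" and "x \<in> carrier W" "i \<in> I" "\<not> sg x (s i)" for f x i
    using that(2-)
  proof (induction "len x" arbitrary: x rule: less_induct)
    case less
    obtain u where u: "u \<in> lists I" "length u = len x" "cl u = x" using reduced_word[OF less.prems(1)] by auto
    show ?case
    proof (cases u)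
      case Nil
      then have "x = e0" using u by (simp add: one_W)
      then show ?thesis using P less.prems by (simp add: conjD_def)
    next
      case (Cons j v)
      then have j: "j \<in> I" "v \<in> lists I" using u by auto
      let ?y = "cl v"
      have y: "?y \<in> carrier W" and xy: "x = s j \<bullet> ?y" using j u Cons by (auto simp: cl_Cons)
      have ly: "len ?y < len x" using len_le[OF j(2)] u Cons by simp
      have sgx: "sg x (s i) = (sg ?y (s i) \<noteq> (?y \<bullet> s i \<bullet> iv ?y = s j))"
        unfolding xy using y j less.prems by (simp add: sg_mult sg_s)
      \<comment> \<open>The recursion may be used at \<open>s j\<close> only for a positive root. If
        \<open>?y\<close> had the descent \<open>i\<close>, then x = s_j y would equal y s_i and be
        shorter than \<open>?y\<close>, but it is longer.\<close>
      have ny: "\<not> sg ?y (s i)"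
      proof
        assume a: "sg ?y (s i)"
        then have c: "?y \<bullet> s i \<bullet> iv ?y = s j" using sgx less.prems by simp
        have "x = ?y \<bullet> s i \<bullet> iv ?y \<bullet> ?y" unfolding xy c ..
        also have "\<dots> = ?y \<bullet> s i" using y less.prems by (simp add: W.m_assoc)
        finally show False using sg_len_less[OF y _ a] ly less.prems by simp
      qed
      then have "?y \<bullet> s i \<bullet> iv ?y \<in> RF - {s j}" using sgx less.prems y by (auto intro!: reflI)
      then have "f (s j \<bullet> (?y \<bullet> s i \<bullet> iv ?y) \<bullet> s j) = hs j \<star> f (?y \<bullet> s i \<bullet> iv ?y) \<star> hs j"
        using P j by blast
      also have "f (?y \<bullet> s i \<bullet> iv ?y) = conjD ?y i" using less.hyps[OF ly y] less.prems ny by blast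
      also have "hs j \<star> conjD ?y i \<star> hs j = conjD x i"
        unfolding xy using conjD_conj[of ?y i "s j"] y j less.prems by (simp add: wH_s)
      finally show ?thesis unfolding xy using y j less.prems by (simp add: W.m_assoc W.inv_mult_group)
    qed
  qed
  have "f = d" if f: "?P f" for f
  proof (rule extensionalityI[of _ RF])
    fix t assume "t \<in> RF"
    then obtain x i where "x \<in> carrier W" "i \<in> I" "t = x \<bullet> s i \<bullet> iv x" "\<not> sg x (s i)" by (rule refl_pos)
    then show "f t = d t" using uniq[OF f] d by metis
  next
    show "f \<in> extensional RF" "d \<in> extensional RF" using f Pd unfolding PiE_def by blast+
  qed
  then have "?P (THE d. ?P d)" by (rule theI[of ?P d, OF Pd])
  then have "?P Dr" unfolding D_refl_def .
  then show ?thesis using uniq xi by blast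
qed

lemma Dr_closed [simp]: "t \<in> RF \<Longrightarrow> Dr t \<in> carrier H"
  by (elim refl_pos) (simp add: D_refl_eq)

lemma Dr_s: "i \<in> I \<Longrightarrow> Dr (s i) = hD i"
  using D_refl_eq[of e0 i] by (simp add: conjD_def)

lemma Dr_conj_pos: "\<lbrakk>t \<in> RF; y \<in> carrier W; \<not> sg y t\<rbrakk> \<Longrightarrow> wH y \<star> Dr t \<star> wH (iv y) = Dr (y \<bullet> t \<bullet> iv y)"
proof (elim refl_pos)
  fix x i assume a: "y \<in> carrier W" "\<not> sg y t" "x \<in> carrier W" "i \<in> I" "t = x \<bullet> s i \<bullet> iv x" "\<not> sg x (s i)"
  then have "\<not> sg (y \<bullet> x) (s i)" by (simp add: sg_mult)
  then have "Dr (y \<bullet> x \<bullet> s i \<bullet> iv (y \<bullet> x)) = conjD (y \<bullet> x) i" using a by (intro D_refl_eq) auto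
  moreover have "y \<bullet> x \<bullet> s i \<bullet> iv (y \<bullet> x) = y \<bullet> t \<bullet> iv y" using a by (simp add: W.inv_mult_group W.m_assoc)
  moreover have "Dr t = conjD x i" unfolding a(5) using a by (intro D_refl_eq)
  ultimately show ?thesis using a(1,3,4) by (simp add: conjD_conj)
qed

text \<open>The conjugating element is split so that s_i stands next to D_i, and s_i D_i s_i = 1 -
  s_i - D_i. The remaining conjugation leaves the root positive.\<close>

lemma Dr_conj_neg: "\<lbrakk>t \<in> RF; y \<in> carrier W; sg y t\<rbrakk> \<Longrightarrow>
   wH y \<star> Dr t \<star> wH (iv y) = \<one>\<^bsub>H\<^esub> \<ominus>\<^bsub>H\<^esub> wH (y \<bullet> t \<bullet> iv y) \<ominus>\<^bsub>H\<^esub> Dr (y \<bullet> t \<bullet> iv y)"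
proof (elim refl_pos)
  fix x i assume a: "y \<in> carrier W" "sg y t" "x \<in> carrier W" "i \<in> I" "t = x \<bullet> s i \<bullet> iv x" "\<not> sg x (s i)"
  define z where "z = y \<bullet> x \<bullet> s i"
  have z: "z \<in> carrier W" and yx: "y \<bullet> x = z \<bullet> s i" using a by (auto simp: z_def)
  have t': "z \<bullet> s i \<bullet> iv z = y \<bullet> t \<bullet> iv y" using a by (simp add: z_def W.inv_mult_group W.m_assoc)
  have "sg (y \<bullet> x) (s i)" using a by (simp add: sg_mult)
  then have "\<not> sg z (s i)" using a by (simp add: z_def sg_mult_s)
  then have D: "Dr (y \<bullet> t \<bullet> iv y) = conjD z i" using D_refl_eq[of z i] a(4) z t' by simp
  have "hs i \<star> hD i = hs i \<ominus>\<^bsub>H\<^esub> \<one>\<^bsub>H\<^esub> \<ominus>\<^bsub>H\<^esub> hD i \<star> hs i" using hd_hs_hd[of i "\<one>\<^bsub>H\<^esub>"] a by simp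
  then have "hs i \<star> hD i \<star> hs i = (hs i \<ominus>\<^bsub>H\<^esub> \<one>\<^bsub>H\<^esub> \<ominus>\<^bsub>H\<^esub> hD i \<star> hs i) \<star> hs i" by simp
  also have "\<dots> = \<one>\<^bsub>H\<^esub> \<ominus>\<^bsub>H\<^esub> hs i \<ominus>\<^bsub>H\<^esub> hD i"
    using a(4) by (simp add: a_minus_def H.l_distr H.l_minus hs_sq)
  finally have c: "hs i \<star> hD i \<star> hs i = \<one>\<^bsub>H\<^esub> \<ominus>\<^bsub>H\<^esub> hs i \<ominus>\<^bsub>H\<^esub> hD i" .
  have "Dr t = conjD x i" unfolding a(5) using a by (intro D_refl_eq)
  then have "wH y \<star> Dr t \<star> wH (iv y) = conjD (z \<bullet> s i) i" using a by (simp add: conjD_conj yx)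
  also have "\<dots> = wH z \<star> (hs i \<star> hD i \<star> hs i) \<star> wH (iv z)"
    using a(4) z by (simp add: conjD_def wH_mult wH_s W.inv_mult_group H.m_assoc)
  also have "\<dots> = wH z \<star> wH (iv z) \<ominus>\<^bsub>H\<^esub> wH z \<star> hs i \<star> wH (iv z) \<ominus>\<^bsub>H\<^esub> conjD z i"
    unfolding c conjD_def using z a(4) by (simp add: a_minus_def H.l_distr H.r_distr H.l_minus H.r_minus)
  also have "\<dots> = \<one>\<^bsub>H\<^esub> \<ominus>\<^bsub>H\<^esub> wH (z \<bullet> s i \<bullet> iv z) \<ominus>\<^bsub>H\<^esub> conjD z i"
    using z a(4) by (simp add: wH_mult wH_s)
  finally show ?thesis unfolding D t' .
qed

end

section \<open>The module of functions on the Coxeter group\<close>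

text \<open>Additive endomorphisms with products in reversed order: a homomorphism into this ring is
  a right action. \<open>restrict\<close> turns agreement on the carrier into equality.\<close>

definition endo_op :: "('a, 'm) ring_scheme \<Rightarrow> ('a \<Rightarrow> 'a) ring" where
  "endo_op G = \<lparr>carrier = {f. f \<in> extensional (carrier G) \<and> abgroup_hom G G f},
     mult = (\<lambda>f g. restrict (\<lambda>x. g (f x)) (carrier G)), one = restrict (\<lambda>x. x) (carrier G),
     zero = restrict (\<lambda>x. \<zero>\<^bsub>G\<^esub>) (carrier G), add = (\<lambda>f g. restrict (\<lambda>x. f x \<oplus>\<^bsub>G\<^esub> g x) (carrier G))\<rparr>"

lemma endo_op_simps [simp]:
  "f \<in> carrier (endo_op G) \<longleftrightarrow> f \<in> extensional (carrier G) \<and> abgroup_hom G G f"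
  "mult (endo_op G) f g = restrict (\<lambda>x. g (f x)) (carrier G)"
  "one (endo_op G) = restrict (\<lambda>x. x) (carrier G)"
  "zero (endo_op G) = restrict (\<lambda>x. \<zero>\<^bsub>G\<^esub>) (carrier G)"
  "add (endo_op G) f g = restrict (\<lambda>x. f x \<oplus>\<^bsub>G\<^esub> g x) (carrier G)"
  by (simp_all add: endo_op_def)

lemma (in abelian_group) restrict_hom:
  assumes "\<And>x. x \<in> carrier G \<Longrightarrow> f x \<in> carrier G"
    "\<And>x y. \<lbrakk>x \<in> carrier G; y \<in> carrier G\<rbrakk> \<Longrightarrow> f (x \<oplus> y) = f x \<oplus> f y"
  shows "abgroup_hom G G (restrict f (carrier G))"
  using assms by (intro abgroup_homI) (auto simp: abelian_group_axioms)

lemma ring_endo_op: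
  assumes "abelian_group G"
  shows "ring (endo_op G)"
proof -
  interpret G: abelian_group G by fact
  have cl: "f x \<in> carrier G" and ad: "\<lbrakk>x \<in> carrier G; y \<in> carrier G\<rbrakk> \<Longrightarrow> f (x \<oplus>\<^bsub>G\<^esub> y) = f x \<oplus>\<^bsub>G\<^esub> f y"
    if "abgroup_hom G G f" "x \<in> carrier G" for f x y
    using that abgroup_hom.closed abgroup_hom.add by metis+
  have eqI: "restrict f (carrier G) = restrict g (carrier G)" if "\<And>x. x \<in> carrier G \<Longrightarrow> f x = g x" for f g :: "'a \<Rightarrow> 'a"
    using that by (rule restrict_ext)
  have restr: "restrict f (carrier G) = f" if "f \<in> extensional (carrier G)" for f :: "'a \<Rightarrow> 'a"
    using that by (rule extensional_restrict)
  show ?thesis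
  proof (rule ringI)
    show "abelian_group (endo_op G)"
    proof (rule abelian_groupI)
      fix f g assume f: "f \<in> carrier (endo_op G)" and g: "g \<in> carrier (endo_op G)"
      show "f \<oplus>\<^bsub>endo_op G\<^esub> g \<in> carrier (endo_op G)"
        using f g by (auto intro!: G.restrict_hom simp: cl ad G.a_ac)
      show "f \<oplus>\<^bsub>endo_op G\<^esub> g = g \<oplus>\<^bsub>endo_op G\<^esub> f"
        using f g by (auto intro!: eqI simp: cl G.a_comm)
      fix h assume h: "h \<in> carrier (endo_op G)"
      show "f \<oplus>\<^bsub>endo_op G\<^esub> g \<oplus>\<^bsub>endo_op G\<^esub> h = f \<oplus>\<^bsub>endo_op G\<^esub> (g \<oplus>\<^bsub>endo_op G\<^esub> h)"
        using f g h by (auto intro!: eqI simp: cl G.a_assoc)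
    next
      show "\<zero>\<^bsub>endo_op G\<^esub> \<in> carrier (endo_op G)" by (auto intro!: G.restrict_hom)
    next
      fix f assume f: "f \<in> carrier (endo_op G)"
      have "restrict (\<lambda>x. \<zero>\<^bsub>G\<^esub> \<oplus>\<^bsub>G\<^esub> f x) (carrier G) = restrict f (carrier G)" using f by (intro eqI) (auto simp: cl)
      then show "\<zero>\<^bsub>endo_op G\<^esub> \<oplus>\<^bsub>endo_op G\<^esub> f = f" using f by (auto simp: restr cong: restrict_cong)
      show "\<exists>g\<in>carrier (endo_op G). g \<oplus>\<^bsub>endo_op G\<^esub> f = \<zero>\<^bsub>endo_op G\<^esub>"
      proof (rule bexI[of _ "restrict (\<lambda>x. \<ominus>\<^bsub>G\<^esub> f x) (carrier G)"])
        show "restrict (\<lambda>x. \<ominus>\<^bsub>G\<^esub> f x) (carrier G) \<in> carrier (endo_op G)"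
          using f by (auto intro!: G.restrict_hom simp: cl ad G.minus_add)
        show "restrict (\<lambda>x. \<ominus>\<^bsub>G\<^esub> f x) (carrier G) \<oplus>\<^bsub>endo_op G\<^esub> f = \<zero>\<^bsub>endo_op G\<^esub>"
          using f by (auto intro!: eqI simp: cl G.l_neg)
      qed
    qed
    show "monoid (endo_op G)"
    proof (rule monoidI)
      fix f g h assume "f \<in> carrier (endo_op G)" "g \<in> carrier (endo_op G)" "h \<in> carrier (endo_op G)"
      then show "f \<otimes>\<^bsub>endo_op G\<^esub> g \<otimes>\<^bsub>endo_op G\<^esub> h = f \<otimes>\<^bsub>endo_op G\<^esub> (g \<otimes>\<^bsub>endo_op G\<^esub> h)"
        by (auto intro!: eqI simp: cl)
    next
      fix f assume f: "f \<in> carrier (endo_op G)"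
      have "restrict (\<lambda>x. f (restrict (\<lambda>x. x) (carrier G) x)) (carrier G) = restrict f (carrier G)"
        by (intro eqI) auto
      then show "\<one>\<^bsub>endo_op G\<^esub> \<otimes>\<^bsub>endo_op G\<^esub> f = f" using f restr by auto
      have "restrict (\<lambda>x. restrict (\<lambda>x. x) (carrier G) (f x)) (carrier G) = restrict f (carrier G)"
        using f by (intro eqI) (auto simp: cl)
      then show "f \<otimes>\<^bsub>endo_op G\<^esub> \<one>\<^bsub>endo_op G\<^esub> = f" using f restr by auto
    qed (auto intro!: G.restrict_hom simp: cl ad)
  qed (auto intro!: eqI simp: cl ad)
qed

context coxeter begin

sublocale MR: mring H W
  by (intro mring.intro H.ring_axioms W.monoid_axioms)

abbreviation FM where "FM \<equiv> monoid_ring H W"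

lemma FM_add: "f \<oplus>\<^bsub>FM\<^esub> g = (\<lambda>x. f x \<oplus>\<^bsub>H\<^esub> g x)" by (rule MR.add_eq)

text \<open>\<open>f w\<close> is the coefficient in Hhat of the basis element \<open>w\<close>. The
  term r \<otimes> a is sent to r s_i \<otimes> a s_i, so the coefficient arriving at
  \<open>w\<close> comes from w s_i.\<close>

definition sF :: "'i \<Rightarrow> ('i list set \<Rightarrow> 'i hhat) \<Rightarrow> 'i list set \<Rightarrow> 'i hhat" where
  "sF i f = (\<lambda>w. if w \<in> carrier W then f (w \<bullet> s i) \<star> hs i else \<zero>\<^bsub>H\<^esub>)"

text \<open>By the coproduct, r \<otimes> a is sent to r D_i \<otimes> a + r s_i \<otimes> a D_i,
  with a D_i = a - a s_i at a descent and 0 otherwise. Read off at \<open>w\<close>: a descent keeps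
  its own second term, and an ascent receives the negative term of its neighbour w s_i.\<close>

definition dF :: "'i \<Rightarrow> ('i list set \<Rightarrow> 'i hhat) \<Rightarrow> 'i list set \<Rightarrow> 'i hhat" where
  "dF i f = (\<lambda>w. if w \<in> carrier W then
     (if sg w (s i) then f w \<star> hD i \<oplus>\<^bsub>H\<^esub> f w \<star> hs i else f w \<star> hD i \<ominus>\<^bsub>H\<^esub> f (w \<bullet> s i) \<star> hs i) else \<zero>\<^bsub>H\<^esub>)"

lemma
  assumes f: "f \<in> carrier FM" and i: "i \<in> I"
  shows sF_closed: "sF i f \<in> carrier FM" and dF_closed: "dF i f \<in> carrier FM"
proof -
  let ?A = "msupp H f \<union> (\<lambda>w. w \<bullet> s i) ` msupp H f"
  note c = MR.coeff[OF f]
  have A: "finite ?A" "?A \<subseteq> carrier W" using MR.fin[OF f] MR.supp[OF f] i by auto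
  have z: "f w = \<zero>\<^bsub>H\<^esub>" if "w \<notin> ?A" for w using that by (auto simp: msupp_def)
  have z': "f (w \<bullet> s i) = \<zero>\<^bsub>H\<^esub>" if "w \<notin> ?A" "w \<in> carrier W" for w
  proof (rule ccontr)
    assume "f (w \<bullet> s i) \<noteq> \<zero>\<^bsub>H\<^esub>"
    then have "w \<bullet> s i \<in> msupp H f" by (simp add: msupp_def)
    then have "w \<bullet> s i \<bullet> s i \<in> ?A" by blast
    then show False using that i by simp
  qed
  show "sF i f \<in> carrier FM" using A z z' c i by (intro MR.memI[of _ ?A]) (auto simp: sF_def)
  show "dF i f \<in> carrier FM" using A z z' c i
    by (intro MR.memI[of _ ?A]) (auto simp: dF_def a_minus_def H.r_neg)
qed

lemma
  assumes f: "f \<in> carrier FM" and g: "g \<in> carrier FM" and i: "i \<in> I"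
  shows sF_add: "sF i (f \<oplus>\<^bsub>FM\<^esub> g) = sF i f \<oplus>\<^bsub>FM\<^esub> sF i g"
    and dF_add: "dF i (f \<oplus>\<^bsub>FM\<^esub> g) = dF i f \<oplus>\<^bsub>FM\<^esub> dF i g"
proof -
  note c = MR.coeff[OF f] MR.coeff[OF g]
  show "sF i (f \<oplus>\<^bsub>FM\<^esub> g) = sF i f \<oplus>\<^bsub>FM\<^esub> sF i g"
    using c i by (simp add: fun_eq_iff sF_def FM_add H.l_distr)
  show "dF i (f \<oplus>\<^bsub>FM\<^esub> g) = dF i f \<oplus>\<^bsub>FM\<^esub> dF i g"
    using c i by (simp add: fun_eq_iff dF_def FM_add H.l_distr a_minus_def H.minus_add H.a_ac)
qed

text \<open>The coefficient at a descent in the verification that D_i is idempotent.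
  \<open>dd_neg\<close> is the one at an ascent, where \<open>Y\<close> is the coefficient of the
  neighbour; \<open>sd_ds\<close> does the same for the mixed relation.\<close>

lemma dd_pos: "\<lbrakk>X \<in> carrier H; i \<in> I\<rbrakk> \<Longrightarrow> (X \<star> hD i \<oplus>\<^bsub>H\<^esub> X \<star> hs i) \<star> hD i \<oplus>\<^bsub>H\<^esub> (X \<star> hD i \<oplus>\<^bsub>H\<^esub> X \<star> hs i) \<star> hs i
    = X \<star> hD i \<oplus>\<^bsub>H\<^esub> X \<star> hs i"
proof -
  assume a: "X \<in> carrier H" "i \<in> I"
  define p q r where "p = X \<star> hD i" and "q = X \<star> hs i" and "r = X \<star> hD i \<star> hs i"
  have c: "p \<in> carrier H" "q \<in> carrier H" "r \<in> carrier H" using a by (auto simp: p_def q_def r_def)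
  have "(X \<star> hD i \<oplus>\<^bsub>H\<^esub> X \<star> hs i) \<star> hD i \<oplus>\<^bsub>H\<^esub> (X \<star> hD i \<oplus>\<^bsub>H\<^esub> X \<star> hs i) \<star> hs i =
     (p \<oplus>\<^bsub>H\<^esub> (q \<ominus>\<^bsub>H\<^esub> X \<ominus>\<^bsub>H\<^esub> r)) \<oplus>\<^bsub>H\<^esub> (r \<oplus>\<^bsub>H\<^esub> X)"
    using a by (simp add: H.l_distr hd_hs_hd p_def q_def r_def)
  also have "\<dots> = p \<oplus>\<^bsub>H\<^esub> q" using c a by algebra
  finally show ?thesis by (simp add: p_def q_def)
qed

lemma dd_neg: "\<lbrakk>X \<in> carrier H; Y \<in> carrier H; i \<in> I\<rbrakk> \<Longrightarrow>
    (X \<star> hD i \<ominus>\<^bsub>H\<^esub> Y \<star> hs i) \<star> hD i \<ominus>\<^bsub>H\<^esub> (Y \<star> hD i \<oplus>\<^bsub>H\<^esub> Y \<star> hs i) \<star> hs i = X \<star> hD i \<ominus>\<^bsub>H\<^esub> Y \<star> hs i"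
proof -
  assume a: "X \<in> carrier H" "Y \<in> carrier H" "i \<in> I"
  define p q r where "p = X \<star> hD i" and "q = Y \<star> hs i" and "r = Y \<star> hD i \<star> hs i"
  have c: "p \<in> carrier H" "q \<in> carrier H" "r \<in> carrier H" using a by (auto simp: p_def q_def r_def)
  have "(X \<star> hD i \<ominus>\<^bsub>H\<^esub> Y \<star> hs i) \<star> hD i \<ominus>\<^bsub>H\<^esub> (Y \<star> hD i \<oplus>\<^bsub>H\<^esub> Y \<star> hs i) \<star> hs i =
     (p \<ominus>\<^bsub>H\<^esub> (q \<ominus>\<^bsub>H\<^esub> Y \<ominus>\<^bsub>H\<^esub> r)) \<ominus>\<^bsub>H\<^esub> (r \<oplus>\<^bsub>H\<^esub> Y)"
    using a by (simp add: H.l_distr H.l_minus hd_hs_hd p_def q_def r_def a_minus_def)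
  also have "\<dots> = p \<ominus>\<^bsub>H\<^esub> q" using c a by algebra
  finally show ?thesis by (simp add: p_def q_def)
qed

lemma sd_ds:
  assumes a: "X \<in> carrier H" "Y \<in> carrier H" "i \<in> I"
  shows "(Y \<star> hs i \<star> hD i \<oplus>\<^bsub>H\<^esub> Y \<star> hs i \<star> hs i) \<oplus>\<^bsub>H\<^esub> (Y \<star> hD i \<ominus>\<^bsub>H\<^esub> X \<star> hs i) \<star> hs i = Y \<star> hs i \<ominus>\<^bsub>H\<^esub> X" (is ?A)
    and "(Y \<star> hs i \<star> hD i \<ominus>\<^bsub>H\<^esub> X \<star> hs i \<star> hs i) \<oplus>\<^bsub>H\<^esub> (Y \<star> hD i \<oplus>\<^bsub>H\<^esub> Y \<star> hs i) \<star> hs i = Y \<star> hs i \<ominus>\<^bsub>H\<^esub> X" (is ?B)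
proof -
  define q r where "q = Y \<star> hs i" and "r = Y \<star> hD i \<star> hs i"
  have c: "q \<in> carrier H" "r \<in> carrier H" using a by (auto simp: q_def r_def)
  have "(Y \<star> hs i \<star> hD i \<oplus>\<^bsub>H\<^esub> Y \<star> hs i \<star> hs i) \<oplus>\<^bsub>H\<^esub> (Y \<star> hD i \<ominus>\<^bsub>H\<^esub> X \<star> hs i) \<star> hs i =
    (q \<ominus>\<^bsub>H\<^esub> Y \<ominus>\<^bsub>H\<^esub> r \<oplus>\<^bsub>H\<^esub> Y) \<oplus>\<^bsub>H\<^esub> (r \<ominus>\<^bsub>H\<^esub> X)"
    using a by (simp add: H.l_distr H.l_minus hd_hs_hd q_def r_def a_minus_def)
  also have "\<dots> = q \<ominus>\<^bsub>H\<^esub> X" using c a by algebra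
  finally show ?A by (simp add: q_def)
  have "(Y \<star> hs i \<star> hD i \<ominus>\<^bsub>H\<^esub> X \<star> hs i \<star> hs i) \<oplus>\<^bsub>H\<^esub> (Y \<star> hD i \<oplus>\<^bsub>H\<^esub> Y \<star> hs i) \<star> hs i =
    (q \<ominus>\<^bsub>H\<^esub> Y \<ominus>\<^bsub>H\<^esub> r \<ominus>\<^bsub>H\<^esub> X) \<oplus>\<^bsub>H\<^esub> (r \<oplus>\<^bsub>H\<^esub> Y)"
    using a by (simp add: H.l_distr H.l_minus hd_hs_hd q_def r_def a_minus_def)
  also have "\<dots> = q \<ominus>\<^bsub>H\<^esub> X" using c a by algebra
  finally show ?B by (simp add: q_def)
qed

abbreviation EF where "EF \<equiv> endo_op FM"
abbreviation sE where "sE i \<equiv> restrict (sF i) (carrier FM)"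
abbreviation dE where "dE i \<equiv> restrict (dF i) (carrier FM)"

lemma ring_EF: "ring EF" by (rule ring_endo_op[OF MR.abelian_group_RM])

lemma sE_closed: "i \<in> I \<Longrightarrow> sE i \<in> carrier EF"
  by (auto intro!: MR.RMg.restrict_hom sF_closed sF_add)

lemma dE_closed: "i \<in> I \<Longrightarrow> dE i \<in> carrier EF"
  by (auto intro!: MR.RMg.restrict_hom dF_closed dF_add)

lemma wprod_sE:
  assumes "u \<in> lists I" "f \<in> carrier FM"
  shows "wprod EF sE u f = (\<lambda>w. if w \<in> carrier W then f (w \<bullet> iv (cl u)) \<star> wprod H hs u else \<zero>\<^bsub>H\<^esub>)"
  using assms
proof (induction u arbitrary: f)
  case Nil
  then show ?case using MR.coeff[of f] MR.outside[of f] by (auto simp: fun_eq_iff simp flip: one_W)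
next
  case (Cons i u)
  then have iu: "i \<in> I" "u \<in> lists I" by auto
  then have "wprod EF sE (i # u) f = wprod EF sE u (sF i f)" using Cons.prems by simp
  also have "\<dots> = (\<lambda>w. if w \<in> carrier W then sF i f (w \<bullet> iv (cl u)) \<star> wprod H hs u else \<zero>\<^bsub>H\<^esub>)"
    using Cons iu by (intro Cons.IH sF_closed)
  also have "\<dots> = (\<lambda>w. if w \<in> carrier W then f (w \<bullet> iv (cl (i # u))) \<star> wprod H hs (i # u) else \<zero>\<^bsub>H\<^esub>)"
    using iu MR.coeff[OF \<open>f \<in> carrier FM\<close>] by (simp add: fun_eq_iff sF_def cl_Cons W.inv_mult_group W.m_assoc H.m_assoc)
  finally show ?case .
qed

text \<open>The relations in one index hold coefficient by coefficient. For the last relation the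
  alternating word sends the root of one generator to that of another without a sign change, so the
  case distinction in \<open>dF\<close> at \<open>w\<close> agrees with the one at the translate of
  \<open>w\<close> by the inverse of the word.\<close>

lemma act_ex: "\<exists>h. ring_homo H EF h \<and> h \<in> extensional (carrier H) \<and> (\<forall>i\<in>I. h (hs i) = sE i \<and> h (hD i) = dE i)"
proof (rule H_lift)
  interpret EF: ring EF by (rule ring_EF)
  show "ring EF" by (rule ring_EF)
  fix i assume i: "i \<in> I"
  show "sE i \<in> carrier EF" "dE i \<in> carrier EF" using i sE_closed dE_closed by blast+
  have eqI: "restrict a (carrier FM) = restrict b (carrier FM)"
    if "\<And>f w. \<lbrakk>f \<in> carrier FM; \<And>w. f w \<in> carrier H; w \<in> carrier W\<rbrakk> \<Longrightarrow> a f w = b f w"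
      "\<And>f w. \<lbrakk>f \<in> carrier FM; w \<notin> carrier W\<rbrakk> \<Longrightarrow> a f w = b f w" for a b :: "('i list set \<Rightarrow> 'i hhat) \<Rightarrow> _"
  proof (rule restrict_ext, rule ext)
    fix f w assume "f \<in> carrier FM"
    then show "a f w = b f w" using that MR.coeff by (cases "w \<in> carrier W") auto
  qed
  show "sE i \<otimes>\<^bsub>EF\<^esub> sE i = \<one>\<^bsub>EF\<^esub>"
    unfolding endo_op_simps
    by (intro eqI) (use i sF_closed MR.outside in \<open>auto simp: sF_def\<close>)
  have dd: "dF i (dF i f) w = dF i f w" if "f \<in> carrier FM" "\<And>w. f w \<in> carrier H" "w \<in> carrier W" for f w
    using that i dd_pos[of "f w" i] dd_neg[of "f w" "f (w \<bullet> s i)" i]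
    by (auto simp: dF_def sg_mult_s)
  have "restrict (\<lambda>f. dE i (dE i f)) (carrier FM) = dE i"
    by (intro eqI) (use i dF_closed dd in \<open>auto\<close>, auto simp: dF_def)
  then show "dE i \<otimes>\<^bsub>EF\<^esub> dE i = dE i" by simp
  have sd: "dF i (sF i f) w \<oplus>\<^bsub>H\<^esub> sF i (dF i f) w = sF i f w \<ominus>\<^bsub>H\<^esub> f w"
    if "f \<in> carrier FM" "\<And>w. f w \<in> carrier H" "w \<in> carrier W" for f w
  proof (cases "sg w (s i)")
    case True
    then show ?thesis using that i sd_ds(1)[of "f w" "f (w \<bullet> s i)" i] by (simp add: dF_def sF_def sg_mult_s)
  next
    case False
    then show ?thesis using that i sd_ds(2)[of "f w" "f (w \<bullet> s i)" i] by (simp add: dF_def sF_def sg_mult_s)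
  qed
  have minus: "sE i \<ominus>\<^bsub>EF\<^esub> \<one>\<^bsub>EF\<^esub> = restrict (\<lambda>f. sF i f \<ominus>\<^bsub>FM\<^esub> f) (carrier FM)"
  proof -
    have cl: "restrict (\<lambda>f. \<ominus>\<^bsub>FM\<^esub> f) (carrier FM) \<in> carrier EF"
      by (auto intro!: MR.RMg.restrict_hom simp: MR.RMg.minus_add MR.RMg.a_comm)
    have "\<ominus>\<^bsub>EF\<^esub> \<one>\<^bsub>EF\<^esub> = restrict (\<lambda>f. \<ominus>\<^bsub>FM\<^esub> f) (carrier FM)"
      by (rule EF.minus_equality[OF _ EF.one_closed cl])
        (auto intro!: restrict_ext simp: MR.RMg.l_neg)
    then show ?thesis unfolding a_minus_def endo_op_simps by (intro restrict_ext) auto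
  qed
  show "sE i \<otimes>\<^bsub>EF\<^esub> dE i \<oplus>\<^bsub>EF\<^esub> dE i \<otimes>\<^bsub>EF\<^esub> sE i = sE i \<ominus>\<^bsub>EF\<^esub> \<one>\<^bsub>EF\<^esub>"
    unfolding minus unfolding endo_op_simps
  proof (intro eqI)
    fix f w assume f: "f \<in> carrier FM" "\<And>w. f w \<in> carrier H" and w: "w \<in> carrier W"
    show "(restrict (\<lambda>x. dE i (sE i x)) (carrier FM) f \<oplus>\<^bsub>FM\<^esub> restrict (\<lambda>x. sE i (dE i x)) (carrier FM) f) w =
       (sF i f \<ominus>\<^bsub>FM\<^esub> f) w"
      using sd[OF f w] f i by (simp add: sF_closed dF_closed FM_add a_minus_def MR.uminus_eq)
  next
    fix f w assume f: "f \<in> carrier FM" and w: "w \<notin> carrier W"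
    show "(restrict (\<lambda>x. dE i (sE i x)) (carrier FM) f \<oplus>\<^bsub>FM\<^esub> restrict (\<lambda>x. sE i (dE i x)) (carrier FM) f) w =
       (sF i f \<ominus>\<^bsub>FM\<^esub> f) w"
      using f w i MR.outside[OF f w] by (simp add: sF_closed dF_closed FM_add a_minus_def MR.uminus_eq) (simp add: sF_def dF_def)
  qed
  fix j assume j: "j \<in> I"
  let ?u = "concat (replicate (m i j) [i, j])"
  show "wprod EF sE ?u = \<one>\<^bsub>EF\<^esub>"
  proof -
    have "wprod EF sE ?u \<in> carrier EF"
      using replicate_lists[OF i j] sE_closed by (intro EF.wprod_closed) (auto simp only: in_lists_conv_set)
    then have e: "wprod EF sE ?u \<in> extensional (carrier FM)" by simp
    have "wprod EF sE ?u f = f" if f: "f \<in> carrier FM" for f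
      unfolding wprod_sE[OF replicate_lists[OF i j] f] hs_relation[OF i j] cl_relation[OF i j]
      using MR.coeff[OF f] MR.outside[OF f] by (simp add: fun_eq_iff)
    then show ?thesis using e by (intro extensionalityI[of _ "carrier FM"]) auto
  qed
  assume ij: "i \<noteq> j" "m i j \<noteq> 0"
  let ?v = "alt j i (m i j - 1)" and ?k = "if even (m i j) then i else j"
  let ?V = "cl ?v" and ?h = "wprod H hs ?v"
  have v: "?v \<in> lists I" and k: "?k \<in> I" using i j by auto
  then have V: "?V \<in> carrier W" and h: "?h \<in> carrier H" by auto
  obtain n where n: "m i j = Suc n" using ij by (cases "m i j") auto
  have comm: "s i \<bullet> ?V = ?V \<bullet> s ?k"
  proof -
    have "s i \<bullet> ?V = cl (alt i j (m i j))" using i j by (simp add: n cl_Cons)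
    also have "\<dots> = cl (alt j i (m i j))" by (rule braid_W[OF i j])
    also have "alt j i (m i j) = ?v @ [?k]" unfolding n alt_snoc by simp
    also have "cl \<dots> = ?V \<bullet> s ?k" using v k by (rule cl_snoc)
    finally show ?thesis .
  qed
  have hcomm: "hs i \<star> ?h = ?h \<star> hs ?k"
    using arg_cong[OF comm, of wH] V i k v by (simp add: wH_mult wH_s wH_cl)
  \<comment> \<open>The word has m - 1 letters and is read from its last letter, so which of the two
    forms of \<open>alt_up\<close> is required depends on the parity of m.\<close>
  have nV: "\<not> sg ?V (s ?k)"
  proof (cases "even (m i j)")
    case True
    then have "?v = rev (alt j i n)" by (simp add: n rev_alt)
    moreover have "\<not> sg (cl (rev (alt j i n))) (s i)" using i j ij n m_sym[OF i j] by (intro alt_up) auto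
    ultimately show ?thesis using True by simp
  next
    case False
    then have "?v = rev (alt i j n)" by (simp add: n rev_alt)
    moreover have "\<not> sg (cl (rev (alt i j n))) (s j)" using i j ij n by (intro alt_up) auto
    ultimately show ?thesis using False by simp
  qed
  have sgx: "sg w (s ?k) = sg (w \<bullet> iv ?V) (s i)" if w: "w \<in> carrier W" for w
  proof -
    have "?V \<bullet> s ?k \<bullet> iv ?V = s i \<bullet> ?V \<bullet> iv ?V" unfolding comm ..
    also have "\<dots> = s i" using V i by (simp only: W.m_assoc W.r_inv W.inv_closed s_closed W.r_one)
    finally have "?V \<bullet> s ?k \<bullet> iv ?V = s i" .
    then have "sg (w \<bullet> iv ?V \<bullet> ?V) (s ?k) = sg (w \<bullet> iv ?V) (s i)" using w V k nV by (subst sg_mult) auto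
    then show ?thesis using w V by (simp add: W.m_assoc)
  qed
  have ivc: "w \<bullet> iv ?V \<bullet> s i = w \<bullet> s ?k \<bullet> iv ?V" if w: "w \<in> carrier W" for w
  proof -
    have "iv (s i \<bullet> ?V) = iv (?V \<bullet> s ?k)" unfolding comm ..
    then have "iv ?V \<bullet> s i = s ?k \<bullet> iv ?V" using V i k by (simp only: W.inv_mult_group s_closed iv_s)
    then show ?thesis using w V i k by (simp only: W.m_assoc W.inv_closed s_closed)
  qed
  have cv: "wprod EF sE ?v \<in> carrier EF"
    using v sE_closed by (intro EF.wprod_closed) (auto simp only: in_lists_conv_set)
  have pc: "wprod EF sE ?v f \<in> carrier FM" if "f \<in> carrier FM" for f
    using cv that abgroup_hom.closed by fastforce
  show "dE i \<otimes>\<^bsub>EF\<^esub> wprod EF sE ?v = wprod EF sE ?v \<otimes>\<^bsub>EF\<^esub> dE ?k"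
    unfolding endo_op_simps
  proof (intro eqI)
    fix f w assume f: "f \<in> carrier FM" "\<And>w. f w \<in> carrier H" and w: "w \<in> carrier W"
    have 1: "wprod EF sE ?v (dE i f) w = dF i f (w \<bullet> iv ?V) \<star> ?h"
      using wprod_sE[OF v dF_closed[OF f(1) i]] w f(1) by (simp only: if_True restrict_apply')
    have 2: "dE ?k (wprod EF sE ?v f) w = dF ?k (wprod EF sE ?v f) w"
      using pc[OF f(1)] by simp
    let ?x = "w \<bullet> iv ?V"
    have x: "?x \<in> carrier W" using w V by simp
    have fc: "f (?x \<bullet> s i) \<star> hs i \<star> ?h = f (w \<bullet> s ?k \<bullet> iv ?V) \<star> ?h \<star> hs ?k"
      unfolding ivc[OF w] using f(2) h i k hcomm by (simp only: H.m_assoc hs_closed)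
    have fs: "f ?x \<star> hs i \<star> ?h = f ?x \<star> ?h \<star> hs ?k"
      using f(2) h i k hcomm by (simp only: H.m_assoc hs_closed)
    have fd: "f ?x \<star> hD i \<star> ?h = f ?x \<star> ?h \<star> hD ?k"
      using f(2) h i k hd_braid[OF i j ij] by (simp only: H.m_assoc hd_closed)
    have wk: "w \<bullet> s ?k \<in> carrier W" using w k s_closed W.m_closed by metis
    show "wprod EF sE ?v (dE i f) w = dE ?k (wprod EF sE ?v f) w"
    proof (cases "sg ?x (s i)")
      case True
      have "dF i f ?x \<star> ?h = (f ?x \<star> hD i \<oplus>\<^bsub>H\<^esub> f ?x \<star> hs i) \<star> ?h"
        using x True unfolding dF_def by (simp only: if_True)
      also have "\<dots> = f ?x \<star> ?h \<star> hD ?k \<oplus>\<^bsub>H\<^esub> f ?x \<star> ?h \<star> hs ?k"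
        unfolding fs[symmetric] fd[symmetric] using f(2) h i by (intro H.l_distr) auto
      also have "\<dots> = dF ?k (wprod EF sE ?v f) w"
        using True w unfolding dF_def wprod_sE[OF v f(1)] sgx[OF w] by (simp only: if_True)
      finally show ?thesis unfolding 1 2 .
    next
      case False
      have "dF i f ?x \<star> ?h = (f ?x \<star> hD i \<ominus>\<^bsub>H\<^esub> f (?x \<bullet> s i) \<star> hs i) \<star> ?h"
        using x False unfolding dF_def by (simp only: if_True if_False)
      also have "\<dots> = f ?x \<star> hD i \<star> ?h \<ominus>\<^bsub>H\<^esub> f (?x \<bullet> s i) \<star> hs i \<star> ?h"
        using f(2) h i by (simp add: a_minus_def H.l_distr H.l_minus)
      also have "\<dots> = f ?x \<star> ?h \<star> hD ?k \<ominus>\<^bsub>H\<^esub> f (w \<bullet> s ?k \<bullet> iv ?V) \<star> ?h \<star> hs ?k"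
        unfolding fc fd ..
      also have "\<dots> = dF ?k (wprod EF sE ?v f) w"
        using False w wk unfolding dF_def wprod_sE[OF v f(1)] sgx[OF w] by (simp only: if_True if_False)
      finally show ?thesis unfolding 1 2 .
    qed
  next
    fix f w assume f: "f \<in> carrier FM" and w: "w \<notin> carrier W"
    show "wprod EF sE ?v (dE i f) w = dE ?k (wprod EF sE ?v f) w"
      using MR.outside[OF pc[OF dF_closed[OF f i]] w] MR.outside[OF dF_closed[OF pc[OF f] k] w] f pc[OF f] by simp
  qed
qed

section \<open>The right action and its effect on delta functions\<close>

definition act :: "('i list set \<Rightarrow> 'i hhat) \<Rightarrow> 'i hhat \<Rightarrow> 'i list set \<Rightarrow> 'i hhat" (infixl "\<triangleleft>" 72) where
  "f \<triangleleft> x = (SOME h. ring_homo H EF h \<and> h \<in> extensional (carrier H) \<and> (\<forall>i\<in>I. h (hs i) = sE i \<and> h (hD i) = dE i)) x f"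

lemma act_hom: "\<exists>h. ring_homo H EF h \<and> (\<forall>x f. f \<triangleleft> x = h x f) \<and> (\<forall>i\<in>I. h (hs i) = sE i \<and> h (hD i) = dE i)"
  using someI_ex[OF act_ex] unfolding act_def by blast

lemma
  assumes f: "f \<in> carrier FM" and x: "x \<in> carrier H"
  shows act_closed [simp]: "f \<triangleleft> x \<in> carrier FM"
    and act_add_left: "g \<in> carrier FM \<Longrightarrow> (f \<oplus>\<^bsub>FM\<^esub> g) \<triangleleft> x = f \<triangleleft> x \<oplus>\<^bsub>FM\<^esub> g \<triangleleft> x"
    and act_add: "y \<in> carrier H \<Longrightarrow> f \<triangleleft> (x \<oplus>\<^bsub>H\<^esub> y) = f \<triangleleft> x \<oplus>\<^bsub>FM\<^esub> f \<triangleleft> y"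
    and act_mult: "y \<in> carrier H \<Longrightarrow> f \<triangleleft> (x \<star> y) = f \<triangleleft> x \<triangleleft> y"
    and act_one: "f \<triangleleft> \<one>\<^bsub>H\<^esub> = f"
    and act_uminus: "f \<triangleleft> (\<ominus>\<^bsub>H\<^esub> x) = \<ominus>\<^bsub>FM\<^esub> (f \<triangleleft> x)"
    and act_s: "i \<in> I \<Longrightarrow> f \<triangleleft> hs i = sF i f"
    and act_d: "i \<in> I \<Longrightarrow> f \<triangleleft> hD i = dF i f"
proof -
  obtain h where h: "ring_homo H EF h" and ac: "\<And>x f. f \<triangleleft> x = h x f"
    and g: "\<And>i. i \<in> I \<Longrightarrow> h (hs i) = sE i \<and> h (hD i) = dE i" using act_hom by blast
  interpret h: ring_homo H EF h by fact
  have hom: "abgroup_hom FM FM (h x)" if "x \<in> carrier H" for x using h.closed[OF that] by simp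
  show c: "f \<triangleleft> x \<in> carrier FM" unfolding ac by (rule abgroup_hom.closed[OF hom[OF x] f])
  show "(f \<oplus>\<^bsub>FM\<^esub> g) \<triangleleft> x = f \<triangleleft> x \<oplus>\<^bsub>FM\<^esub> g \<triangleleft> x" if "g \<in> carrier FM"
    unfolding ac by (rule abgroup_hom.add[OF hom[OF x] f that])
  show ad: "f \<triangleleft> (x \<oplus>\<^bsub>H\<^esub> y) = f \<triangleleft> x \<oplus>\<^bsub>FM\<^esub> f \<triangleleft> y" if "y \<in> carrier H" for y
    unfolding ac using h.add[OF x that] f by simp
  show "f \<triangleleft> (x \<star> y) = f \<triangleleft> x \<triangleleft> y" if "y \<in> carrier H"
    unfolding ac using h.mult[OF x that] f by simp
  show "f \<triangleleft> \<one>\<^bsub>H\<^esub> = f" unfolding ac using h.one f by simp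
  show "i \<in> I \<Longrightarrow> f \<triangleleft> hs i = sF i f" "i \<in> I \<Longrightarrow> f \<triangleleft> hD i = dF i f"
    unfolding ac using g f by auto
  have "f \<triangleleft> \<zero>\<^bsub>H\<^esub> = \<zero>\<^bsub>FM\<^esub>" unfolding ac using h.zero f by simp
  moreover have "f \<triangleleft> (\<ominus>\<^bsub>H\<^esub> x) \<in> carrier FM" unfolding ac using x by (intro abgroup_hom.closed[OF hom f]) simp
  ultimately show "f \<triangleleft> (\<ominus>\<^bsub>H\<^esub> x) = \<ominus>\<^bsub>FM\<^esub> (f \<triangleleft> x)"
    using ad[of "\<ominus>\<^bsub>H\<^esub> x"] x c
    by (metis H.a_inv_closed H.r_neg MR.RMg.minus_equality MR.RMg.a_comm)
qed

lemma act_zero_left: "x \<in> carrier H \<Longrightarrow> \<zero>\<^bsub>FM\<^esub> \<triangleleft> x = \<zero>\<^bsub>FM\<^esub>"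
  using act_add_left[of "\<zero>\<^bsub>FM\<^esub>" x "\<zero>\<^bsub>FM\<^esub>"]
  by (metis MR.RMg.add.l_cancel_one' MR.RMg.l_zero MR.RMg.zero_closed act_closed)

definition lm :: "'i hhat \<Rightarrow> ('i list set \<Rightarrow> 'i hhat) \<Rightarrow> 'i list set \<Rightarrow> 'i hhat" where
  "lm r f = (\<lambda>w. r \<star> f w)"

lemma lm_closed [simp]: "\<lbrakk>r \<in> carrier H; f \<in> carrier FM\<rbrakk> \<Longrightarrow> lm r f \<in> carrier FM"
  using MR.coeff[of f] MR.supp[of f] MR.fin[of f]
  by (intro MR.memI[of _ "msupp H f"]) (auto simp: lm_def msupp_def)

text \<open>Every generator multiplies coefficients on the right, which commutes with multiplication
  on the left.\<close>

lemma lm_act: "\<lbrakk>r \<in> carrier H; f \<in> carrier FM; x \<in> carrier H\<rbrakk> \<Longrightarrow> lm r f \<triangleleft> x = lm r (f \<triangleleft> x)"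
proof -
  assume r: "r \<in> carrier H" and f: "f \<in> carrier FM" and x: "x \<in> carrier H"
  from x f show ?thesis
  proof (induction arbitrary: f rule: H_induct)
    case one
    then show ?case using r by (simp add: act_one[OF _ H.one_closed])
  next
    case (s i)
    have "lm r f \<triangleleft> hs i = sF i (lm r f)" "f \<triangleleft> hs i = sF i f"
      using s r by (auto simp: act_s[OF _ H.one_closed])
    then show ?case using r s MR.coeff[of f] by (simp add: fun_eq_iff lm_def sF_def H.m_assoc)
  next
    case (D i)
    have "lm r f \<triangleleft> hD i = dF i (lm r f)" "f \<triangleleft> hD i = dF i f"
      using D r by (auto simp: act_d[OF _ H.one_closed])
    then show ?case using r D MR.coeff[of f]
      by (simp add: fun_eq_iff lm_def dF_def H.m_assoc H.r_distr a_minus_def H.r_minus)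
  next
    case (add x y)
    then show ?case using r MR.coeff[OF act_closed[OF add.prems add.hyps(1)]] MR.coeff[OF act_closed[OF add.prems add.hyps(2)]]
      by (simp add: act_add) (simp add: lm_def FM_add H.r_distr)
  next
    case (uminus x)
    then show ?case using r MR.coeff[OF act_closed[OF uminus.prems uminus.hyps]]
      by (simp add: act_uminus) (simp add: MR.uminus_eq lm_closed act_closed, simp add: lm_def H.r_minus)
  next
    case (mult x y)
    then show ?case using r by (simp add: act_mult)
  qed
qed

abbreviation dl where "dl a r \<equiv> mterm H r a"

lemma lm_dl: "\<lbrakk>r \<in> carrier H\<rbrakk> \<Longrightarrow> lm r (dl a x) = dl a (r \<star> x)"
  by (simp add: lm_def mterm_def fun_eq_iff)

lemma dl_s: "\<lbrakk>a \<in> carrier W; r \<in> carrier H; i \<in> I\<rbrakk> \<Longrightarrow> dl a r \<triangleleft> hs i = dl (a \<bullet> s i) (r \<star> hs i)"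
proof -
  assume a: "a \<in> carrier W" "r \<in> carrier H" "i \<in> I"
  have "w \<bullet> s i = a \<longleftrightarrow> w = a \<bullet> s i" if "w \<in> carrier W" for w using that a by auto
  moreover have "dl a r \<triangleleft> hs i = sF i (dl a r)" using a by (simp add: act_s[OF _ H.one_closed])
  ultimately show ?thesis using a by (auto simp: fun_eq_iff sF_def mterm_def)
qed

text \<open>At an ascent D_i annihilates the group element, so only the summand D_i \<otimes> 1 of
  the coproduct contributes.\<close>

lemma dl_d: "\<lbrakk>a \<in> carrier W; r \<in> carrier H; i \<in> I; \<not> sg a (s i)\<rbrakk> \<Longrightarrow> dl a r \<triangleleft> hD i = dl a (r \<star> hD i)"
proof -
  assume a: "a \<in> carrier W" "r \<in> carrier H" "i \<in> I" "\<not> sg a (s i)"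
  have "w \<bullet> s i = a \<Longrightarrow> sg w (s i)" if "w \<in> carrier W" for w using that a sg_mult_s[of w i] by auto
  moreover have "dl a r \<triangleleft> hD i = dF i (dl a r)" using a by (simp add: act_d[OF _ H.one_closed])
  ultimately show ?thesis using a by (auto simp: fun_eq_iff dF_def mterm_def a_minus_def)
qed

lemma dl_w: "\<lbrakk>x \<in> carrier W; a \<in> carrier W; r \<in> carrier H\<rbrakk> \<Longrightarrow> dl a r \<triangleleft> wH x = dl (a \<bullet> x) (r \<star> wH x)"
proof (induction arbitrary: a r rule: W_s_induct)
  case one
  then show ?case by (simp add: act_one[OF _ H.one_closed])
next
  case (step i w)
  then show ?case by (simp add: wH_mult wH_s act_mult dl_s W.m_assoc H.m_assoc)
qed

text \<open>For t = x s_i x^-1 with positive root, acting by x leads to a x, for which s_i is still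
  an ascent. There D_i multiplies the coefficient, and x^-1 leads back to a.\<close>

lemma dl_D: "\<lbrakk>t \<in> RF; a \<in> carrier W; r \<in> carrier H; \<not> sg a t\<rbrakk> \<Longrightarrow> dl a r \<triangleleft> Dr t = dl a (r \<star> Dr t)"
proof (elim refl_pos)
  fix x i assume a: "a \<in> carrier W" "r \<in> carrier H" "\<not> sg a t" "x \<in> carrier W" "i \<in> I"
    "t = x \<bullet> s i \<bullet> iv x" "\<not> sg x (s i)"
  have D: "Dr t = wH x \<star> hD i \<star> wH (iv x)" unfolding a(6) using a by (simp add: D_refl_eq conjD_def)
  have "\<not> sg (a \<bullet> x) (s i)" using a by (simp add: sg_mult)
  then show ?thesis unfolding D using a by (simp add: act_mult dl_w dl_d H.m_assoc W.m_assoc)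
qed


subsection \<open>The ideals\<close>

lemma Dhat_gens: "Dr ` (RF \<inter> parabolic I m J) \<subseteq> carrier H"
  by auto

lemma Dhat_closed: "x \<in> Dhat I m J \<Longrightarrow> x \<in> carrier H"
  unfolding Dhat_def by (rule H.generate_ring_in_carrier[OF Dhat_gens])

lemma Dhat_subring: "subring (Dhat I m J) H"
  unfolding Dhat_def by (rule H.generate_ring_is_subring[OF Dhat_gens])

lemma Dhat_D: "\<lbrakk>t \<in> RF; t \<in> parabolic I m J\<rbrakk> \<Longrightarrow> Dr t \<in> Dhat I m J"
  unfolding Dhat_def by (auto intro: generate_ring.incl)

lemma Dhat_rules:
  "\<one>\<^bsub>H\<^esub> \<in> Dhat I m J" "x \<in> Dhat I m J \<Longrightarrow> \<ominus>\<^bsub>H\<^esub> x \<in> Dhat I m J"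
  "\<lbrakk>x \<in> Dhat I m J; y \<in> Dhat I m J\<rbrakk> \<Longrightarrow> x \<oplus>\<^bsub>H\<^esub> y \<in> Dhat I m J"
  "\<lbrakk>x \<in> Dhat I m J; y \<in> Dhat I m J\<rbrakk> \<Longrightarrow> x \<star> y \<in> Dhat I m J"
  unfolding Dhat_def by (auto intro: generate_ring.intros)

lemma Dhat_induct [consumes 1, case_names one D uminus add mult]:
  assumes "x \<in> Dhat I m J" "P \<one>\<^bsub>H\<^esub>" "\<And>t. \<lbrakk>t \<in> RF; t \<in> parabolic I m J\<rbrakk> \<Longrightarrow> P (Dr t)"
    "\<And>x. \<lbrakk>x \<in> Dhat I m J; x \<in> carrier H; P x\<rbrakk> \<Longrightarrow> P (\<ominus>\<^bsub>H\<^esub> x)"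
    "\<And>x y. \<lbrakk>x \<in> Dhat I m J; y \<in> Dhat I m J; x \<in> carrier H; y \<in> carrier H; P x; P y\<rbrakk> \<Longrightarrow> P (x \<oplus>\<^bsub>H\<^esub> y)"
    "\<And>x y. \<lbrakk>x \<in> Dhat I m J; y \<in> Dhat I m J; x \<in> carrier H; y \<in> carrier H; P x; P y\<rbrakk> \<Longrightarrow> P (x \<star> y)"
  shows "P x"
  using assms(1) unfolding Dhat_def
proof (induction rule: generate_ring.induct)
  case (a_inv h)
  then show ?case using assms(4)[of h] Dhat_closed[of h J] by (simp add: Dhat_def)
next
  case (eng_add x y)
  then show ?case using assms(5)[of x y] Dhat_closed[of x J] Dhat_closed[of y J] by (simp add: Dhat_def)
next
  case (eng_mult x y)
  then show ?case using assms(6)[of x y] Dhat_closed[of x J] Dhat_closed[of y J] by (simp add: Dhat_def)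
qed (use assms in auto)

lemma dl_add: "\<lbrakk>r \<in> carrier H; r' \<in> carrier H\<rbrakk> \<Longrightarrow> dl a r \<oplus>\<^bsub>FM\<^esub> dl a r' = dl a (r \<oplus>\<^bsub>H\<^esub> r')"
  by (rule MR.mterm_add)

lemma dl_uminus: "\<lbrakk>a \<in> carrier W; r \<in> carrier H\<rbrakk> \<Longrightarrow> \<ominus>\<^bsub>FM\<^esub> dl a r = dl a (\<ominus>\<^bsub>H\<^esub> r)"
proof -
  assume a: "a \<in> carrier W" "r \<in> carrier H"
  then have "\<ominus>\<^bsub>FM\<^esub> dl a r = (\<lambda>x. \<ominus>\<^bsub>H\<^esub> dl a r x)" by (intro MR.uminus_eq) simp
  then show ?thesis by (simp add: mterm_def fun_eq_iff)
qed

lemma dl_Dhat: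
  assumes "x \<in> Dhat I m J" "a \<in> carrier W" "\<And>t. t \<in> parabolic I m J \<inter> RF \<Longrightarrow> \<not> sg a t" "r \<in> carrier H"
  shows "dl a r \<triangleleft> x = dl a (r \<star> x)"
  using assms(1,4)
proof (induction arbitrary: r rule: Dhat_induct)
  case one
  then show ?case using assms(2) by (simp add: act_one[OF _ H.one_closed])
next
  case (D t)
  then show ?case using assms(2,3) by (intro dl_D) auto
next
  case (uminus x)
  then show ?case using assms(2) by (simp add: act_uminus dl_uminus H.r_minus)
next
  case (add x y)
  then show ?case using assms(2) by (simp add: act_add dl_add H.r_distr)
next
  case (mult x y)
  then show ?case using assms(2) by (simp add: act_mult H.m_assoc)
qed

lemma dl_one_Dhat: "\<lbrakk>x \<in> Dhat I m J; J \<subseteq> I; r \<in> carrier H\<rbrakk> \<Longrightarrow> dl e0 r \<triangleleft> x = dl e0 (r \<star> x)"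
  by (rule dl_Dhat) auto

text \<open>A shortest coset representative makes no root of the parabolic subgroup negative, so
  conjugation turns every \<open>Dr t\<close> into another \<open>Dr\<close> without correction
  terms.\<close>

lemma conj_Dhat:
  assumes "x \<in> Dhat I m J" "J \<subseteq> I" "y \<in> carrier W" "\<And>t. t \<in> parabolic I m J \<inter> RF \<Longrightarrow> \<not> sg y t"
  shows "wH y \<star> x \<star> wH (iv y) \<in> Dhat I m I"
  using assms(1)
proof (induction rule: Dhat_induct)
  case one
  then show ?case using assms by (simp add: Dhat_rules)
next
  case (D t)
  then have "wH y \<star> Dr t \<star> wH (iv y) = Dr (y \<bullet> t \<bullet> iv y)" using assms by (intro Dr_conj_pos) auto
  then show ?case using D assms by (auto intro!: Dhat_D refl_conj simp: parabolic_I)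
next
  case (uminus x)
  have "wH y \<star> (\<ominus>\<^bsub>H\<^esub> x) \<star> wH (iv y) = \<ominus>\<^bsub>H\<^esub> (wH y \<star> x \<star> wH (iv y))"
    using uminus assms by (simp add: H.r_minus H.l_minus)
  then show ?case using uminus by (simp add: Dhat_rules)
next
  case (add u v)
  have "wH y \<star> (u \<oplus>\<^bsub>H\<^esub> v) \<star> wH (iv y) = (wH y \<star> u \<star> wH (iv y)) \<oplus>\<^bsub>H\<^esub> (wH y \<star> v \<star> wH (iv y))"
    using add assms by (simp add: H.r_distr H.l_distr)
  then show ?case using add by (simp add: Dhat_rules)
next
  case (mult u v)
  have "wH y \<star> (u \<star> v) \<star> wH (iv y) = (wH y \<star> u \<star> wH (iv y)) \<star> (wH y \<star> v \<star> wH (iv y))"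
    using mult assms by (simp add: H.m_assoc)
  then show ?case using mult by (simp add: Dhat_rules)
qed

text \<open>The definition intersects images of \<open>Dhat\<close>; solving for \<open>x\<close>
  and passing to inverses gives a condition on all conjugates of \<open>x\<close> itself.\<close>

lemma Kalg_iff:
  assumes J: "J \<subseteq> I"
  shows "x \<in> Kalg I m J \<longleftrightarrow> x \<in> carrier H \<and> (\<forall>w\<in>parabolic I m J. wH w \<star> x \<star> wH (iv w) \<in> Dhat I m J)"
proof -
  interpret P: subgroup "parabolic I m J" W by (rule parabolic_subgroup[OF J])
  note pc = P.mem_carrier
  have *: "x \<in> (\<lambda>x. wH w \<star> x \<star> wH (iv w)) ` Dhat I m J \<longleftrightarrow> x \<in> carrier H \<and> wH (iv w) \<star> x \<star> wH w \<in> Dhat I m J"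
    if w: "w \<in> parabolic I m J" for w
  proof
    assume "x \<in> (\<lambda>x. wH w \<star> x \<star> wH (iv w)) ` Dhat I m J"
    then obtain d where d: "d \<in> Dhat I m J" "x = wH w \<star> d \<star> wH (iv w)" by blast
    then show "x \<in> carrier H \<and> wH (iv w) \<star> x \<star> wH w \<in> Dhat I m J"
      using pc[OF w] Dhat_closed[OF d(1)] by (simp add: H.m_assoc)
  next
    assume a: "x \<in> carrier H \<and> wH (iv w) \<star> x \<star> wH w \<in> Dhat I m J"
    then have "x = wH w \<star> (wH (iv w) \<star> x \<star> wH w) \<star> wH (iv w)" using pc[OF w] by (simp add: H.m_assoc)
    then show "x \<in> (\<lambda>x. wH w \<star> x \<star> wH (iv w)) ` Dhat I m J" using a by blast
  qed
  have "x \<in> Kalg I m J \<longleftrightarrow> (\<forall>w\<in>parabolic I m J. x \<in> carrier H \<and> wH (iv w) \<star> x \<star> wH w \<in> Dhat I m J)"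
    unfolding Kalg_def using * by auto
  also have "\<dots> \<longleftrightarrow> x \<in> carrier H \<and> (\<forall>w\<in>parabolic I m J. wH w \<star> x \<star> wH (iv w) \<in> Dhat I m J)"
    using P.one_closed P.m_inv_closed pc W.inv_inv by metis
  finally show ?thesis .
qed

text \<open>In w = y v with \<open>y\<close> shortest in its coset, conjugation by \<open>v\<close>
  stays in the algebra of the parabolic subgroup by assumption, and conjugation by \<open>y\<close>
  then stays in the full one by \<open>conj_Dhat\<close>.\<close>

lemma Kalg_mono:
  assumes J: "J \<subseteq> I"
  shows "Kalg I m J \<subseteq> Kalg I m I"
proof
  fix x assume x: "x \<in> Kalg I m J"
  then have xc: "x \<in> carrier H" using Kalg_iff[OF J] by blast
  have "wH w \<star> x \<star> wH (iv w) \<in> Dhat I m I" if w: "w \<in> carrier W" for w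
  proof -
    obtain y v where y: "y \<in> carrier W" and v: "v \<in> parabolic I m J" and wyv: "w = y \<bullet> v"
      and min: "\<And>t. t \<in> parabolic I m J \<inter> RF \<Longrightarrow> \<not> sg y t"
      using min_coset_rep[OF J w] by metis
    have vc: "v \<in> carrier W" using v parabolic_closed[OF J] by blast
    have "wH w \<star> x \<star> wH (iv w) = wH y \<star> (wH v \<star> x \<star> wH (iv v)) \<star> wH (iv y)"
      unfolding wyv using y vc xc by (simp add: wH_mult W.inv_mult_group H.m_assoc)
    then show ?thesis using conj_Dhat[OF _ J y min] x v Kalg_iff[OF J] by simp
  qed
  then show "x \<in> Kalg I m I" using xc by (simp add: Kalg_iff parabolic_I)
qed

lemma Ker_closed: "Ker_counit I m \<subseteq> carrier H" by (auto simp: Ker_counit_def)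

lemma J_full_ideal: "ideal (J_full I m) H"
  unfolding J_full_def by (rule H.genideal_ideal) (use Ker_closed in blast)

lemma K_pairs_closed: "(\<Union>(i, j)\<in>{(i, j). i \<in> I \<and> j \<in> I \<and> i \<noteq> j}. K_pair I m i j) \<subseteq> carrier H"
  unfolding K_pair_def using Ker_closed by blast

lemma J_pairs_ideal: "ideal (J_pairs I m) H"
  unfolding J_pairs_def by (rule H.genideal_ideal[OF K_pairs_closed])

lemma J_pairs_subset: "J_pairs I m \<subseteq> J_full I m"
proof -
  have "K_pair I m i j \<subseteq> J_full I m" if "i \<in> I" "j \<in> I" for i j
  proof -
    have "K_pair I m i j \<subseteq> Kalg I m I \<inter> Ker_counit I m"
      using that Kalg_mono[of "{i, j}"] by (auto simp: K_pair_def)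
    also have "\<dots> \<subseteq> J_full I m"
      unfolding J_full_def by (rule H.genideal_self) (use Ker_closed in blast)
    finally show ?thesis .
  qed
  then show ?thesis unfolding J_pairs_def by (intro H.genideal_minimal J_full_ideal) blast
qed

text \<open>Generators change coefficients by right multiplication, translation and sums with signs,
  and \<open>eps\<close> is multiplicative.\<close>

lemma eps_act:
  assumes "x \<in> carrier H" "f \<in> carrier FM" "\<And>w. eps (f w) = 0"
  shows "eps ((f \<triangleleft> x) w) = 0"
  using assms
proof (induction arbitrary: f w rule: H_induct)
  case one
  then show ?case by (simp add: act_one[OF _ H.one_closed])
next
  case (s i)
  then show ?case using MR.coeff[of f] by (simp add: act_s[OF _ H.one_closed] sF_def)
next
  case (D i)
  then show ?case using MR.coeff[of f] by (simp add: act_d[OF _ H.one_closed] dF_def a_minus_def)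
next
  case (add x y)
  then show ?case using MR.coeff[OF act_closed[of f x]] MR.coeff[OF act_closed[of f y]]
    by (simp add: act_add FM_add)
next
  case (uminus x)
  then show ?case using MR.coeff[OF act_closed[of f x]] by (simp add: act_uminus MR.uminus_eq)
next
  case (mult x y)
  then show ?case by (simp add: act_mult)
qed

text \<open>Elements of \<open>Dhat\<close> act at the identity by multiplying the coefficient. To
  use this at \<open>a\<close>, write a k = (a k a^-1) a: the conjugate lies in \<open>Dhat\<close>,
  acts at the identity, and \<open>a\<close> translates back. So \<open>k\<close> acts alike at all
  group elements.\<close>

lemma dl_Kalg: "\<lbrakk>k \<in> Kalg I m I; a \<in> carrier W; r \<in> carrier H\<rbrakk> \<Longrightarrow> dl a r \<triangleleft> k = dl a (r \<star> k)"
proof -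
  assume k: "k \<in> Kalg I m I" and a: "a \<in> carrier W" and r: "r \<in> carrier H"
  let ?d = "wH a \<star> k \<star> wH (iv a)" and ?r = "r \<star> wH (iv a)"
  have kc: "k \<in> carrier H" and d: "?d \<in> Dhat I m I" using k a by (auto simp: Kalg_iff parabolic_I)
  have rc: "?r \<in> carrier H" using r a by simp
  have "dl a r = dl e0 ?r \<triangleleft> wH a" using a r by (simp add: dl_w H.m_assoc)
  then have "dl a r \<triangleleft> k = dl e0 ?r \<triangleleft> (wH a \<star> k)" using a r kc by (simp add: act_mult)
  also have "wH a \<star> k = ?d \<star> wH a" using a kc by (simp add: H.m_assoc)
  also have "dl e0 ?r \<triangleleft> (?d \<star> wH a) = dl e0 ?r \<triangleleft> ?d \<triangleleft> wH a"
    using a kc rc by (intro act_mult) auto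
  also have "\<dots> = dl e0 (?r \<star> ?d) \<triangleleft> wH a" using dl_one_Dhat[OF d _ rc] by simp
  also have "\<dots> = dl a (r \<star> k)" using a r kc by (simp add: dl_w H.m_assoc)
  finally show ?thesis .
qed

text \<open>By \<open>dl_Kalg\<close> a generator of the ideal multiplies coefficients by an element
  of counit 0. The elements with the asserted property form a two-sided ideal: a left factor only
  changes the function acted on, and a right factor is harmless by \<open>eps_act\<close>.\<close>

lemma J_full_act:
  assumes "x \<in> J_full I m" "f \<in> carrier FM"
  shows "eps ((f \<triangleleft> x) w) = 0"
proof -
  let ?A = "{x \<in> carrier H. \<forall>f\<in>carrier FM. \<forall>w. eps ((f \<triangleleft> x) w) = 0}"
  have "ideal ?A H"
  proof (rule idealI[OF H.ring_axioms])
    show "subgroup ?A (add_monoid H)"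
    proof (rule H.add.subgroupI)
      have z: "f \<triangleleft> \<zero>\<^bsub>H\<^esub> = \<zero>\<^bsub>FM\<^esub>" if "f \<in> carrier FM" for f
        using act_add[OF that H.one_closed, of "\<ominus>\<^bsub>H\<^esub> \<one>\<^bsub>H\<^esub>"] that
        by (simp add: act_uminus H.r_neg MR.RMg.r_neg)
      show "?A \<noteq> {}" using z by (auto simp: MR.zero_eq intro!: exI[of _ "\<zero>\<^bsub>H\<^esub>"])
      fix x assume "x \<in> ?A"
      then show "\<ominus>\<^bsub>H\<^esub> x \<in> ?A" using MR.coeff[OF act_closed[of _ x]] by (auto simp: act_uminus MR.uminus_eq)
      fix y assume "y \<in> ?A"
      then show "x \<oplus>\<^bsub>H\<^esub> y \<in> ?A" using \<open>x \<in> ?A\<close> MR.coeff[OF act_closed[of _ x]] MR.coeff[OF act_closed[of _ y]]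
        by (auto simp: act_add FM_add)
    qed auto
    fix a x assume "a \<in> ?A" "x \<in> carrier H"
    then show "x \<star> a \<in> ?A" "a \<star> x \<in> ?A" by (auto simp: act_mult intro: eps_act)
  qed
  moreover have "Kalg I m I \<inter> Ker_counit I m \<subseteq> ?A"
  proof
    fix k assume k: "k \<in> Kalg I m I \<inter> Ker_counit I m"
    then have kc: "k \<in> carrier H" "eps k = 0" by (auto simp: Ker_counit_def)
    have "\<forall>w. eps ((f \<triangleleft> k) w) = 0" if "f \<in> carrier FM" for f
      using that
    proof (induction rule: MR.RM_induct)
      case zero
      have "\<zero>\<^bsub>FM\<^esub> \<triangleleft> k = \<zero>\<^bsub>FM\<^esub>" using kc by (intro act_zero_left)
      then show ?case by (simp only:) (simp add: MR.zero_eq)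
    next
      case (mterm r a)
      then have "dl a r \<triangleleft> k = dl a (r \<star> k)" using k by (intro dl_Kalg) auto
      then show ?case using kc mterm by (simp only:) (simp add: mterm_def)
    next
      case (add f g)
      then have "(f \<oplus>\<^bsub>FM\<^esub> g) \<triangleleft> k = f \<triangleleft> k \<oplus>\<^bsub>FM\<^esub> g \<triangleleft> k" using kc by (intro act_add_left)
      then show ?case using add kc MR.coeff[OF act_closed[of f k]] MR.coeff[OF act_closed[of g k]]
        by (simp only:) (simp add: FM_add)
    qed
    then show "k \<in> ?A" using kc by simp
  qed
  ultimately have "J_full I m \<subseteq> ?A" unfolding J_full_def by (rule H.genideal_minimal)
  then show ?thesis using assms by blast
qed

section \<open>The action on the group ring seen through the counit\<close>

definition ef :: "'i hhat \<Rightarrow> 'i list set \<Rightarrow> int" where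
  "ef x = (\<lambda>w. eps ((dl e0 \<one>\<^bsub>H\<^esub> \<triangleleft> x) w))"

lemma row_closed: "x \<in> carrier H \<Longrightarrow> dl e0 \<one>\<^bsub>H\<^esub> \<triangleleft> x \<in> carrier FM"
  by simp

lemma row_coeff [simp]: "x \<in> carrier H \<Longrightarrow> (dl e0 \<one>\<^bsub>H\<^esub> \<triangleleft> x) w \<in> carrier H"
  by (rule MR.coeff[OF row_closed])

lemma ef_outside: "\<lbrakk>x \<in> carrier H; w \<notin> carrier W\<rbrakk> \<Longrightarrow> ef x w = 0"
  using MR.outside[OF row_closed] by (simp add: ef_def)

lemma ef_add: "\<lbrakk>x \<in> carrier H; y \<in> carrier H\<rbrakk> \<Longrightarrow> ef (x \<oplus>\<^bsub>H\<^esub> y) w = ef x w + ef y w"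
  by (simp add: ef_def act_add FM_add)

lemma ef_w: "v \<in> carrier W \<Longrightarrow> ef (wH v) = mterm \<Z> 1 v"
  by (simp add: ef_def dl_w) (simp add: mterm_def fun_eq_iff)

lemma ef_s: "\<lbrakk>x \<in> carrier H; i \<in> I; w \<in> carrier W\<rbrakk> \<Longrightarrow> ef (x \<star> hs i) w = ef x (w \<bullet> s i)"
  by (simp add: ef_def act_mult act_s[OF _ H.one_closed] sF_def)

text \<open>The counit of the coefficients removes the summand D_i \<otimes> 1 and turns s_i
  \<otimes> D_i into the bare action of D_i. So \<open>ef x\<close> is the image of the identity
  under the action of \<open>x\<close> on the group ring.\<close>

lemma ef_d: "\<lbrakk>x \<in> carrier H; i \<in> I; w \<in> carrier W\<rbrakk> \<Longrightarrow>
    ef (x \<star> hD i) w = (if sg w (s i) then ef x w else - ef x (w \<bullet> s i))"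
  by (simp add: ef_def act_mult act_d[OF _ H.one_closed] dF_def a_minus_def)

lemma ef_J: "x \<in> J_full I m \<Longrightarrow> ef x w = 0"
  unfolding ef_def by (rule J_full_act) auto

lemma ef_closed: "x \<in> carrier H \<Longrightarrow> ef x \<in> carrier (monoid_ring \<Z> W)"
proof -
  assume x: "x \<in> carrier H"
  interpret Z: mring \<Z> W by (intro mring.intro ring_int W.monoid_axioms)
  let ?f = "dl e0 \<one>\<^bsub>H\<^esub> \<triangleleft> x"
  show ?thesis
    using MR.fin[OF row_closed[OF x]] MR.supp[OF row_closed[OF x]]
    by (intro Z.memI[of _ "msupp H ?f"]) (auto simp: ef_def msupp_def)
qed

end

section \<open>The braid relation modulo $\mathbf{K}_{ij}$\<close>

lemma (in abelian_group) span_induct [consumes 2, case_names zero elem uminus add]: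
  assumes "x \<in> generate (add_monoid G) S" "S \<subseteq> carrier G" "P \<zero>" "\<And>e. e \<in> S \<Longrightarrow> P e"
    and "\<And>x. \<lbrakk>x \<in> carrier G; P x\<rbrakk> \<Longrightarrow> P (\<ominus> x)"
    and "\<And>x y. \<lbrakk>x \<in> generate (add_monoid G) S; y \<in> generate (add_monoid G) S; x \<in> carrier G; y \<in> carrier G; P x; P y\<rbrakk> \<Longrightarrow> P (x \<oplus> y)"
  shows "P x"
proof -
  have "P x \<and> x \<in> carrier G" using assms(1)
  proof (induction rule: generate.induct)
    case (inv h)
    moreover have "inv\<^bsub>add_monoid G\<^esub> h = \<ominus> h" by (simp add: a_inv_def)
    ultimately show ?case using assms(2,4,5) by auto
  next
    case (eng x y)
    then show ?case using assms(6)[of x y] by simp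
  qed (use assms in auto)
  then show ?thesis ..
qed

lemma (in abelian_group) span_rules:
  assumes "S \<subseteq> carrier G"
  shows span_closed: "x \<in> generate (add_monoid G) S \<Longrightarrow> x \<in> carrier G"
    and span_zero: "\<zero> \<in> generate (add_monoid G) S"
    and span_elem: "e \<in> S \<Longrightarrow> e \<in> generate (add_monoid G) S"
    and span_uminus: "x \<in> generate (add_monoid G) S \<Longrightarrow> \<ominus> x \<in> generate (add_monoid G) S"
    and span_add: "\<lbrakk>x \<in> generate (add_monoid G) S; y \<in> generate (add_monoid G) S\<rbrakk> \<Longrightarrow> x \<oplus> y \<in> generate (add_monoid G) S"
proof -
  show "x \<in> generate (add_monoid G) S \<Longrightarrow> x \<in> carrier G"
    using add.generate_in_carrier[of S x] assms by simp
  show "\<zero> \<in> generate (add_monoid G) S" using generate.one[of "add_monoid G" S] by simp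
  show "e \<in> S \<Longrightarrow> e \<in> generate (add_monoid G) S" by (rule generate.incl)
  show "x \<in> generate (add_monoid G) S \<Longrightarrow> \<ominus> x \<in> generate (add_monoid G) S"
    using add.generate_m_inv_closed[of S x] assms by simp
  show "\<lbrakk>x \<in> generate (add_monoid G) S; y \<in> generate (add_monoid G) S\<rbrakk> \<Longrightarrow> x \<oplus> y \<in> generate (add_monoid G) S"
    using generate.eng[of x "add_monoid G" S y] by simp
qed

text \<open>\<open>al\<close> gives the exponents of the formal parameter attached to the two
  generators. They are positive, so that every correction term has higher degree. They agree for odd
  M because then the two generators are conjugate, and the commutation of left with right operators
  compares their weights.\<close>

locale dihedral_pair = coxeter I m for I :: "'i set" and m +
  fixes i1 i2 :: 'i and al :: "'i \<Rightarrow> nat"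
  assumes i12: "i1 \<in> I" "i2 \<in> I" "i1 \<noteq> i2" and mne: "m i1 i2 \<noteq> 0"
    and al_pos: "al i1 > 0" "al i2 > 0" and al_odd: "odd (m i1 i2) \<Longrightarrow> al i1 = al i2"
begin

abbreviation J2 where "J2 \<equiv> {i1, i2}"
abbreviation P where "P \<equiv> parabolic I m J2"
abbreviation M where "M \<equiv> m i1 i2"
abbreviation Dh where "Dh \<equiv> Dhat I m J2"

lemma J2I: "J2 \<subseteq> I" using i12 by simp

sublocale P: subgroup P W by (rule parabolic_subgroup[OF J2I])

lemma J2_I [simp]: "k \<in> J2 \<Longrightarrow> k \<in> I" using J2I by blast

lemma s_P [simp]: "k \<in> J2 \<Longrightarrow> s k \<in> P"
  unfolding parabolic_def by (rule generate.incl) blast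

lemma cl_P: "u \<in> lists J2 \<Longrightarrow> cl u \<in> P"
  by (simp add: parabolic_eq[OF J2I])

lemma J2_lists: "u \<in> lists J2 \<Longrightarrow> u \<in> lists I"
  using lists_subset[OF _ J2I] .

lemma al_pos': "k \<in> J2 \<Longrightarrow> al k > 0" using al_pos by auto

lemma m_J2: "\<lbrakk>x \<in> J2; y \<in> J2; x \<noteq> y\<rbrakk> \<Longrightarrow> m x y = M"
  using m_sym[OF i12(1,2)] by auto

lemma odd_power: "\<lbrakk>k \<in> J2; l \<in> J2; k \<noteq> l; (s k \<bullet> s l) [^]\<^bsub>W\<^esub> Suc (2 * h) = e0\<rbrakk> \<Longrightarrow> odd M"
  using s_s_pow_iff[of k l "Suc (2 * h)"] m_J2[of k l] by (metis J2_I dvd_trans even_Suc even_mult_iff even_numeral)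

text \<open>Alternating words give \<open>w\<close> one of four forms. In each of them the equation
  makes an odd power of s_k s_l or of its inverse trivial, and the order of this product is
  M.\<close>

lemma conj_odd:
  assumes kl: "k \<in> J2" "l \<in> J2" "k \<noteq> l" and w: "w \<in> P" and e: "s k \<bullet> w = w \<bullet> s l"
  shows "odd M"
proof -
  have I: "k \<in> I" "l \<in> I" using kl by auto
  let ?p = "s k \<bullet> s l" and ?q = "s l \<bullet> s k"
  have p: "?p \<in> carrier W" and q: "?q \<in> carrier W" using I by auto
  have J: "J2 = {k, l}" using kl by auto
  obtain a b n where ab: "{a, b} = J2" "w = cl (rev (alt a b n))"
    using parabolic_alt[OF i12 w] by auto
  have ab': "(a = k \<and> b = l) \<or> (a = l \<and> b = k)" using ab(1) unfolding J by (auto simp: doubleton_eq_iff)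
  have even: "cl (rev (alt x y (2 * h))) = (s y \<bullet> s x) [^]\<^bsub>W\<^esub> h" if "x \<in> I" "y \<in> I" for x y h
  proof -
    have "rev (alt x y (2 * h)) = alt y x (2 * h)" by (simp only: rev_alt) simp
    then show ?thesis using that by (simp add: alt_double cl_replicate)
  qed
  have odd: "cl (rev (alt x y (Suc (2 * h)))) = s x \<bullet> (s y \<bullet> s x) [^]\<^bsub>W\<^esub> h" if "x \<in> I" "y \<in> I" for x y h
  proof -
    have "rev (alt x y (Suc (2 * h))) = x # alt y x (2 * h)" by (simp only: rev_alt) simp
    then show ?thesis using that cl_replicate[of y x h] replicate_lists[of y x h] by (simp add: alt_double cl_Cons)
  qed
  obtain h where h: "n = 2 * h \<or> n = Suc (2 * h)" by (metis evenE oddE Suc_eq_plus1)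
  have dl: "?q [^]\<^bsub>W\<^esub> h \<bullet> s k \<bullet> ?q [^]\<^bsub>W\<^esub> h = s k" and dk: "?p [^]\<^bsub>W\<^esub> h \<bullet> s l \<bullet> ?p [^]\<^bsub>W\<^esub> h = s l"
    using dihedral_pow I by auto
  have pc: "?p [^]\<^bsub>W\<^esub> h \<in> carrier W" and qc: "?q [^]\<^bsub>W\<^esub> h \<in> carrier W" using p q by auto
  have pp: "x [^]\<^bsub>W\<^esub> h \<bullet> x [^]\<^bsub>W\<^esub> h \<bullet> x = x [^]\<^bsub>W\<^esub> Suc (2 * h)" if "x \<in> carrier W" for x
    using that W.nat_pow_mult[of x h h] by (simp add: mult_2)
  consider (1) "w = ?p [^]\<^bsub>W\<^esub> h" | (2) "w = ?q [^]\<^bsub>W\<^esub> h" | (3) "w = s l \<bullet> ?p [^]\<^bsub>W\<^esub> h" | (4) "w = s k \<bullet> ?q [^]\<^bsub>W\<^esub> h"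
    using ab' h even[of a b h] odd[of a b h] I ab(2) by metis
  then show ?thesis
  proof cases
    case 1
    have "s k \<bullet> (?p [^]\<^bsub>W\<^esub> h \<bullet> ?p [^]\<^bsub>W\<^esub> h) = s k \<bullet> w \<bullet> ?p [^]\<^bsub>W\<^esub> h" unfolding 1 using pc I by (simp add: W.m_assoc)
    also have "\<dots> = s l" unfolding e unfolding 1 by (rule dk)
    finally have "s k \<bullet> (s k \<bullet> (?p [^]\<^bsub>W\<^esub> h \<bullet> ?p [^]\<^bsub>W\<^esub> h)) = ?p" by simp
    then have pp2: "?p [^]\<^bsub>W\<^esub> (2 * h) = ?p" using pc I W.nat_pow_mult[OF p, of h h] by (simp add: mult_2)
    \<comment> \<open>Here p^(2h) = p for p = s_k s_l. As h may be 0, the exponent 2h - 1 is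
      replaced by 2h + (M - 1), which has the same effect and the parity that is needed.\<close>
    obtain M' where M': "M = Suc M'" using mne by (cases M) auto
    have pM: "?p [^]\<^bsub>W\<^esub> M = e0" using s_s_pow_iff[OF I kl(3), of M] m_J2[OF kl] by simp
    have "?p [^]\<^bsub>W\<^esub> (2 * h + M') = ?p [^]\<^bsub>W\<^esub> (2 * h) \<bullet> ?p [^]\<^bsub>W\<^esub> M'" using W.nat_pow_mult[OF p] by simp
    also have "\<dots> = ?p [^]\<^bsub>W\<^esub> M" unfolding pp2 M' using W.nat_pow_Suc2[OF p] by simp
    finally have "M dvd 2 * h + M'" using pM s_s_pow_iff[OF I kl(3)] m_J2[OF kl] by simp
    then show ?thesis using M' by (metis dvd_trans even_Suc even_add even_mult_iff even_numeral)
  next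
    case 2
    have "?q [^]\<^bsub>W\<^esub> h \<bullet> ?q [^]\<^bsub>W\<^esub> h \<bullet> s l = ?q [^]\<^bsub>W\<^esub> h \<bullet> (w \<bullet> s l)" unfolding 2 using qc I by (simp add: W.m_assoc)
    also have "\<dots> = s k" unfolding e[symmetric] unfolding 2 using dl qc I by (simp add: W.m_assoc)
    finally have "?q [^]\<^bsub>W\<^esub> h \<bullet> ?q [^]\<^bsub>W\<^esub> h \<bullet> s l \<bullet> s k = s k \<bullet> s k" by simp
    then have "?q [^]\<^bsub>W\<^esub> Suc (2 * h) = e0" using pp[OF q] qc I by (simp add: W.m_assoc s_square)
    then show ?thesis using odd_power[OF kl(2,1)] kl by auto
  next
    case 3
    have "?p \<bullet> (?p [^]\<^bsub>W\<^esub> h \<bullet> ?p [^]\<^bsub>W\<^esub> h) = (s k \<bullet> w) \<bullet> ?p [^]\<^bsub>W\<^esub> h" unfolding 3 using pc I by (simp add: W.m_assoc)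
    also have "\<dots> = s l \<bullet> (?p [^]\<^bsub>W\<^esub> h \<bullet> s l \<bullet> ?p [^]\<^bsub>W\<^esub> h)" unfolding e unfolding 3 using pc I by (simp add: W.m_assoc)
    also have "\<dots> = e0" unfolding dk using I by (simp add: s_square)
    finally have "?p \<bullet> ?p [^]\<^bsub>W\<^esub> (2 * h) = e0" using W.nat_pow_mult[OF p, of h h] by (simp add: mult_2)
    then have "?p [^]\<^bsub>W\<^esub> Suc (2 * h) = e0" using W.nat_pow_Suc2[OF p, of "2 * h"] by simp
    then show ?thesis using odd_power[OF kl] by auto
  next
    case 4
    have "?q [^]\<^bsub>W\<^esub> h = s k \<bullet> w" unfolding 4 using qc I by simp
    also have "\<dots> = s k \<bullet> (?q [^]\<^bsub>W\<^esub> h \<bullet> s l)" unfolding e unfolding 4 using qc I by (simp add: W.m_assoc)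
    finally have "?q [^]\<^bsub>W\<^esub> h \<bullet> ?q [^]\<^bsub>W\<^esub> h = ?q [^]\<^bsub>W\<^esub> h \<bullet> (s k \<bullet> (?q [^]\<^bsub>W\<^esub> h \<bullet> s l))" by simp
    also have "\<dots> = (?q [^]\<^bsub>W\<^esub> h \<bullet> s k \<bullet> ?q [^]\<^bsub>W\<^esub> h) \<bullet> s l" using qc I by (simp add: W.m_assoc)
    also have "\<dots> = s k \<bullet> s l" unfolding dl ..
    finally have "?q [^]\<^bsub>W\<^esub> h \<bullet> ?q [^]\<^bsub>W\<^esub> h \<bullet> ?q = s k \<bullet> s l \<bullet> ?q" by simp
    then have "?q [^]\<^bsub>W\<^esub> Suc (2 * h) = e0" using pp[OF q] I by (simp add: W.m_assoc s_square)
    then show ?thesis using odd_power[OF kl(2,1)] kl by auto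
  qed
qed

lemma P_alt: "w \<in> P \<Longrightarrow> \<exists>x y n. {x, y} = J2 \<and> x \<noteq> y \<and> w = cl (alt x y n) \<and> n \<le> M"
proof -
  assume "w \<in> P"
  then obtain a b n where ab: "{a, b} = J2" "w = cl (rev (alt a b n))" "n \<le> M"
    using parabolic_alt[OF i12] mne by blast
  have ba: "{b, a} = J2" using ab(1) by (simp only: insert_commute)
  have ne: "a \<noteq> b" using ab(1) i12(3) by auto
  show ?thesis
  proof (cases "even n")
    case True
    then have "w = cl (alt b a n)" using ab(2) by (simp add: rev_alt)
    then show ?thesis using ba ne ab(3) by blast
  next
    case False
    then have "w = cl (alt a b n)" using ab(2) by (simp add: rev_alt)
    then show ?thesis using ab(1,3) ne by blast
  qed
qed

lemma finite_P: "finite P"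
proof (rule finite_subset)
  show "P \<subseteq> (\<lambda>(x, y, n). cl (alt x y n)) ` (J2 \<times> J2 \<times> {..M})"
  proof
    fix w assume "w \<in> P"
    then obtain x y n where "{x, y} = J2" "w = cl (alt x y n)" "n \<le> M" using P_alt by blast
    then show "w \<in> (\<lambda>(x, y, n). cl (alt x y n)) ` (J2 \<times> J2 \<times> {..M})"
      by (intro image_eqI[of _ _ "(x, y, n)"]) auto
  qed
qed simp

subsection \<open>Formal power series in the parameter\<close>

text \<open>Multiplication by X^n on a power series given by its coefficients.\<close>

definition sh :: "nat \<Rightarrow> (nat \<Rightarrow> 'i hhat) \<Rightarrow> nat \<Rightarrow> 'i hhat" where
  "sh n g d = (if n \<le> d then g (d - n) else \<zero>\<^bsub>H\<^esub>)"

lemma sh_closed [simp]: "(\<And>e. g e \<in> carrier H) \<Longrightarrow> sh n g d \<in> carrier H"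
  by (simp add: sh_def)

lemma sh_add: "\<lbrakk>\<And>e. g e \<in> carrier H; \<And>e. h e \<in> carrier H\<rbrakk> \<Longrightarrow> sh n (\<lambda>e. g e \<oplus>\<^bsub>H\<^esub> h e) d = sh n g d \<oplus>\<^bsub>H\<^esub> sh n h d"
  by (simp add: sh_def)

lemma sh_uminus: "sh n (\<lambda>e. \<ominus>\<^bsub>H\<^esub> g e) d = \<ominus>\<^bsub>H\<^esub> sh n g d"
  by (simp add: sh_def)

lemma sh_mult: "r \<in> carrier H \<Longrightarrow> sh n (\<lambda>e. g e \<star> r) d = sh n g d \<star> r"
  by (simp add: sh_def)

lemma sh_sh: "sh n (\<lambda>e. sh k g e) d = sh (n + k) g d"
  by (auto simp: sh_def)

text \<open>\<open>stp i\<close> is the right action of \<open>s\<^sub>i + X\<^bsup>al i\<^esup> D\<^sub>i\<close> on power series with coefficients in \<open>FM\<close>, and \<open>L k\<close> is the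
  left Hecke operator commuting with it.\<close>

definition stp :: "'i \<Rightarrow> (nat \<Rightarrow> 'i list set \<Rightarrow> 'i hhat) \<Rightarrow> nat \<Rightarrow> 'i list set \<Rightarrow> 'i hhat" where
  "stp i F = (\<lambda>d. sF i (F d) \<oplus>\<^bsub>FM\<^esub> (if al i \<le> d then dF i (F (d - al i)) else \<zero>\<^bsub>FM\<^esub>))"

definition L :: "'i \<Rightarrow> (nat \<Rightarrow> 'i list set \<Rightarrow> 'i hhat) \<Rightarrow> nat \<Rightarrow> 'i list set \<Rightarrow> 'i hhat" where
  "L k F = (\<lambda>d w. if w \<in> P then F d (s k \<bullet> w) \<oplus>\<^bsub>H\<^esub>
     sh (al k) (\<lambda>e. if sg (iv w) (s k) then F e w else \<ominus>\<^bsub>H\<^esub> F e (s k \<bullet> w)) d else \<zero>\<^bsub>H\<^esub>)"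

definition SP :: "(nat \<Rightarrow> 'i list set \<Rightarrow> 'i hhat) \<Rightarrow> bool" where
  "SP F \<longleftrightarrow> (\<forall>d. F d \<in> carrier FM \<and> (\<forall>w. w \<notin> P \<longrightarrow> F d w = \<zero>\<^bsub>H\<^esub>))"

lemma SP_closed: "SP F \<Longrightarrow> F d w \<in> carrier H"
  unfolding SP_def using MR.coeff by blast

lemma P_right: "\<lbrakk>k \<in> J2; w \<in> carrier W\<rbrakk> \<Longrightarrow> w \<bullet> s k \<in> P \<longleftrightarrow> w \<in> P"
  by (metis P.m_closed P.mem_carrier s_P s_s_right J2_I)

lemma L_FM:
  assumes "\<And>d. F d \<in> carrier FM"
  shows "L k F d \<in> carrier FM"
  using finite_P MR.coeff[OF assms]
  by (intro MR.memI[of _ P]) (auto simp: L_def)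

lemma L_SP: "SP F \<Longrightarrow> SP (L k F)"
  unfolding SP_def
proof (intro allI conjI impI)
  assume F: "\<forall>d. F d \<in> carrier FM \<and> (\<forall>w. w \<notin> P \<longrightarrow> F d w = \<zero>\<^bsub>H\<^esub>)"
  show "L k F d \<in> carrier FM" for d using L_FM[of F k] F by metis
  show "L k F d w = \<zero>\<^bsub>H\<^esub>" if "w \<notin> P" for d w using that by (simp only: L_def if_False)
qed

lemma stp_at: "\<lbrakk>\<And>d. F d \<in> carrier FM; i \<in> I; w \<in> carrier W\<rbrakk> \<Longrightarrow> stp i F d w =
   F d (w \<bullet> s i) \<star> hs i \<oplus>\<^bsub>H\<^esub> sh (al i) (\<lambda>e. if sg w (s i) then F e w \<star> hD i \<oplus>\<^bsub>H\<^esub> F e w \<star> hs i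
     else F e w \<star> hD i \<oplus>\<^bsub>H\<^esub> \<ominus>\<^bsub>H\<^esub> (F e (w \<bullet> s i) \<star> hs i)) d"
  by (simp add: stp_def FM_add sF_def dF_def sh_def MR.zero_eq a_minus_def)

lemma stp_FM: "\<lbrakk>\<And>d. F d \<in> carrier FM; i \<in> I\<rbrakk> \<Longrightarrow> stp i F d \<in> carrier FM"
  unfolding stp_def by (intro MR.RMg.a_closed) (auto intro: sF_closed dF_closed)

lemma stp_SP: "\<lbrakk>SP F; i \<in> J2\<rbrakk> \<Longrightarrow> SP (stp i F)"
proof -
  assume F: "SP F" and i: "i \<in> J2"
  then have Fd: "\<And>d. F d \<in> carrier FM" and z: "\<And>d w. w \<notin> P \<Longrightarrow> F d w = \<zero>\<^bsub>H\<^esub>" by (auto simp: SP_def)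
  have "stp i F d w = \<zero>\<^bsub>H\<^esub>" if w: "w \<notin> P" for d w
  proof (cases "w \<in> carrier W")
    case True
    then have "w \<bullet> s i \<notin> P" using w P_right i by simp
    then show ?thesis using True w z i Fd by (simp add: stp_at sh_def)
  next
    case False
    then show ?thesis using MR.outside[OF stp_FM[OF Fd]] i by simp
  qed
  then show ?thesis using stp_FM[OF Fd] i by (simp add: SP_def)
qed

text \<open>Left descents at \<open>w\<close> and at w s_i differ only if s_k w = w s_i, and the
  same holds for right descents at \<open>w\<close> and s_k w. Outside this case the two operators
  do not interact. In it they permute the same two points, the left and right signs coincide, and
  equal weights give the equality.\<close>

lemma L_stp:
  assumes F: "SP F" and k: "k \<in> J2" and i: "i \<in> J2"
  shows "L k (stp i F) = stp i (L k F)"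
proof (intro ext)
  fix d w
  have Fd: "\<And>d. F d \<in> carrier FM" using F by (simp add: SP_def)
  have LFd: "\<And>d. L k F d \<in> carrier FM" using L_FM[OF Fd] .
  note c [simp] = SP_closed[OF F]
  show "L k (stp i F) d w = stp i (L k F) d w"
  proof (cases "w \<in> P")
    case False
    have "SP (stp i (L k F))" using F i by (intro stp_SP L_SP)
    then show ?thesis using False by (simp add: L_def SP_def)
  next
    case w: True
    then have wc: "w \<in> carrier W" by simp
    let ?x = "w \<bullet> s i" and ?y = "s k \<bullet> w" and ?z = "s k \<bullet> w \<bullet> s i"
    have xP: "?x \<in> P" "?y \<in> P" "?z \<in> P" using w k i by auto
    have e: "s k \<bullet> ?x = ?z" using wc k i by (auto simp: W.m_assoc)
    have sl: "sg (iv ?x) (s k) = (sg (iv w) (s k) \<noteq> (?y = ?x))"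
    proof -
      have "sg (iv ?x) (s k) = sg (s i \<bullet> iv w) (s k)" using wc i by (simp add: W.inv_mult_group)
      also have "\<dots> = (sg (iv w) (s k) \<noteq> (iv w \<bullet> s k \<bullet> w = s i))" using wc k i by (simp add: sg_mult sg_s)
      also have "iv w \<bullet> s k \<bullet> w = s i \<longleftrightarrow> ?y = ?x"
      proof
        assume "iv w \<bullet> s k \<bullet> w = s i"
        then have "w \<bullet> (iv w \<bullet> s k \<bullet> w) = ?x" by simp
        then show "?y = ?x" using wc k by (simp add: W.m_assoc)
      next
        assume "?y = ?x"
        then have "iv w \<bullet> ?y = iv w \<bullet> ?x" by simp
        then show "iv w \<bullet> s k \<bullet> w = s i" using wc k i by (simp add: W.m_assoc)
      qed
      finally show ?thesis .
    qed
    have sr: "sg ?y (s i) = (sg w (s i) \<noteq> (?y = ?x))"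
    proof -
      have "sg ?y (s i) = (sg w (s i) \<noteq> (w \<bullet> s i \<bullet> iv w = s k))" using wc k i by (simp add: sg_mult sg_s)
      also have "w \<bullet> s i \<bullet> iv w = s k \<longleftrightarrow> ?y = ?x"
      proof
        assume "w \<bullet> s i \<bullet> iv w = s k"
        then have "w \<bullet> s i \<bullet> iv w \<bullet> w = ?y" by simp
        then show "?y = ?x" using wc i by (simp add: W.m_assoc)
      next
        assume "?y = ?x"
        then have "?x \<bullet> iv w = ?y \<bullet> iv w" by simp
        then show "w \<bullet> s i \<bullet> iv w = s k" using wc k i by (simp add: W.m_assoc)
      qed
      finally show ?thesis .
    qed
    have LS: "L k (stp i F) d w = stp i F d ?y \<oplus>\<^bsub>H\<^esub>
        sh (al k) (\<lambda>e. if sg (iv w) (s k) then stp i F e w else \<ominus>\<^bsub>H\<^esub> stp i F e ?y) d"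
      using w by (simp add: L_def)
    have Lw: "L k F e w = F e ?y \<oplus>\<^bsub>H\<^esub> sh (al k) (\<lambda>e. if sg (iv w) (s k) then F e w else \<ominus>\<^bsub>H\<^esub> F e ?y) e" for e
      using w by (simp add: L_def)
    have Lx: "L k F e ?x = F e ?z \<oplus>\<^bsub>H\<^esub> sh (al k) (\<lambda>e. if sg (iv ?x) (s k) then F e ?x else \<ominus>\<^bsub>H\<^esub> F e ?z) e" for e
      unfolding L_def e using xP by (simp only: if_True)
    have Sw: "stp i F e w = F e ?x \<star> hs i \<oplus>\<^bsub>H\<^esub> sh (al i) (\<lambda>e. if sg w (s i) then F e w \<star> hD i \<oplus>\<^bsub>H\<^esub> F e w \<star> hs i
     else F e w \<star> hD i \<oplus>\<^bsub>H\<^esub> \<ominus>\<^bsub>H\<^esub> (F e ?x \<star> hs i)) e" for e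
      using wc i by (intro stp_at Fd) auto
    have Sy: "stp i F e ?y = F e ?z \<star> hs i \<oplus>\<^bsub>H\<^esub> sh (al i) (\<lambda>e. if sg ?y (s i) then F e ?y \<star> hD i \<oplus>\<^bsub>H\<^esub> F e ?y \<star> hs i
     else F e ?y \<star> hD i \<oplus>\<^bsub>H\<^esub> \<ominus>\<^bsub>H\<^esub> (F e ?z \<star> hs i)) e" for e
      using stp_at[of F i ?y e, OF Fd] wc k i by simp
    have R: "stp i (L k F) d w = L k F d ?x \<star> hs i \<oplus>\<^bsub>H\<^esub> sh (al i) (\<lambda>e. if sg w (s i) then L k F e w \<star> hD i \<oplus>\<^bsub>H\<^esub> L k F e w \<star> hs i
     else L k F e w \<star> hD i \<oplus>\<^bsub>H\<^esub> \<ominus>\<^bsub>H\<^esub> (L k F e ?x \<star> hs i)) d"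
      using wc i by (intro stp_at LFd) auto
    have iI: "i \<in> I" using i by simp
    note rules = sh_add sh_uminus sh_mult sh_sh H.l_distr H.l_minus H.minus_add H.a_ac add.commute iI
    show ?thesis
    proof (cases "?y = ?x")
      case False
      then have s1: "sg (iv ?x) (s k) = sg (iv w) (s k)" and s2: "sg ?y (s i) = sg w (s i)" using sl sr by auto
      show ?thesis unfolding LS R Lw Lx Sw Sy s1 s2
        by (cases "sg w (s i)"; cases "sg (iv w) (s k)"; simp add: rules)
    next
      case True
      have zw: "?z = w" unfolding True using wc i by simp
      \<comment> \<open>Two different generators conjugate inside \<open>P\<close> force M to be
        odd, and then \<open>al_odd\<close> applies.\<close>
      have aa: "al k = al i"
      proof (cases "k = i")
        case False
        then have "odd M" using conj_odd[OF k i False w True] by simp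
        then show ?thesis using al_odd k i by auto
      qed simp
      have s1: "sg (iv ?x) (s k) = (\<not> sg (iv w) (s k))" and s2: "sg ?x (s i) = (\<not> sg w (s i))"
        using sl sr True by auto
      have "iv w \<bullet> s k \<bullet> w = s i" using True wc k i by (metis W.m_assoc W.inv_closed iv_left(1) s_closed J2_I)
      then have s3: "sg (iv w) (s k) = sg w (s i)" using sg_iv[OF wc, of "s k"] k by simp
      show ?thesis unfolding LS R Lw Lx Sw Sy unfolding True zw s1 s2 s3 aa
        by (cases "sg w (s i)"; simp add: rules)
    qed
  qed
qed

text \<open>\<open>Tc u d\<close> is the coefficient of \<open>X\<^sup>d\<close> in the product of the \<open>s\<^sub>i + X\<^bsup>al i\<^esup> D\<^sub>i\<close> over the reversal of \<open>u\<close>.\<close>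

primrec Tc :: "'i list \<Rightarrow> nat \<Rightarrow> 'i hhat" where
  "Tc [] = (\<lambda>d. if d = 0 then \<one>\<^bsub>H\<^esub> else \<zero>\<^bsub>H\<^esub>)"
| "Tc (i # u) = (\<lambda>d. Tc u d \<star> hs i \<oplus>\<^bsub>H\<^esub> sh (al i) (\<lambda>e. Tc u e \<star> hD i) d)"

primrec runs :: "'i list \<Rightarrow> (nat \<Rightarrow> 'i list set \<Rightarrow> 'i hhat) \<Rightarrow> nat \<Rightarrow> 'i list set \<Rightarrow> 'i hhat" where
  "runs [] F = F"
| "runs (i # u) F = stp i (runs u F)"

primrec Lw :: "'i list \<Rightarrow> (nat \<Rightarrow> 'i list set \<Rightarrow> 'i hhat) \<Rightarrow> nat \<Rightarrow> 'i list set \<Rightarrow> 'i hhat" where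
  "Lw [] F = F"
| "Lw (k # a) F = L k (Lw a F)"

definition c0 :: "('i list set \<Rightarrow> 'i hhat) \<Rightarrow> nat \<Rightarrow> 'i list set \<Rightarrow> 'i hhat" where
  "c0 f = (\<lambda>d. if d = 0 then f else \<zero>\<^bsub>FM\<^esub>)"

lemma Tc_closed [simp]: "u \<in> lists I \<Longrightarrow> Tc u d \<in> carrier H"
  by (induction u arbitrary: d) auto

lemma act_zero: "f \<in> carrier FM \<Longrightarrow> f \<triangleleft> \<zero>\<^bsub>H\<^esub> = \<zero>\<^bsub>FM\<^esub>"
  using act_add[of f "\<one>\<^bsub>H\<^esub>" "\<ominus>\<^bsub>H\<^esub> \<one>\<^bsub>H\<^esub>"] by (simp add: act_uminus H.r_neg MR.RMg.r_neg)

text \<open>\<open>runs\<close> applies the last letter of \<open>u\<close> first, and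
  \<open>Tc u\<close> is the product over the reversal of \<open>u\<close>; so the two orders
  agree.\<close>

lemma runs_c0: "\<lbrakk>f \<in> carrier FM; u \<in> lists I\<rbrakk> \<Longrightarrow> runs u (c0 f) d = f \<triangleleft> Tc u d"
proof (induction u arbitrary: d)
  case Nil
  then show ?case by (simp add: c0_def act_one[OF _ H.one_closed] act_zero)
next
  case (Cons i u)
  then have iu: "i \<in> I" "u \<in> lists I" by auto
  have "f \<triangleleft> Tc (i # u) d = f \<triangleleft> (Tc u d \<star> hs i) \<oplus>\<^bsub>FM\<^esub> f \<triangleleft> sh (al i) (\<lambda>e. Tc u e \<star> hD i) d"
    using iu Cons.prems by (simp add: act_add)
  also have "f \<triangleleft> (Tc u d \<star> hs i) = sF i (f \<triangleleft> Tc u d)"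
    using iu Cons.prems by (simp add: act_mult act_s[OF _ H.one_closed])
  also have "f \<triangleleft> sh (al i) (\<lambda>e. Tc u e \<star> hD i) d = (if al i \<le> d then dF i (f \<triangleleft> Tc u (d - al i)) else \<zero>\<^bsub>FM\<^esub>)"
    using iu Cons.prems by (simp add: sh_def act_mult act_d[OF _ H.one_closed] act_zero)
  finally show ?case using Cons iu by (simp add: stp_def)
qed

lemma Lw_SP: "SP F \<Longrightarrow> SP (Lw a F)"
  by (induction a) (auto intro: L_SP)

lemma runs_SP: "\<lbrakk>SP F; u \<in> lists J2\<rbrakk> \<Longrightarrow> SP (runs u F)"
  by (induction u) (auto intro: stp_SP)

lemma L_runs: "\<lbrakk>SP F; u \<in> lists J2; k \<in> J2\<rbrakk> \<Longrightarrow> runs u (L k F) = L k (runs u F)"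
proof (induction u)
  case (Cons i u)
  then have "runs (i # u) (L k F) = stp i (L k (runs u F))" by simp
  also have "\<dots> = L k (stp i (runs u F))"
    using Cons.prems by (intro L_stp[symmetric] runs_SP) auto
  finally show ?case by simp
qed simp

lemma Lw_runs: "\<lbrakk>SP F; u \<in> lists J2; a \<in> lists J2\<rbrakk> \<Longrightarrow> runs u (Lw a F) = Lw a (runs u F)"
  by (induction a) (auto simp: L_runs Lw_SP)

lemma SP_c0: "b \<in> P \<Longrightarrow> SP (c0 (dl b \<one>\<^bsub>H\<^esub>))"
  unfolding SP_def
proof (intro allI conjI impI)
  assume b: "b \<in> P"
  show "c0 (dl b \<one>\<^bsub>H\<^esub>) d \<in> carrier FM" for d
    using b by (cases "d = 0") (simp_all add: c0_def)
  show "c0 (dl b \<one>\<^bsub>H\<^esub>) d w = \<zero>\<^bsub>H\<^esub>" if "w \<notin> P" for d w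
  proof -
    have "w \<noteq> b" using b that by metis
    then show ?thesis by (cases "d = 0") (simp_all add: c0_def mterm_def MR.zero_eq)
  qed
qed

text \<open>The correction in \<open>L\<close> does not vanish only at \<open>b\<close> with a left
  descent or at s_k b without one. Neither occurs if s_k lengthens \<open>b\<close>, so only the
  translation remains.\<close>

lemma L_c0:
  assumes b: "b \<in> P" and k: "k \<in> J2" and n: "\<not> sg (iv b) (s k)"
  shows "L k (c0 (dl b \<one>\<^bsub>H\<^esub>)) = c0 (dl (s k \<bullet> b) \<one>\<^bsub>H\<^esub>)"
proof (intro ext)
  fix d w
  have kb: "s k \<bullet> b \<in> P" using b k by simp
  have c: "c0 (dl a \<one>\<^bsub>H\<^esub>) e v = (if e = 0 \<and> v = a then \<one>\<^bsub>H\<^esub> else \<zero>\<^bsub>H\<^esub>)" for a e v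
    by (simp add: c0_def mterm_def MR.zero_eq)
  show "L k (c0 (dl b \<one>\<^bsub>H\<^esub>)) d w = c0 (dl (s k \<bullet> b) \<one>\<^bsub>H\<^esub>) d w"
  proof (cases "w \<in> P")
    case True
    have e: "s k \<bullet> w = b \<longleftrightarrow> w = s k \<bullet> b" using True b k by auto
    have "sg (iv (s k \<bullet> b)) (s k)"
      using b k n sg_mult_s[of "iv b" k] by (simp add: W.inv_mult_group)
    then show ?thesis using True n e al_pos'[OF k] by (auto simp: L_def c sh_def)
  next
    case False
    then show ?thesis using kb by (auto simp: L_def c)
  qed
qed

lemma Lw_c0: "\<lbrakk>x \<in> J2; y \<in> J2; x \<noteq> y; n \<le> M\<rbrakk> \<Longrightarrow>
   Lw (alt x y n) (c0 (dl e0 \<one>\<^bsub>H\<^esub>)) = c0 (dl (cl (alt x y n)) \<one>\<^bsub>H\<^esub>)"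
proof (induction n arbitrary: x y)
  case 0
  then show ?case by (simp flip: one_W)
next
  case (Suc n)
  let ?b = "cl (alt y x n)"
  have l: "alt y x n \<in> lists J2" "alt y x n \<in> lists I" using Suc.prems by simp_all
  have "\<not> sg (cl (rev (alt y x n))) (s x)"
    using Suc.prems m_J2[of y x] by (intro alt_up) auto
  then have "\<not> sg (iv ?b) (s x)" using l iv_cl[of "alt y x n"] by simp
  then have "L x (c0 (dl ?b \<one>\<^bsub>H\<^esub>)) = c0 (dl (s x \<bullet> ?b) \<one>\<^bsub>H\<^esub>)"
    using Suc.prems cl_P[OF l(1)] by (intro L_c0) auto
  then show ?case using Suc l by (simp add: cl_Cons)
qed

text \<open>The delta function at an alternating element arises from the one at the identity by left
  operators, along a word that grows in length at every step. These operators pass through the right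
  action.\<close>

lemma theta_Tc:
  assumes "x \<in> J2" "y \<in> J2" "x \<noteq> y" "n \<le> M" "u \<in> lists J2"
  shows "dl (cl (alt x y n)) \<one>\<^bsub>H\<^esub> \<triangleleft> Tc u d = Lw (alt x y n) (\<lambda>d. dl e0 \<one>\<^bsub>H\<^esub> \<triangleleft> Tc u d) d"
proof -
  have a: "alt x y n \<in> lists J2" using assms by simp
  have u: "u \<in> lists I" using J2_lists[OF assms(5)] .
  have c: "dl (cl (alt x y n)) \<one>\<^bsub>H\<^esub> \<in> carrier FM" using J2_lists[OF a] by simp
  have "dl (cl (alt x y n)) \<one>\<^bsub>H\<^esub> \<triangleleft> Tc u d = runs u (c0 (dl (cl (alt x y n)) \<one>\<^bsub>H\<^esub>)) d"
    using runs_c0[OF c u] by simp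
  also have "\<dots> = runs u (Lw (alt x y n) (c0 (dl e0 \<one>\<^bsub>H\<^esub>))) d" using assms by (simp add: Lw_c0)
  also have "\<dots> = Lw (alt x y n) (runs u (c0 (dl e0 \<one>\<^bsub>H\<^esub>))) d"
    using assms a by (subst Lw_runs) (auto intro: SP_c0)
  also have "runs u (c0 (dl e0 \<one>\<^bsub>H\<^esub>)) = (\<lambda>d. dl e0 \<one>\<^bsub>H\<^esub> \<triangleleft> Tc u d)"
    using u by (intro ext runs_c0) auto
  finally show ?thesis .
qed

end

section \<open>Filtration bounds for the coefficients of the action\<close>

context dihedral_pair begin

text \<open>A filtration by additive groups in which right multiplication by some D_t costs one
  degree. It has two instances, the constant family \<open>Dh\<close> for membership in the
  subalgebra and \<open>DF\<close> for the degree bound, so that one induction yields both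
  conditions on \<open>K_pair\<close>.\<close>

definition chain :: "(int \<Rightarrow> 'i hhat set) \<Rightarrow> bool" where
  "chain C \<longleftrightarrow> (\<forall>z. C z \<subseteq> carrier H \<and> \<zero>\<^bsub>H\<^esub> \<in> C z \<and> C z \<subseteq> C (z + 1) \<and>
     (\<forall>x\<in>C z. \<ominus>\<^bsub>H\<^esub> x \<in> C z \<and> (\<forall>y\<in>C z. x \<oplus>\<^bsub>H\<^esub> y \<in> C z) \<and> (\<forall>t\<in>RF \<inter> P. x \<star> Dr t \<in> C (z + 1))))"

lemma chainD:
  assumes "chain C"
  shows "x \<in> C z \<Longrightarrow> x \<in> carrier H" "\<zero>\<^bsub>H\<^esub> \<in> C z" "x \<in> C z \<Longrightarrow> \<ominus>\<^bsub>H\<^esub> x \<in> C z"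
    "\<lbrakk>x \<in> C z; y \<in> C z\<rbrakk> \<Longrightarrow> x \<oplus>\<^bsub>H\<^esub> y \<in> C z" "\<lbrakk>x \<in> C z; t \<in> RF; t \<in> P\<rbrakk> \<Longrightarrow> x \<star> Dr t \<in> C (z + 1)"
  using assms unfolding chain_def by blast+

lemma chain_mono: "\<lbrakk>chain C; y \<le> z; x \<in> C y\<rbrakk> \<Longrightarrow> x \<in> C z"
proof -
  assume C: "chain C" and "y \<le> z" and x: "x \<in> C y"
  from this(2) show "x \<in> C z"
  proof (induction z rule: int_ge_induct)
    case (step z)
    then show ?case using C unfolding chain_def by blast
  qed (rule x)
qed

lemma chain_Dh: "chain (\<lambda>_. Dh)"
proof -
  have "\<zero>\<^bsub>H\<^esub> \<in> Dh" using subringE(2)[OF Dhat_subring] .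
  then show ?thesis unfolding chain_def using Dhat_rules Dhat_D Dhat_closed by auto
qed

text \<open>\<open>DF\<close> is indexed by integers because \<open>Q\<close> below subtracts lengths; it is \<open>{0}\<close> in negative degrees.\<close>

definition DF :: "int \<Rightarrow> 'i hhat set" where
  "DF z = generate (add_monoid H) {wprod H Dr ts | ts. ts \<in> lists (RF \<inter> P) \<and> int (length ts) \<le> z}"

lemma DF_gens: "{wprod H Dr ts | ts. ts \<in> lists (RF \<inter> P) \<and> int (length ts) \<le> z} \<subseteq> carrier H"
  by (auto intro!: H.wprod_closed simp: in_lists_conv_set)

lemmas DF_closed = H.span_closed[OF DF_gens, folded DF_def]
  and DF_zero = H.span_zero[OF DF_gens, folded DF_def]
  and DF_elem = H.span_elem[OF DF_gens, folded DF_def]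
  and DF_uminus = H.span_uminus[OF DF_gens, folded DF_def]
  and DF_add = H.span_add[OF DF_gens, folded DF_def]

lemma DF_wprod: "\<lbrakk>ts \<in> lists (RF \<inter> P); int (length ts) \<le> z\<rbrakk> \<Longrightarrow> wprod H Dr ts \<in> DF z"
  by (rule DF_elem) blast

lemma DF_mult: "\<lbrakk>x \<in> DF a; y \<in> DF b\<rbrakk> \<Longrightarrow> x \<star> y \<in> DF (a + b)"
proof -
  assume x: "x \<in> DF a" and y: "y \<in> DF b"
  have yc: "y \<in> carrier H" using DF_closed[OF y] .
  have gen: "wprod H Dr ts \<star> y \<in> DF (a + b)" if ts: "ts \<in> lists (RF \<inter> P)" "int (length ts) \<le> a" for ts
    using y unfolding DF_def[of b]
  proof (rule H.span_induct[OF _ DF_gens])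
    have tc: "wprod H Dr ts \<in> carrier H" using ts by (intro H.wprod_closed) (auto simp: in_lists_conv_set)
    show "wprod H Dr ts \<star> \<zero>\<^bsub>H\<^esub> \<in> DF (a + b)" using tc DF_zero by simp
    show "wprod H Dr ts \<star> e \<in> DF (a + b)" if "e \<in> {wprod H Dr ts |ts. ts \<in> lists (RF \<inter> P) \<and> int (length ts) \<le> b}" for e
    proof -
      obtain us where us: "e = wprod H Dr us" "us \<in> lists (RF \<inter> P)" "int (length us) \<le> b" using \<open>e \<in> _\<close> by blast
      have "wprod H Dr ts \<star> e = wprod H Dr (ts @ us)"
        unfolding us(1) using ts us by (intro H.wprod_append[symmetric]) (auto simp: in_lists_conv_set)
      then show ?thesis using ts us by (simp only:) (intro DF_wprod, auto)
    qed
    show "wprod H Dr ts \<star> \<ominus>\<^bsub>H\<^esub> x \<in> DF (a + b)" if "x \<in> carrier H" "wprod H Dr ts \<star> x \<in> DF (a + b)" for x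
      using that tc DF_uminus by (simp add: H.r_minus)
    show "wprod H Dr ts \<star> (x \<oplus>\<^bsub>H\<^esub> z) \<in> DF (a + b)"
      if "x \<in> carrier H" "z \<in> carrier H" "wprod H Dr ts \<star> x \<in> DF (a + b)" "wprod H Dr ts \<star> z \<in> DF (a + b)" for x z
      using that tc DF_add by (simp add: H.r_distr)
  qed
  show ?thesis using x unfolding DF_def[of a]
  proof (rule H.span_induct[OF _ DF_gens])
    show "\<zero>\<^bsub>H\<^esub> \<star> y \<in> DF (a + b)" using yc DF_zero by simp
    show "e \<star> y \<in> DF (a + b)" if "e \<in> {wprod H Dr ts |ts. ts \<in> lists (RF \<inter> P) \<and> int (length ts) \<le> a}" for e
      using that gen by blast
    show "\<ominus>\<^bsub>H\<^esub> x \<star> y \<in> DF (a + b)" if "x \<in> carrier H" "x \<star> y \<in> DF (a + b)" for x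
      using that yc DF_uminus by (simp add: H.l_minus)
    show "(x \<oplus>\<^bsub>H\<^esub> z) \<star> y \<in> DF (a + b)"
      if "x \<in> carrier H" "z \<in> carrier H" "x \<star> y \<in> DF (a + b)" "z \<star> y \<in> DF (a + b)" for x z
      using that yc DF_add by (simp add: H.l_distr)
  qed
qed

lemma chain_DF: "chain DF"
proof -
  have s: "DF z \<subseteq> DF (z + 1)" for z unfolding DF_def by (rule H.add.mono_generate) auto
  have t: "x \<star> Dr t \<in> DF (z + 1)" if "x \<in> DF z" "t \<in> RF \<inter> P" for x t z
  proof -
    have "Dr t \<in> DF 1" using that DF_wprod[of "[t]" 1] by simp
    then show ?thesis using DF_mult[OF that(1)] by simp
  qed
  show ?thesis unfolding chain_def
    by (intro allI conjI ballI subsetI) (auto intro: DF_closed DF_zero DF_uminus DF_add subsetD[OF s] t)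
qed

lemma DF_deg: "x \<in> DF (int r) \<Longrightarrow> x \<in> Dhat_deg_le I m r"
proof -
  assume x: "x \<in> DF (int r)"
  have "DF (int r) \<subseteq> Dhat_deg_le I m r"
    unfolding DF_def Dhat_deg_le_def
  proof (rule H.add.mono_generate, clarify)
    fix ts assume "ts \<in> lists (RF \<inter> P)" "int (length ts) \<le> int r"
    moreover have "foldr (\<otimes>\<^bsub>H\<^esub>) (map Dr ts) \<one>\<^bsub>H\<^esub> = wprod H Dr ts" by (induction ts) auto
    ultimately show "\<exists>ts'. wprod H Dr ts = foldr (\<otimes>\<^bsub>H\<^esub>) (map Dr ts') \<one>\<^bsub>H\<^esub> \<and> ts' \<in> lists RF \<and> length ts' \<le> r"
      by (intro exI[of _ ts]) auto
  qed
  then show ?thesis using x by blast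
qed

text \<open>The coefficient at \<open>w\<close> has the form c w with c in degree \<open>z\<close>
  minus the length of \<open>w\<close>. Counting the length against the degree leaves room for
  multiplying c later by a product over a reduced word of \<open>w\<close> within the bound
  M.\<close>

definition Q :: "(int \<Rightarrow> 'i hhat set) \<Rightarrow> int \<Rightarrow> ('i list set \<Rightarrow> 'i hhat) \<Rightarrow> bool" where
  "Q C z f \<longleftrightarrow> (\<forall>w. (w \<in> P \<longrightarrow> f w \<star> wH (iv w) \<in> C (z - int (len w))) \<and> (w \<notin> P \<longrightarrow> f w = \<zero>\<^bsub>H\<^esub>))"

lemma QD: "\<lbrakk>Q C z f; w \<in> P\<rbrakk> \<Longrightarrow> f w \<star> wH (iv w) \<in> C (z - int (len w))"
  "\<lbrakk>Q C z f; w \<notin> P\<rbrakk> \<Longrightarrow> f w = \<zero>\<^bsub>H\<^esub>"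
  by (auto simp: Q_def)

lemma Q_zero: "chain C \<Longrightarrow> Q C z \<zero>\<^bsub>FM\<^esub>"
  unfolding Q_def by (auto simp: MR.zero_eq chainD(2))

lemma Q_add: "\<lbrakk>chain C; f \<in> carrier FM; g \<in> carrier FM; Q C z f; Q C z g\<rbrakk> \<Longrightarrow> Q C z (f \<oplus>\<^bsub>FM\<^esub> g)"
proof -
  assume a: "chain C" "f \<in> carrier FM" "g \<in> carrier FM" "Q C z f" "Q C z g"
  note c = MR.coeff[OF a(2)] MR.coeff[OF a(3)]
  show ?thesis unfolding Q_def
  proof (intro allI conjI impI)
    fix w assume w: "w \<in> P"
    have "(f \<oplus>\<^bsub>FM\<^esub> g) w \<star> wH (iv w) = f w \<star> wH (iv w) \<oplus>\<^bsub>H\<^esub> g w \<star> wH (iv w)"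
      using w c by (simp add: FM_add H.l_distr)
    then show "(f \<oplus>\<^bsub>FM\<^esub> g) w \<star> wH (iv w) \<in> C (z - int (len w))" using a w QD(1) chainD(4)[OF a(1)] by metis
  qed (use a in \<open>simp add: FM_add QD\<close>)
qed

lemma Q_uminus: "\<lbrakk>chain C; f \<in> carrier FM; Q C z f\<rbrakk> \<Longrightarrow> Q C z (\<ominus>\<^bsub>FM\<^esub> f)"
proof -
  assume a: "chain C" "f \<in> carrier FM" "Q C z f"
  note c = MR.coeff[OF a(2)] and u = MR.uminus_eq[OF a(2)]
  show ?thesis unfolding Q_def
  proof (intro allI conjI impI)
    fix w assume w: "w \<in> P"
    have "(\<ominus>\<^bsub>FM\<^esub> f) w \<star> wH (iv w) = \<ominus>\<^bsub>H\<^esub> (f w \<star> wH (iv w))"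
      using w c by (simp add: u H.l_minus)
    then show "(\<ominus>\<^bsub>FM\<^esub> f) w \<star> wH (iv w) \<in> C (z - int (len w))" using a w QD(1) chainD(3)[OF a(1)] by metis
  qed (use a in \<open>simp add: u QD\<close>)
qed

text \<open>The coefficient only moves from w s_k to \<open>w\<close>, and the lengths of these
  elements differ by at most one.\<close>

lemma Q_sF:
  assumes C: "chain C" and f: "f \<in> carrier FM" "Q C z f" and k: "k \<in> J2"
  shows "Q C (z + 1) (sF k f)"
  unfolding Q_def
proof (intro allI conjI impI)
  note c = MR.coeff[OF f(1)]
  fix w assume w: "w \<in> P"
  then have wc: "w \<in> carrier W" by simp
  have kI: "k \<in> I" using k by simp
  have "sF k f w \<star> wH (iv w) = f (w \<bullet> s k) \<star> wH (iv (w \<bullet> s k))"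
    using wc kI c by (simp add: sF_def W.inv_mult_group wH_mult wH_s H.m_assoc)
  moreover have "\<dots> \<in> C (z - int (len (w \<bullet> s k)))" using f w k by (intro QD) auto
  moreover have "len w \<le> Suc (len (w \<bullet> s k))" using len_mult_s_le[of "w \<bullet> s k" k] wc kI by simp
  ultimately show "sF k f w \<star> wH (iv w) \<in> C (z + 1 - int (len w))"
    using chain_mono[OF C, of "z - int (len (w \<bullet> s k))" "z + 1 - int (len w)"] by simp
next
  fix w assume "w \<notin> P"
  then show "sF k f w = \<zero>\<^bsub>H\<^esub>" using f k P_right[of k w] by (simp add: sF_def QD)
qed

text \<open>Let X = f(w) w^-1 and t = w s_k w^-1. At an ascent D_k becomes right multiplication of X
  by D_t. At a descent it becomes 1 - t - D_t, and the term with t cancels against the one from s_k,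
  so no group element is left over.\<close>

lemma Q_dF:
  assumes C: "chain C" and f: "f \<in> carrier FM" "Q C z f" and k: "k \<in> J2"
  shows "Q C (z + 1) (dF k f)"
  unfolding Q_def
proof (intro allI conjI impI)
  note c = MR.coeff[OF f(1)]
  have kI: "k \<in> I" using k by simp
  have fc: "f v \<star> wH (iv v) \<in> C (z - int (len v))" if "v \<in> P" for v using that f by (intro QD) auto
  fix w assume w: "w \<in> P"
  then have wc: "w \<in> carrier W" by simp
  let ?t = "w \<bullet> s k \<bullet> iv w" and ?X = "f w \<star> wH (iv w)"
  have t: "?t \<in> RF" "?t \<in> P" using reflI[OF wc kI] w k by auto
  have X: "?X \<in> carrier H" using c wc by simp
  have ws: "len w \<le> Suc (len (w \<bullet> s k))" using len_mult_s_le[of "w \<bullet> s k" k] wc kI by simp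
  have D: "?X \<star> Dr ?t \<in> C (z + 1 - int (len w))"
    using chainD(5)[OF C fc[OF w] t] by (simp add: algebra_simps)
  have dX: "f w \<star> hD k \<star> wH (iv w) = ?X \<star> (wH w \<star> Dr (s k) \<star> wH (iv w))"
    using c wc kI by (simp add: Dr_s H.m_assoc)
  have sX: "f w \<star> hs k \<star> wH (iv w) = ?X \<star> wH ?t"
    using c wc kI by (simp add: wH_mult wH_s H.m_assoc)
  show "dF k f w \<star> wH (iv w) \<in> C (z + 1 - int (len w))"
  proof (cases "sg w (s k)")
    case False
    have 1: "f w \<star> hD k \<star> wH (iv w) = ?X \<star> Dr ?t" unfolding dX using False wc kI by (simp add: Dr_conj_pos)
    have "f (w \<bullet> s k) \<star> hs k \<star> wH (iv w) = f (w \<bullet> s k) \<star> wH (iv (w \<bullet> s k))"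
      using wc kI c by (simp add: W.inv_mult_group wH_mult wH_s H.m_assoc)
    moreover have "\<dots> \<in> C (z + 1 - int (len w))"
      by (rule chain_mono[OF C _ fc]) (use ws w k in auto)
    ultimately have 2: "\<ominus>\<^bsub>H\<^esub> (f (w \<bullet> s k) \<star> hs k \<star> wH (iv w)) \<in> C (z + 1 - int (len w))"
      using chainD(3)[OF C] by simp
    have "dF k f w \<star> wH (iv w) = f w \<star> hD k \<star> wH (iv w) \<oplus>\<^bsub>H\<^esub> \<ominus>\<^bsub>H\<^esub> (f (w \<bullet> s k) \<star> hs k \<star> wH (iv w))"
      using False wc kI c by (simp add: dF_def a_minus_def H.l_distr H.l_minus)
    then show ?thesis using 1 2 D chainD(4)[OF C] by simp
  next
    case True
    have "dF k f w \<star> wH (iv w) = f w \<star> hD k \<star> wH (iv w) \<oplus>\<^bsub>H\<^esub> f w \<star> hs k \<star> wH (iv w)"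
      using True wc kI c by (simp add: dF_def H.l_distr)
    also have "\<dots> = ?X \<oplus>\<^bsub>H\<^esub> \<ominus>\<^bsub>H\<^esub> (?X \<star> Dr ?t)"
    proof -
      have "wH w \<star> Dr (s k) \<star> wH (iv w) = \<one>\<^bsub>H\<^esub> \<ominus>\<^bsub>H\<^esub> wH ?t \<ominus>\<^bsub>H\<^esub> Dr ?t"
        using True wc kI by (intro Dr_conj_neg) auto
      moreover have "wH ?t \<in> carrier H" "Dr ?t \<in> carrier H" using t by auto
      moreover have "p \<oplus>\<^bsub>H\<^esub> \<ominus>\<^bsub>H\<^esub> x \<oplus>\<^bsub>H\<^esub> \<ominus>\<^bsub>H\<^esub> y \<oplus>\<^bsub>H\<^esub> x = p \<oplus>\<^bsub>H\<^esub> \<ominus>\<^bsub>H\<^esub> y"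
        if "p \<in> carrier H" "x \<in> carrier H" "y \<in> carrier H" for p x y
        using that H.a_lcomm[of x "\<ominus>\<^bsub>H\<^esub> y" "\<ominus>\<^bsub>H\<^esub> x"] by (simp add: H.a_ac H.r_neg)
      ultimately show ?thesis unfolding dX sX using X
        by (simp only: a_minus_def H.r_distr H.r_minus H.a_closed H.a_inv_closed H.m_closed H.one_closed H.r_one)
    qed
    finally have "dF k f w \<star> wH (iv w) = ?X \<oplus>\<^bsub>H\<^esub> \<ominus>\<^bsub>H\<^esub> (?X \<star> Dr ?t)" .
    moreover have "?X \<in> C (z + 1 - int (len w))"
      by (rule chain_mono[OF C _ fc]) (use w in auto)
    ultimately show ?thesis using D chainD(3,4)[OF C] by simp
  qed
next
  fix w assume "w \<notin> P"
  then show "dF k f w = \<zero>\<^bsub>H\<^esub>" using f k P_right[of k w] by (simp add: dF_def QD a_minus_def)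
qed

lemma act_Tc_Cons:
  assumes "f \<in> carrier FM" "u \<in> lists I" "i \<in> I"
  shows "f \<triangleleft> Tc (i # u) d = sF i (f \<triangleleft> Tc u d) \<oplus>\<^bsub>FM\<^esub> (if al i \<le> d then dF i (f \<triangleleft> Tc u (d - al i)) else \<zero>\<^bsub>FM\<^esub>)"
proof -
  have "runs u (c0 f) = (\<lambda>d. f \<triangleleft> Tc u d)" using assms by (intro ext runs_c0)
  moreover have "f \<triangleleft> Tc (i # u) d = runs (i # u) (c0 f) d" using assms by (intro runs_c0[symmetric]) auto
  ultimately show ?thesis by (simp only: runs.simps stp_def)
qed

lemma Q_Tc:
  assumes C: "chain C" and f: "f \<in> carrier FM" "Q C z f" and u: "u \<in> lists J2"
  shows "Q C (z + int (length u)) (f \<triangleleft> Tc u d)"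
  using u
proof (induction u arbitrary: d)
  case Nil
  then show ?case using f Q_zero[OF C] by (simp add: act_one[OF _ H.one_closed] act_zero)
next
  case (Cons i u)
  then have u: "u \<in> lists I" "i \<in> J2" "i \<in> I" "u \<in> lists J2" using J2_lists[of u] by auto
  have g: "f \<triangleleft> Tc u e \<in> carrier FM" "Q C (z + int (length u)) (f \<triangleleft> Tc u e)" for e using f u Cons by auto
  have e: "z + int (length (i # u)) = z + int (length u) + 1" by simp
  show ?case unfolding act_Tc_Cons[OF f(1) u(1,3)] e
    using u by (intro Q_add[OF C] sF_closed Q_sF[OF C] g) (auto intro: dF_closed Q_dF[OF C] g Q_zero[OF C])
qed

text \<open>The augmentation of the group ring applied to the second tensor factor. It is compatible
  with the right action because each a D_i has augmentation 0.\<close>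

definition tot :: "('i list set \<Rightarrow> 'i hhat) \<Rightarrow> 'i hhat" where
  "tot f = (\<Oplus>\<^bsub>H\<^esub>w\<in>P. f w)"

lemma tot_closed: "f \<in> carrier FM \<Longrightarrow> tot f \<in> carrier H"
  unfolding tot_def using MR.coeff[of f] by (intro H.finsum_closed) auto

lemma tot_add: "\<lbrakk>f \<in> carrier FM; g \<in> carrier FM\<rbrakk> \<Longrightarrow> tot (f \<oplus>\<^bsub>FM\<^esub> g) = tot f \<oplus>\<^bsub>H\<^esub> tot g"
  unfolding tot_def FM_add using MR.coeff[of f] MR.coeff[of g] by (intro H.finsum_addf) auto

lemma tot_uminus: "f \<in> carrier FM \<Longrightarrow> tot (\<ominus>\<^bsub>FM\<^esub> f) = \<ominus>\<^bsub>H\<^esub> tot f"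
proof -
  assume f: "f \<in> carrier FM"
  have "tot f \<oplus>\<^bsub>H\<^esub> tot (\<ominus>\<^bsub>FM\<^esub> f) = tot \<zero>\<^bsub>FM\<^esub>"
    using f tot_add[of f "\<ominus>\<^bsub>FM\<^esub> f"] by (simp only: MR.RMg.a_inv_closed MR.RMg.r_neg)
  also have "\<dots> = \<zero>\<^bsub>H\<^esub>" by (simp add: tot_def MR.zero_eq)
  finally show ?thesis using tot_closed f by (metis H.minus_equality H.a_comm MR.RMg.a_inv_closed)
qed

lemma tot_lm: "\<lbrakk>r \<in> carrier H; f \<in> carrier FM\<rbrakk> \<Longrightarrow> tot (lm r f) = r \<star> tot f"
  unfolding tot_def lm_def using MR.coeff[of f] finite_P by (intro H.finsum_rdistr[symmetric]) auto

lemma tot_right: "\<lbrakk>f \<in> carrier FM; k \<in> J2; r \<in> carrier H\<rbrakk> \<Longrightarrow> (\<Oplus>\<^bsub>H\<^esub>w\<in>P. f (w \<bullet> s k) \<star> r) = tot f \<star> r"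
proof -
  assume a: "f \<in> carrier FM" "k \<in> J2" "r \<in> carrier H"
  note c = MR.coeff[OF a(1)]
  have inj: "inj_on (\<lambda>w. w \<bullet> s k) P" using a(2) by (intro inj_onI) auto
  have im: "(\<lambda>w. w \<bullet> s k) ` P = P"
  proof
    show "P \<subseteq> (\<lambda>w. w \<bullet> s k) ` P"
    proof
      fix w assume w: "w \<in> P"
      then have "w = (w \<bullet> s k) \<bullet> s k" using a(2) by simp
      then show "w \<in> (\<lambda>w. w \<bullet> s k) ` P" using w a(2) by (metis P.m_closed image_eqI s_P)
    qed
  qed (use a(2) in auto)
  have "(\<Oplus>\<^bsub>H\<^esub>w\<in>P. f (w \<bullet> s k) \<star> r) = (\<Oplus>\<^bsub>H\<^esub>w\<in>(\<lambda>w. w \<bullet> s k) ` P. f w \<star> r)"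
    using inj c a by (intro H.finsum_reindex[symmetric]) auto
  also have "\<dots> = tot f \<star> r" unfolding im tot_def using c a finite_P by (intro H.finsum_ldistr[symmetric]) auto
  finally show ?thesis .
qed

lemma tot_sF: "\<lbrakk>f \<in> carrier FM; k \<in> J2\<rbrakk> \<Longrightarrow> tot (sF k f) = tot f \<star> hs k"
proof -
  assume a: "f \<in> carrier FM" "k \<in> J2"
  note c = MR.coeff[OF a(1)]
  have "tot (sF k f) = (\<Oplus>\<^bsub>H\<^esub>w\<in>P. f (w \<bullet> s k) \<star> hs k)"
    unfolding tot_def using a(2) c by (intro H.finsum_cong') (auto simp: sF_def)
  then show ?thesis using a tot_right[of f k "hs k"] by simp
qed

text \<open>A descent \<open>w\<close> contributes the term with s_k once at \<open>w\<close> and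
  once with the opposite sign at w s_k. \<open>g\<close> isolates the descents, so the two sums
  cancel after translation.\<close>

lemma tot_dF: "\<lbrakk>f \<in> carrier FM; k \<in> J2\<rbrakk> \<Longrightarrow> tot (dF k f) = tot f \<star> hD k"
proof -
  assume a: "f \<in> carrier FM" "k \<in> J2"
  note c = MR.coeff[OF a(1)]
  have kI: "k \<in> I" using a by simp
  define g where "g = (\<lambda>w. if sg w (s k) then f w else \<zero>\<^bsub>H\<^esub>)"
  have gc: "g w \<in> carrier H" for w using c by (simp add: g_def)
  have g: "g \<in> carrier FM"
    using gc MR.outside[OF a(1)] MR.fin[OF a(1)] MR.supp[OF a(1)]
    by (intro MR.memI[of _ "msupp H f"]) (auto simp: g_def msupp_def)
  have "tot (dF k f) = (\<Oplus>\<^bsub>H\<^esub>w\<in>P. f w \<star> hD k \<oplus>\<^bsub>H\<^esub> (g w \<star> hs k \<oplus>\<^bsub>H\<^esub> \<ominus>\<^bsub>H\<^esub> (g (w \<bullet> s k) \<star> hs k)))"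
    unfolding tot_def using a(2) c gc kI
    by (intro H.finsum_cong') (auto simp: dF_def g_def sg_mult_s a_minus_def)
  also have "\<dots> = (\<Oplus>\<^bsub>H\<^esub>w\<in>P. f w \<star> hD k) \<oplus>\<^bsub>H\<^esub> ((\<Oplus>\<^bsub>H\<^esub>w\<in>P. g w \<star> hs k) \<oplus>\<^bsub>H\<^esub> (\<Oplus>\<^bsub>H\<^esub>w\<in>P. \<ominus>\<^bsub>H\<^esub> (g (w \<bullet> s k) \<star> hs k)))"
    using c gc kI by (simp add: H.finsum_addf Pi_def)
  also have "(\<Oplus>\<^bsub>H\<^esub>w\<in>P. \<ominus>\<^bsub>H\<^esub> (g (w \<bullet> s k) \<star> hs k)) = (\<Oplus>\<^bsub>H\<^esub>w\<in>P. g (w \<bullet> s k) \<star> (\<ominus>\<^bsub>H\<^esub> hs k))"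
    using gc kI by (intro H.finsum_cong') (auto simp: H.r_minus)
  also have "\<dots> = tot g \<star> (\<ominus>\<^bsub>H\<^esub> hs k)" using tot_right[OF g a(2)] kI by simp
  also have "(\<Oplus>\<^bsub>H\<^esub>w\<in>P. g w \<star> hs k) = tot g \<star> hs k"
    unfolding tot_def using gc kI finite_P by (intro H.finsum_ldistr[symmetric]) auto
  also have "(\<Oplus>\<^bsub>H\<^esub>w\<in>P. f w \<star> hD k) = tot f \<star> hD k"
    unfolding tot_def using c kI finite_P by (intro H.finsum_ldistr[symmetric]) auto
  finally show ?thesis using tot_closed[OF g] tot_closed[OF a(1)] kI by (simp add: H.r_minus H.r_neg)
qed

lemma tot_Tc: "\<lbrakk>f \<in> carrier FM; u \<in> lists J2\<rbrakk> \<Longrightarrow> tot (f \<triangleleft> Tc u d) = tot f \<star> Tc u d"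
proof (induction u arbitrary: d)
  case Nil
  have "tot \<zero>\<^bsub>FM\<^esub> = \<zero>\<^bsub>H\<^esub>" by (simp add: tot_def MR.zero_eq)
  then show ?case using Nil tot_closed by (simp add: act_one[OF _ H.one_closed] act_zero)
next
  case (Cons i u)
  then have u: "u \<in> lists I" "i \<in> J2" "i \<in> I" "u \<in> lists J2" using J2_lists[of u] by auto
  have z: "tot \<zero>\<^bsub>FM\<^esub> = \<zero>\<^bsub>H\<^esub>" by (simp add: tot_def MR.zero_eq)
  have c: "tot f \<in> carrier H" using tot_closed Cons by simp
  have g: "f \<triangleleft> Tc u e \<in> carrier FM" for e using Cons u by simp
  have "tot (f \<triangleleft> Tc (i # u) d) = tot (sF i (f \<triangleleft> Tc u d)) \<oplus>\<^bsub>H\<^esub> tot (if al i \<le> d then dF i (f \<triangleleft> Tc u (d - al i)) else \<zero>\<^bsub>FM\<^esub>)"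
    unfolding act_Tc_Cons[OF Cons.prems(1) u(1,3)] using u g sF_closed dF_closed by (intro tot_add) auto
  then show ?case using Cons u c g z
    by (cases "al i \<le> d") (simp_all add: tot_sF tot_dF sh_def H.r_distr H.m_assoc)
qed

lemma Lw_FM: "(\<And>d. F d \<in> carrier FM) \<Longrightarrow> Lw a F d \<in> carrier FM"
  by (induction a arbitrary: d) (auto intro: L_FM)

lemma L_add:
  assumes "\<And>d. F d \<in> carrier FM" "\<And>d. G d \<in> carrier FM"
  shows "L k (\<lambda>d. F d \<oplus>\<^bsub>FM\<^esub> G d) = (\<lambda>d. L k F d \<oplus>\<^bsub>FM\<^esub> L k G d)"
proof (intro ext)
  fix d w
  note [simp] = MR.coeff[OF assms(1)] MR.coeff[OF assms(2)]
  show "L k (\<lambda>d. F d \<oplus>\<^bsub>FM\<^esub> G d) d w = (L k F d \<oplus>\<^bsub>FM\<^esub> L k G d) w"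
    by (cases "w \<in> P"; cases "sg (iv w) (s k)") (simp_all add: L_def FM_add sh_add H.minus_add H.a_ac)
qed

lemma L_uminus:
  assumes "\<And>d. F d \<in> carrier FM"
  shows "L k (\<lambda>d. \<ominus>\<^bsub>FM\<^esub> F d) = (\<lambda>d. \<ominus>\<^bsub>FM\<^esub> L k F d)"
proof (intro ext)
  fix d w
  note [simp] = MR.coeff[OF assms]
  show "L k (\<lambda>d. \<ominus>\<^bsub>FM\<^esub> F d) d w = (\<ominus>\<^bsub>FM\<^esub> L k F d) w"
    unfolding MR.uminus_eq[OF L_FM[OF assms]] MR.uminus_eq[OF assms]
    by (cases "w \<in> P"; cases "sg (iv w) (s k)") (simp_all add: L_def sh_uminus H.minus_add)
qed

lemma L_lm:
  assumes "\<And>d. F d \<in> carrier FM" and r: "r \<in> carrier H"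
  shows "L k (\<lambda>d. lm r (F d)) = (\<lambda>d. lm r (L k F d))"
proof (intro ext)
  fix d w
  note [simp] = MR.coeff[OF assms(1)]
  show "L k (\<lambda>d. lm r (F d)) d w = lm r (L k F d) w"
    using r by (cases "w \<in> P"; cases "sg (iv w) (s k)") (simp_all add: L_def lm_def sh_def H.r_distr H.r_minus)
qed

lemma Lw_add: "\<lbrakk>\<And>d. F d \<in> carrier FM; \<And>d. G d \<in> carrier FM\<rbrakk> \<Longrightarrow> Lw a (\<lambda>d. F d \<oplus>\<^bsub>FM\<^esub> G d) = (\<lambda>d. Lw a F d \<oplus>\<^bsub>FM\<^esub> Lw a G d)"
  by (induction a) (simp_all add: L_add Lw_FM)

lemma Lw_uminus: "(\<And>d. F d \<in> carrier FM) \<Longrightarrow> Lw a (\<lambda>d. \<ominus>\<^bsub>FM\<^esub> F d) = (\<lambda>d. \<ominus>\<^bsub>FM\<^esub> Lw a F d)"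
  by (induction a) (simp_all add: L_uminus Lw_FM)

lemma Lw_lm: "\<lbrakk>\<And>d. F d \<in> carrier FM; r \<in> carrier H\<rbrakk> \<Longrightarrow> Lw a (\<lambda>d. lm r (F d)) = (\<lambda>d. lm r (Lw a F d))"
  by (induction a) (simp_all add: L_lm Lw_FM)

definition shF :: "nat \<Rightarrow> (nat \<Rightarrow> 'i list set \<Rightarrow> 'i hhat) \<Rightarrow> nat \<Rightarrow> 'i list set \<Rightarrow> 'i hhat" where
  "shF n F d = (if n \<le> d then F (d - n) else \<zero>\<^bsub>FM\<^esub>)"

lemma shF_at: "shF n F d w = sh n (\<lambda>e. F e w) d"
  by (simp add: shF_def sh_def MR.zero_eq)

lemma L_shF:
  assumes "\<And>d. F d \<in> carrier FM"
  shows "L k (shF n F) = shF n (L k F)"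
proof (intro ext)
  fix d w
  note [simp] = MR.coeff[OF assms]
  have z: "sh n (\<lambda>e. \<zero>\<^bsub>H\<^esub>) d = \<zero>\<^bsub>H\<^esub>" by (simp add: sh_def)
  have "shF n (L k F) d w = sh n (\<lambda>e. L k F e w) d" by (rule shF_at)
  then show "L k (shF n F) d w = shF n (L k F) d w"
    by (cases "w \<in> P"; cases "sg (iv w) (s k)")
      (simp_all add: L_def shF_at sh_add sh_sh add.commute z flip: sh_uminus)
qed

lemma Lw_shF: "(\<And>d. F d \<in> carrier FM) \<Longrightarrow> Lw a (shF n F) = shF n (Lw a F)"
  by (induction a) (simp_all add: L_shF Lw_FM)

text \<open>Each correction in \<open>L\<close> is shifted by a positive exponent and cannot reach
  the lowest coefficient, where only left translation is visible.\<close>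

lemma Lw_low:
  assumes "\<And>e. e < n \<Longrightarrow> F e = \<zero>\<^bsub>FM\<^esub>" "\<And>d. F d \<in> carrier FM" "a \<in> lists J2"
  shows "(\<forall>e<n. Lw a F e = \<zero>\<^bsub>FM\<^esub>) \<and> (\<forall>w\<in>P. Lw a F n w = F n (iv (cl a) \<bullet> w))"
  using assms(3)
proof (induction a)
  case Nil
  then show ?case using assms(1) by (simp flip: one_W)
next
  case (Cons k a)
  then have k: "k \<in> J2" "a \<in> lists J2" "a \<in> lists I" using J2_lists[of a] by auto
  have c: "Lw a F d w \<in> carrier H" for d w using MR.coeff[OF Lw_FM[of F a d]] assms(2) by simp
  have z: "\<And>e w. e < n \<Longrightarrow> Lw a F e w = \<zero>\<^bsub>H\<^esub>" using Cons k by (simp add: MR.zero_eq)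
  have zs: "sh (al k) (\<lambda>e. if sg (iv w) (s k) then Lw a F e w else \<ominus>\<^bsub>H\<^esub> Lw a F e (s k \<bullet> w)) d = \<zero>\<^bsub>H\<^esub>" if "d \<le> n" for d w
    using that al_pos'[OF k(1)] z by (simp add: sh_def)
  have "Lw (k # a) F e = \<zero>\<^bsub>FM\<^esub>" if "e < n" for e
    unfolding MR.zero_eq using that z zs by (intro ext) (simp add: L_def)
  moreover have "Lw (k # a) F n w = F n (iv (cl (k # a)) \<bullet> w)" if w: "w \<in> P" for w
  proof -
    have "Lw (k # a) F n w = Lw a F n (s k \<bullet> w)" using w zs c by (simp add: L_def)
    also have "\<dots> = F n (iv (cl a) \<bullet> (s k \<bullet> w))" using Cons k w by simp
    also have "iv (cl a) \<bullet> (s k \<bullet> w) = iv (cl (k # a)) \<bullet> w"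
      using k w by (simp add: cl_Cons W.inv_mult_group W.m_assoc)
    finally show ?thesis .
  qed
  ultimately show ?case by blast
qed

section \<open>The invariant of the reduction\<close>

abbreviation row where "row x \<equiv> dl e0 \<one>\<^bsub>H\<^esub> \<triangleleft> x"

text \<open>\<open>V1\<close> for all coefficients together with \<open>V2\<close> is the invariant of the reduction: it holds for the difference of
  the two braid words and forces the lowest coefficient to be a combination of elements of \<open>K_pair\<close>.\<close>

definition V1 :: "'i hhat \<Rightarrow> bool" where
  "V1 x \<longleftrightarrow> x \<in> carrier H \<and> tot (row x) = x \<and> Q DF (int M) (row x) \<and> (\<forall>w. ef x w = 0) \<and>
     (\<forall>a\<in>P. Q (\<lambda>_. Dh) 0 (lm (wH a) (dl a \<one>\<^bsub>H\<^esub> \<triangleleft> x)))"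

definition V2 :: "(nat \<Rightarrow> 'i hhat) \<Rightarrow> bool" where
  "V2 B \<longleftrightarrow> (\<forall>x y n d. {x, y} = J2 \<and> n \<le> M \<longrightarrow>
     dl (cl (alt x y n)) \<one>\<^bsub>H\<^esub> \<triangleleft> B d = Lw (alt x y n) (\<lambda>d. row (B d)) d)"

lemma lm_add: "\<lbrakk>r \<in> carrier H; f \<in> carrier FM; g \<in> carrier FM\<rbrakk> \<Longrightarrow> lm r (f \<oplus>\<^bsub>FM\<^esub> g) = lm r f \<oplus>\<^bsub>FM\<^esub> lm r g"
  using MR.coeff[of f] MR.coeff[of g] by (simp add: lm_def FM_add H.r_distr)

lemma lm_uminus: "\<lbrakk>r \<in> carrier H; f \<in> carrier FM\<rbrakk> \<Longrightarrow> lm r (\<ominus>\<^bsub>FM\<^esub> f) = \<ominus>\<^bsub>FM\<^esub> lm r f"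
  using MR.coeff[of f] by (simp add: lm_def MR.uminus_eq[of f] MR.uminus_eq[OF lm_closed, unfolded lm_def] H.r_minus)

lemma V1_closed [simp]: "V1 x \<Longrightarrow> x \<in> carrier H" by (simp add: V1_def)

lemma ef_zero: "ef \<zero>\<^bsub>H\<^esub> w = 0"
  using ef_add[of "\<zero>\<^bsub>H\<^esub>" "\<zero>\<^bsub>H\<^esub>" w] by simp

lemma V1_zero: "V1 \<zero>\<^bsub>H\<^esub>"
proof -
  have l: "lm r \<zero>\<^bsub>FM\<^esub> = \<zero>\<^bsub>FM\<^esub>" if "r \<in> carrier H" for r using that by (simp add: lm_def MR.zero_eq)
  have "tot \<zero>\<^bsub>FM\<^esub> = \<zero>\<^bsub>H\<^esub>" by (simp add: tot_def MR.zero_eq)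
  then show ?thesis unfolding V1_def using Q_zero[OF chain_DF] Q_zero[OF chain_Dh] by (simp add: act_zero l ef_zero)
qed

lemma V1_add: "\<lbrakk>V1 x; V1 y\<rbrakk> \<Longrightarrow> V1 (x \<oplus>\<^bsub>H\<^esub> y)"
  unfolding V1_def by (auto simp: act_add tot_add ef_add lm_add intro!: Q_add[OF chain_DF] Q_add[OF chain_Dh])

lemma V1_uminus: "V1 x \<Longrightarrow> V1 (\<ominus>\<^bsub>H\<^esub> x)"
proof -
  assume x: "V1 x"
  have "ef (\<ominus>\<^bsub>H\<^esub> x) w = 0" for w
    using ef_add[of x "\<ominus>\<^bsub>H\<^esub> x" w] x ef_zero[of w] by (simp add: V1_def H.r_neg)
  then show ?thesis using x unfolding V1_def
    by (auto simp: act_uminus tot_uminus lm_uminus intro!: Q_uminus[OF chain_DF] Q_uminus[OF chain_Dh])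
qed

lemma V2_D: "\<lbrakk>V2 B; {x, y} = J2; n \<le> M\<rbrakk> \<Longrightarrow>
    dl (cl (alt x y n)) \<one>\<^bsub>H\<^esub> \<triangleleft> B d = Lw (alt x y n) (\<lambda>d. row (B d)) d"
  unfolding V2_def by blast

lemma alt_J2: "{x, y} = J2 \<Longrightarrow> alt x y n \<in> lists J2 \<and> alt x y n \<in> lists I \<and> x \<in> J2 \<and> y \<in> J2 \<and> x \<noteq> y"
proof -
  assume e: "{x, y} = J2"
  then have "x \<in> J2" "y \<in> J2" "x \<noteq> y" using i12(3) by (auto simp: doubleton_eq_iff)
  then show ?thesis by simp
qed

lemma V2_add: "\<lbrakk>V2 B; V2 C; \<And>d. B d \<in> carrier H; \<And>d. C d \<in> carrier H\<rbrakk> \<Longrightarrow> V2 (\<lambda>d. B d \<oplus>\<^bsub>H\<^esub> C d)"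
  unfolding V2_def
proof (intro allI impI)
  fix x y n d
  assume a: "\<And>d. B d \<in> carrier H" "\<And>d. C d \<in> carrier H" "{x, y} = J2 \<and> n \<le> M"
    and V: "\<forall>x y n d. {x, y} = J2 \<and> n \<le> M \<longrightarrow> dl (cl (alt x y n)) \<one>\<^bsub>H\<^esub> \<triangleleft> B d = Lw (alt x y n) (\<lambda>d. row (B d)) d"
      "\<forall>x y n d. {x, y} = J2 \<and> n \<le> M \<longrightarrow> dl (cl (alt x y n)) \<one>\<^bsub>H\<^esub> \<triangleleft> C d = Lw (alt x y n) (\<lambda>d. row (C d)) d"
  have "(\<lambda>d. row (B d \<oplus>\<^bsub>H\<^esub> C d)) = (\<lambda>d. row (B d) \<oplus>\<^bsub>FM\<^esub> row (C d))" using a by (intro ext act_add) auto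
  then show "dl (cl (alt x y n)) \<one>\<^bsub>H\<^esub> \<triangleleft> (B d \<oplus>\<^bsub>H\<^esub> C d) = Lw (alt x y n) (\<lambda>d. row (B d \<oplus>\<^bsub>H\<^esub> C d)) d"
    using a V alt_J2[of x y n] by (simp add: act_add Lw_add)
qed

lemma V2_uminus: "\<lbrakk>V2 B; \<And>d. B d \<in> carrier H\<rbrakk> \<Longrightarrow> V2 (\<lambda>d. \<ominus>\<^bsub>H\<^esub> B d)"
  unfolding V2_def
proof (intro allI impI)
  fix x y n d
  assume a: "\<And>d. B d \<in> carrier H" "{x, y} = J2 \<and> n \<le> M"
    and V: "\<forall>x y n d. {x, y} = J2 \<and> n \<le> M \<longrightarrow> dl (cl (alt x y n)) \<one>\<^bsub>H\<^esub> \<triangleleft> B d = Lw (alt x y n) (\<lambda>d. row (B d)) d"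
  have "(\<lambda>d. row (\<ominus>\<^bsub>H\<^esub> B d)) = (\<lambda>d. \<ominus>\<^bsub>FM\<^esub> row (B d))" using a by (intro ext act_uminus) auto
  then show "dl (cl (alt x y n)) \<one>\<^bsub>H\<^esub> \<triangleleft> (\<ominus>\<^bsub>H\<^esub> B d) = Lw (alt x y n) (\<lambda>d. row (\<ominus>\<^bsub>H\<^esub> B d)) d"
    using a V alt_J2[of x y n] by (simp add: act_uminus Lw_uminus)
qed

lemma V2_sh: "\<lbrakk>V2 B; \<And>d. B d \<in> carrier H\<rbrakk> \<Longrightarrow> V2 (sh k B)"
  unfolding V2_def
proof (intro allI impI)
  fix x y n d
  assume a: "\<And>d. B d \<in> carrier H" "{x, y} = J2 \<and> n \<le> M"
    and V: "\<forall>x y n d. {x, y} = J2 \<and> n \<le> M \<longrightarrow> dl (cl (alt x y n)) \<one>\<^bsub>H\<^esub> \<triangleleft> B d = Lw (alt x y n) (\<lambda>d. row (B d)) d"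
  let ?b = "cl (alt x y n)"
  have "(\<lambda>d. dl b \<one>\<^bsub>H\<^esub> \<triangleleft> sh k B d) = shF k (\<lambda>d. dl b \<one>\<^bsub>H\<^esub> \<triangleleft> B d)" if "b \<in> carrier W" for b
    using that by (intro ext) (simp add: sh_def shF_def act_zero)
  note e = this
  have b: "?b \<in> carrier W" using alt_J2[of x y n] a by simp
  have "dl ?b \<one>\<^bsub>H\<^esub> \<triangleleft> sh k B d = shF k (\<lambda>d. dl ?b \<one>\<^bsub>H\<^esub> \<triangleleft> B d) d" using fun_cong[OF e[OF b], of d] .
  also have "(\<lambda>d. dl ?b \<one>\<^bsub>H\<^esub> \<triangleleft> B d) = Lw (alt x y n) (\<lambda>d. row (B d))" by (intro ext V[rule_format] a(2))
  also have "shF k (Lw (alt x y n) (\<lambda>d. row (B d))) = Lw (alt x y n) (shF k (\<lambda>d. row (B d)))"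
    using a by (intro Lw_shF[symmetric]) simp
  also have "shF k (\<lambda>d. row (B d)) = (\<lambda>d. row (sh k B d))" using e[of e0] by simp
  finally show "dl ?b \<one>\<^bsub>H\<^esub> \<triangleleft> sh k B d = Lw (alt x y n) (\<lambda>d. row (sh k B d)) d" .
qed

lemma V_finsum:
  assumes "finite A" "\<And>v d. v \<in> A \<Longrightarrow> V1 (G v d)" "\<And>v. v \<in> A \<Longrightarrow> V2 (G v)"
  shows "(\<forall>d. V1 (\<Oplus>\<^bsub>H\<^esub>v\<in>A. G v d)) \<and> V2 (\<lambda>d. \<Oplus>\<^bsub>H\<^esub>v\<in>A. G v d)"
  using assms
proof (induction A rule: finite_induct)
  case empty
  have "V2 (\<lambda>d. \<zero>\<^bsub>H\<^esub>)"
  proof (unfold V2_def, intro allI impI)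
    fix x y n d assume a: "{x, y} = J2 \<and> n \<le> M"
    have z: "L k (\<lambda>d. \<zero>\<^bsub>FM\<^esub>) = (\<lambda>d. \<zero>\<^bsub>FM\<^esub>)" for k by (intro ext) (simp add: L_def MR.zero_eq sh_def)
    have "Lw u (\<lambda>d. \<zero>\<^bsub>FM\<^esub>) = (\<lambda>d. \<zero>\<^bsub>FM\<^esub>)" for u by (induction u) (simp_all only: Lw.simps z)
    then show "dl (cl (alt x y n)) \<one>\<^bsub>H\<^esub> \<triangleleft> \<zero>\<^bsub>H\<^esub> = Lw (alt x y n) (\<lambda>d. row \<zero>\<^bsub>H\<^esub>) d"
      using a alt_J2[of x y n] by (simp add: act_zero)
  qed
  then show ?case using V1_zero by simp
next
  case (insert a A)
  have c: "\<And>v d. v \<in> insert a A \<Longrightarrow> G v d \<in> carrier H" using insert.prems by simp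
  have "(\<Oplus>\<^bsub>H\<^esub>v\<in>insert a A. G v d) = G a d \<oplus>\<^bsub>H\<^esub> (\<Oplus>\<^bsub>H\<^esub>v\<in>A. G v d)" for d
    using insert.hyps c by (intro H.finsum_insert) auto
  then show ?case using insert c by (auto intro!: V1_add V2_add)
qed

lemma Q_dl: "\<lbrakk>chain C; a \<in> P; r \<in> carrier H; r \<star> wH (iv a) \<in> C (z - int (len a))\<rbrakk> \<Longrightarrow> Q C z (dl a r)"
  unfolding Q_def by (auto simp: mterm_def chainD(2))

lemma tot_dl: "\<lbrakk>a \<in> P; r \<in> carrier H\<rbrakk> \<Longrightarrow> tot (dl a r) = r"
  unfolding tot_def mterm_def using finite_P H.add.finprod_singleton_swap[of a P "\<lambda>_. r"]
  by (simp add: finsum_def)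

lemma Tc_row:
  assumes u: "u \<in> lists J2"
  shows "tot (row (Tc u d)) = Tc u d" "Q DF (int (length u)) (row (Tc u d))"
    "a \<in> P \<Longrightarrow> Q (\<lambda>_. Dh) 0 (lm (wH a) (dl a \<one>\<^bsub>H\<^esub> \<triangleleft> Tc u d))"
proof -
  have uI: "u \<in> lists I" using J2_lists[OF u] .
  show "tot (row (Tc u d)) = Tc u d" using u uI by (simp add: tot_Tc tot_dl)
  have "Q DF 0 (dl e0 \<one>\<^bsub>H\<^esub>)" using DF_wprod[of "[]" 0] by (intro Q_dl chain_DF) auto
  then show "Q DF (int (length u)) (row (Tc u d))" using Q_Tc[OF chain_DF _ _ u, of "dl e0 \<one>\<^bsub>H\<^esub>" 0 d] by simp
  assume a: "a \<in> P"
  have "lm (wH a) (dl a \<one>\<^bsub>H\<^esub> \<triangleleft> Tc u d) = dl a (wH a) \<triangleleft> Tc u d"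
    using a uI by (simp add: lm_dl flip: lm_act)
  moreover have "Q (\<lambda>_. Dh) 0 (dl a (wH a))" using a Dhat_rules(1) by (intro Q_dl chain_Dh) auto
  ultimately show "Q (\<lambda>_. Dh) 0 (lm (wH a) (dl a \<one>\<^bsub>H\<^esub> \<triangleleft> Tc u d))"
    using Q_Tc[OF chain_Dh _ _ u, of "dl a (wH a)" 0 d] a by (simp add: Q_def)
qed

text \<open>By \<open>dl_Kalg\<close> the element \<open>k\<close> replaces the coefficient 1 at
  \<open>a\<close> by \<open>k\<close>. As a left factor it then commutes with the action of
  \<open>x\<close>.\<close>

lemma K_row: "\<lbrakk>k \<in> Kalg I m J2; a \<in> carrier W; x \<in> carrier H\<rbrakk> \<Longrightarrow> dl a \<one>\<^bsub>H\<^esub> \<triangleleft> (k \<star> x) = lm k (dl a \<one>\<^bsub>H\<^esub> \<triangleleft> x)"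
proof -
  assume k: "k \<in> Kalg I m J2" and a: "a \<in> carrier W" and x: "x \<in> carrier H"
  have kc: "k \<in> carrier H" using k Kalg_iff[OF J2I] by blast
  have "dl a \<one>\<^bsub>H\<^esub> \<triangleleft> (k \<star> x) = dl a k \<triangleleft> x"
    using dl_Kalg[of k a "\<one>\<^bsub>H\<^esub>"] Kalg_mono[OF J2I] k a x kc by (simp add: act_mult subset_iff)
  also have "dl a k = lm k (dl a \<one>\<^bsub>H\<^esub>)" using kc lm_dl[of k "\<one>\<^bsub>H\<^esub>" a] by (simp only: H.r_one)
  finally show ?thesis using kc a x by (simp add: lm_act)
qed

text \<open>The bound M - length u for \<open>k\<close> and the bound length u - len w for the
  coefficients of \<open>Tc u\<close> add up to M - len w. Membership in \<open>Dh\<close> is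
  inherited by inserting a^-1 a between the factors, as a k a^-1 lies in \<open>Dh\<close>; the
  counits vanish with that of \<open>k\<close>.\<close>

lemma V_K_Tc:
  assumes k: "k \<in> Kalg I m J2" "eps k = 0" "k \<in> DF (int M - int (length u))" and u: "u \<in> lists J2"
  shows "V1 (k \<star> Tc u d)" "V2 (\<lambda>d. k \<star> Tc u d)"
proof -
  have uI: "u \<in> lists I" using J2_lists[OF u] .
  have kc: "k \<in> carrier H" using k Kalg_iff[OF J2I] by blast
  have T: "Tc u d \<in> carrier H" for d using uI by simp
  note r = K_row[OF k(1)]
  have rc: "(dl a \<one>\<^bsub>H\<^esub> \<triangleleft> Tc u d) w \<in> carrier H" if "a \<in> carrier W" for a w using that T MR.coeff by simp
  have "tot (row (k \<star> Tc u d)) = k \<star> Tc u d" using r[of e0] T kc Tc_row[OF u] by (simp add: tot_lm)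
  moreover have "Q DF (int M) (row (k \<star> Tc u d))"
    unfolding Q_def r[OF W.one_closed T] lm_def
  proof (intro allI conjI impI)
    fix w assume w: "w \<in> P"
    have "row (Tc u d) w \<star> wH (iv w) \<in> DF (int (length u) - int (len w))" using Tc_row(2)[OF u] w by (intro QD)
    then have "k \<star> (row (Tc u d) w \<star> wH (iv w)) \<in> DF ((int M - int (length u)) + (int (length u) - int (len w)))"
      using k(3) by (intro DF_mult)
    then show "k \<star> row (Tc u d) w \<star> wH (iv w) \<in> DF (int M - int (len w))"
      using kc rc[of e0] w by (simp add: H.m_assoc)
  next
    fix w assume "w \<notin> P"
    then show "k \<star> row (Tc u d) w = \<zero>\<^bsub>H\<^esub>" using QD(2)[OF Tc_row(2)[OF u]] kc by simp
  qed
  moreover have "ef (k \<star> Tc u d) w = 0" for w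
    unfolding ef_def r[OF W.one_closed T] lm_def using k rc[of e0] kc by simp
  moreover have "Q (\<lambda>_. Dh) 0 (lm (wH a) (dl a \<one>\<^bsub>H\<^esub> \<triangleleft> (k \<star> Tc u d)))" if a: "a \<in> P" for a
  proof -
    have ac: "a \<in> carrier W" using a by simp
    show ?thesis
      unfolding Q_def r[OF ac T] lm_def
    proof (intro allI conjI impI)
      fix w assume w: "w \<in> P"
      let ?f = "(dl a \<one>\<^bsub>H\<^esub> \<triangleleft> Tc u d) w"
      have "wH a \<star> ?f \<star> wH (iv w) \<in> Dh" using QD(1)[OF Tc_row(3)[OF u a] w] by (simp add: lm_def)
      moreover have "wH a \<star> k \<star> wH (iv a) \<in> Dh" using k(1) a Kalg_iff[OF J2I] by blast
      ultimately have "(wH a \<star> k \<star> wH (iv a)) \<star> (wH a \<star> ?f \<star> wH (iv w)) \<in> Dh" by (rule Dhat_rules(4)[rotated])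
      then show "wH a \<star> (k \<star> ?f) \<star> wH (iv w) \<in> Dh" using kc rc[OF ac] ac w by (simp add: H.m_assoc)
    next
      fix w assume "w \<notin> P"
      then have "wH a \<star> (dl a \<one>\<^bsub>H\<^esub> \<triangleleft> Tc u d) w = \<zero>\<^bsub>H\<^esub>" using QD(2)[OF Tc_row(3)[OF u a]] by (simp add: lm_def)
      then have "wH (iv a) \<star> (wH a \<star> (dl a \<one>\<^bsub>H\<^esub> \<triangleleft> Tc u d) w) = \<zero>\<^bsub>H\<^esub>" using ac by simp
      then have "(dl a \<one>\<^bsub>H\<^esub> \<triangleleft> Tc u d) w = \<zero>\<^bsub>H\<^esub>" using ac rc by simp
      then show "wH a \<star> (k \<star> (dl a \<one>\<^bsub>H\<^esub> \<triangleleft> Tc u d) w) = \<zero>\<^bsub>H\<^esub>" using kc ac by simp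
    qed
  qed
  ultimately show "V1 (k \<star> Tc u d)" unfolding V1_def using kc T by blast
  show "V2 (\<lambda>d. k \<star> Tc u d)"
    unfolding V2_def
  proof (intro allI impI)
    fix x y n d assume a: "{x, y} = J2 \<and> n \<le> M"
    then have xy: "alt x y n \<in> lists I" "x \<in> J2" "y \<in> J2" "x \<noteq> y" using alt_J2[of x y n] by auto
    have "dl (cl (alt x y n)) \<one>\<^bsub>H\<^esub> \<triangleleft> (k \<star> Tc u d) = lm k (Lw (alt x y n) (\<lambda>d. row (Tc u d)) d)"
      using theta_Tc[OF xy(2-4) _ u] a r[of "cl (alt x y n)"] xy T by simp
    also have "\<dots> = Lw (alt x y n) (\<lambda>d. lm k (row (Tc u d))) d"
      using fun_cong[OF Lw_lm[of "\<lambda>d. row (Tc u d)" k "alt x y n"], of d] T kc by simp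
    also have "(\<lambda>d. lm k (row (Tc u d))) = (\<lambda>d. row (k \<star> Tc u d))" using r[of e0] T by (intro ext) simp
    finally show "dl (cl (alt x y n)) \<one>\<^bsub>H\<^esub> \<triangleleft> (k \<star> Tc u d) = Lw (alt x y n) (\<lambda>d. row (k \<star> Tc u d)) d" .
  qed
qed

end

lemma (in ideal) ideal_finsum_closed:
  assumes "\<And>v. v \<in> A \<Longrightarrow> g v \<in> I"
  shows "(\<Oplus>v\<in>A. g v) \<in> I"
proof (cases "finite A")
  case True
  then show ?thesis using assms
  proof (induction A rule: finite_induct)
    case (insert a A)
    have "(\<Oplus>v\<in>insert a A. g v) = g a \<oplus> (\<Oplus>v\<in>A. g v)" using insert Icarr by (intro finsum_insert) auto
    then show ?case using insert by simp
  qed simp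
next
  case False
  then show ?thesis by (simp add: finsum_infinite)
qed

section \<open>Reduction of the braid difference modulo the ideal\<close>

context dihedral_pair begin

lemma len_alt: "\<lbrakk>{a, b} = J2; n \<le> M\<rbrakk> \<Longrightarrow> len (cl (rev (alt a b n))) = n"
  using len_coset[of e0 a b n] alt_J2[of a b n] m_J2[of a b] by simp

lemma Tc_0: "u \<in> lists J2 \<Longrightarrow> Tc u 0 = wH (cl (rev u))"
proof (induction u)
  case Nil
  then show ?case by (simp flip: one_W)
next
  case (Cons i u)
  then have u: "u \<in> lists I" "rev u \<in> lists I" "i \<in> J2" "i \<in> I" using J2_lists[of u] by auto
  then show ?case using Cons al_pos'[OF u(3)] by (simp add: sh_def cl_append wH_mult wH_s flip: s_def)
qed

text \<open>An alternating word of length at most M is reduced, and the constant coefficient of its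
  product is the group element itself.\<close>

lemma ex_word: "v \<in> P \<Longrightarrow> \<exists>u. u \<in> lists J2 \<and> length u = len v \<and> Tc u 0 = wH v \<and> len v \<le> M"
proof -
  assume "v \<in> P"
  then obtain a b n where ab: "{a, b} = J2" "v = cl (rev (alt a b n))" "n \<le> M"
    using parabolic_alt[OF i12] mne by blast
  have "alt a b n \<in> lists J2" using alt_J2[OF ab(1)] by blast
  moreover have "len v = n" using len_alt[OF ab(1,3)] ab(2) by simp
  ultimately show ?thesis using ab Tc_0[of "alt a b n"] by (intro exI[of _ "alt a b n"]) auto
qed

text \<open>\<open>k\<close> is the coefficient at \<open>v\<close> with \<open>v\<close> divided
  off. The filtration bounds its degree and \<open>ef\<close> gives its counit. For a conjugate by
  \<open>a\<close>, the coefficient of the action on \<open>a\<close> at a v equals the one of the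
  action on 1 at \<open>v\<close>, and the bound in \<open>Dh\<close> for the former is the
  assertion about a k a^-1.\<close>

lemma lowest_coeff:
  assumes B: "\<And>d. V1 (B d)" "V2 B" "\<And>e. e < n \<Longrightarrow> B e = \<zero>\<^bsub>H\<^esub>" and v: "v \<in> P"
  defines "k \<equiv> row (B n) v \<star> wH (iv v)"
  shows "k \<in> K_pair I m i1 i2" "k \<in> DF (int M - int (len v))" "k \<star> wH v = row (B n) v"
proof -
  have Bc: "B d \<in> carrier H" for d using B(1) by simp
  have vc: "v \<in> carrier W" using v by simp
  have kc: "k \<in> carrier H" using Bc vc by (simp add: k_def)
  show kv: "k \<star> wH v = row (B n) v" using Bc vc by (simp add: k_def H.m_assoc)
  show kD: "k \<in> DF (int M - int (len v))" using B(1)[of n] v unfolding k_def V1_def by (blast intro: QD)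
  have "k \<in> DF (int M)" using chain_mono[OF chain_DF _ kD] by simp
  then have "k \<in> Dhat_deg_le I m M" by (rule DF_deg)
  moreover have "eps k = 0"
  proof -
    have "eps (row (B n) v) = 0" using B(1)[of n] unfolding V1_def ef_def by blast
    then show ?thesis using Bc vc by (simp add: k_def)
  qed
  then have "k \<in> Ker_counit I m" using kc by (simp add: Ker_counit_def)
  moreover have "k \<in> Kalg I m J2"
    unfolding Kalg_iff[OF J2I]
  proof (intro conjI ballI kc)
    fix a assume a: "a \<in> P"
    then obtain x y l where xy: "{x, y} = J2" "a = cl (alt x y l)" "l \<le> M" using P_alt by blast
    have ac: "a \<in> carrier W" using a by simp
    have av: "a \<bullet> v \<in> P" using a v by simp
    have rz: "row (B e) = \<zero>\<^bsub>FM\<^esub>" if "e < n" for e using B(3)[OF that] by (simp add: act_zero)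
    \<comment> \<open>\<open>V2\<close> expresses the action on \<open>a\<close> by left operators;
      all lower coefficients vanish, so \<open>Lw_low\<close> replaces these operators by
      translation.\<close>
    have "(dl a \<one>\<^bsub>H\<^esub> \<triangleleft> B n) (a \<bullet> v) = Lw (alt x y l) (\<lambda>d. row (B d)) n (a \<bullet> v)"
      using V2_D[OF B(2) xy(1,3), of n] xy(2) by simp
    also have "\<dots> = row (B n) (iv a \<bullet> (a \<bullet> v))"
      using Lw_low[of n "\<lambda>d. row (B d)" "alt x y l"] rz Bc av alt_J2[OF xy(1), of l] xy(2) by simp
    also have "\<dots> = row (B n) v" using ac vc by simp
    finally have e: "(dl a \<one>\<^bsub>H\<^esub> \<triangleleft> B n) (a \<bullet> v) = row (B n) v" .
    have "Q (\<lambda>_. Dh) 0 (lm (wH a) (dl a \<one>\<^bsub>H\<^esub> \<triangleleft> B n))" using B(1)[of n] a unfolding V1_def by blast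
    from QD(1)[OF this av] have "wH a \<star> row (B n) v \<star> wH (iv (a \<bullet> v)) \<in> Dh" unfolding lm_def e .
    moreover have "wH (iv (a \<bullet> v)) = wH (iv v) \<star> wH (iv a)" using ac vc by (simp add: W.inv_mult_group wH_mult)
    ultimately show "wH a \<star> k \<star> wH (iv a) \<in> Dh" using ac vc Bc by (simp add: k_def H.m_assoc)
  qed
  ultimately show "k \<in> K_pair I m i1 i2" by (simp add: K_pair_def)
qed

lemma K_pair_J_pairs: "K_pair I m i1 i2 \<subseteq> J_pairs I m"
  unfolding J_pairs_def using i12 by (intro order.trans[OF _ H.genideal_self[OF K_pairs_closed]]) blast

lemma V_reduce:
  assumes B: "\<And>d. V1 (B d)" "V2 B" "\<forall>e<n. B e = \<zero>\<^bsub>H\<^esub>"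
  shows "\<exists>C. (\<forall>d. V1 (C d)) \<and> V2 C \<and> (\<forall>e\<le>n. C e = \<zero>\<^bsub>H\<^esub>) \<and> (\<forall>d. \<exists>j\<in>J_pairs I m. B d = C d \<oplus>\<^bsub>H\<^esub> j)"
proof -
  interpret J: ideal "J_pairs I m" H by (rule J_pairs_ideal)
  define k where "k v = row (B n) v \<star> wH (iv v)" for v
  have k: "k v \<in> K_pair I m i1 i2" "k v \<in> DF (int M - int (len v))" "k v \<star> wH v = row (B n) v" if "v \<in> P" for v
    unfolding k_def using lowest_coeff[OF B(1,2) _ that, of n] B(3) by simp_all
  obtain z where z: "\<And>v. v \<in> P \<Longrightarrow> z v \<in> lists J2 \<and> length (z v) = len v \<and> Tc (z v) 0 = wH v"
    using ex_word by metis
  define G where "G v = sh n (\<lambda>d. k v \<star> Tc (z v) d)" for v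
  define E where "E d = (\<Oplus>\<^bsub>H\<^esub>v\<in>P. G v d)" for d
  have Bc: "B d \<in> carrier H" for d using B(1) by simp
  have KV: "V1 (k v \<star> Tc (z v) d)" "V2 (\<lambda>d. k v \<star> Tc (z v) d)" if v: "v \<in> P" for v d
  proof -
    have "k v \<in> Kalg I m J2" "eps (k v) = 0" using k(1)[OF v] by (simp_all add: K_pair_def Ker_counit_def)
    then show "V1 (k v \<star> Tc (z v) d)" "V2 (\<lambda>d. k v \<star> Tc (z v) d)" using k(2)[OF v] z[OF v] by (intro V_K_Tc; simp)+
  qed
  have G1: "V1 (G v d)" if "v \<in> P" for v d using KV(1)[OF that] V1_zero by (simp add: G_def sh_def)
  have G2: "V2 (G v)" if "v \<in> P" for v unfolding G_def using KV[OF that] by (intro V2_sh) auto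
  have E: "V1 (E d)" "V2 E" for d
    using V_finsum[OF finite_P, of G] G1 G2 unfolding E_def by auto
  have EJ: "E d \<in> J_pairs I m" for d
    unfolding E_def
  proof (rule J.ideal_finsum_closed)
    fix v assume v: "v \<in> P"
    have "Tc (z v) e \<in> carrier H" for e using z[OF v] J2_lists by simp
    then show "G v d \<in> J_pairs I m" using k(1)[OF v] K_pair_J_pairs J.I_r_closed J.zero_closed
      by (auto simp: G_def sh_def)
  qed
  have E0: "E e = \<zero>\<^bsub>H\<^esub>" if "e < n" for e unfolding E_def G_def sh_def using that by simp
  \<comment> \<open>The constant coefficient of \<open>Tc (z v)\<close> is \<open>wH v\<close>, so
    degree n of the correction is the sum of the k_v v, that is, the sum of all coefficients of
    \<open>row (B n)\<close>, which is \<open>B n\<close> by \<open>V1\<close>.\<close>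
  have En: "E n = B n"
  proof -
    have "E n = (\<Oplus>\<^bsub>H\<^esub>v\<in>P. row (B n) v)"
      unfolding E_def using z k(3) Bc by (intro H.finsum_cong') (auto simp: G_def sh_def)
    also have "\<dots> = B n" using B(1)[of n] by (simp add: V1_def tot_def)
    finally show ?thesis .
  qed
  let ?C = "\<lambda>d. B d \<oplus>\<^bsub>H\<^esub> \<ominus>\<^bsub>H\<^esub> E d"
  have "\<forall>d. V1 (?C d)" using B E by (intro allI V1_add V1_uminus)
  moreover have "V2 ?C" using B E Bc by (intro V2_add V2_uminus) auto
  moreover have "\<forall>e\<le>n. ?C e = \<zero>\<^bsub>H\<^esub>"
  proof (intro allI impI)
    fix e assume "e \<le> n"
    then consider "e < n" | "e = n" by linarith
    then show "?C e = \<zero>\<^bsub>H\<^esub>" by cases (use B(3) E0 En Bc in \<open>simp_all add: H.r_neg\<close>)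
  qed
  moreover have "\<forall>d. \<exists>j\<in>J_pairs I m. B d = ?C d \<oplus>\<^bsub>H\<^esub> j"
  proof
    show "\<exists>j\<in>J_pairs I m. B d = ?C d \<oplus>\<^bsub>H\<^esub> j" for d
      using Bc E by (intro bexI[OF _ EJ[of d]]) (simp add: H.a_assoc H.l_neg)
  qed
  ultimately show ?thesis by (intro exI[of _ ?C] conjI)
qed

text \<open>Every reduction clears one more degree and changes each coefficient by an element of the
  ideal only. A fixed coefficient is cleared after finitely many steps, so convergence of series
  does not arise.\<close>

lemma V_J_pairs:
  assumes "\<And>d. V1 (B d)" "V2 B" "\<forall>e<n. B e = \<zero>\<^bsub>H\<^esub>"
  shows "B (n + j) \<in> J_pairs I m"
  using assms
proof (induction j arbitrary: n B)
  case 0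
  interpret J: ideal "J_pairs I m" H by (rule J_pairs_ideal)
  obtain C where "\<forall>e\<le>n. C e = \<zero>\<^bsub>H\<^esub>" "\<forall>d. \<exists>j\<in>J_pairs I m. B d = C d \<oplus>\<^bsub>H\<^esub> j"
    using V_reduce[OF 0] by (elim exE conjE) (rule that)
  then obtain j where C: "C n = \<zero>\<^bsub>H\<^esub>" and j: "j \<in> J_pairs I m" "B n = C n \<oplus>\<^bsub>H\<^esub> j" by blast
  have "B n = j" using j(2) J.Icarr[OF j(1)] by (simp only: C H.l_zero)
  then show ?case using j(1) by simp
next
  case (Suc j)
  interpret J: ideal "J_pairs I m" H by (rule J_pairs_ideal)
  obtain C where C: "\<forall>d. V1 (C d)" "V2 C" "\<forall>e\<le>n. C e = \<zero>\<^bsub>H\<^esub>" "\<forall>d. \<exists>j\<in>J_pairs I m. B d = C d \<oplus>\<^bsub>H\<^esub> j"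
    using V_reduce[OF Suc.prems] by (elim exE conjE) (rule that)
  have "C (Suc n + j) \<in> J_pairs I m" using C(1-3) by (intro Suc.IH) (simp_all add: less_Suc_eq_le)
  moreover obtain j' where "j' \<in> J_pairs I m" "B (n + Suc j) = C (n + Suc j) \<oplus>\<^bsub>H\<^esub> j'" using C(4) by blast
  ultimately show ?case using J.a_closed by simp
qed

text \<open>Alternating words up to length M are reduced. So each D_x meets an element for which s_x
  is an ascent and annihilates it; only the product of the s_x survives.\<close>

lemma ef_Tc: "\<lbrakk>{x, y} = J2; n \<le> M\<rbrakk> \<Longrightarrow>
   ef (Tc (alt x y n) d) w = (if d = 0 \<and> w = cl (rev (alt x y n)) then 1 else 0)"
proof (induction n arbitrary: x y d w)
  case 0
  have "ef \<one>\<^bsub>H\<^esub> v = (if v = e0 then 1 else 0)" for v using fun_cong[OF ef_w[of e0], of v] by (simp add: mterm_def)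
  then show ?case by (simp add: ef_zero flip: one_W)
next
  case (Suc n)
  have yx: "{y, x} = J2" using Suc.prems(1) by (simp only: insert_commute)
  have xy: "x \<in> I" "y \<in> I" "x \<in> J2" "y \<in> J2" "x \<noteq> y" and l: "alt y x n \<in> lists I"
    using alt_J2[OF yx] by auto
  let ?u = "alt y x n" and ?b = "cl (rev (alt y x n))"
  have T: "Tc ?u e \<in> carrier H" for e using l by simp
  have b: "?b \<in> carrier W" using l by simp
  have IH: "ef (Tc ?u e) v = (if e = 0 \<and> v = ?b then 1 else 0)" for e v using Suc.IH[OF yx] Suc.prems by simp
  have nb: "\<not> sg ?b (s x)" using xy m_J2[of y x] Suc.prems by (intro alt_up) auto
  have B: "cl (rev (alt x y (Suc n))) = ?b \<bullet> s x" using l xy by (simp add: cl_append s_def)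
  show ?case
  proof (cases "w \<in> carrier W")
    case True
    have e: "w \<bullet> s x = ?b \<longleftrightarrow> w = ?b \<bullet> s x" using True b xy by (metis s_s_right)
    have 1: "ef (Tc ?u d \<star> hs x) w = (if d = 0 \<and> w = ?b \<bullet> s x then 1 else 0)"
      using True xy T by (simp add: ef_s IH e)
    have 2: "ef (Tc ?u c \<star> hD x) w = 0" for c
    proof -
      have "sg w (s x)" if "w \<bullet> s x = ?b" using that nb sg_mult_s[of w x] True xy by simp
      then show ?thesis using True xy T nb by (auto simp: ef_d IH)
    qed
    have "ef (Tc (alt x y (Suc n)) d) w = ef (Tc ?u d \<star> hs x) w + ef (sh (al x) (\<lambda>e. Tc ?u e \<star> hD x) d) w"
      using T xy by (simp add: ef_add)
    then show ?thesis using 1 2 B by (simp add: sh_def ef_zero)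
  next
    case False
    have "alt x y (Suc n) \<in> lists I" using alt_J2[OF Suc.prems(1)] by blast
    moreover have "w \<noteq> cl (rev (alt x y (Suc n)))" using False B b xy by auto
    ultimately show ?thesis using False ef_outside[of "Tc (alt x y (Suc n)) d" w] by (simp del: alt.simps)
  qed
qed

text \<open>Both words satisfy all conditions of the invariant except the vanishing of
  \<open>ef\<close>. This holds for their difference, because the two alternating words of length M
  represent the same group element.\<close>

theorem braid_J_pairs: "Tc (alt i1 i2 M) d \<ominus>\<^bsub>H\<^esub> Tc (alt i2 i1 M) d \<in> J_pairs I m"
proof -
  let ?u = "alt i1 i2 M" and ?v = "alt i2 i1 M"
  define B where "B d = Tc ?u d \<oplus>\<^bsub>H\<^esub> \<ominus>\<^bsub>H\<^esub> Tc ?v d" for d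
  have vu: "{i2, i1} = J2" by (rule insert_commute)
  have u: "?u \<in> lists J2" "?u \<in> lists I" and v: "?v \<in> lists J2" "?v \<in> lists I" using alt_J2[of i1 i2 M] alt_J2[OF vu, of M] by blast+
  have T: "Tc ?u d \<in> carrier H" "Tc ?v d \<in> carrier H" for d using u v by simp_all
  have e: "ef (Tc ?u d) w = ef (Tc ?v d) w" for d w
    using ef_Tc[of i1 i2 M d w] ef_Tc[OF vu, of M d w] braid_W_rev[OF i12(1,2)] m_sym[OF i12(1,2)] by simp
  have "V2 (Tc w)" if "w \<in> lists J2" for w
    unfolding V2_def
  proof (intro allI impI)
    fix x y n d assume a: "{x, y} = J2 \<and> n \<le> M"
    then have "x \<in> J2" "y \<in> J2" "x \<noteq> y" using alt_J2[of x y] by blast+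
    then show "dl (cl (alt x y n)) \<one>\<^bsub>H\<^esub> \<triangleleft> Tc w d = Lw (alt x y n) (\<lambda>d. row (Tc w d)) d"
      using theta_Tc[of x y n w d] a that by metis
  qed
  then have "V2 B" unfolding B_def using u v T by (intro V2_add V2_uminus) auto
  moreover have "V1 (B d)" for d
    unfolding V1_def
  proof (intro conjI allI ballI)
    note [simp] = T
    have q: "Q DF (int M) (row (Tc ?u d))" "Q DF (int M) (row (Tc ?v d))"
      using Tc_row(2)[OF u(1), of d] Tc_row(2)[OF v(1), of d] by simp_all
    show "B d \<in> carrier H" by (simp add: B_def)
    show "tot (row (B d)) = B d"
      using Tc_row(1)[OF u(1), of d] Tc_row(1)[OF v(1), of d] by (simp add: B_def act_add act_uminus tot_add tot_uminus)
    show "Q DF (int M) (row (B d))"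
      using q by (simp add: B_def act_add act_uminus Q_add[OF chain_DF] Q_uminus[OF chain_DF])
    show "ef (B d) w = 0" for w
    proof -
      have "ef (\<ominus>\<^bsub>H\<^esub> Tc ?v d) w = - ef (Tc ?v d) w"
        using ef_add[of "Tc ?v d" "\<ominus>\<^bsub>H\<^esub> Tc ?v d" w] by (simp add: H.r_neg ef_zero)
      then show ?thesis using e by (simp add: B_def ef_add)
    qed
    fix a assume a: "a \<in> P"
    then show "Q (\<lambda>_. Dh) 0 (lm (wH a) (dl a \<one>\<^bsub>H\<^esub> \<triangleleft> B d))"
      using Tc_row(3)[OF u(1) a, of d] Tc_row(3)[OF v(1) a, of d]
      by (simp add: B_def act_add act_uminus lm_add lm_uminus Q_add[OF chain_Dh] Q_uminus[OF chain_Dh])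
  qed
  ultimately have "B (0 + d) \<in> J_pairs I m" by (intro V_J_pairs) auto
  then show ?thesis by (simp add: B_def a_minus_def)
qed

end

section \<open>Hecke algebras\<close>

locale hecke = coxeter I m + K: cring K
  for I :: "'i set" and m and K :: "('k, 'b) ring_scheme" and q +
  assumes q_closed [simp, intro]: "i \<in> I \<Longrightarrow> q i \<in> carrier K"
    and q_odd: "\<lbrakk>i \<in> I; j \<in> I; odd (m i j)\<rbrakk> \<Longrightarrow> q i = q j"

text \<open>The properties of the projection onto either of the two quotients that the arguments need.\<close>

locale hecke_target = hecke I m K q + t: ring_homo "Hhat I m" A t
  for I :: "'i set" and m and K :: "('k, 'b) ring_scheme" and q and A :: "('a, 'n) ring_scheme" and t +
  assumes t_surj: "carrier A = t ` carrier (Hhat I m)"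
    and t_J: "x \<in> J_pairs I m \<Longrightarrow> t x = \<zero>\<^bsub>A\<^esub>"
    and t_ef: "\<lbrakk>x \<in> carrier (Hhat I m); t x = \<zero>\<^bsub>A\<^esub>\<rbrakk> \<Longrightarrow> coxeter.ef I m x w = 0"
begin

sublocale TE: tensor_rings A K
  by (intro tensor_rings.intro t.A.ring_axioms K.ring_axioms)

abbreviation pk where "pk x c \<equiv> pure A K (t x) c"

definition gT where "gT i = pk (hs i) \<one>\<^bsub>K\<^esub> \<oplus>\<^bsub>TE.T\<^esub> pk (hD i) (\<one>\<^bsub>K\<^esub> \<ominus>\<^bsub>K\<^esub> q i)"

lemma qc [simp]: "i \<in> I \<Longrightarrow> \<one>\<^bsub>K\<^esub> \<ominus>\<^bsub>K\<^esub> q i \<in> carrier K" by simp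

lemma gT_closed [simp]: "i \<in> I \<Longrightarrow> gT i \<in> carrier TE.T"
  by (simp add: gT_def)

lemma scalar_hom: "pure A K \<one>\<^bsub>A\<^esub> \<in> ring_hom K TE.T"
  by (rule ring_hom_memI) (auto simp: TE.pure_mult TE.pure_add_right TE.pure_one)

lemma scalar_central: "\<lbrakk>c \<in> carrier K; y \<in> carrier TE.T\<rbrakk> \<Longrightarrow> pure A K \<one>\<^bsub>A\<^esub> c \<otimes>\<^bsub>TE.T\<^esub> y = y \<otimes>\<^bsub>TE.T\<^esub> pure A K \<one>\<^bsub>A\<^esub> c"
proof -
  assume c: "c \<in> carrier K" and y: "y \<in> carrier TE.T"
  from y show ?thesis using c
    by (induction rule: TE.T_induct) (simp_all add: TE.pure_mult K.m_comm TE.T.l_distr TE.T.r_distr)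
qed

lemma gT_mult_right:
  assumes "x \<in> carrier H" "c \<in> carrier K" "i \<in> I"
  shows "pk x c \<otimes>\<^bsub>TE.T\<^esub> gT i = pk (x \<star> hs i) c \<oplus>\<^bsub>TE.T\<^esub> pk (x \<star> hD i) (c \<otimes>\<^bsub>K\<^esub> (\<one>\<^bsub>K\<^esub> \<ominus>\<^bsub>K\<^esub> q i))"
  using assms by (simp add: gT_def TE.T.r_distr TE.pure_mult)

text \<open>With c = 1 - q_i the relations give (s + c D)^2 = 1 + c (s D + D s) + c^2 D = 1 + c (s -
  1) + c^2 D = c (s + c D) + (1 - c).\<close>

lemma gT_quadratic:
  assumes i: "i \<in> I"
  shows "gT i \<otimes>\<^bsub>TE.T\<^esub> gT i = pure A K \<one>\<^bsub>A\<^esub> (\<one>\<^bsub>K\<^esub> \<ominus>\<^bsub>K\<^esub> q i) \<otimes>\<^bsub>TE.T\<^esub> gT i \<oplus>\<^bsub>TE.T\<^esub> pure A K \<one>\<^bsub>A\<^esub> (q i)"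
proof -
  define c where "c = \<one>\<^bsub>K\<^esub> \<ominus>\<^bsub>K\<^esub> q i"
  have c: "c \<in> carrier K" and qi: "q i \<in> carrier K" using i by (simp_all add: c_def)
  have qe: "q i = \<one>\<^bsub>K\<^esub> \<oplus>\<^bsub>K\<^esub> \<ominus>\<^bsub>K\<^esub> c"
    using qi unfolding c_def by (simp add: a_minus_def K.minus_add K.r_neg2)
  interpret P1: abgroup_hom K TE.T "pure A K \<one>\<^bsub>A\<^esub>" by (rule TE.pure_right_hom) simp
  interpret PC: abgroup_hom A TE.T "\<lambda>a. pure A K a c" by (rule TE.pure_left_hom) (rule c)
  have sd: "pk (hs i \<star> hD i) c \<oplus>\<^bsub>TE.T\<^esub> pk (hD i \<star> hs i) c = pk (hs i) c \<oplus>\<^bsub>TE.T\<^esub> \<ominus>\<^bsub>TE.T\<^esub> pure A K \<one>\<^bsub>A\<^esub> c"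
  proof -
    have "pk (hs i \<star> hD i) c \<oplus>\<^bsub>TE.T\<^esub> pk (hD i \<star> hs i) c = pk (hs i \<star> hD i \<oplus>\<^bsub>H\<^esub> hD i \<star> hs i) c"
      using i c by simp
    also have "\<dots> = pk (hs i) c \<oplus>\<^bsub>TE.T\<^esub> \<ominus>\<^bsub>TE.T\<^esub> pure A K \<one>\<^bsub>A\<^esub> c"
      unfolding hs_hd[OF i] using i c by (simp add: a_minus_def)
    finally show ?thesis .
  qed
  have cl: "pk (hs i) c \<in> carrier TE.T" "pk (hD i) (c \<otimes>\<^bsub>K\<^esub> c) \<in> carrier TE.T" "pk (hs i \<star> hD i) c \<in> carrier TE.T"
    "pk (hD i \<star> hs i) c \<in> carrier TE.T" "pk \<one>\<^bsub>H\<^esub> \<one>\<^bsub>K\<^esub> \<in> carrier TE.T"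
    using i c by simp_all
  have "gT i \<otimes>\<^bsub>TE.T\<^esub> gT i = pk (hs i) \<one>\<^bsub>K\<^esub> \<otimes>\<^bsub>TE.T\<^esub> gT i \<oplus>\<^bsub>TE.T\<^esub> pk (hD i) c \<otimes>\<^bsub>TE.T\<^esub> gT i"
    using i by (subst (1) gT_def) (simp add: TE.T.l_distr c_def)
  also have "\<dots> = (pk \<one>\<^bsub>H\<^esub> \<one>\<^bsub>K\<^esub> \<oplus>\<^bsub>TE.T\<^esub> pk (hs i \<star> hD i) c) \<oplus>\<^bsub>TE.T\<^esub> (pk (hD i \<star> hs i) c \<oplus>\<^bsub>TE.T\<^esub> pk (hD i) (c \<otimes>\<^bsub>K\<^esub> c))"
    using i c gT_mult_right[of "hs i" "\<one>\<^bsub>K\<^esub>" i] gT_mult_right[of "hD i" c i] hs_sq[OF i] hd_idem[OF i]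
    by (simp add: c_def[symmetric] del: t.mult)
  also have "\<dots> = pk \<one>\<^bsub>H\<^esub> \<one>\<^bsub>K\<^esub> \<oplus>\<^bsub>TE.T\<^esub> (pk (hs i \<star> hD i) c \<oplus>\<^bsub>TE.T\<^esub> pk (hD i \<star> hs i) c) \<oplus>\<^bsub>TE.T\<^esub> pk (hD i) (c \<otimes>\<^bsub>K\<^esub> c)"
    using cl by (simp add: TE.T.a_assoc del: t.mult t.one)
  also have "\<dots> = (pk (hs i) c \<oplus>\<^bsub>TE.T\<^esub> pk (hD i) (c \<otimes>\<^bsub>K\<^esub> c)) \<oplus>\<^bsub>TE.T\<^esub> (pure A K \<one>\<^bsub>A\<^esub> \<one>\<^bsub>K\<^esub> \<oplus>\<^bsub>TE.T\<^esub> \<ominus>\<^bsub>TE.T\<^esub> pure A K \<one>\<^bsub>A\<^esub> c)"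
    unfolding sd using cl c i by (simp add: TE.T.a_ac)
  also have "pk (hs i) c \<oplus>\<^bsub>TE.T\<^esub> pk (hD i) (c \<otimes>\<^bsub>K\<^esub> c) = pure A K \<one>\<^bsub>A\<^esub> c \<otimes>\<^bsub>TE.T\<^esub> gT i"
    using gT_mult_right[of "\<one>\<^bsub>H\<^esub>" c i] i c by (simp add: c_def[symmetric])
  also have "pure A K \<one>\<^bsub>A\<^esub> \<one>\<^bsub>K\<^esub> \<oplus>\<^bsub>TE.T\<^esub> \<ominus>\<^bsub>TE.T\<^esub> pure A K \<one>\<^bsub>A\<^esub> c = pure A K \<one>\<^bsub>A\<^esub> (q i)"
    unfolding qe using c by simp
  finally show ?thesis by (simp add: c_def)
qed

end

text \<open>\<open>\<gamma> d\<close> is the value substituted for X^d. Multiplicativity is demanded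
  only at exponents with a nonzero coefficient, because with two packed parameters it fails where
  the first exponent would carry over into the second.\<close>

locale hecke_pair = hecke_target I m K q A t + dihedral_pair I m i1 i2 al
  for I :: "'i set" and m and K :: "('k, 'b) ring_scheme" and q and A :: "('a, 'n) ring_scheme" and t and i1 i2 al +
  fixes \<gamma> :: "nat \<Rightarrow> 'k"
  assumes gamma_zero: "\<gamma> 0 = \<one>\<^bsub>K\<^esub>" and gamma_closed [simp]: "\<gamma> d \<in> carrier K"
    and gamma_step: "\<lbrakk>u \<in> lists {i1, i2}; length u < m i1 i2; k \<in> {i1, i2}; dihedral_pair.Tc I m al u d \<noteq> \<zero>\<^bsub>Hhat I m\<^esub>\<rbrakk>
      \<Longrightarrow> \<gamma> (d + al k) = \<gamma> d \<otimes>\<^bsub>K\<^esub> (\<one>\<^bsub>K\<^esub> \<ominus>\<^bsub>K\<^esub> q k)"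
begin

text \<open>A common bound for both weights, so that the range of exponents depends only on the
  length of the word.\<close>

abbreviation Bd where "Bd \<equiv> al i1 + al i2"

lemma al_Bd: "k \<in> J2 \<Longrightarrow> al k \<le> Bd" by auto

lemma Tc_support: "\<lbrakk>u \<in> lists J2; d > length u * Bd\<rbrakk> \<Longrightarrow> Tc u d = \<zero>\<^bsub>H\<^esub>"
proof (induction u arbitrary: d)
  case (Cons k u)
  have "Tc u d = \<zero>\<^bsub>H\<^esub>" "al k \<le> d \<Longrightarrow> Tc u (d - al k) = \<zero>\<^bsub>H\<^esub>"
    using Cons al_Bd[of k] by auto
  moreover have "k \<in> I" using Cons.prems by auto
  ultimately show ?case by (simp add: sh_def)
qed simp

lemma wprod_gT:
  assumes "u \<in> lists J2" "length u \<le> M"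
  shows "wprod TE.T gT (rev u) = (\<Oplus>\<^bsub>TE.T\<^esub>d\<in>{..length u * Bd}. pk (Tc u d) (\<gamma> d))"
  using assms
proof (induction u)
  case Nil
  then show ?case by (simp add: gamma_zero TE.pure_one)
next
  case (Cons k u)
  then have k: "k \<in> J2" "k \<in> I" and u: "u \<in> lists J2" "u \<in> lists I" "length u < M" using J2_lists[of u] by auto
  let ?c = "\<one>\<^bsub>K\<^esub> \<ominus>\<^bsub>K\<^esub> q k" and ?S = "{..length u * Bd}" and ?S' = "{..length (k # u) * Bd}"
  have T [simp]: "Tc u d \<in> carrier H" for d using u by simp
  have SS: "?S \<subseteq> ?S'" by auto
  let ?G = "\<lambda>d. pk (sh (al k) (\<lambda>e. Tc u e \<star> hD k) d) (\<gamma> d)"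
  have gc: "?G d \<in> carrier TE.T" for d using k by simp
  have z: "pk \<zero>\<^bsub>H\<^esub> (\<gamma> d) = \<zero>\<^bsub>TE.T\<^esub>" for d
    using abgroup_hom.zero[OF TE.pure_left_hom[OF gamma_closed[of d]]] by simp
  have 1: "(\<Oplus>\<^bsub>TE.T\<^esub>d\<in>?S. pk (Tc u d \<star> hs k) (\<gamma> d)) = (\<Oplus>\<^bsub>TE.T\<^esub>d\<in>?S'. pk (Tc u d \<star> hs k) (\<gamma> d))"
    using k SS Tc_support[OF u(1)] z
    by (intro TE.T.add.finprod_mono_neutral_cong_left) (auto simp del: t.mult)
  have 2: "(\<Oplus>\<^bsub>TE.T\<^esub>d\<in>?S. pk (Tc u d \<star> hD k) (\<gamma> d \<otimes>\<^bsub>K\<^esub> ?c)) = (\<Oplus>\<^bsub>TE.T\<^esub>d\<in>?S'. ?G d)"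
  proof -
    have e: "pk (Tc u d \<star> hD k) (\<gamma> d \<otimes>\<^bsub>K\<^esub> ?c) = ?G (d + al k)" for d
    proof (cases "Tc u d = \<zero>\<^bsub>H\<^esub>")
      case True
      have "pk \<zero>\<^bsub>H\<^esub> (\<gamma> d \<otimes>\<^bsub>K\<^esub> ?c) = \<zero>\<^bsub>TE.T\<^esub>"
        using abgroup_hom.zero[OF TE.pure_left_hom[of "\<gamma> d \<otimes>\<^bsub>K\<^esub> ?c"]] k by simp
      then show ?thesis using True z k by (simp add: sh_def)
    next
      case False
      then show ?thesis using gamma_step[OF u(1,3) k(1)] by (simp add: sh_def)
    qed
    have "(\<Oplus>\<^bsub>TE.T\<^esub>d\<in>?S. pk (Tc u d \<star> hD k) (\<gamma> d \<otimes>\<^bsub>K\<^esub> ?c)) = (\<Oplus>\<^bsub>TE.T\<^esub>d\<in>?S. ?G (d + al k))"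
      by (simp only: e)
    also have "\<dots> = (\<Oplus>\<^bsub>TE.T\<^esub>d\<in>(\<lambda>d. d + al k) ` ?S. ?G d)"
      using gc by (intro TE.T.finsum_reindex[symmetric]) (auto simp: inj_on_def)
    also have "\<dots> = (\<Oplus>\<^bsub>TE.T\<^esub>d\<in>?S'. ?G d)"
    proof (rule TE.T.add.finprod_mono_neutral_cong_left)
      show "(\<lambda>d. d + al k) ` ?S \<subseteq> ?S'" using al_Bd[OF k(1)] by auto
      show "?G d = \<zero>\<^bsub>TE.T\<^esub>" if "d \<in> ?S' - (\<lambda>d. d + al k) ` ?S" for d
      proof -
        have "al k \<le> d \<Longrightarrow> d - al k > length u * Bd"
          using that by (metis DiffD2 atMost_iff image_eqI le_add_diff_inverse2 not_le)
        then have "sh (al k) (\<lambda>e. Tc u e \<star> hD k) d = \<zero>\<^bsub>H\<^esub>" using Tc_support[OF u(1)] k by (simp add: sh_def)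
        then show ?thesis using z by simp
      qed
    qed (use gc in auto)
    finally show ?thesis .
  qed
  have "wprod TE.T gT (rev (k # u)) = wprod TE.T gT (rev u) \<otimes>\<^bsub>TE.T\<^esub> gT k"
    using k u TE.T.wprod_append[of "rev u" gT "[k]"] by (simp add: in_lists_conv_set)
  also have "\<dots> = (\<Oplus>\<^bsub>TE.T\<^esub>d\<in>?S. pk (Tc u d) (\<gamma> d) \<otimes>\<^bsub>TE.T\<^esub> gT k)"
    using Cons u k by (simp add: TE.T.finsum_ldistr)
  also have "\<dots> = (\<Oplus>\<^bsub>TE.T\<^esub>d\<in>?S. pk (Tc u d \<star> hs k) (\<gamma> d) \<oplus>\<^bsub>TE.T\<^esub> pk (Tc u d \<star> hD k) (\<gamma> d \<otimes>\<^bsub>K\<^esub> ?c))"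
    using k by (simp add: gT_mult_right del: t.mult)
  also have "\<dots> = (\<Oplus>\<^bsub>TE.T\<^esub>d\<in>?S'. pk (Tc u d \<star> hs k) (\<gamma> d)) \<oplus>\<^bsub>TE.T\<^esub> (\<Oplus>\<^bsub>TE.T\<^esub>d\<in>?S'. ?G d)"
    unfolding 1[symmetric] 2[symmetric] using k by (intro TE.T.finsum_addf) auto
  also have "\<dots> = (\<Oplus>\<^bsub>TE.T\<^esub>d\<in>?S'. pk (Tc u d \<star> hs k) (\<gamma> d) \<oplus>\<^bsub>TE.T\<^esub> ?G d)"
    using k gc by (intro TE.T.finsum_addf[symmetric]) auto
  also have "\<dots> = (\<Oplus>\<^bsub>TE.T\<^esub>d\<in>?S'. pk (Tc (k # u) d) (\<gamma> d))"
    using k by (intro TE.T.finsum_cong') (simp_all add: TE.pure_add_left)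
  finally show ?case .
qed

lemma gT_braid: "wprod TE.T gT (alt i1 i2 M) = wprod TE.T gT (alt i2 i1 M)"
proof -
  interpret J: ideal "J_pairs I m" H by (rule J_pairs_ideal)
  let ?u = "alt i1 i2 M" and ?v = "alt i2 i1 M"
  have u: "?u \<in> lists J2" "?u \<in> lists I" and v: "?v \<in> lists J2" "?v \<in> lists I" using i12 by simp_all
  have "t (Tc ?u d) = t (Tc ?v d)" for d
  proof -
    have "t (Tc ?u d) \<ominus>\<^bsub>A\<^esub> t (Tc ?v d) = \<zero>\<^bsub>A\<^esub>" using t_J[OF braid_J_pairs[of d]] u v by simp
    then show ?thesis using u v t.A.r_right_minus_eq by simp
  qed
  then have "wprod TE.T gT (rev ?u) = wprod TE.T gT (rev ?v)" using wprod_gT[OF u(1)] wprod_gT[OF v(1)] by simp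
  \<comment> \<open>Reversal exchanges the two alternating words for even M and fixes each of them
    for odd M.\<close>
  then show ?thesis by (cases "even M") (simp_all add: rev_alt)
qed

end

context dihedral_pair begin

text \<open>With the weights \<open>1\<close> and \<open>M + 1\<close> an exponent \<open>d\<close> encodes the two numbers \<open>d mod (M + 1)\<close> and \<open>d div (M + 1)\<close> of
  factors \<open>D\<^sub>i\<close> and \<open>D\<^sub>j\<close>, since at most \<open>M\<close> factors occur. This allows different parameters when \<open>M\<close> is even.\<close>

lemma Tc_mod:
  assumes al: "al i1 = 1" "al i2 = Suc M"
  shows "\<lbrakk>u \<in> lists J2; length u \<le> M; Tc u d \<noteq> \<zero>\<^bsub>H\<^esub>\<rbrakk> \<Longrightarrow> d mod Suc M \<le> length u"
proof (induction u arbitrary: d)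
  case Nil
  then show ?case by (auto split: if_splits)
next
  case (Cons k u)
  have k: "k \<in> J2" "k \<in> I" and u: "u \<in> lists J2" "length u < M" using Cons.prems by auto
  have IH: "e mod Suc M \<le> length u" if "Tc u e \<noteq> \<zero>\<^bsub>H\<^esub>" for e using Cons.IH[OF _ _ that] u by simp
  consider "Tc u d \<noteq> \<zero>\<^bsub>H\<^esub>" | "al k \<le> d" "Tc u (d - al k) \<noteq> \<zero>\<^bsub>H\<^esub>"
  proof (rule ccontr)
    assume n: "\<not> thesis"
    then have "Tc u d = \<zero>\<^bsub>H\<^esub>" "al k \<le> d \<Longrightarrow> Tc u (d - al k) = \<zero>\<^bsub>H\<^esub>" using that by metis+
    then have "Tc (k # u) d = \<zero>\<^bsub>H\<^esub>" using k by (simp add: sh_def)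
    then show False using Cons.prems(3) by contradiction
  qed
  then show ?case
  proof cases
    case 1
    then show ?thesis using IH[of d] by simp
  next
    case 2
    have le: "(d - al k) mod Suc M \<le> length u" using IH 2 by simp
    show ?thesis
    proof (cases "k = i1")
      case True
      then have "d = Suc (d - al k)" using 2 al by simp
      then show ?thesis using le by (metis mod_Suc le_SucI le0 length_Cons Suc_le_mono)
    next
      case False
      then have "al k = Suc M" using k al by simp
      then have "d mod Suc M = (d - al k) mod Suc M" using 2 by (metis le_mod_geq)
      then show ?thesis using le by simp
    qed
  qed
qed

end

context hecke_target begin

text \<open>For odd m the two parameters coincide and one substitution of c_i for X suffices. For
  even m, X becomes c_i and its power m + 1 becomes c_j, as if the exponent were written in base m +
  1. For m = 0 both words are empty.\<close>

theorem gT_braid: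
  assumes ij: "i \<in> I" "j \<in> I" "i \<noteq> j"
  shows "wprod TE.T gT (alt i j (m i j)) = wprod TE.T gT (alt j i (m i j))"
proof (cases "m i j = 0")
  case False
  define c where "c k = \<one>\<^bsub>K\<^esub> \<ominus>\<^bsub>K\<^esub> q k" for k
  have cc: "c i \<in> carrier K" "c j \<in> carrier K" using ij by (simp_all add: c_def)
  show ?thesis
  proof (cases "odd (m i j)")
    case True
    have cij: "c i = c j" using q_odd[OF ij(1,2) True] by (simp add: c_def)
    interpret D: dihedral_pair I m i j "\<lambda>_. 1" using ij False by unfold_locales auto
    interpret hecke_pair I m K q A t i j "\<lambda>_. 1" "\<lambda>d. c i [^]\<^bsub>K\<^esub> d"
    proof unfold_locales
      fix u k d assume "k \<in> {i, j}"
      then have "\<one>\<^bsub>K\<^esub> \<ominus>\<^bsub>K\<^esub> q k = c i" using cij by (auto simp: c_def)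
      then show "c i [^]\<^bsub>K\<^esub> (d + 1 :: nat) = c i [^]\<^bsub>K\<^esub> d \<otimes>\<^bsub>K\<^esub> (\<one>\<^bsub>K\<^esub> \<ominus>\<^bsub>K\<^esub> q k)" by simp
    qed (use cc in auto)
    show ?thesis by (rule gT_braid)
  next
    case ev: False
    let ?N = "Suc (m i j)" and ?al = "\<lambda>k. if k = i then 1 else Suc (m i j)"
    interpret D: dihedral_pair I m i j ?al using ij False ev by unfold_locales auto
    interpret hecke_pair I m K q A t i j ?al "\<lambda>d. c i [^]\<^bsub>K\<^esub> (d mod ?N) \<otimes>\<^bsub>K\<^esub> c j [^]\<^bsub>K\<^esub> (d div ?N)"
    proof unfold_locales
      fix u k d assume u: "u \<in> lists {i, j}" "length u < m i j" and k: "k \<in> {i, j}" and nz: "D.Tc u d \<noteq> \<zero>\<^bsub>H\<^esub>"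
      \<comment> \<open>Fewer than m letters have been used, so the lower digit is less than m and
        one further factor D_i produces no carry in base m + 1.\<close>
      have "d mod ?N \<le> length u" using ij u nz by (intro D.Tc_mod) auto
      then have lt: "d mod ?N < m i j" using u by simp
      have "c i [^]\<^bsub>K\<^esub> ((d + ?al k) mod ?N) \<otimes>\<^bsub>K\<^esub> c j [^]\<^bsub>K\<^esub> ((d + ?al k) div ?N) =
          c i [^]\<^bsub>K\<^esub> (d mod ?N) \<otimes>\<^bsub>K\<^esub> c j [^]\<^bsub>K\<^esub> (d div ?N) \<otimes>\<^bsub>K\<^esub> c k"
      proof (cases "k = i")
        case True
        have "Suc d mod ?N = Suc (d mod ?N)" "Suc d div ?N = d div ?N"
          using lt by (simp_all add: mod_Suc div_Suc)
        then show ?thesis using True cc by (simp add: K.m_ac)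
      next
        case False
        then have k: "k = j" using k by simp
        have "(d + ?N) mod ?N = d mod ?N" by (rule mod_add_self2)
        moreover have "(d + ?N) div ?N = Suc (d div ?N)" by (metis div_add_self2 Suc_eq_plus1 nat.distinct(1))
        moreover have "?al k = ?N" using k ij by simp
        ultimately show ?thesis using k cc by (simp only: K.nat_pow_Suc K.m_assoc K.nat_pow_closed)
      qed
      then show "c i [^]\<^bsub>K\<^esub> ((d + ?al k) mod ?N) \<otimes>\<^bsub>K\<^esub> c j [^]\<^bsub>K\<^esub> ((d + ?al k) div ?N) =
          c i [^]\<^bsub>K\<^esub> (d mod ?N) \<otimes>\<^bsub>K\<^esub> c j [^]\<^bsub>K\<^esub> (d div ?N) \<otimes>\<^bsub>K\<^esub> (\<one>\<^bsub>K\<^esub> \<ominus>\<^bsub>K\<^esub> q k)" by (simp add: c_def)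
    qed (use cc in auto)
    show ?thesis by (rule gT_braid)
  qed
qed simp

end

section \<open>The Hecke algebra and its standard elements\<close>

context hecke begin

lemma Hecke_relators_closed: "Hecke_relators K I m q \<subseteq> carrier (free_algebra K I)"
proof -
  interpret F: mring K "free_monoid I" by (intro mring.intro K.ring_axioms monoid_free_monoid)
  show ?thesis unfolding Hecke_relators_def
    by (auto intro!: F.RMg.minus_closed F.RMg.a_closed F.mterm_closed)
qed

sublocale HR: presentation K I "Hecke_relators K I m q"
  by unfold_locales (rule Hecke_relators_closed)

abbreviation HQ where "HQ \<equiv> Hecke_algebra K I m q"
abbreviation hsc where "hsc \<equiv> Hecke_scalar K I m q"
abbreviation HT where "HT \<equiv> Hecke_T K I m q"

sublocale HQ: ring HQ
  unfolding Hecke_algebra_def by (rule HR.PA.ring_axioms)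

lemmas hecke_defs = Hecke_algebra_def Hecke_scalar_def Hecke_T_def

lemma hsc_closed [simp, intro]: "c \<in> carrier K \<Longrightarrow> hsc c \<in> carrier HQ"
  by (simp add: hecke_defs)

lemma HT_closed [simp, intro]: "i \<in> I \<Longrightarrow> HT i \<in> carrier HQ"
  by (simp add: hecke_defs)

lemma pc_one: "HR.pc (mterm K \<one>\<^bsub>K\<^esub> []) = \<one>\<^bsub>HR.PA\<^esub>"
  using HR.pc.one by (simp add: HR.one_eq del: HR.pc.one)

lemma HQ_mterm: "\<lbrakk>c \<in> carrier K; u \<in> lists I\<rbrakk> \<Longrightarrow> HR.pc (mterm K c u) = hsc c \<otimes>\<^bsub>HQ\<^esub> wprod HQ HT u"
proof -
  assume c: "c \<in> carrier K" and u: "u \<in> lists I"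
  have "HR.pc (mterm K \<one>\<^bsub>K\<^esub> u) = wprod HQ HT u" using u
  proof (induction u)
    case Nil
    then show ?case by (simp add: Hecke_algebra_def pc_one)
  next
    case (Cons i u)
    then have "HR.pc (mterm K \<one>\<^bsub>K\<^esub> (i # u)) = HT i \<otimes>\<^bsub>HQ\<^esub> HR.pc (mterm K \<one>\<^bsub>K\<^esub> u)"
      using HR.mterm_append[of "\<one>\<^bsub>K\<^esub>" "\<one>\<^bsub>K\<^esub>" "[i]" u] by (simp add: hecke_defs)
    then show ?case using Cons by simp
  qed
  then show ?thesis using HR.mterm_append[of c "\<one>\<^bsub>K\<^esub>" "[]" u] c u by (simp add: hecke_defs)
qed

lemma hsc_hom: "hsc \<in> ring_hom K HQ"
proof (rule ring_hom_memI)
  fix c d assume c: "c \<in> carrier K" "d \<in> carrier K"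
  show "hsc (c \<otimes>\<^bsub>K\<^esub> d) = hsc c \<otimes>\<^bsub>HQ\<^esub> hsc d"
    using HR.mterm_append[of c d "[]" "[]"] c by (simp add: hecke_defs)
  have "hsc (c \<oplus>\<^bsub>K\<^esub> d) = HR.pc (mterm K c [] \<oplus>\<^bsub>HR.FA\<^esub> mterm K d [])"
    using c by (simp only: HR.mterm_add) (simp add: hecke_defs)
  then show "hsc (c \<oplus>\<^bsub>K\<^esub> d) = hsc c \<oplus>\<^bsub>HQ\<^esub> hsc d" using c HR.pc.add[of "mterm K c []" "mterm K d []"]
    by (simp add: hecke_defs del: HR.add_eq HR.pc.add)
next
  show "hsc \<one>\<^bsub>K\<^esub> = \<one>\<^bsub>HQ\<^esub>" by (simp add: hecke_defs pc_one)
qed auto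

sublocale hsc: ring_homo K HQ hsc
  by (intro ring_homoI hsc_hom K.ring_axioms HQ.ring_axioms)

lemma HQ_induct [consumes 1, case_names scalar gen add mult]:
  assumes "x \<in> carrier HQ" "\<And>c. c \<in> carrier K \<Longrightarrow> P (hsc c)" "\<And>i. i \<in> I \<Longrightarrow> P (HT i)"
    "\<And>x y. \<lbrakk>x \<in> carrier HQ; y \<in> carrier HQ; P x; P y\<rbrakk> \<Longrightarrow> P (x \<oplus>\<^bsub>HQ\<^esub> y)"
    "\<And>x y. \<lbrakk>x \<in> carrier HQ; y \<in> carrier HQ; P x; P y\<rbrakk> \<Longrightarrow> P (x \<otimes>\<^bsub>HQ\<^esub> y)"
  shows "P x"
  using assms unfolding hecke_defs by (rule HR.PA_induct)

lemma HQ_hom_eqI: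
  assumes "f \<in> ring_hom HQ B" "g \<in> ring_hom HQ B"
    and "\<And>c. c \<in> carrier K \<Longrightarrow> f (hsc c) = g (hsc c)" "\<And>i. i \<in> I \<Longrightarrow> f (HT i) = g (HT i)"
    and "x \<in> carrier HQ"
  shows "f x = g x"
  using assms unfolding hecke_defs by (rule HR.PA_hom_eqI)

lemma hsc_HT_comm: "\<lbrakk>c \<in> carrier K; i \<in> I\<rbrakk> \<Longrightarrow> hsc c \<otimes>\<^bsub>HQ\<^esub> HT i = HT i \<otimes>\<^bsub>HQ\<^esub> hsc c"
  using HR.mterm_append[of c "\<one>\<^bsub>K\<^esub>" "[]" "[i]"] HR.mterm_append[of "\<one>\<^bsub>K\<^esub>" c "[i]" "[]"]
  by (simp add: hecke_defs)

lemma hsc_central: "\<lbrakk>c \<in> carrier K; x \<in> carrier HQ\<rbrakk> \<Longrightarrow> hsc c \<otimes>\<^bsub>HQ\<^esub> x = x \<otimes>\<^bsub>HQ\<^esub> hsc c"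
proof -
  assume c: "c \<in> carrier K" and x: "x \<in> carrier HQ"
  from x show ?thesis
  proof (induction rule: HQ_induct)
    case (scalar d)
    then show ?case using c by (simp add: K.m_comm flip: hsc.mult)
  next
    case (mult x y)
    then show ?case using c by (metis HQ.m_assoc hsc_closed)
  qed (use c hsc_HT_comm in \<open>simp_all add: HQ.l_distr HQ.r_distr\<close>)
qed

lemma HT_quadratic:
  assumes i: "i \<in> I"
  shows "HT i \<otimes>\<^bsub>HQ\<^esub> HT i = hsc (\<one>\<^bsub>K\<^esub> \<ominus>\<^bsub>K\<^esub> q i) \<otimes>\<^bsub>HQ\<^esub> HT i \<oplus>\<^bsub>HQ\<^esub> hsc (q i)"
proof -
  let ?y = "mterm K (\<one>\<^bsub>K\<^esub> \<ominus>\<^bsub>K\<^esub> q i) [i] \<oplus>\<^bsub>HR.FA\<^esub> mterm K (q i) []"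
  have y: "mterm K (\<one>\<^bsub>K\<^esub> \<ominus>\<^bsub>K\<^esub> q i) [i] \<in> carrier HR.FA" "mterm K (q i) [] \<in> carrier HR.FA" using i by auto
  have "HR.pc (mterm K \<one>\<^bsub>K\<^esub> [i, i]) = HR.pc ?y"
  proof (rule HR.relation)
    show "mterm K \<one>\<^bsub>K\<^esub> [i, i] \<ominus>\<^bsub>HR.FA\<^esub> ?y \<in> Hecke_relators K I m q"
      unfolding Hecke_relators_def using i by blast
    show "?y \<in> carrier HR.FA" using y by (rule HR.RMg.a_closed)
  qed (use i in auto)
  also have "\<dots> = HR.pc (mterm K (\<one>\<^bsub>K\<^esub> \<ominus>\<^bsub>K\<^esub> q i) [i]) \<oplus>\<^bsub>HQ\<^esub> HR.pc (mterm K (q i) [])"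
    unfolding Hecke_algebra_def by (rule HR.pc.add[OF y])
  finally show ?thesis using i by (simp add: HQ_mterm)
qed

lemma HT_braid: "\<lbrakk>i \<in> I; j \<in> I; i \<noteq> j\<rbrakk> \<Longrightarrow> wprod HQ HT (alt i j (m i j)) = wprod HQ HT (alt j i (m i j))"
proof -
  assume ij: "i \<in> I" "j \<in> I" "i \<noteq> j"
  then have l: "alt i j (m i j) \<in> lists I" "alt j i (m i j) \<in> lists I" by simp_all
  have "HR.pc (mterm K \<one>\<^bsub>K\<^esub> (alt i j (m i j))) = HR.pc (mterm K \<one>\<^bsub>K\<^esub> (alt j i (m i j)))"
  proof (rule HR.relation)
    show "mterm K \<one>\<^bsub>K\<^esub> (alt i j (m i j)) \<ominus>\<^bsub>HR.FA\<^esub> mterm K \<one>\<^bsub>K\<^esub> (alt j i (m i j)) \<in> Hecke_relators K I m q"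
      unfolding Hecke_relators_def using ij by blast
  qed (use l in auto)
  then show ?thesis using l by (simp add: HQ_mterm HQ.wprod_closed in_lists_conv_set)
qed

lemma Hecke_lift:
  assumes "ring B" and al: "\<alpha> \<in> ring_hom K B" and g: "\<And>i. i \<in> I \<Longrightarrow> g i \<in> carrier B"
    and comm: "\<And>c i. \<lbrakk>c \<in> carrier K; i \<in> I\<rbrakk> \<Longrightarrow> \<alpha> c \<otimes>\<^bsub>B\<^esub> g i = g i \<otimes>\<^bsub>B\<^esub> \<alpha> c"
    and quad: "\<And>i. i \<in> I \<Longrightarrow> g i \<otimes>\<^bsub>B\<^esub> g i = \<alpha> (\<one>\<^bsub>K\<^esub> \<ominus>\<^bsub>K\<^esub> q i) \<otimes>\<^bsub>B\<^esub> g i \<oplus>\<^bsub>B\<^esub> \<alpha> (q i)"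
    and braid: "\<And>i j. \<lbrakk>i \<in> I; j \<in> I; i \<noteq> j\<rbrakk> \<Longrightarrow> wprod B g (alt i j (m i j)) = wprod B g (alt j i (m i j))"
  shows "\<exists>h\<in>ring_hom HQ B \<inter> extensional (carrier HQ). (\<forall>c\<in>carrier K. h (hsc c) = \<alpha> c) \<and> (\<forall>i\<in>I. h (HT i) = g i)"
proof -
  interpret B: ring B by fact
  interpret al: ring_homo K B \<alpha> by (intro ring_homoI al K.ring_axioms B.ring_axioms)
  have "\<exists>h\<in>ring_hom HR.PA B \<inter> extensional (carrier HR.PA).
     \<forall>c\<in>carrier K. \<forall>u\<in>lists I. h (HR.pc (mterm K c u)) = \<alpha> c \<otimes>\<^bsub>B\<^esub> wprod B g u"
  proof (rule HR.PA_lift[OF assms(1) al g comm])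
    fix h e assume "ring_homo HR.FA B h" and hm: "\<And>c u. \<lbrakk>c \<in> carrier K; u \<in> lists I\<rbrakk> \<Longrightarrow> h (mterm K c u) = \<alpha> c \<otimes>\<^bsub>B\<^esub> wprod B g u"
      and e: "e \<in> Hecke_relators K I m q"
    interpret h: ring_homo HR.FA B h by fact
    consider i where "i \<in> I" "e = mterm K \<one>\<^bsub>K\<^esub> [i, i] \<ominus>\<^bsub>HR.FA\<^esub> (mterm K (\<one>\<^bsub>K\<^esub> \<ominus>\<^bsub>K\<^esub> q i) [i] \<oplus>\<^bsub>HR.FA\<^esub> mterm K (q i) [])"
      | i j where "i \<in> I" "j \<in> I" "i \<noteq> j" "e = mterm K \<one>\<^bsub>K\<^esub> (alt i j (m i j)) \<ominus>\<^bsub>HR.FA\<^esub> mterm K \<one>\<^bsub>K\<^esub> (alt j i (m i j))"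
      using e unfolding Hecke_relators_def by blast
    then show "h e = \<zero>\<^bsub>B\<^esub>"
    proof cases
      case 1
      let ?a = "mterm K \<one>\<^bsub>K\<^esub> [i, i]" and ?b = "mterm K (\<one>\<^bsub>K\<^esub> \<ominus>\<^bsub>K\<^esub> q i) [i]" and ?c = "mterm K (q i) []"
      have c: "?a \<in> carrier HR.FA" "?b \<in> carrier HR.FA" "?c \<in> carrier HR.FA" using 1 by auto
      have "h e = h ?a \<ominus>\<^bsub>B\<^esub> (h ?b \<oplus>\<^bsub>B\<^esub> h ?c)"
        unfolding 1(2) using c HR.RMg.a_closed[OF c(2,3)] by (simp only: h.a_minus h.add)
      also have "\<dots> = \<zero>\<^bsub>B\<^esub>" using 1 g al.closed by (simp add: hm quad B.r_neg a_minus_def[of B])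
      finally show ?thesis .
    next
      case 2
      then have l: "alt i j (m i j) \<in> lists I" "alt j i (m i j) \<in> lists I" by simp_all
      have w: "wprod B g (alt j i (m i j)) \<in> carrier B" using l g by (auto simp: in_lists_conv_set)
      have "h e = h (mterm K \<one>\<^bsub>K\<^esub> (alt i j (m i j))) \<ominus>\<^bsub>B\<^esub> h (mterm K \<one>\<^bsub>K\<^esub> (alt j i (m i j)))"
        unfolding 2(4) using l by (intro h.a_minus) auto
      also have "\<dots> = \<zero>\<^bsub>B\<^esub>" using l w braid[OF 2(1-3)] by (simp add: hm a_minus_def[of B] B.r_neg)
      finally show ?thesis .
    qed
  qed
  then obtain h where h: "h \<in> ring_hom HR.PA B" "h \<in> extensional (carrier HR.PA)"
    "\<forall>c\<in>carrier K. \<forall>u\<in>lists I. h (HR.pc (mterm K c u)) = \<alpha> c \<otimes>\<^bsub>B\<^esub> wprod B g u" by blast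
  have "\<forall>c\<in>carrier K. h (hsc c) = \<alpha> c" using h(3) by (simp add: hecke_defs)
  moreover have "\<forall>i\<in>I. h (HT i) = g i" using h(3) g by (simp add: hecke_defs)
  ultimately show ?thesis using h(1,2) unfolding Hecke_algebra_def by blast
qed

definition Tw where "Tw w = wprod HQ HT (SOME u. u \<in> lists I \<and> length u = len w \<and> cl u = w)"

lemma wprod_HT_closed [simp]: "u \<in> lists I \<Longrightarrow> wprod HQ HT u \<in> carrier HQ"
  by (auto simp: in_lists_conv_set)

text \<open>The reduced word in \<open>Tw\<close> is picked by \<open>SOME\<close>. Matsumoto's
  theorem makes the choice immaterial, since the \<open>HT i\<close> satisfy the braid
  relations.\<close>

lemma Tw_cl: "\<lbrakk>u \<in> lists I; length u = len (cl u)\<rbrakk> \<Longrightarrow> Tw (cl u) = wprod HQ HT u"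
proof -
  assume u: "u \<in> lists I" "length u = len (cl u)"
  let ?v = "SOME v. v \<in> lists I \<and> length v = len (cl u) \<and> cl v = cl u"
  have v: "?v \<in> lists I \<and> length ?v = len (cl u) \<and> cl ?v = cl u"
    by (rule someI[where x = u]) (use u in blast)
  then show ?thesis unfolding Tw_def using u
    by (intro matsumoto[OF HQ.monoid_axioms HT_closed HT_braid]) auto
qed

lemma Tw_closed [simp]: "w \<in> carrier W \<Longrightarrow> Tw w \<in> carrier HQ"
  using reduced_word[of w] Tw_cl by fastforce

lemma Tw_one: "Tw e0 = \<one>\<^bsub>HQ\<^esub>"
  using Tw_cl[of "[]"] by (simp flip: one_W)

lemma Tw_up: "\<lbrakk>w \<in> carrier W; i \<in> I; \<not> sg w (s i)\<rbrakk> \<Longrightarrow> Tw (w \<bullet> s i) = Tw w \<otimes>\<^bsub>HQ\<^esub> HT i"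
proof -
  assume a: "w \<in> carrier W" "i \<in> I" "\<not> sg w (s i)"
  obtain u where u: "u \<in> lists I" "length u = len w" "cl u = w" using reduced_word[OF a(1)] by blast
  have c: "cl (u @ [i]) = w \<bullet> s i" using u a by (simp add: cl_append s_def)
  have "Tw (cl (u @ [i])) = wprod HQ HT (u @ [i])"
    using u a len_up[OF a] by (intro Tw_cl) (simp_all add: c)
  also have "\<dots> = wprod HQ HT u \<otimes>\<^bsub>HQ\<^esub> HT i"
    using u a HQ.wprod_append[of u HT "[i]"] by (auto simp: in_lists_conv_set)
  also have "wprod HQ HT u = Tw w" using Tw_cl[of u] u by simp
  finally show ?thesis unfolding c .
qed

text \<open>The last letter of \<open>w\<close> can be taken to be \<open>i\<close>; the quadratic
  relation is applied to the resulting square and the scalars are moved to the front.\<close>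

lemma Tw_down:
  assumes a: "w \<in> carrier W" "i \<in> I" "sg w (s i)"
  shows "Tw w \<otimes>\<^bsub>HQ\<^esub> HT i = hsc (\<one>\<^bsub>K\<^esub> \<ominus>\<^bsub>K\<^esub> q i) \<otimes>\<^bsub>HQ\<^esub> Tw w \<oplus>\<^bsub>HQ\<^esub> hsc (q i) \<otimes>\<^bsub>HQ\<^esub> Tw (w \<bullet> s i)"
proof -
  let ?v = "w \<bullet> s i"
  have v: "Tw w = Tw ?v \<otimes>\<^bsub>HQ\<^esub> HT i" using Tw_up[of ?v i] a sg_mult_s[of w i] by simp
  have c: "Tw ?v \<in> carrier HQ" "HT i \<in> carrier HQ" "hsc (\<one>\<^bsub>K\<^esub> \<ominus>\<^bsub>K\<^esub> q i) \<in> carrier HQ" "hsc (q i) \<in> carrier HQ"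
    using a by (simp_all del: hsc.a_minus)
  have "Tw w \<otimes>\<^bsub>HQ\<^esub> HT i = Tw ?v \<otimes>\<^bsub>HQ\<^esub> (hsc (\<one>\<^bsub>K\<^esub> \<ominus>\<^bsub>K\<^esub> q i) \<otimes>\<^bsub>HQ\<^esub> HT i \<oplus>\<^bsub>HQ\<^esub> hsc (q i))"
    unfolding v using c HT_quadratic[OF a(2)] by (simp add: HQ.m_assoc)
  also have "\<dots> = Tw ?v \<otimes>\<^bsub>HQ\<^esub> hsc (\<one>\<^bsub>K\<^esub> \<ominus>\<^bsub>K\<^esub> q i) \<otimes>\<^bsub>HQ\<^esub> HT i \<oplus>\<^bsub>HQ\<^esub> Tw ?v \<otimes>\<^bsub>HQ\<^esub> hsc (q i)"
    using c by (simp only: HQ.r_distr HQ.m_closed HQ.m_assoc)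
  also have "Tw ?v \<otimes>\<^bsub>HQ\<^esub> hsc (\<one>\<^bsub>K\<^esub> \<ominus>\<^bsub>K\<^esub> q i) = hsc (\<one>\<^bsub>K\<^esub> \<ominus>\<^bsub>K\<^esub> q i) \<otimes>\<^bsub>HQ\<^esub> Tw ?v"
    using c a by (intro hsc_central[symmetric]) auto
  also have "Tw ?v \<otimes>\<^bsub>HQ\<^esub> hsc (q i) = hsc (q i) \<otimes>\<^bsub>HQ\<^esub> Tw ?v"
    using c a by (intro hsc_central[symmetric]) auto
  finally show ?thesis unfolding v using c by (simp only: HQ.m_assoc)
qed

section \<open>The additive map from the group ring to the Hecke algebra\<close>

abbreviation ZW where "ZW \<equiv> monoid_ring \<Z> W"

lemma ZW_add: "f \<oplus>\<^bsub>ZW\<^esub> g = (\<lambda>w. f w + g w)"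
  by (simp add: monoid_ring_def)

sublocale bT: mring_ext \<Z> W HQ "\<lambda>w n. [(n::int)] \<cdot>\<^bsub>HQ\<^esub> Tw w"
  by unfold_locales (auto simp: HQ.int_mult_add ring_int)

definition bT where "bT = mr_ext \<Z> HQ (\<lambda>w n. [(n::int)] \<cdot>\<^bsub>HQ\<^esub> Tw w)"

sublocale bTh: abgroup_hom ZW HQ bT
  unfolding bT_def by (rule bT.ext_hom)

lemma bT_mterm: "w \<in> carrier W \<Longrightarrow> bT (mterm \<Z> n w) = [n] \<cdot>\<^bsub>HQ\<^esub> Tw w"
  unfolding bT_def by (rule bT.ext_mterm) auto

text \<open>The effect on \<open>ef x\<close> of multiplying \<open>x\<close> by \<open>s\<^sub>i\<close> and by \<open>D\<^sub>i\<close>.\<close>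

definition rs :: "'i \<Rightarrow> ('i list set \<Rightarrow> int) \<Rightarrow> 'i list set \<Rightarrow> int" where
  "rs i a = (\<lambda>w. if w \<in> carrier W then a (w \<bullet> s i) else 0)"

definition rd :: "'i \<Rightarrow> ('i list set \<Rightarrow> int) \<Rightarrow> 'i list set \<Rightarrow> int" where
  "rd i a = (\<lambda>w. if w \<in> carrier W then (if sg w (s i) then a w else - a (w \<bullet> s i)) else 0)"

lemma rs_closed: "\<lbrakk>a \<in> carrier ZW; i \<in> I\<rbrakk> \<Longrightarrow> rs i a \<in> carrier ZW"
  and rd_closed: "\<lbrakk>a \<in> carrier ZW; i \<in> I\<rbrakk> \<Longrightarrow> rd i a \<in> carrier ZW"
proof -
  assume a: "a \<in> carrier ZW" and i: "i \<in> I"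
  let ?A = "msupp \<Z> a \<union> (\<lambda>w. w \<bullet> s i) ` msupp \<Z> a"
  have A: "finite ?A" "?A \<subseteq> carrier W" using bT.fin[OF a] bT.supp[OF a] i by auto
  have z: "a (w \<bullet> s i) = 0 \<and> a w = 0" if w: "w \<in> carrier W" "w \<notin> ?A" for w
  proof -
    have "w = (w \<bullet> s i) \<bullet> s i" using w i by simp
    then have "w \<bullet> s i \<notin> msupp \<Z> a" using w(2) by (metis UnCI image_eqI)
    then show ?thesis using w(2) by (simp add: msupp_def)
  qed
  show "rs i a \<in> carrier ZW"
    using A z by (intro bT.memI[of _ ?A]) (simp_all add: rs_def)
  show "rd i a \<in> carrier ZW"
    using A z by (intro bT.memI[of _ ?A]) (simp_all add: rd_def)
qed

text \<open>Right multiplication by T_i corresponds to s_i + c D_i acting on the group ring, c = 1 -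
  q_i. At a descent \<open>v\<close> the left side is T_vs + c (T_v - T_vs) = c T_v + q_i T_vs with
  vs = v s_i, which is \<open>Tw_down\<close>; at an ascent D_i gives 0 and it is
  \<open>Tw_up\<close>.\<close>

lemma bT_step:
  assumes "a \<in> carrier ZW" and i: "i \<in> I"
  shows "bT (rs i a) \<oplus>\<^bsub>HQ\<^esub> hsc (\<one>\<^bsub>K\<^esub> \<ominus>\<^bsub>K\<^esub> q i) \<otimes>\<^bsub>HQ\<^esub> bT (rd i a) = bT a \<otimes>\<^bsub>HQ\<^esub> HT i"
  using assms(1)
proof (induction rule: bT.RM_induct)
  case zero
  have "\<zero>\<^bsub>ZW\<^esub> = (\<lambda>w. 0)" by (simp add: monoid_ring_def)
  then have "rs i \<zero>\<^bsub>ZW\<^esub> = \<zero>\<^bsub>ZW\<^esub>" "rd i \<zero>\<^bsub>ZW\<^esub> = \<zero>\<^bsub>ZW\<^esub>" by (simp_all only: rs_def rd_def if_cancel minus_zero)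
  then show ?case using i bTh.zero by (simp del: bT.zero_eq hsc.a_minus)
next
  case (mterm n v)
  then have v: "v \<in> carrier W" by simp
  let ?v = "v \<bullet> s i" and ?c = "hsc (\<one>\<^bsub>K\<^esub> \<ominus>\<^bsub>K\<^esub> q i)"
  have e: "w \<bullet> s i = v \<longleftrightarrow> w = ?v" if "w \<in> carrier W" for w using that v i by (metis s_s_right)
  have c: "?c \<in> carrier HQ" "hsc (q i) \<in> carrier HQ" "Tw v \<in> carrier HQ" "Tw ?v \<in> carrier HQ" "HT i \<in> carrier HQ"
    using v i by (simp_all del: hsc.a_minus)
  have vv: "?v \<in> carrier W" using v i by simp
  have 1: "rs i (mterm \<Z> n v) = mterm \<Z> n ?v"
    using vv e by (simp add: fun_eq_iff rs_def mterm_def)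
  show ?case
  proof (cases "sg v (s i)")
    case True
    have nv: "\<not> sg ?v (s i)" using True v i by (simp add: sg_mult_s)
    have ne: "v \<noteq> ?v" using True nv by metis
    have 2: "rd i (mterm \<Z> n v) = mterm \<Z> n v \<oplus>\<^bsub>ZW\<^esub> mterm \<Z> (- n) ?v"
      using True nv ne v vv e by (simp add: fun_eq_iff rd_def mterm_def ZW_add)
    have "bT (rd i (mterm \<Z> n v)) = bT (mterm \<Z> n v) \<oplus>\<^bsub>HQ\<^esub> bT (mterm \<Z> (- n) ?v)"
      unfolding 2 using v vv by (intro bTh.add) auto
    then have "bT (rd i (mterm \<Z> n v)) = [n] \<cdot>\<^bsub>HQ\<^esub> Tw v \<ominus>\<^bsub>HQ\<^esub> [n] \<cdot>\<^bsub>HQ\<^esub> Tw ?v"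
      using v vv c HQ.add.int_pow_neg[of "Tw ?v" n] by (simp add: bT_mterm a_minus_def[of HQ])
    then have "bT (rs i (mterm \<Z> n v)) \<oplus>\<^bsub>HQ\<^esub> ?c \<otimes>\<^bsub>HQ\<^esub> bT (rd i (mterm \<Z> n v)) =
       [n] \<cdot>\<^bsub>HQ\<^esub> Tw ?v \<oplus>\<^bsub>HQ\<^esub> ([n] \<cdot>\<^bsub>HQ\<^esub> (?c \<otimes>\<^bsub>HQ\<^esub> Tw v) \<oplus>\<^bsub>HQ\<^esub> \<ominus>\<^bsub>HQ\<^esub> ([n] \<cdot>\<^bsub>HQ\<^esub> (?c \<otimes>\<^bsub>HQ\<^esub> Tw ?v)))"
      unfolding 1 using vv c
      by (simp only: bT_mterm a_minus_def[of HQ] HQ.r_distr HQ.r_minus HQ.add_pow_rdistr_int HQ.add.int_pow_closed HQ.a_inv_closed)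
    also have "\<dots> = [n] \<cdot>\<^bsub>HQ\<^esub> (?c \<otimes>\<^bsub>HQ\<^esub> Tw v) \<oplus>\<^bsub>HQ\<^esub> [n] \<cdot>\<^bsub>HQ\<^esub> (hsc (q i) \<otimes>\<^bsub>HQ\<^esub> Tw ?v)"
    proof -
      let ?X = "[n] \<cdot>\<^bsub>HQ\<^esub> Tw ?v"
      have X: "?X \<in> carrier HQ" using c by simp
      have qi: "hsc (q i) = \<one>\<^bsub>HQ\<^esub> \<oplus>\<^bsub>HQ\<^esub> \<ominus>\<^bsub>HQ\<^esub> ?c" using i
        by (simp add: a_minus_def[of HQ] HQ.minus_add HQ.r_neg2)
      have "?c \<otimes>\<^bsub>HQ\<^esub> ?X \<in> carrier HQ" using c X by simp
      then have "hsc (q i) \<otimes>\<^bsub>HQ\<^esub> ?X = ?X \<oplus>\<^bsub>HQ\<^esub> \<ominus>\<^bsub>HQ\<^esub> (?c \<otimes>\<^bsub>HQ\<^esub> ?X)"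
        unfolding qi using c X by (simp only: HQ.l_distr HQ.l_minus HQ.l_one HQ.one_closed HQ.a_inv_closed)
      then have "[n] \<cdot>\<^bsub>HQ\<^esub> (hsc (q i) \<otimes>\<^bsub>HQ\<^esub> Tw ?v) = ?X \<oplus>\<^bsub>HQ\<^esub> \<ominus>\<^bsub>HQ\<^esub> ([n] \<cdot>\<^bsub>HQ\<^esub> (?c \<otimes>\<^bsub>HQ\<^esub> Tw ?v))"
        using c by (simp only: HQ.add_pow_rdistr_int)
      then show ?thesis using c X by (simp add: HQ.a_ac del: hsc.a_minus)
    qed
    also have "\<dots> = [n] \<cdot>\<^bsub>HQ\<^esub> (Tw v \<otimes>\<^bsub>HQ\<^esub> HT i)"
      unfolding Tw_down[OF v i True] using c by (intro HQ.int_mult_distr[symmetric]) auto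
    also have "\<dots> = bT (mterm \<Z> n v) \<otimes>\<^bsub>HQ\<^esub> HT i" using v c by (simp add: bT_mterm HQ.add_pow_ldistr_int)
    finally show ?thesis .
  next
    case False
    have vs: "sg ?v (s i)" using False v i by (simp add: sg_mult_s)
    have ne: "v \<noteq> ?v" using False vs by metis
    have 2: "rd i (mterm \<Z> n v) = \<zero>\<^bsub>ZW\<^esub>"
    proof
      fix w
      have "\<not> sg w (s i)" if "w = v" using False that by simp
      moreover have "sg w (s i)" if "w \<in> carrier W" "w \<bullet> s i = v" using vs e that by simp
      ultimately show "rd i (mterm \<Z> n v) w = \<zero>\<^bsub>ZW\<^esub> w"
        using ne[symmetric] by (cases "w = v"; simp add: rd_def mterm_def monoid_ring_def; metis)
    qed
    show ?thesis unfolding 1 2 bTh.zero using v vv c Tw_up[OF v i False]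
      by (simp add: bT_mterm HQ.add_pow_ldistr_int del: hsc.a_minus)
  qed
next
  case (add f g)
  have r: "rs i (f \<oplus>\<^bsub>ZW\<^esub> g) = rs i f \<oplus>\<^bsub>ZW\<^esub> rs i g" "rd i (f \<oplus>\<^bsub>ZW\<^esub> g) = rd i f \<oplus>\<^bsub>ZW\<^esub> rd i g"
    by (simp_all add: rs_def rd_def fun_eq_iff ZW_add)
  let ?c = "hsc (\<one>\<^bsub>K\<^esub> \<ominus>\<^bsub>K\<^esub> q i)"
  have c: "?c \<in> carrier HQ" "HT i \<in> carrier HQ" using i by (simp_all del: hsc.a_minus)
  have b: "bT (rs i f) \<in> carrier HQ" "bT (rs i g) \<in> carrier HQ" "bT (rd i f) \<in> carrier HQ" "bT (rd i g) \<in> carrier HQ"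
    "bT f \<in> carrier HQ" "bT g \<in> carrier HQ"
    using add i rs_closed rd_closed by auto
  have "bT (rs i (f \<oplus>\<^bsub>ZW\<^esub> g)) \<oplus>\<^bsub>HQ\<^esub> ?c \<otimes>\<^bsub>HQ\<^esub> bT (rd i (f \<oplus>\<^bsub>ZW\<^esub> g)) =
     (bT (rs i f) \<oplus>\<^bsub>HQ\<^esub> ?c \<otimes>\<^bsub>HQ\<^esub> bT (rd i f)) \<oplus>\<^bsub>HQ\<^esub> (bT (rs i g) \<oplus>\<^bsub>HQ\<^esub> ?c \<otimes>\<^bsub>HQ\<^esub> bT (rd i g))"
    unfolding r using add.hyps i rs_closed rd_closed b c
    by (simp add: bTh.add HQ.r_distr HQ.a_ac del: hsc.a_minus bT.add_eq)
  also have "\<dots> = bT (f \<oplus>\<^bsub>ZW\<^esub> g) \<otimes>\<^bsub>HQ\<^esub> HT i"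
    unfolding add.IH using add.hyps b c by (simp add: bTh.add HQ.l_distr del: bT.add_eq)
  finally show ?case .
qed

end

lemma int_multiple_int: "[(n::int)] \<cdot>\<^bsub>\<Z>\<^esub> k = n * k"
proof -
  note Z = ring.is_abelian_group[OF ring_int]
  have kc: "k \<in> carrier \<Z>" by simp
  have o: "[(1::int)] \<cdot>\<^bsub>\<Z>\<^esub> k = k"
    using group.int_pow_1[OF abelian_group.a_group[OF Z], of k] kc by (simp add: add_pow_def)
  show ?thesis
  proof (induction n rule: int_induct[where k = 0])
    case (step1 i)
    then show ?case using abelian_group.int_mult_add[OF Z kc, of i 1] by (simp add: algebra_simps o)
  next
    case (step2 i)
    then show ?case using abelian_group.int_mult_minus[OF Z kc, of i 1] by (simp add: algebra_simps a_minus_def o)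
  qed (use abelian_group.int_mult_minus[OF Z kc, of 1 1] in \<open>simp add: a_minus_def o\<close>)
qed

lemma (in ideal) coset_zero_iff: "x \<in> carrier R \<Longrightarrow> I +> x = \<zero>\<^bsub>R Quot I\<^esub> \<longleftrightarrow> x \<in> I"
proof -
  assume x: "x \<in> carrier R"
  have z: "\<zero>\<^bsub>R Quot I\<^esub> = I" by (simp add: FactRing_def)
  show ?thesis unfolding z using a_rcos_const a_rcos_self[OF x] by metis
qed

context coxeter begin

lemma ef_hom: "abgroup_hom H \<Z> (\<lambda>x. ef x w)"
  by (intro abgroup_homI) (auto simp: ef_add H.abelian_group_axioms ring.is_abelian_group[OF ring_int])

sublocale zw: mring_lift \<Z> W H "\<lambda>n. [(n::int)] \<cdot>\<^bsub>H\<^esub> \<one>\<^bsub>H\<^esub>" wH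
  by (intro mring_lift.intro mring.intro mring_lift_axioms.intro ring_int W.monoid_axioms H.ring_axioms H.int_embed)
    (auto simp: hom_def wH_mult intro!: H.int_mult_comm)

text \<open>Group elements act on the delta function at the identity by translation, and their
  coefficients have counit 1. Hence the group ring survives in every quotient through which
  \<open>ef\<close> factors.\<close>

lemma ef_zw: "a \<in> carrier (monoid_ring \<Z> W) \<Longrightarrow> ef (zw.lift a) = a"
proof (induction rule: zw.RM_induct)
  case zero
  have "ef \<zero>\<^bsub>H\<^esub> w = 0" for w using abgroup_hom.zero[OF ef_hom] by simp
  then show ?case unfolding zw.li.zero by (simp add: fun_eq_iff monoid_ring_def)
next
  case (mterm n v)
  have v: "v \<in> carrier W" using mterm by simp
  have "ef (zw.lift (mterm \<Z> n v)) w = mterm \<Z> n v w" for w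
  proof -
    have "zw.lift (mterm \<Z> n v) = [n] \<cdot>\<^bsub>H\<^esub> wH v" using v by (simp add: zw.lift_mterm H.add_pow_ldistr_int)
    also have "ef \<dots> w = n * ef (wH v) w"
      using ring_hom_int_mult[OF ef_hom, of "wH v" n w] v by (simp add: int_multiple_int)
    also have "\<dots> = mterm \<Z> n v w" unfolding ef_w[OF v] by (simp add: mterm_def)
    finally show ?thesis .
  qed
  then show ?case by (rule ext)
next
  case (add f g)
  have "ef (zw.lift (f \<oplus>\<^bsub>monoid_ring \<Z> W\<^esub> g)) w = (f \<oplus>\<^bsub>monoid_ring \<Z> W\<^esub> g) w" for w
    using add by (simp add: ef_add zw.li.add del: zw.add_eq) (simp add: monoid_ring_def)
  then show ?case by (rule ext)
qed

end

section \<open>Injectivity by a left inverse\<close>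

context hecke_target begin

abbreviation is_hom where "is_hom \<phi> \<equiv> is_Hecke_hom K I m q A (\<lambda>i. t (hs i)) (\<lambda>i. t (hD i)) \<phi>"

lemma is_hom_iff: "is_hom \<phi> \<longleftrightarrow> \<phi> \<in> extensional (carrier HQ) \<and> \<phi> \<in> ring_hom HQ TE.T \<and>
    (\<forall>c\<in>carrier K. \<phi> (hsc c) = pure A K \<one>\<^bsub>A\<^esub> c) \<and> (\<forall>i\<in>I. \<phi> (HT i) = gT i)"
  by (simp add: is_Hecke_hom_def gT_def)

lemma is_hom_unique: "\<lbrakk>is_hom \<phi>; is_hom \<psi>\<rbrakk> \<Longrightarrow> \<phi> = \<psi>"
proof -
  assume a: "is_hom \<phi>" "is_hom \<psi>"
  then have e: "\<phi> \<in> extensional (carrier HQ)" "\<psi> \<in> extensional (carrier HQ)" and r: "\<phi> \<in> ring_hom HQ TE.T" "\<psi> \<in> ring_hom HQ TE.T"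
    unfolding is_hom_iff by blast+
  have "\<phi> x = \<psi> x" if "x \<in> carrier HQ" for x
    using r _ _ that by (rule HQ_hom_eqI) (use a in \<open>simp_all add: is_hom_iff\<close>)
  then show ?thesis using e by (intro extensionalityI)
qed

theorem ex1_hom: "\<exists>!\<phi>. is_hom \<phi>"
proof (rule ex_ex1I)
  have "\<exists>h\<in>ring_hom HQ TE.T \<inter> extensional (carrier HQ).
      (\<forall>c\<in>carrier K. h (hsc c) = pure A K \<one>\<^bsub>A\<^esub> c) \<and> (\<forall>i\<in>I. h (HT i) = gT i)"
    by (rule Hecke_lift[OF TE.T.ring_axioms scalar_hom gT_closed scalar_central gT_quadratic gT_braid]) auto
  then show "\<exists>\<phi>. is_hom \<phi>" unfolding is_hom_iff by blast
qed (rule is_hom_unique)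

lemma ef_eq: "\<lbrakk>x \<in> carrier H; y \<in> carrier H; t x = t y\<rbrakk> \<Longrightarrow> ef x = ef y"
proof
  fix w assume a: "x \<in> carrier H" "y \<in> carrier H" "t x = t y"
  have "t (x \<ominus>\<^bsub>H\<^esub> y) = \<zero>\<^bsub>A\<^esub>" using a by (simp add: a_minus_def[of A] t.A.r_neg)
  then have "ef (x \<ominus>\<^bsub>H\<^esub> y) w = 0" using a by (intro t_ef) auto
  then show "ef x w = ef y w" using a abgroup_hom.a_minus[OF ef_hom, of x y w] by (simp add: a_minus_def[of \<Z>])
qed

text \<open>A preimage in Hhat is chosen by \<open>SOME\<close>; \<open>ef\<close> is constant on
  the fibres of \<open>t\<close> by \<open>ef_eq\<close>, so the value depends only on
  \<open>X\<close>.\<close>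

definition bA where "bA X = bT (ef (SOME x. x \<in> carrier H \<and> t x = X))"

lemma bA_t: "x \<in> carrier H \<Longrightarrow> bA (t x) = bT (ef x)"
proof -
  assume x: "x \<in> carrier H"
  define y where "y = (SOME y. y \<in> carrier H \<and> t y = t x)"
  have y: "y \<in> carrier H \<and> t y = t x"
    unfolding y_def by (rule someI[where x = x]) (use x in simp)
  then have "ef y = ef x" using x by (intro ef_eq) auto
  then show ?thesis by (simp only: bA_def y_def)
qed

lemma A_cases: "X \<in> carrier A \<Longrightarrow> \<exists>x\<in>carrier H. X = t x"
  unfolding t_surj by blast

lemma ef_plus: "\<lbrakk>x \<in> carrier H; y \<in> carrier H\<rbrakk> \<Longrightarrow> ef (x \<oplus>\<^bsub>H\<^esub> y) = ef x \<oplus>\<^bsub>ZW\<^esub> ef y"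
  unfolding ZW_add by (intro ext) (rule ef_add)

lemma bA_hom: "abgroup_hom A HQ bA"
proof (rule abgroup_homI)
  fix X Y assume "X \<in> carrier A" "Y \<in> carrier A"
  then obtain x y where xy: "x \<in> carrier H" "X = t x" "y \<in> carrier H" "Y = t y" using A_cases by metis
  then have "bA (t (x \<oplus>\<^bsub>H\<^esub> y)) = bT (ef x \<oplus>\<^bsub>ZW\<^esub> ef y)" by (simp only: bA_t H.a_closed ef_plus)
  also have "\<dots> = bT (ef x) \<oplus>\<^bsub>HQ\<^esub> bT (ef y)" using xy ef_closed by (intro bTh.add) auto
  finally show "bA (X \<oplus>\<^bsub>A\<^esub> Y) = bA X \<oplus>\<^bsub>HQ\<^esub> bA Y" using xy by (simp add: bA_t)
next
  fix X assume "X \<in> carrier A"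
  then obtain x where "x \<in> carrier H" "X = t x" using A_cases by metis
  then show "bA X \<in> carrier HQ" using ef_closed by (simp add: bA_t)
qed (rule t.A.abelian_group_axioms HQ.abelian_group_axioms)+

lemma bA_step: "\<lbrakk>x \<in> carrier H; i \<in> I\<rbrakk> \<Longrightarrow>
    bA (t (x \<star> hs i)) \<oplus>\<^bsub>HQ\<^esub> hsc (\<one>\<^bsub>K\<^esub> \<ominus>\<^bsub>K\<^esub> q i) \<otimes>\<^bsub>HQ\<^esub> bA (t (x \<star> hD i)) = bA (t x) \<otimes>\<^bsub>HQ\<^esub> HT i"
proof -
  assume x: "x \<in> carrier H" and i: "i \<in> I"
  have "ef (x \<star> hs i) = rs i (ef x)" "ef (x \<star> hD i) = rd i (ef x)"
    using x i ef_outside[of "x \<star> hs i"] ef_outside[of "x \<star> hD i"] unfolding fun_eq_iff rs_def rd_def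
    by (simp_all add: ef_s ef_d)
  moreover have "x \<star> hs i \<in> carrier H" "x \<star> hD i \<in> carrier H" using x i by simp_all
  ultimately show ?thesis using bT_step[OF ef_closed[OF x] i] bA_t x by metis
qed

text \<open>The left inverse \<open>\<Phi>\<close> is additive but not claimed to be multiplicative.
  What matters is that it carries right multiplication by \<open>\<phi> x\<close> to right
  multiplication by \<open>x\<close>; at 1 this reads \<open>\<Phi> (\<phi> x) = x\<close>.\<close>

theorem hom_inj:
  assumes "is_hom \<phi>"
  shows "inj_on \<phi> (carrier HQ)"
proof -
  note h = assms[unfolded is_hom_iff]
  interpret ph: ring_homo HQ TE.T \<phi> using h by (intro ring_homoI HQ.ring_axioms TE.T.ring_axioms) auto
  interpret b: abgroup_hom A HQ bA by (rule bA_hom)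
  obtain \<Phi> where "abgroup_hom TE.T HQ \<Phi>" and P: "\<And>a c. \<lbrakk>a \<in> carrier A; c \<in> carrier K\<rbrakk> \<Longrightarrow> \<Phi> (pure A K a c) = hsc c \<otimes>\<^bsub>HQ\<^esub> bA a"
    using TE.T_lift[of HQ "\<lambda>a c. hsc c \<otimes>\<^bsub>HQ\<^esub> bA a"] HQ.abelian_group_axioms
    by (auto simp: HQ.l_distr HQ.r_distr)
  then interpret P: abgroup_hom TE.T HQ \<Phi> by simp
  have gen: "\<Phi> (y \<otimes>\<^bsub>TE.T\<^esub> gT i) = \<Phi> y \<otimes>\<^bsub>HQ\<^esub> HT i" if "y \<in> carrier TE.T" "i \<in> I" for y i
    using that(1)
  proof (induction rule: TE.T_induct)
    case (pure a c)
    then obtain x where x: "x \<in> carrier H" "a = t x" using A_cases by metis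
    let ?c = "\<one>\<^bsub>K\<^esub> \<ominus>\<^bsub>K\<^esub> q i"
    have xs: "x \<star> hs i \<in> carrier H" "x \<star> hD i \<in> carrier H" using x that by simp_all
    have cl: "hsc c \<in> carrier HQ" "hsc ?c \<in> carrier HQ" "bA (t (x \<star> hs i)) \<in> carrier HQ" "bA (t (x \<star> hD i)) \<in> carrier HQ"
      "bA (t x) \<in> carrier HQ"
      using pure that x xs by (simp_all del: t.mult hsc.a_minus)
    have "\<Phi> (pure A K a c \<otimes>\<^bsub>TE.T\<^esub> gT i) = \<Phi> (pk (x \<star> hs i) c \<oplus>\<^bsub>TE.T\<^esub> pk (x \<star> hD i) (c \<otimes>\<^bsub>K\<^esub> ?c))"
      using x pure that by (simp only: gT_mult_right)
    also have "\<dots> = hsc c \<otimes>\<^bsub>HQ\<^esub> bA (t (x \<star> hs i)) \<oplus>\<^bsub>HQ\<^esub> hsc (c \<otimes>\<^bsub>K\<^esub> ?c) \<otimes>\<^bsub>HQ\<^esub> bA (t (x \<star> hD i))"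
      using xs pure that by (simp add: P del: t.mult hsc.mult)
    also have "hsc (c \<otimes>\<^bsub>K\<^esub> ?c) = hsc c \<otimes>\<^bsub>HQ\<^esub> hsc ?c" using pure that by (intro hsc.mult) auto
    also have "hsc c \<otimes>\<^bsub>HQ\<^esub> bA (t (x \<star> hs i)) \<oplus>\<^bsub>HQ\<^esub> hsc c \<otimes>\<^bsub>HQ\<^esub> hsc ?c \<otimes>\<^bsub>HQ\<^esub> bA (t (x \<star> hD i)) =
      hsc c \<otimes>\<^bsub>HQ\<^esub> (bA (t (x \<star> hs i)) \<oplus>\<^bsub>HQ\<^esub> hsc ?c \<otimes>\<^bsub>HQ\<^esub> bA (t (x \<star> hD i)))"
      using cl by (simp only: HQ.r_distr HQ.m_assoc HQ.m_closed)
    also have "\<dots> = \<Phi> (pure A K a c) \<otimes>\<^bsub>HQ\<^esub> HT i"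
      unfolding bA_step[OF x(1) that(2)] using x cl that pure by (simp add: P HQ.m_assoc)
    finally show ?case .
  qed (use that in \<open>simp_all add: TE.T.l_distr HQ.l_distr\<close>)
  have sc: "\<Phi> (y \<otimes>\<^bsub>TE.T\<^esub> pure A K \<one>\<^bsub>A\<^esub> c) = \<Phi> y \<otimes>\<^bsub>HQ\<^esub> hsc c" if "y \<in> carrier TE.T" "c \<in> carrier K" for y c
    using that(1)
  proof (induction rule: TE.T_induct)
    case (pure a d)
    then have "hsc d \<otimes>\<^bsub>HQ\<^esub> hsc c \<otimes>\<^bsub>HQ\<^esub> bA a = hsc d \<otimes>\<^bsub>HQ\<^esub> bA a \<otimes>\<^bsub>HQ\<^esub> hsc c"
      using that hsc_central[of c "bA a"] by (simp add: HQ.m_assoc)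
    then show ?case using pure that by (simp add: TE.pure_mult P)
  qed (use that in \<open>simp_all add: TE.T.l_distr HQ.l_distr\<close>)
  \<comment> \<open>The universal quantifier over \<open>y\<close> is kept in the induction because
    a product is treated by absorbing its first factor into \<open>y\<close>.\<close>
  have "\<forall>y\<in>carrier TE.T. \<Phi> (y \<otimes>\<^bsub>TE.T\<^esub> \<phi> x) = \<Phi> y \<otimes>\<^bsub>HQ\<^esub> x" if "x \<in> carrier HQ" for x
    using that
  proof (induction rule: HQ_induct)
    case (mult x y)
    then show ?case by (simp flip: TE.T.m_assoc HQ.m_assoc)
  qed (use h gen sc in \<open>simp_all add: TE.T.r_distr HQ.r_distr\<close>)
  note key = this
  have "\<Phi> \<one>\<^bsub>TE.T\<^esub> = \<one>\<^bsub>HQ\<^esub>"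
  proof -
    have "bA (t \<one>\<^bsub>H\<^esub>) = bT (mterm \<Z> 1 e0)" using ef_w[of e0] by (simp add: bA_t del: t.one)
    then have "bA \<one>\<^bsub>A\<^esub> = \<one>\<^bsub>HQ\<^esub>" by (simp add: bT_mterm Tw_one HQ.add.int_pow_1)
    then show ?thesis by (simp add: TE.pure_one P)
  qed
  then have "\<Phi> (\<phi> x) = x" if "x \<in> carrier HQ" for x using key[OF that] that by (metis HQ.l_one TE.T.l_one TE.T.one_closed ph.closed)
  then show ?thesis by (metis inj_onI)
qed

lemma ZW_embedding: "is_ZW_embedding I m A (\<lambda>i. t (hs i)) (t \<circ> zw.lift)"
  unfolding is_ZW_embedding_def
proof (intro conjI ballI)
  show "t \<circ> zw.lift \<in> ring_hom ZW A" using zw.lift_ring_hom t.ring_hom by (rule ring_hom_trans)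
  show "inj_on (t \<circ> zw.lift) (carrier ZW)"
  proof (rule inj_onI)
    fix a b assume a: "a \<in> carrier ZW" "b \<in> carrier ZW" "(t \<circ> zw.lift) a = (t \<circ> zw.lift) b"
    have "ef (zw.lift a) = ef (zw.lift b)" using a by (intro ef_eq) auto
    then show "a = b" using a ef_zw by metis
  qed
  show "(t \<circ> zw.lift) (mterm \<Z> 1 (s i)) = t (hs i)" if "i \<in> I" for i
    using that by (simp add: zw.lift_mterm H.add.int_pow_1 wH_s)
qed

end

text \<open>An ideal containing \<open>J_pairs\<close> forces the braid relations in the quotient,
  and one contained in \<open>J_full\<close> leaves \<open>ef\<close> well defined on it. Both
  algebras of the theorem are extreme cases.\<close>

lemma (in hecke) hecke_target_Quot:
  assumes "ideal J H" "J_pairs I m \<subseteq> J" "J \<subseteq> J_full I m"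
  shows "hecke_target I m K q (H Quot J) (\<lambda>x. J +>\<^bsub>H\<^esub> x)"
proof -
  interpret J: ideal J H by fact
  interpret h: ring_homo H "H Quot J" "\<lambda>x. J +>\<^bsub>H\<^esub> x"
    using J.rcos_ring_hom by (intro ring_homoI H.ring_axioms J.quotient_is_ring)
  show ?thesis
  proof unfold_locales
    show "carrier (H Quot J) = (\<lambda>x. J +>\<^bsub>H\<^esub> x) ` carrier H" by (rule carrier_Quot)
    show "J +>\<^bsub>H\<^esub> x = \<zero>\<^bsub>H Quot J\<^esub>" if "x \<in> J_pairs I m" for x
      using that assms(2) J.Icarr by (subst J.coset_zero_iff) auto
    show "ef x w = 0" if "x \<in> carrier H" "J +>\<^bsub>H\<^esub> x = \<zero>\<^bsub>H Quot J\<^esub>" for x w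
      using that assms(3) by (intro ef_J) (auto simp: J.coset_zero_iff)
  qed
qed

section \<open>The canonical projection\<close>

context hecke begin

lemma target_H_alg: "hecke_target I m K q (H_alg I m) (to_H I m)"
  using hecke_target_Quot[OF J_pairs_ideal _ J_pairs_subset] by (simp add: H_alg_def to_H_def[abs_def])

lemma target_H_lower: "hecke_target I m K q (H_lower I m) (to_H_lower I m)"
  using hecke_target_Quot[OF J_full_ideal J_pairs_subset] by (simp add: H_lower_def to_H_lower_def[abs_def])

lemma ex1_pi: "\<exists>!p. is_pi I m p"
proof (rule ex_ex1I)
  interpret L: hecke_target I m K q "H_lower I m" "to_H_lower I m" by (rule target_H_lower)
  interpret J: ideal "J_pairs I m" H by (rule J_pairs_ideal)
  let ?p = "qlift H (J_pairs I m) (to_H_lower I m)"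
  have "?p \<in> ring_hom (H_alg I m) (H_lower I m)"
    unfolding H_alg_def by (rule L.t.qlift_ring_hom[OF J_pairs_ideal L.t_J])
  moreover have "?p (to_H I m x) = to_H_lower I m x" if "x \<in> carrier H" for x
    unfolding to_H_def by (rule L.t.qlift_coset[OF J.additive_subgroup_axioms L.t_J that])
  ultimately show "\<exists>p. is_pi I m p"
    unfolding is_pi_def H_alg_def using qlift_extensional by blast
next
  interpret A: hecke_target I m K q "H_alg I m" "to_H I m" by (rule target_H_alg)
  fix p p' assume p: "is_pi I m p" "is_pi I m p'"
  have "p x = p' x" if "x \<in> carrier (H_alg I m)" for x
    using A.A_cases[OF that] p unfolding is_pi_def by auto
  then show "p = p'" using p unfolding is_pi_def by (intro extensionalityI) auto
qed

end

section \<open>Compatibility of the projection with the other structures\<close>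

locale hecke_pi = hecke I m K q + A: hecke_target I m K q "H_alg I m" "to_H I m"
    + L: hecke_target I m K q "H_lower I m" "to_H_lower I m"
  for I :: "'i set" and m and K :: "('k, 'b) ring_scheme" and q +
  fixes p assumes pi: "is_pi I m p"
begin

abbreviation HA where "HA \<equiv> H_alg I m"
abbreviation HL where "HL \<equiv> H_lower I m"

lemma p_hom: "p \<in> ring_hom HA HL" and p_to [simp]: "x \<in> carrier H \<Longrightarrow> p (to_H I m x) = to_H_lower I m x"
  using pi by (auto simp: is_pi_def)

sublocale p: ring_homo HA HL p
  by (intro ring_homoI p_hom A.t.A.ring_axioms L.t.A.ring_axioms)

lemma p_image: "X \<subseteq> carrier H \<Longrightarrow> p ` (to_H I m ` X) = to_H_lower I m ` X"
  unfolding image_image by (intro image_cong) auto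

text \<open>The composite has the values on scalars and generators that characterise
  \<open>\<phi>'\<close>; \<open>L.is_hom_unique\<close> then applies to its restriction to the
  carrier.\<close>

lemma hom_comp:
  assumes "A.is_hom \<phi>" "L.is_hom \<phi>'" "x \<in> carrier HQ"
  shows "\<phi>' x = tensor_map HA K HL K p (\<lambda>c. c) (\<phi> x)"
proof -
  interpret tm: tensor_maps HA K HL K p "\<lambda>c. c"
    by (intro tensor_maps.intro tensor_maps_axioms.intro A.TE.tensor_rings_axioms L.TE.tensor_rings_axioms p_hom)
      (auto simp: ring_hom_def)
  note h = assms(1)[unfolded A.is_hom_iff]
  let ?h = "restrict (tm.tm \<circ> \<phi>) (carrier HQ)"
  have r: "tm.tm \<circ> \<phi> \<in> ring_hom HQ L.TE.T"
    using h tm.tensor_map_ring_hom by (intro ring_hom_trans) auto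
  have "L.is_hom ?h"
    unfolding L.is_hom_iff
  proof (intro conjI ballI)
    show "?h \<in> ring_hom HQ L.TE.T"
      proof (rule ring_hom_memI)
      fix x y assume x: "x \<in> carrier HQ" and y: "y \<in> carrier HQ"
      show "?h x \<in> carrier L.TE.T" using ring_hom_closed[OF r x] x by simp
      show "?h (x \<otimes>\<^bsub>HQ\<^esub> y) = ?h x \<otimes>\<^bsub>L.TE.T\<^esub> ?h y" using ring_hom_mult[OF r x y] x y by simp
      show "?h (x \<oplus>\<^bsub>HQ\<^esub> y) = ?h x \<oplus>\<^bsub>L.TE.T\<^esub> ?h y" using ring_hom_add[OF r x y] x y by simp
    next
      show "?h \<one>\<^bsub>HQ\<^esub> = \<one>\<^bsub>L.TE.T\<^esub>" using ring_hom_one[OF r] by simp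
    qed
    show "?h (hsc c) = pure HL K \<one>\<^bsub>HL\<^esub> c" if "c \<in> carrier K" for c
      using that h by (simp add: tm.tensor_map_pure)
    show "?h (HT i) = L.gT i" if "i \<in> I" for i
    proof -
      have x: "to_H I m (hs i) \<in> carrier HA" "to_H I m (hD i) \<in> carrier HA" using that by simp_all
      have "?h (HT i) = tm.tm (A.gT i)" using that h by simp
      also have "\<dots> = tm.tm (pure HA K (to_H I m (hs i)) \<one>\<^bsub>K\<^esub>) \<oplus>\<^bsub>L.TE.T\<^esub> tm.tm (pure HA K (to_H I m (hD i)) (\<one>\<^bsub>K\<^esub> \<ominus>\<^bsub>K\<^esub> q i))"
        unfolding A.gT_def using x that by (intro tm.tm.add A.TE.pure_closed A.qc K.one_closed)
      also have "\<dots> = L.gT i"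
        unfolding L.gT_def tm.tensor_map_pure[OF x(1) K.one_closed] tm.tensor_map_pure[OF x(2) A.qc[OF that]]
        using that by (simp only: p_to hs_closed hd_closed)
      finally show ?thesis .
    qed
  qed simp
  then have "\<phi>' = ?h" using assms(2) by (intro L.is_hom_unique)
  then show ?thesis using assms(3) by simp
qed

text \<open>The coproduct and the counit are homomorphisms, so agreement on generators is enough.
  The antipodes reverse products, so their compatibility is proved by induction over the algebra
  instead.\<close>

lemma Hopf_compatible:
  assumes A: "Hopf_maps I HA (\<lambda>i. to_H I m (hs i)) (\<lambda>i. to_H I m (hD i)) \<Delta> \<epsilon> S"
    and L: "Hopf_maps I HL (\<lambda>i. to_H_lower I m (hs i)) (\<lambda>i. to_H_lower I m (hD i)) \<Delta>' \<epsilon>' S'"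
  shows "Hopf_map_compatible HA HL \<Delta> \<epsilon> S \<Delta>' \<epsilon>' S' p"
proof -
  interpret AA: tensor_rings HA HA by (intro tensor_rings.intro A.t.A.ring_axioms)
  interpret LL: tensor_rings HL HL by (intro tensor_rings.intro L.t.A.ring_axioms)
  interpret tm: tensor_maps HA HA HL HL p p
    by (intro tensor_maps.intro tensor_maps_axioms.intro AA.tensor_rings_axioms LL.tensor_rings_axioms p_hom)
  note A' = A[unfolded Hopf_maps_def] and L' = L[unfolded Hopf_maps_def]
  \<comment> \<open>A homomorphism to the opposite ring is unpacked into an additive map that
    reverses products; the additive structure of the opposite ring is unchanged.\<close>
  have op: "abgroup_hom R R f" "\<And>x y. \<lbrakk>x \<in> carrier R; y \<in> carrier R\<rbrakk> \<Longrightarrow> f (x \<otimes>\<^bsub>R\<^esub> y) = f y \<otimes>\<^bsub>R\<^esub> f x" "f \<one>\<^bsub>R\<^esub> = \<one>\<^bsub>R\<^esub>"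
    if "ring R" "f \<in> ring_hom R (R\<lparr>mult := \<lambda>x y. y \<otimes>\<^bsub>R\<^esub> x\<rparr>)" for R :: "'i hhat set ring" and f
    using that ring.is_abelian_group[OF that(1)] by (auto simp: ring_hom_def Pi_iff intro!: abgroup_homI)
  interpret S: abgroup_hom HA HA S using A' by (intro op A.t.A.ring_axioms) auto
  interpret S': abgroup_hom HL HL S' using L' by (intro op L.t.A.ring_axioms) auto
  have Sm: "\<lbrakk>x \<in> carrier HA; y \<in> carrier HA\<rbrakk> \<Longrightarrow> S (x \<otimes>\<^bsub>HA\<^esub> y) = S y \<otimes>\<^bsub>HA\<^esub> S x" "S \<one>\<^bsub>HA\<^esub> = \<one>\<^bsub>HA\<^esub>" for x y
    using op(2,3)[OF A.t.A.ring_axioms, of S] A' by auto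
  have Sm': "\<lbrakk>x \<in> carrier HL; y \<in> carrier HL\<rbrakk> \<Longrightarrow> S' (x \<otimes>\<^bsub>HL\<^esub> y) = S' y \<otimes>\<^bsub>HL\<^esub> S' x" "S' \<one>\<^bsub>HL\<^esub> = \<one>\<^bsub>HL\<^esub>" for x y
    using op(2,3)[OF L.t.A.ring_axioms, of S'] L' by auto
  have D: "\<Delta>' (to_H_lower I m x) = tm.tm (\<Delta> (to_H I m x))" if "x \<in> carrier H" for x
  proof -
    have "(\<Delta>' \<circ> to_H_lower I m) x = (tm.tm \<circ> (\<Delta> \<circ> to_H I m)) x"
    proof (rule H_hom_eqI[OF _ _ _ _ that])
      show "ring_homo H LL.T (\<Delta>' \<circ> to_H_lower I m)"
        using L' by (intro ring_homoI H.ring_axioms LL.T.ring_axioms ring_hom_trans[OF L.t.ring_hom]) simp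
      show "ring_homo H LL.T (tm.tm \<circ> (\<Delta> \<circ> to_H I m))"
        using A' by (intro ring_homoI H.ring_axioms LL.T.ring_axioms
            ring_hom_trans[OF _ tm.tensor_map_ring_hom] ring_hom_trans[OF A.t.ring_hom]) simp
    qed (use A' L' in \<open>simp_all add: tm.tensor_map_pure\<close>)
    then show ?thesis by simp
  qed
  have E: "\<epsilon>' (to_H_lower I m x) = \<epsilon> (to_H I m x)" if "x \<in> carrier H" for x
  proof -
    have "(\<epsilon>' \<circ> to_H_lower I m) x = (\<epsilon> \<circ> to_H I m) x"
    proof (rule H_hom_eqI[OF _ _ _ _ that])
      show "ring_homo H \<Z> (\<epsilon>' \<circ> to_H_lower I m)"
        using L' by (intro ring_homoI H.ring_axioms ring_int ring_hom_trans[OF L.t.ring_hom]) simp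
      show "ring_homo H \<Z> (\<epsilon> \<circ> to_H I m)"
        using A' by (intro ring_homoI H.ring_axioms ring_int ring_hom_trans[OF A.t.ring_hom]) simp
    qed (use A' L' in simp_all)
    then show ?thesis by simp
  qed
  have SS: "S' (to_H_lower I m x) = p (S (to_H I m x))" if "x \<in> carrier H" for x
    using that
  proof (induction rule: H_induct)
    case one
    then show ?case by (simp add: Sm Sm')
  qed (use A' L' in \<open>simp_all add: Sm Sm'\<close>)
  show ?thesis
    unfolding Hopf_map_compatible_def
  proof
    fix X assume "X \<in> carrier HA"
    then obtain x where x: "x \<in> carrier H" "X = to_H I m x" using A.A_cases by blast
    show "\<Delta>' (p X) = tensor_map HA HA HL HL p p (\<Delta> X) \<and> \<epsilon>' (p X) = \<epsilon> X \<and> S' (p X) = p (S X)"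
      unfolding x(2) p_to[OF x(1)] using D[OF x(1)] E[OF x(1)] SS[OF x(1)] by blast
  qed
qed

end

theorem theorem1p33:
  fixes K :: "('k, 'b) ring_scheme" and I :: "'i set" and m :: "'i \<Rightarrow> 'i \<Rightarrow> nat" and q :: "'i \<Rightarrow> 'k"
  assumes "coxeter_matrix I m"
    and "cring K"
    and "q \<in> I \<rightarrow> carrier K"
    and "\<And>i j. \<lbrakk>i \<in> I; j \<in> I; odd (m i j)\<rbrakk> \<Longrightarrow> q i = q j"
  defines "sH \<equiv> \<lambda>i. to_H I m (Hhat_s I m i)" and "dH \<equiv> \<lambda>i. to_H I m (Hhat_D I m i)"
    and "sL \<equiv> \<lambda>i. to_H_lower I m (Hhat_s I m i)" and "dL \<equiv> \<lambda>i. to_H_lower I m (Hhat_D I m i)"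
  shows
    "(\<exists>!\<phi>. is_Hecke_hom K I m q (H_alg I m) sH dH \<phi>)
     \<and> (\<exists>!\<phi>'. is_Hecke_hom K I m q (H_lower I m) sL dL \<phi>')
     \<and> (\<exists>!p. is_pi I m p)
     \<and> (\<forall>\<phi> \<phi>' p. is_Hecke_hom K I m q (H_alg I m) sH dH \<phi>
          \<and> is_Hecke_hom K I m q (H_lower I m) sL dL \<phi>' \<and> is_pi I m p \<longrightarrow>
          inj_on \<phi> (carrier (Hecke_algebra K I m q))
          \<and> (\<forall>x\<in>carrier (Hecke_algebra K I m q).
               \<phi>' x = tensor_map (H_alg I m) K (H_lower I m) K p (\<lambda>c. c) (\<phi> x))
          \<and> p ` carrier (H_alg I m) = carrier (H_lower I m)
          \<and> (\<forall>\<Delta> \<epsilon> S \<Delta>' \<epsilon>' S'. Hopf_maps I (H_alg I m) sH dH \<Delta> \<epsilon> S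
               \<and> Hopf_maps I (H_lower I m) sL dL \<Delta>' \<epsilon>' S' \<longrightarrow>
               Hopf_map_compatible (H_alg I m) (H_lower I m) \<Delta> \<epsilon> S \<Delta>' \<epsilon>' S' p)
          \<and> (\<exists>g g'. is_ZW_embedding I m (H_alg I m) sH g \<and> is_ZW_embedding I m (H_lower I m) sL g'
               \<and> (\<forall>x\<in>carrier (monoid_ring \<Z> (coxeter_group I m)). p (g x) = g' x))
          \<and> p ` (to_H I m ` Dhat I m I) = to_H_lower I m ` Dhat I m I)"
proof -
  interpret hecke I m K q
    using assms(1-4) by (intro hecke.intro coxeter.intro hecke_axioms.intro) auto
  interpret A: hecke_target I m K q "H_alg I m" "to_H I m" by (rule target_H_alg)
  interpret L: hecke_target I m K q "H_lower I m" "to_H_lower I m" by (rule target_H_lower)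
  have "inj_on \<phi> (carrier (Hecke_algebra K I m q))
          \<and> (\<forall>x\<in>carrier (Hecke_algebra K I m q).
               \<phi>' x = tensor_map (H_alg I m) K (H_lower I m) K p (\<lambda>c. c) (\<phi> x))
          \<and> p ` carrier (H_alg I m) = carrier (H_lower I m)
          \<and> (\<forall>\<Delta> \<epsilon> S \<Delta>' \<epsilon>' S'. Hopf_maps I (H_alg I m) sH dH \<Delta> \<epsilon> S
               \<and> Hopf_maps I (H_lower I m) sL dL \<Delta>' \<epsilon>' S' \<longrightarrow>
               Hopf_map_compatible (H_alg I m) (H_lower I m) \<Delta> \<epsilon> S \<Delta>' \<epsilon>' S' p)
          \<and> (\<exists>g g'. is_ZW_embedding I m (H_alg I m) sH g \<and> is_ZW_embedding I m (H_lower I m) sL g'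
               \<and> (\<forall>x\<in>carrier (monoid_ring \<Z> (coxeter_group I m)). p (g x) = g' x))
          \<and> p ` (to_H I m ` Dhat I m I) = to_H_lower I m ` Dhat I m I"
    if h: "A.is_hom \<phi>" "L.is_hom \<phi>'" "is_pi I m p" for \<phi> \<phi>' p
  proof -
    interpret hecke_pi I m K q p by unfold_locales (rule h(3))
    \<comment> \<open>Both embeddings are the map of the group ring into Hhat followed by a
      projection, so \<open>p\<close> carries one to the other.\<close>
    have "p ((to_H I m \<circ> zw.lift) x) = (to_H_lower I m \<circ> zw.lift) x" if "x \<in> carrier ZW" for x
      using that by (simp only: o_apply p_to zw.li.closed)
    then have zw: "\<exists>g g'. is_ZW_embedding I m (H_alg I m) sH g \<and> is_ZW_embedding I m (H_lower I m) sL g'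
               \<and> (\<forall>x\<in>carrier ZW. p (g x) = g' x)"
      unfolding sH_def sL_def using A.ZW_embedding L.ZW_embedding by blast
    show ?thesis
    proof (intro conjI allI impI ballI zw)
      show "inj_on \<phi> (carrier HQ)" by (rule A.hom_inj[OF h(1)])
      show "\<phi>' x = tensor_map HA K HL K p (\<lambda>c. c) (\<phi> x)" if "x \<in> carrier HQ" for x
        by (rule hom_comp[OF h(1,2) that])
      show "p ` carrier HA = carrier HL" unfolding A.t_surj L.t_surj by (rule p_image) (rule subset_refl)
      show "p ` (to_H I m ` Dhat I m I) = to_H_lower I m ` Dhat I m I" by (rule p_image) (use Dhat_closed in blast)
      show "Hopf_map_compatible HA HL \<Delta> \<epsilon> S \<Delta>' \<epsilon>' S' p"
        if "Hopf_maps I HA sH dH \<Delta> \<epsilon> S \<and> Hopf_maps I HL sL dL \<Delta>' \<epsilon>' S'" for \<Delta> \<epsilon> S \<Delta>' \<epsilon>' S'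
        using that unfolding sH_def dH_def sL_def dL_def by (intro Hopf_compatible) simp_all
    qed
  qed
  note main = this
  show ?thesis
    unfolding sH_def dH_def sL_def dL_def
    by (intro conjI A.ex1_hom L.ex1_hom ex1_pi; intro allI impI; elim conjE; rule main[unfolded sH_def dH_def sL_def dL_def])
qed

end
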